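(* Let $J$ be a nonempty open subset of $\mathcal I$ and let $k\ge2$. There exist $c_0>0$, $\mu_0\ge1$ and $\widehat s_0\ge1$ such that for all $\mu\ge\mu_0$ and all $\lambda\ge\mu$, for all $\alpha>0$, for all $T>0$ and for all $s\ge\widehat s_0(1+\alpha)(T^k+T^{k-1})$, the following inequality holds for all functions $\eta\in C^2([0,T];C^4(\mathcal I))$: $$ \begin{aligned} &\frac{\alpha^2}{1+\alpha^2}\frac1s\iint_{(0,T)\times\mathcal I}\frac1{\xi_0}e^{2s\varphi_0}\left(|\partial_{x_1}^4\eta|^2+|\partial_t^2\eta|^2\right)+\frac{\alpha^2}{s}\iint_{(0,T)\times\mathcal I}\frac1{\xi_0}e^{2s\varphi_0}|\partial_t\partial_{x_1}^2\eta|^2\\ &+\iint_{(0,T)\times\mathcal I}e^{2s\varphi_0}\Big(s^7\mu^8\xi_0^7|\eta|^2+s^5\mu^6\xi_0^5|\partial_{x_1}\eta|^2+s^3\mu^4\xi_0^3|\partial_{x_1}^2\eta|^2\\ &\qquad\qquad+(1+\alpha^2)s^3\mu^4\xi_0^3|\partial_t\eta|^2+s\mu^2\xi_0|\partial_{x_1}^3\eta|^2+(1+\alpha^2)s\mu^2\xi_0|\partial_t\partial_{x_1}\eta|^2\Big)\\ &\le c_0\Big((\alpha^{-8}+\alpha^4)\iint_{(0,T)\times J}s^7\mu^8\xi_0^7e^{2s\varphi_0}|\eta|^2+\iint_{(0,T)\times\mathcal I}e^{2s\varphi_0}\left|\partial_t^2\eta-\alpha\partial_{x_1}^2\partial_t\eta+\partial_{x_1}^4\eta\right|^2\\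 &\qquad+\alpha^2s^3\mu^4\iint_{(0,T)\times\mathcal I}\xi_0^3e^{2s\varphi_0}|\partial_t\eta|^2\Big). \end{aligned} $$
   Context: $\mathcal I=\mathbb R/2\pi\mathbb Z$ is the one-dimensional torus and $\Omega=\mathcal I\times(0,1)$; $\omega$ is a fixed nonempty open subset of $\Omega$ and $\partial_n$ is the outward normal derivative on $\partial\Omega$. Weights: $\ell(t)=t(T-t)$ for $t\in(0,T)$. Fix nonempty open sets $\omega_0\Subset\omega$, $J_0\Subset J$, and smooth functions $\psi_\Omega$ (on $\overline\Omega$) and $\psi_{\mathcal I}$ (on $\mathcal I$) such that $\psi_\Omega>0$ in $\Omega$, $\psi_\Omega=0$ and $\partial_n\psi_\Omega=-1$ on $\partial\Omega$, $\nabla\psi_\Omega(x)=0\Rightarrow x\in\omega_0$; and $\psi_{\mathcal I}>0$ on $\mathcal I$, $\psi_{\mathcal I}'(x_1)=0\Rightarrow x_1\in J_0$ (such functions exist). These are fixed once and for all, independently of $\alpha,\lambda,\mu,s,T$. Let $\Psi=\|\psi_\Omega\|_{L^\infty(\Omega)}+\|\psi_{\mathcal I}\|_{L^\infty(\mathcal I)}$. For $\lambda\ge\mu>0$ set $$\varphi_0(t,x_1)=\frac{e^{\mu\psi_{\mathcal I}(x_1)+8\lambda\Psi}-e^{10\lambda\Psi}}{\ell(t)^{k/2}},\qquad \xi_0(t,x_1)=\frac{e^{\mu\psi_{\mathcal I}(x_1)+8\lambda\Psi}}{\ell(t)^{k/2}}.$$ *)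

theory Defs
  imports
    "HOL-Analysis.Analysis"
    "HOL-Library.Periodic_Fun"
    "HOL-Probability.Essential_Supremum"
begin

text \<open>
  The torus R/2 pi Z is handled through its universal cover: functions on the torus are
  2 pi-periodic functions on the reals, and a subset of the torus is identified with its
  (2 pi-periodic) preimage in the reals.  The covering map is continuous, open and a local
  isometry, so being open, closures and derivatives may be computed upstairs.  Integrals and
  null sets are taken over the fundamental domain \<^term>\<open>{0..<2*pi}\<close>.
\<close>

definition torus_fun :: "(real \<Rightarrow> 'b) \<Rightarrow> bool" where
  "torus_fun f \<longleftrightarrow> periodic_fun_simple f (2 * pi)"

definition torus_set :: "real set \<Rightarrow> bool" where
  "torus_set A \<longleftrightarrow> torus_fun (\<lambda>x. x \<in> A)"

definition strip_set :: "(real \<times> real) set \<Rightarrow> bool" where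
  "strip_set A \<longleftrightarrow> (\<forall>y. torus_set {x. (x, y) \<in> A})"

abbreviation Omega :: "(real \<times> real) set" where
  "Omega \<equiv> UNIV \<times> {0<..<1}"

abbreviation Omega_closed :: "(real \<times> real) set" where
  "Omega_closed \<equiv> UNIV \<times> {0..1}"

abbreviation Omega_boundary :: "(real \<times> real) set" where
  "Omega_boundary \<equiv> UNIV \<times> {0, 1}"

text \<open>
  Only used for the torus and the strip, whose closed subsets are compact whenever they are
  bounded in the second variable; compactness of the closure is therefore automatic.
\<close>
definition compactly_inside :: "'a::topological_space set \<Rightarrow> 'a set \<Rightarrow> bool"
    (infix "\<Subset>" 50) where
  "A \<Subset> B \<longleftrightarrow> closure A \<subseteq> B"

definition torus_Cn :: "nat \<Rightarrow> (real \<Rightarrow> real) \<Rightarrow> bool" where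
  "torus_Cn n f \<longleftrightarrow> torus_fun f \<and>
     (\<forall>i<n. \<forall>x. (deriv ^^ i) f differentiable (at x)) \<and>
     continuous_on UNIV ((deriv ^^ n) f)"

definition torus_smooth :: "(real \<Rightarrow> real) \<Rightarrow> bool" where
  "torus_smooth f \<longleftrightarrow> (\<forall>n. torus_Cn n f)"

definition Cn_norm :: "nat \<Rightarrow> (real \<Rightarrow> real) \<Rightarrow> real" where
  "Cn_norm n f = (\<Sum>i\<le>n. SUP x. \<bar>(deriv ^^ i) f x\<bar>)"

text \<open>
  \<open>C_time j n T u\<close>: the map sending t to \<open>u t\<close> belongs to \<open>C^j([0,T]; C^n)\<close>, where the space of
  n times continuously differentiable functions on the torus carries the norm
  \<^const>\<open>Cn_norm\<close> and derivatives in time are limits of difference quotients in that norm,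
  one-sided at 0 and T.  The values of u at times outside [0,T] are irrelevant.
\<close>
primrec C_time :: "nat \<Rightarrow> nat \<Rightarrow> real \<Rightarrow> (real \<Rightarrow> real \<Rightarrow> real) \<Rightarrow> bool" where
  "C_time 0 n T u \<longleftrightarrow>
     (\<forall>t\<in>{0..T}. torus_Cn n (u t)) \<and>
     (\<forall>t\<in>{0..T}. ((\<lambda>r. Cn_norm n (\<lambda>x. u r x - u t x)) \<longlongrightarrow> 0) (at t within {0..T}))"
| "C_time (Suc j) n T u \<longleftrightarrow>
     (\<forall>t\<in>{0..T}. torus_Cn n (u t)) \<and>
     (\<exists>v. C_time j n T v \<and>
        (\<forall>t\<in>{0..T}. ((\<lambda>r. Cn_norm n (\<lambda>x. (u r x - u t x) / (r - t) - v t x)) \<longlongrightarrow> 0)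
           (at t within {0..T})))"

text \<open>
  Smoothness up to the boundary: derivatives are taken within S, which determines them
  uniquely for the closed strip.
\<close>
primrec Cn_within :: "nat \<Rightarrow> (real \<times> real) set \<Rightarrow> (real \<times> real \<Rightarrow> real) \<Rightarrow> bool" where
  "Cn_within 0 S f \<longleftrightarrow> continuous_on S f"
| "Cn_within (Suc n) S f \<longleftrightarrow>
     (\<exists>f1 f2. Cn_within n S f1 \<and> Cn_within n S f2 \<and>
        (\<forall>p\<in>S. (f has_derivative (\<lambda>h. f1 p * fst h + f2 p * snd h)) (at p within S)))"

definition strip_smooth :: "(real \<times> real \<Rightarrow> real) \<Rightarrow> bool" where
  "strip_smooth f \<longleftrightarrow>
     (\<forall>y\<in>{0..1}. torus_fun (\<lambda>x. f (x, y))) \<and> (\<forall>n. Cn_within n Omega_closed f)"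

definition has_gradient :: "(real \<times> real \<Rightarrow> real) \<Rightarrow> real \<times> real \<Rightarrow> real \<times> real \<Rightarrow> bool" where
  "has_gradient f g p \<longleftrightarrow> (f has_derivative (\<lambda>h. g \<bullet> h)) (at p within Omega_closed)"

definition outward_normal :: "real \<times> real \<Rightarrow> real \<times> real" where
  "outward_normal p = (0, if snd p = 1 then 1 else - 1)"

definition has_normal_derivative :: "(real \<times> real \<Rightarrow> real) \<Rightarrow> real \<Rightarrow> real \<times> real \<Rightarrow> bool" where
  "has_normal_derivative f d p \<longleftrightarrow> (\<exists>g. has_gradient f g p \<and> d = g \<bullet> outward_normal p)"

definition Linfty_norm :: "'a::euclidean_space set \<Rightarrow> ('a \<Rightarrow> real) \<Rightarrow> real" where
  "Linfty_norm A f = real_of_ereal (esssup (restrict_space lborel A) (\<lambda>x. ereal \<bar>f x\<bar>))"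

definition Psi :: "(real \<times> real \<Rightarrow> real) \<Rightarrow> (real \<Rightarrow> real) \<Rightarrow> real" where
  "Psi psiO psiI =
     Linfty_norm ({0..<2*pi} \<times> {0<..<1}) psiO + Linfty_norm {0..<2*pi} psiI"

definition ell :: "real \<Rightarrow> real \<Rightarrow> real" where
  "ell T t = t * (T - t)"

definition phi0 ::
  "real \<Rightarrow> (real \<times> real \<Rightarrow> real) \<Rightarrow> (real \<Rightarrow> real) \<Rightarrow> real \<Rightarrow> real \<Rightarrow> real \<Rightarrow> real \<Rightarrow> real \<Rightarrow> real" where
  "phi0 k psiO psiI lam mu T t x =
     (exp (mu * psiI x + 8 * lam * Psi psiO psiI) - exp (10 * lam * Psi psiO psiI))
       / ell T t powr (k / 2)"

definition xi0 ::
  "real \<Rightarrow> (real \<times> real \<Rightarrow> real) \<Rightarrow> (real \<Rightarrow> real) \<Rightarrow> real \<Rightarrow> real \<Rightarrow> real \<Rightarrow> real \<Rightarrow> real \<Rightarrow> real" where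
  "xi0 k psiO psiI lam mu T t x =
     exp (mu * psiI x + 8 * lam * Psi psiO psiI) / ell T t powr (k / 2)"

definition Dx :: "nat \<Rightarrow> (real \<Rightarrow> real \<Rightarrow> real) \<Rightarrow> real \<Rightarrow> real \<Rightarrow> real" where
  "Dx n u t x = (deriv ^^ n) (\<lambda>y. u t y) x"

definition Dt :: "nat \<Rightarrow> (real \<Rightarrow> real \<Rightarrow> real) \<Rightarrow> real \<Rightarrow> real \<Rightarrow> real" where
  "Dt n u t x = (deriv ^^ n) (\<lambda>r. u r x) t"

text \<open>
  The integral over (0,T) x A for a periodic set A.  The Bochner integral is 0 by convention for
  non-integrable functions; this does not interfere here, since the weights
  \<open>xi0 ^ m * exp (2 * s * phi0)\<close> (also for \<open>m = - 1\<close>) are bounded (\<open>phi0\<close> is negative and tends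
  to minus infinity like \<open>- xi0\<close> at the ends of (0,T)) and the derivatives of the unknown that
  occur are bounded and continuous, so all integrands used are integrable.
\<close>
definition iint :: "real \<Rightarrow> real set \<Rightarrow> (real \<Rightarrow> real \<Rightarrow> real) \<Rightarrow> real" where
  "iint T A f = (LINT p:({0<..<T} \<times> (A \<inter> {0..<2*pi}))|lborel. f (fst p) (snd p))"

end

theory Submission
  imports Defs
begin

text \<open>
  Write \<open>\<theta> = s \<phi>\<close>, \<open>\<Lambda> = s \<mu> \<xi>\<close>, \<open>z\<close> for the time derivative of \<open>\<eta>\<close> and \<open>f\<close> for the
  right-hand side of the beam equation. Since \<open>\<theta>\<^sub>x = \<psi>' \<Lambda>\<close> and \<open>\<Lambda>\<^sub>x = \<mu> \<psi>' \<Lambda>\<close>, every weight on the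
  left-hand side is \<open>\<mu> \<Lambda>\<^sup>m / \<Lambda>\<close> with \<open>m\<close> even, and the lower bound on \<open>s\<close> makes time derivatives
  of the weight small compared with \<open>\<Lambda>\<^sup>2 / (1 + \<alpha>)\<close>.

  Away from the critical points of \<open>\<psi>\<close>, each space derivative dominates the previous one with weight
  \<open>\<Lambda>\<close>, so everything but \<open>z\<close> is controlled by the fourth derivative and a local term. For
  \<open>\<alpha> \<ge> 1\<close> one expands the square of \<open>z\<^sub>t - \<alpha> z\<^sub>x\<^sub>x + \<eta>\<^sub>x\<^sub>x\<^sub>x\<^sub>x = f\<close> with weight \<open>1 / \<Lambda>\<close>: the term in
  \<open>\<alpha>\<^sup>2 |z|\<^sup>2\<close> on the right absorbs all commutators. For \<open>\<alpha> \<le> 1\<close> the operator factors as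
  \<open>(\<partial>\<^sub>t - r \<partial>\<^sub>x\<^sup>2)(\<partial>\<^sub>t - r' \<partial>\<^sub>x\<^sup>2)\<close> with conjugate roots \<open>r = a + i b\<close>, \<open>r'\<close> of modulus 1, where
  \<open>a = \<alpha> / 2\<close>. The complex function \<open>v = z - r' \<eta>\<^sub>x\<^sub>x\<close> solves \<open>v\<^sub>t - r v\<^sub>x\<^sub>x = f\<close>, and because \<open>|r| = 1\<close>
  the principal commutator does not depend on \<open>r\<close>, so the Carleman estimate for \<open>v\<close> is
  uniform in \<open>\<alpha>\<close>. As \<open>b\<close> is bounded below, \<open>v\<close> controls both \<open>z\<close> and \<open>\<eta>\<^sub>x\<^sub>x\<close>. The dissipation only
  serves to reduce the local terms to \<open>\<eta>\<close> by interpolation, which costs \<open>\<alpha>\<^sup>-\<^sup>8\<close>.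
\<close>


subsection \<open>Tempered functions and integration by parts\<close>

text \<open>Every integral estimate below is a pointwise inequality between integrands, valid up to
  exact x- and t-derivatives of terms \<open>exp (2 * \<theta>) * X\<close>. These integrate to
  zero: in x by periodicity, in t because \<open>exp (2 * \<theta>)\<close> beats every negative
  power of l(t). So no boundary terms appear, and an estimate is proved by exhibiting suitable X.
  The obstacle is uniformity: all constants have to be fixed before \<alpha>, T and s. Therefore all
  smallness is carried by one number \<epsilon>, with \<mu> \<le> \<epsilon> \<Lambda> and first
  time derivatives of the weight at most \<epsilon> \<Lambda>^2 / (1 + \<alpha>), and every
  absorption argument is isolated as a statement about real numbers. The split at \<alpha> = 1 keeps
  b = sqrt (1 - \<alpha>^2 / 4) away from 0; at \<alpha> = 2 the two roots merge. The local terms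
  are removed by repeated interpolation. Each interpolation in x consumes two powers of the cutoff
  g, which is why g^8 is used from the start and g^2 remains in front of \<eta>.\<close>

definition tempered :: "real \<Rightarrow> (real \<Rightarrow> real \<Rightarrow> real) \<Rightarrow> bool" where
  "tempered T f \<longleftrightarrow> continuous_on ({0<..<T} \<times> UNIV) (\<lambda>p. f (fst p) (snd p)) \<and>
     (\<forall>t\<in>{0<..<T}. \<forall>x. f t (x + 2 * pi) = f t x) \<and>
     (\<exists>C\<ge>0. \<exists>N. \<forall>t\<in>{0<..<T}. \<forall>x. \<bar>f t x\<bar> \<le> C / ell T t ^ N)"

text \<open>The counterpart of \<open>tempered\<close>: decay faster than every power of l(t) at the
  ends of (0,T), against growth of at most some power of 1 / l(t). Tempered functions form an
  algebra and rapid ones a module over it, so once \<open>exp (2 * \<theta>)\<close> is rapid, every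
  product with weights and derivatives of \<eta> is integrable and tends to 0 as t tends to 0 or
  T.\<close>

definition rapid :: "real \<Rightarrow> (real \<Rightarrow> real \<Rightarrow> real) \<Rightarrow> bool" where
  "rapid T f \<longleftrightarrow> continuous_on ({0<..<T} \<times> UNIV) (\<lambda>p. f (fst p) (snd p)) \<and>
     (\<forall>t\<in>{0<..<T}. \<forall>x. f t (x + 2 * pi) = f t x) \<and>
     (\<forall>N. \<exists>C. \<forall>t\<in>{0<..<T}. \<forall>x. \<bar>f t x\<bar> \<le> C * ell T t ^ N)"

lemma temperedI:
  assumes "continuous_on ({0<..<T} \<times> UNIV) (\<lambda>p. f (fst p) (snd p))"
    and "\<And>t x. t \<in> {0<..<T} \<Longrightarrow> f t (x + 2 * pi) = f t x"
    and "C \<ge> 0" "\<And>t x. t \<in> {0<..<T} \<Longrightarrow> \<bar>f t x\<bar> \<le> C / ell T t ^ N"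
  shows "tempered T f"
  unfolding tempered_def using assms by blast

lemma temperedD:
  assumes "tempered T f"
  shows "continuous_on ({0<..<T} \<times> UNIV) (\<lambda>p. f (fst p) (snd p))"
    and "t \<in> {0<..<T} \<Longrightarrow> f t (x + 2 * pi) = f t x"
  using assms unfolding tempered_def by blast+

lemma ell_pos: "t \<in> {0<..<T} \<Longrightarrow> ell T t > 0"
  by (simp add: ell_def)

lemma ell_le: "t \<in> {0<..<T} \<Longrightarrow> ell T t \<le> T\<^sup>2"
  unfolding ell_def power2_eq_square by (intro mult_mono) auto

lemma ell_bound_raise:
  assumes "t \<in> {0<..<T}" "M \<le> N" "0 \<le> C"
  shows "C / ell T t ^ M \<le> C * (1 + T\<^sup>2) ^ (N - M) / ell T t ^ N"
proof -
  have e: "0 < ell T t" "ell T t \<le> 1 + T\<^sup>2" using ell_pos[OF assms(1)] ell_le[OF assms(1)] by auto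
  have "ell T t ^ N = ell T t ^ M * ell T t ^ (N - M)"
    using assms(2) by (simp flip: power_add)
  moreover have "ell T t ^ (N - M) \<le> (1 + T\<^sup>2) ^ (N - M)" using e by (intro power_mono) auto
  ultimately show ?thesis using e assms(3)
    by (simp add: field_simps mult_left_mono)
qed

lemma tempered_bounded:
  assumes "continuous_on ({0<..<T} \<times> UNIV) (\<lambda>p. f (fst p) (snd p))"
    and "\<And>t x. t \<in> {0<..<T} \<Longrightarrow> f t (x + 2 * pi) = f t x"
    and "\<And>t x. t \<in> {0<..<T} \<Longrightarrow> \<bar>f t x\<bar> \<le> C"
  shows "tempered T f"
proof (rule temperedI[where C = "\<bar>C\<bar>" and N = 0])
  show "\<bar>f t x\<bar> \<le> \<bar>C\<bar> / ell T t ^ 0" if "t \<in> {0<..<T}" for t x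
    using assms(3)[OF that, of x] by simp
qed (use assms in auto)

lemma tempered_const: "tempered T (\<lambda>t x. c)"
  by (rule tempered_bounded[where C = "\<bar>c\<bar>"]) auto

lemma tempered_add:
  assumes "tempered T f" "tempered T g" shows "tempered T (\<lambda>t x. f t x + g t x)"
proof -
  obtain C M where C: "C \<ge> 0" "\<And>t x. t\<in>{0<..<T} \<Longrightarrow> \<bar>f t x\<bar> \<le> C / ell T t ^ M"
    using assms(1) unfolding tempered_def by blast
  obtain D N where D: "D \<ge> 0" "\<And>t x. t\<in>{0<..<T} \<Longrightarrow> \<bar>g t x\<bar> \<le> D / ell T t ^ N"
    using assms(2) unfolding tempered_def by blast
  define L where "L = M + N"
  define B where "B = C * (1 + T\<^sup>2) ^ (L - M) + D * (1 + T\<^sup>2) ^ (L - N)"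
  have "\<bar>f t x + g t x\<bar> \<le> B / ell T t ^ L" if t: "t\<in>{0<..<T}" for t x
  proof -
    have "\<bar>f t x\<bar> \<le> C * (1 + T\<^sup>2) ^ (L - M) / ell T t ^ L"
      using C(2)[OF t, of x] ell_bound_raise[OF t _ C(1), of M L] unfolding L_def by auto
    moreover have "\<bar>g t x\<bar> \<le> D * (1 + T\<^sup>2) ^ (L - N) / ell T t ^ L"
      using D(2)[OF t, of x] ell_bound_raise[OF t _ D(1), of N L] unfolding L_def by auto
    ultimately show ?thesis unfolding B_def add_divide_distrib by linarith
  qed
  moreover have "B \<ge> 0" unfolding B_def using C(1) D(1) by simp
  moreover have "continuous_on ({0<..<T} \<times> UNIV) (\<lambda>p. f (fst p) (snd p) + g (fst p) (snd p))"
    using assms by (intro continuous_on_add) (auto simp: tempered_def)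
  ultimately show ?thesis using temperedD(2)[OF assms(1)] temperedD(2)[OF assms(2)]
    by (intro temperedI[where C = B and N = L]) auto
qed

lemma tempered_mult:
  assumes "tempered T f" "tempered T g" shows "tempered T (\<lambda>t x. f t x * g t x)"
proof -
  obtain C M where C: "C \<ge> 0" "\<And>t x. t\<in>{0<..<T} \<Longrightarrow> \<bar>f t x\<bar> \<le> C / ell T t ^ M"
    using assms(1) unfolding tempered_def by blast
  obtain D N where D: "D \<ge> 0" "\<And>t x. t\<in>{0<..<T} \<Longrightarrow> \<bar>g t x\<bar> \<le> D / ell T t ^ N"
    using assms(2) unfolding tempered_def by blast
  have "\<bar>f t x * g t x\<bar> \<le> (C * D) / ell T t ^ (M + N)" if t: "t\<in>{0<..<T}" for t x
  proof -
    have "\<bar>f t x * g t x\<bar> \<le> (C / ell T t ^ M) * (D / ell T t ^ N)"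
      unfolding abs_mult using C D t ell_pos[OF t] by (intro mult_mono) auto
    then show ?thesis by (simp add: power_add)
  qed
  moreover have "C * D \<ge> 0" using C(1) D(1) by simp
  moreover have "continuous_on ({0<..<T} \<times> UNIV) (\<lambda>p. f (fst p) (snd p) * g (fst p) (snd p))"
    using assms by (intro continuous_on_mult) (auto simp: tempered_def)
  ultimately show ?thesis using temperedD(2)[OF assms(1)] temperedD(2)[OF assms(2)]
    by (intro temperedI[where C = "C * D" and N = "M + N"]) auto
qed

lemma tempered_uminus: "tempered T f \<Longrightarrow> tempered T (\<lambda>t x. - f t x)"
  using tempered_mult[OF tempered_const[of T "- 1"]] by fastforce

lemma tempered_diff:
  "tempered T f \<Longrightarrow> tempered T g \<Longrightarrow> tempered T (\<lambda>t x. f t x - g t x)"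
  using tempered_add[OF _ tempered_uminus] by fastforce

lemma tempered_power: "tempered T f \<Longrightarrow> tempered T (\<lambda>t x. f t x ^ n)"
  by (induction n) (auto intro: tempered_const tempered_mult)

lemmas tempered_intros = tempered_const tempered_add tempered_mult tempered_uminus
  tempered_diff tempered_power

lemma rapid_mult_tempered:
  assumes "rapid T f" "tempered T g" shows "rapid T (\<lambda>t x. f t x * g t x)"
proof -
  obtain D M where D: "D \<ge> 0" "\<And>t x. t\<in>{0<..<T} \<Longrightarrow> \<bar>g t x\<bar> \<le> D / ell T t ^ M"
    using assms(2) unfolding tempered_def by blast
  have "\<exists>C. \<forall>t\<in>{0<..<T}. \<forall>x. \<bar>f t x * g t x\<bar> \<le> C * ell T t ^ N" for N
  proof -
    \<comment> \<open>Decay of order N + M is requested; M of it is spent on the growth of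
      g.\<close>
    obtain C where C: "\<And>t x. t\<in>{0<..<T} \<Longrightarrow> \<bar>f t x\<bar> \<le> C * ell T t ^ (N + M)"
      using assms(1) unfolding rapid_def by blast
    have "\<bar>f t x * g t x\<bar> \<le> (C * D) * ell T t ^ N" if t: "t\<in>{0<..<T}" for t x
    proof -
      have "\<bar>f t x * g t x\<bar> \<le> (C * ell T t ^ (N + M)) * (D / ell T t ^ M)"
        unfolding abs_mult using C[OF t, of x] D t ell_pos[OF t] by (intro mult_mono) auto
      then show ?thesis using ell_pos[OF t] by (simp add: power_add field_simps)
    qed
    then show ?thesis by blast
  qed
  moreover have "continuous_on ({0<..<T} \<times> UNIV) (\<lambda>p. f (fst p) (snd p) * g (fst p) (snd p))"
    using assms by (intro continuous_on_mult) (auto simp: tempered_def rapid_def)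
  ultimately show ?thesis using assms unfolding tempered_def rapid_def by auto
qed

lemma rapid_integrable:
  assumes "rapid T f" "A \<in> sets borel"
  shows "set_integrable lborel ({0<..<T} \<times> (A \<inter> {0..<2*pi})) (\<lambda>p. f (fst p) (snd p))"
proof -
  obtain C where C: "\<And>t x. t\<in>{0<..<T} \<Longrightarrow> \<bar>f t x\<bar> \<le> C * ell T t ^ 0"
    using assms(1) unfolding rapid_def by blast
  have c: "continuous_on ({0<..<T} \<times> UNIV) (\<lambda>p. f (fst p) (snd p))"
    using assms(1) unfolding rapid_def by blast
  define S where "S = {0<..<T} \<times> (A \<inter> {0..<2*pi})"
  have S: "S \<in> sets lborel" using assms(2) unfolding S_def
    by (auto intro!: borel_Times)
  have fin: "emeasure lborel S < \<infinity>"
  proof (rule emeasure_bounded_finite)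
    have "S \<subseteq> {0..T} \<times> {0..2*pi}" unfolding S_def by auto
    then show "bounded S"
      using bounded_Times[OF bounded_closed_interval bounded_closed_interval] bounded_subset by blast
  qed
  have m: "set_borel_measurable lborel ({0<..<T} \<times> UNIV) (\<lambda>p. f (fst p) (snd p))"
    using borel_measurable_continuous_on_indicator[OF _ c] unfolding set_borel_measurable_def
    by (simp add: borel_Times)
  have m2: "set_borel_measurable lborel S (\<lambda>p. f (fst p) (snd p))"
    by (rule set_borel_measurable_subset[OF m S]) (auto simp: S_def)
  have "set_integrable lborel S (\<lambda>p. C)"
    unfolding set_integrable_def using S fin by simp
  then have "set_integrable lborel S (\<lambda>p. f (fst p) (snd p))"
    by (rule set_integrable_bound[OF _ m2]) (use C in \<open>auto simp: S_def intro!: AE_I2 order_trans[OF _ abs_ge_self]\<close>)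
  then show ?thesis unfolding S_def .
qed

section \<open>Integration over (0,T) times the torus\<close>

lemma iint_cong:
  assumes "\<And>t x. t \<in> {0<..<T} \<Longrightarrow> x \<in> A \<Longrightarrow> f t x = g t x" "A \<in> sets borel"
  shows "iint T A f = iint T A g"
  unfolding iint_def
  by (rule set_lebesgue_integral_cong) (use assms in \<open>auto intro!: borel_Times\<close>)

lemma iint_add:
  assumes "rapid T f" "rapid T g"
  shows "iint T UNIV (\<lambda>t x. f t x + g t x) = iint T UNIV f + iint T UNIV g"
  unfolding iint_def using rapid_integrable[OF assms(1), of UNIV] rapid_integrable[OF assms(2), of UNIV]
  by (simp add: set_integral_add)

lemma iint_cmult: "iint T A (\<lambda>t x. c * f t x) = c * iint T A f"
  unfolding iint_def by simp

text \<open>Outside A the left integrand can only lower the integral, so the restriction to A and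
  the comparison inside A are done at once. This is how the cutoff term becomes an integral over
  J.\<close>

lemma iint_mono_subset:
  assumes "rapid T f" "rapid T g" "A \<in> sets borel"
    and "\<And>t x. t \<in> {0<..<T} \<Longrightarrow> x \<in> A \<Longrightarrow> f t x \<le> g t x"
    and "\<And>t x. t \<in> {0<..<T} \<Longrightarrow> x \<notin> A \<Longrightarrow> f t x \<le> 0"
  shows "iint T UNIV f \<le> iint T A g"
  unfolding iint_def set_lebesgue_integral_def
  by (rule integral_mono)
    (use rapid_integrable[OF assms(1), of UNIV] rapid_integrable[OF assms(2,3)] assms(4,5)
      in \<open>auto simp: set_integrable_def indicator_def mem_Times_iff\<close>)

text \<open>Fubini with x inside: the inner integral over one period is f(t, 2 pi) - f(t, 0), which
  vanishes by periodicity.\<close>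

lemma iint_dx_zero:
  assumes f: "rapid T f" and f': "rapid T f'"
    and d: "\<And>t x. t \<in> {0<..<T} \<Longrightarrow> ((\<lambda>y. f t y) has_real_derivative f' t x) (at x)"
  shows "iint T UNIV f' = 0"
proof -
  define F where "F = (\<lambda>p. indicator ({0<..<T} \<times> {0..<2*pi}) p *\<^sub>R f' (fst p) (snd p))"
  have int: "integrable (lborel \<Otimes>\<^sub>M lborel) F"
    using rapid_integrable[OF f', of UNIV] unfolding set_integrable_def F_def lborel_prod by simp
  have "iint T UNIV f' = (\<integral>p. F p \<partial>(lborel \<Otimes>\<^sub>M lborel))"
    unfolding iint_def set_lebesgue_integral_def F_def lborel_prod by simp
  also have "\<dots> = (\<integral>t. \<integral>x. F (t, x) \<partial>lborel \<partial>lborel)"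
    using lborel_pair.integral_fst'[OF int] by simp
  also have "\<dots> = (\<integral>t. 0 \<partial>(lborel :: real measure))"
  proof (intro Bochner_Integration.integral_cong refl)
    fix t :: real
    show "(\<integral>x. F (t, x) \<partial>lborel) = 0"
    proof (cases "t \<in> {0<..<T}")
      case True
      have cU: "continuous_on UNIV (f' t)"
        using f' True continuous_on_compose2[of "{0<..<T} \<times> UNIV" "\<lambda>p. f' (fst p) (snd p)" UNIV "\<lambda>x. (t, x)",
            OF _ continuous_on_Pair[OF continuous_on_const continuous_on_id]]
        unfolding rapid_def by (simp add: image_subset_iff)
      then have c: "continuous_on {0..2*pi} (f' t)" by (rule continuous_on_subset) simp
      have "(\<integral>x. F (t, x) \<partial>lborel) = (LINT x:{0..<2*pi}|lborel. f' t x)"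
        unfolding F_def set_lebesgue_integral_def using True
        by (auto intro!: Bochner_Integration.integral_cong simp: indicator_def)
      \<comment> \<open>The fundamental domain is half-open; its missing end point is a null set and
        is added for the fundamental theorem of calculus.\<close>
      also have "\<dots> = (LINT x:{0..2*pi}|lborel. f' t x)"
      proof (rule set_integral_cong_set)
        have m: "f' t \<in> borel_measurable lborel" using borel_measurable_continuous_onI[OF cU] by simp
        show "set_borel_measurable lborel {0..<2*pi} (f' t)" "set_borel_measurable lborel {0..2*pi} (f' t)"
          unfolding set_borel_measurable_def using m by measurable
        have "AE x in lborel. x \<noteq> 2*pi" by (rule AE_lborel_singleton)
        then show "AE x in lborel. (x \<in> {0..2*pi}) = (x \<in> {0..<2*pi})" by eventually_elim auto
      qed
      also have "\<dots> = f t (2*pi) - f t 0"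
      proof -
        have "(\<integral>x. indicator {0..2*pi} x *\<^sub>R f' t x \<partial>lborel) = f t (2*pi) - f t 0"
          by (rule integral_FTC_atLeastAtMost)
            (use d[OF True] c in \<open>auto simp: has_real_derivative_iff_has_vector_derivative
              intro: has_vector_derivative_at_within\<close>)
        then show ?thesis unfolding set_lebesgue_integral_def .
      qed
      also have "\<dots> = 0" using f True unfolding rapid_def by (metis add_0 cancel_comm_monoid_add_class.diff_cancel)
      finally show ?thesis .
    next
      case False
      then show ?thesis unfolding F_def by (auto simp: indicator_def)
    qed
  qed
  finally show ?thesis by simp
qed

lemma rapid_vanishes:
  assumes f: "rapid T f" and T: "T > 0"
  shows "((\<lambda>t. f t x) \<longlongrightarrow> 0) (at_right 0)" "((\<lambda>t. f t x) \<longlongrightarrow> 0) (at_left T)"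
proof -
  obtain C where C: "\<And>t x. t\<in>{0<..<T} \<Longrightarrow> \<bar>f t x\<bar> \<le> C * ell T t ^ 1"
    using f unfolding rapid_def by blast
  have e0: "((\<lambda>t. C * ell T t ^ 1) \<longlongrightarrow> C * ell T 0 ^ 1) (at_right 0)"
    unfolding ell_def by (intro tendsto_intros)
  have eT: "((\<lambda>t. C * ell T t ^ 1) \<longlongrightarrow> C * ell T T ^ 1) (at_left T)"
    unfolding ell_def by (intro tendsto_intros)
  have ev0: "\<forall>\<^sub>F t in at_right 0. norm (f t x) \<le> C * ell T t ^ 1"
    using eventually_at_right_less[of "0::real"] eventually_at_right_field[of _ "0::real"] T C
    by (metis (no_types, lifting) greaterThanLessThan_iff real_norm_def)
  have evT: "\<forall>\<^sub>F t in at_left T. norm (f t x) \<le> C * ell T t ^ 1"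
    using eventually_at_left_field[of _ T] T C
    by (metis (no_types, lifting) greaterThanLessThan_iff real_norm_def)
  show "((\<lambda>t. f t x) \<longlongrightarrow> 0) (at_right 0)"
    using Lim_null_comparison[OF ev0] e0 by (simp add: ell_def)
  show "((\<lambda>t. f t x) \<longlongrightarrow> 0) (at_left T)"
    using Lim_null_comparison[OF evT] eT by (simp add: ell_def)
qed

text \<open>Fubini with t inside. Since f is only controlled on the open interval, the boundary
  values are its one-sided limits at 0 and T, both zero by rapid decay.\<close>

lemma iint_dt_zero:
  assumes f: "rapid T f" and f': "rapid T f'" and T: "T > 0"
    and d: "\<And>t x. t \<in> {0<..<T} \<Longrightarrow> ((\<lambda>r. f r x) has_real_derivative f' t x) (at t)"
  shows "iint T UNIV f' = 0"
proof -
  define F where "F = (\<lambda>p. indicator ({0<..<T} \<times> {0..<2*pi}) p *\<^sub>R f' (fst p) (snd p))"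
  have int: "integrable (lborel \<Otimes>\<^sub>M lborel) F"
    using rapid_integrable[OF f', of UNIV] unfolding set_integrable_def F_def lborel_prod by simp
  have "iint T UNIV f' = (\<integral>p. F p \<partial>(lborel \<Otimes>\<^sub>M lborel))"
    unfolding iint_def set_lebesgue_integral_def F_def lborel_prod by simp
  also have "\<dots> = (\<integral>x. \<integral>t. F (t, x) \<partial>lborel \<partial>lborel)"
    using lborel_pair.integral_snd[of "\<lambda>t x. F (t, x)"] int by simp
  also have "\<dots> = (\<integral>x. 0 \<partial>(lborel :: real measure))"
  proof (intro Bochner_Integration.integral_cong refl)
    fix x :: real
    obtain C where C: "\<And>t x. t\<in>{0<..<T} \<Longrightarrow> \<bar>f' t x\<bar> \<le> C * ell T t ^ 0"
      using f' unfolding rapid_def by blast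
    show "(\<integral>t. F (t, x) \<partial>lborel) = 0"
    proof (cases "x \<in> {0..<2*pi}")
      case True
      have c: "continuous_on {0<..<T} (\<lambda>t. f' t x)"
        using f' continuous_on_compose2[of "{0<..<T} \<times> UNIV" "\<lambda>p. f' (fst p) (snd p)" "{0<..<T}" "\<lambda>t. (t, x)",
            OF _ continuous_on_Pair[OF continuous_on_id continuous_on_const]]
        unfolding rapid_def by auto
      have m: "set_borel_measurable lborel {0<..<T} (\<lambda>t. f' t x)"
        using borel_measurable_continuous_on_indicator[OF _ c] unfolding set_borel_measurable_def by simp
      have "set_integrable lborel {0<..<T} (\<lambda>t. C)"
        unfolding set_integrable_def using T by simp
      then have si: "set_integrable lborel {0<..<T} (\<lambda>t. f' t x)"
        by (rule set_integrable_bound[OF _ m]) (use C in \<open>auto intro!: AE_I2 order_trans[OF _ abs_ge_self]\<close>)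
      have "(LBINT t=ereal 0..ereal T. f' t x) = 0 - 0"
      proof (rule interval_integral_FTC_integrable)
        show "ereal 0 < ereal T" using T by simp
        show "((\<lambda>t. f t x) has_vector_derivative f' t x) (at t)" if "ereal 0 < ereal t" "ereal t < ereal T" for t
          using d[of t x] that by (simp add: has_real_derivative_iff_has_vector_derivative)
        show "isCont (\<lambda>t. f' t x) t" if "ereal 0 < ereal t" "ereal t < ereal T" for t
          using continuous_on_interior[OF c, of t] that by simp
        show "set_integrable lborel (einterval (ereal 0) (ereal T)) (\<lambda>t. f' t x)"
          using si by simp
        show "(((\<lambda>t. f t x) \<circ> real_of_ereal) \<longlongrightarrow> 0) (at_right (ereal 0))"
          using rapid_vanishes(1)[OF f T, of x]
          by (simp add: ereal_tendsto_simps)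
        show "(((\<lambda>t. f t x) \<circ> real_of_ereal) \<longlongrightarrow> 0) (at_left (ereal T))"
          using rapid_vanishes(2)[OF f T, of x] by (simp add: ereal_tendsto_simps)
      qed
      then have "(LINT t:{0<..<T}|lborel. f' t x) = 0"
        using T by (simp add: interval_lebesgue_integral_def)
      then show ?thesis unfolding F_def set_lebesgue_integral_def using True
        by (simp add: indicator_def mem_Times_iff cong: if_cong)
    next
      case False
      then show ?thesis unfolding F_def by simp
    qed
  qed
  finally show ?thesis by simp
qed

subsection \<open>The weight\<close>

definition has_dx :: "real \<Rightarrow> (real \<Rightarrow> real \<Rightarrow> real) \<Rightarrow> (real \<Rightarrow> real \<Rightarrow> real) \<Rightarrow> bool" where
  "has_dx T u u' \<longleftrightarrow> (\<forall>t\<in>{0<..<T}. \<forall>x. ((\<lambda>y. u t y) has_real_derivative u' t x) (at x))"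

definition has_dt :: "real \<Rightarrow> (real \<Rightarrow> real \<Rightarrow> real) \<Rightarrow> (real \<Rightarrow> real \<Rightarrow> real) \<Rightarrow> bool" where
  "has_dt T u u' \<longleftrightarrow> (\<forall>t\<in>{0<..<T}. \<forall>x. ((\<lambda>r. u r x) has_real_derivative u' t x) (at t))"

lemma has_dxI:
  "(\<And>t x. t \<in> {0<..<T} \<Longrightarrow> ((\<lambda>y. u t y) has_real_derivative u' t x) (at x)) \<Longrightarrow> has_dx T u u'"
  by (simp add: has_dx_def)

lemma has_dtI:
  "(\<And>t x. t \<in> {0<..<T} \<Longrightarrow> ((\<lambda>r. u r x) has_real_derivative u' t x) (at t)) \<Longrightarrow> has_dt T u u'"
  by (simp add: has_dt_def)

lemma has_dxD:
  "has_dx T u u' \<Longrightarrow> t \<in> {0<..<T} \<Longrightarrow> ((\<lambda>y. u t y) has_real_derivative u' t x) (at x)"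
  by (simp add: has_dx_def)

lemma has_dtD:
  "has_dt T u u' \<Longrightarrow> t \<in> {0<..<T} \<Longrightarrow> ((\<lambda>r. u r x) has_real_derivative u' t x) (at t)"
  by (simp add: has_dt_def)

lemma young:
  fixes a b d :: real assumes "d > 0"
  shows "\<bar>a * b\<bar> \<le> d * a\<^sup>2 + b\<^sup>2 / (4 * d)"
proof -
  have "0 \<le> (2 * d * \<bar>a\<bar> - \<bar>b\<bar>)\<^sup>2 / (4 * d)" using assms by simp
  also have "\<dots> = d * a\<^sup>2 + b\<^sup>2 / (4 * d) - \<bar>a * b\<bar>"
    using assms by (simp add: power2_diff field_simps abs_mult) (simp add: power2_eq_square)
  finally show ?thesis by simp
qed

text \<open>An axiomatic weight, so that the analysis never sees the explicit exponential. \<beta>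
  will be 1 + \<alpha>; \<open>\<psi>1\<close>, \<open>\<psi>2\<close>, \<open>\<psi>3\<close> are
  the derivatives of the weight function on the torus, and g is a cutoff that is bounded below near
  its critical points, as expressed by \<open>coercive\<close>. Through \<open>\<Lambda>_ge\<close>
  each factor \<mu> costs at most \<epsilon> \<Lambda>; the bounds on time derivatives play the same
  role for t, with a factor \<beta> to spare so that terms multiplied by \<alpha> remain small.
  \<open>g_deriv\<close> starts at exponent 2 because g will be a positive part, which need not be
  differentiable itself.\<close>

locale carleman_weight =
  fixes T \<mu> \<beta> \<epsilon> K c :: real and \<theta> \<theta>t \<theta>tt \<Lambda> \<Lambda>t :: "real \<Rightarrow> real \<Rightarrow> real"
    and \<psi>1 \<psi>2 \<psi>3 g g1 :: "real \<Rightarrow> real"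
  assumes T: "T > 0" and \<mu>: "\<mu> \<ge> 1" and \<beta>: "\<beta> \<ge> 1" and \<epsilon>: "0 < \<epsilon>" "\<epsilon> \<le> 1"
    and K: "K \<ge> 1" and c: "0 < c" "c \<le> 1"
    and temp: "tempered T \<Lambda>" "tempered T \<Lambda>t" "tempered T \<theta>t" "tempered T \<theta>tt"
      "tempered T (\<lambda>t. \<psi>1)" "tempered T (\<lambda>t. \<psi>2)" "tempered T (\<lambda>t. \<psi>3)"
      "tempered T (\<lambda>t. g)" "tempered T (\<lambda>t. g1)"
    and rapid_weight: "rapid T (\<lambda>t x. exp (2 * \<theta> t x))"
    and bnd: "\<And>x. \<bar>\<psi>1 x\<bar> \<le> K" "\<And>x. \<bar>\<psi>2 x\<bar> \<le> K" "\<And>x. \<bar>\<psi>3 x\<bar> \<le> K" "\<And>x. \<bar>g1 x\<bar> \<le> K"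
    and g: "\<And>x. 0 \<le> g x" "\<And>x. g x \<le> 1"
    and coercive: "\<And>x. c \<le> (\<psi>1 x)\<^sup>2 + K * g x ^ 8"
    and \<Lambda>_ge: "\<And>t x. t \<in> {0<..<T} \<Longrightarrow> \<mu> / \<epsilon> \<le> \<Lambda> t x"
    and \<theta>t_le: "\<And>t x. t \<in> {0<..<T} \<Longrightarrow> \<bar>\<theta>t t x\<bar> * \<beta> \<le> \<epsilon> * (\<Lambda> t x)\<^sup>2"
    and \<Lambda>t_le: "\<And>t x. t \<in> {0<..<T} \<Longrightarrow> \<bar>\<Lambda>t t x\<bar> * \<beta> \<le> \<epsilon> * (\<Lambda> t x)\<^sup>2"
    and \<theta>tt_le: "\<And>t x. t \<in> {0<..<T} \<Longrightarrow> \<bar>\<theta>tt t x\<bar> \<le> \<epsilon> * \<Lambda> t x ^ 3"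
    and \<theta>_dx: "has_dx T \<theta> (\<lambda>t x. \<psi>1 x * \<Lambda> t x)"
    and \<Lambda>_dx: "has_dx T \<Lambda> (\<lambda>t x. \<mu> * \<psi>1 x * \<Lambda> t x)"
    and \<psi>1_deriv: "\<And>x. (\<psi>1 has_real_derivative \<psi>2 x) (at x)"
    and \<psi>2_deriv: "\<And>x. (\<psi>2 has_real_derivative \<psi>3 x) (at x)"
    and g_deriv: "\<And>x n. ((\<lambda>y. g y ^ (n + 2)) has_real_derivative real (n + 2) * g x ^ (n + 1) * g1 x) (at x)"
    and \<theta>_dt: "has_dt T \<theta> \<theta>t" and \<theta>t_dt: "has_dt T \<theta>t \<theta>tt" and \<Lambda>_dt: "has_dt T \<Lambda> \<Lambda>t"
    and \<theta>t_dx: "has_dx T \<theta>t (\<lambda>t x. \<psi>1 x * \<Lambda>t t x)"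
begin

lemma \<Lambda>_bounds:
  assumes "t \<in> {0<..<T}"
  shows "0 < \<Lambda> t x" "1 \<le> \<Lambda> t x" "\<mu> \<le> \<Lambda> t x" "\<mu> \<le> \<epsilon> * \<Lambda> t x" "1 \<le> \<epsilon> * \<Lambda> t x"
proof -
  show 1: "\<mu> \<le> \<epsilon> * \<Lambda> t x" using \<Lambda>_ge[OF assms, of x] \<epsilon> by (simp add: field_simps)
  show "1 \<le> \<epsilon> * \<Lambda> t x" using 1 \<mu> by simp
  have pos: "0 < \<Lambda> t x"
    using 1 \<mu> \<epsilon> by (metis less_le_trans order.strict_trans1 zero_less_mult_pos zero_less_one)
  then show "0 < \<Lambda> t x" .
  show "\<mu> \<le> \<Lambda> t x" using 1 pos \<epsilon> mult_right_mono[of \<epsilon> 1 "\<Lambda> t x"] by linarith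
  then show "1 \<le> \<Lambda> t x" using \<mu> by simp
qed

definition \<rho> :: "real \<Rightarrow> real \<Rightarrow> real" where "\<rho> t x = 1 / \<Lambda> t x"
text \<open>The exponent of \<Lambda> is m - 1: the shift puts the weight 1 / \<Lambda> of the
  top-order terms at m = 0 and keeps the index a natural number. In \<open>N m n\<close> the second
  index is the power of the cutoff, n = 0 being the global norm.\<close>

definition W :: "nat \<Rightarrow> real \<Rightarrow> real \<Rightarrow> real" where "W m t x = \<Lambda> t x ^ m / \<Lambda> t x"
definition I :: "(real \<Rightarrow> real \<Rightarrow> real) \<Rightarrow> real" where
  "I f = iint T UNIV (\<lambda>t x. exp (2 * \<theta> t x) * f t x)"
definition N :: "nat \<Rightarrow> nat \<Rightarrow> (real \<Rightarrow> real \<Rightarrow> real) \<Rightarrow> real" where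
  "N m n u = I (\<lambda>t x. g x ^ n * W m t x * (u t x)\<^sup>2)"

lemma \<rho>_bounds:
  assumes "t \<in> {0<..<T}"
  shows "0 < \<rho> t x" "\<rho> t x \<le> 1" "\<rho> t x * \<Lambda> t x = 1" "\<mu> * \<rho> t x \<le> \<epsilon>" "\<rho> t x \<le> \<epsilon>" "\<mu> * \<rho> t x \<le> 1"
  using \<Lambda>_bounds[OF assms, of x] by (auto simp: \<rho>_def field_simps)

lemma tempered_\<rho>: "tempered T \<rho>"
proof (rule tempered_bounded[where C = 1])
  show "continuous_on ({0<..<T} \<times> UNIV) (\<lambda>p. \<rho> (fst p) (snd p))"
  proof -
    have "\<forall>p\<in>{0<..<T} \<times> UNIV. \<Lambda> (fst p) (snd p) \<noteq> 0"
    proof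
      fix p :: "real \<times> real" assume "p \<in> {0<..<T} \<times> UNIV"
      then show "\<Lambda> (fst p) (snd p) \<noteq> 0" using \<Lambda>_bounds(1)[of "fst p" "snd p"] by auto
    qed
    then show ?thesis
      unfolding \<rho>_def by (intro continuous_on_divide continuous_on_const temperedD(1)[OF temp(1)])
  qed
  show "\<rho> t (x + 2 * pi) = \<rho> t x" if "t \<in> {0<..<T}" for t x
    unfolding \<rho>_def using temperedD(2)[OF temp(1) that] by simp
  show "\<bar>\<rho> t x\<bar> \<le> 1" if "t \<in> {0<..<T}" for t x
    using \<rho>_bounds[OF that, of x] by simp
qed

lemma W_eq: "W m t x = \<rho> t x * \<Lambda> t x ^ m" by (simp add: W_def \<rho>_def)

lemma tempered_W: "tempered T (W m)"
  using tempered_mult[OF tempered_\<rho> tempered_power[OF temp(1)], of m]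
  by (simp add: W_eq[abs_def])

lemmas tempered_all = temp tempered_\<rho> tempered_W tempered_intros

lemma W_bounds:
  assumes "t \<in> {0<..<T}"
  shows "0 < W m t x" "W (Suc m) t x = \<Lambda> t x * W m t x"
  using \<Lambda>_bounds[OF assms, of x] by (auto simp: W_def)

lemma \<rho>_dx: "has_dx T \<rho> (\<lambda>t x. - \<mu> * \<psi>1 x * \<rho> t x)"
proof (rule has_dxI)
  fix t x assume t: "t \<in> {0<..<T}"
  show "((\<lambda>y. \<rho> t y) has_real_derivative - \<mu> * \<psi>1 x * \<rho> t x) (at x)"
    unfolding \<rho>_def using \<Lambda>_bounds(1)[OF t, of x]
    by (auto intro!: derivative_eq_intros has_dxD[OF \<Lambda>_dx t] simp: field_simps)
qed

lemma \<rho>_dt: "has_dt T \<rho> (\<lambda>t x. - \<Lambda>t t x * (\<rho> t x)\<^sup>2)"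
proof (rule has_dtI)
  fix t x assume t: "t \<in> {0<..<T}"
  show "((\<lambda>r. \<rho> r x) has_real_derivative - \<Lambda>t t x * (\<rho> t x)\<^sup>2) (at t)"
    unfolding \<rho>_def using \<Lambda>_bounds(1)[OF t, of x]
    by (auto intro!: derivative_eq_intros has_dtD[OF \<Lambda>_dt t] simp: field_simps power2_eq_square)
qed

lemma W_dx: "has_dx T (W m) (\<lambda>t x. (real m - 1) * \<mu> * \<psi>1 x * W m t x)"
proof (rule has_dxI)
  fix t x assume t: "t \<in> {0<..<T}"
  show "((\<lambda>y. W m t y) has_real_derivative (real m - 1) * \<mu> * \<psi>1 x * W m t x) (at x)"
    unfolding W_def using \<Lambda>_bounds(1)[OF t, of x]
    by (auto intro!: derivative_eq_intros has_dxD[OF \<Lambda>_dx t]) (cases m; simp add: field_simps)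
qed

lemma W_dt: "has_dt T (W m) (\<lambda>t x. (real m - 1) * \<Lambda>t t x * \<rho> t x * W m t x)"
proof (rule has_dtI)
  fix t x assume t: "t \<in> {0<..<T}"
  show "((\<lambda>r. W m r x) has_real_derivative (real m - 1) * \<Lambda>t t x * \<rho> t x * W m t x) (at t)"
    unfolding W_def \<rho>_def using \<Lambda>_bounds(1)[OF t, of x]
    by (auto intro!: derivative_eq_intros has_dtD[OF \<Lambda>_dt t]) (cases m; simp add: field_simps)
qed

lemma rapid_E: "tempered T f \<Longrightarrow> rapid T (\<lambda>t x. exp (2 * \<theta> t x) * f t x)"
  by (rule rapid_mult_tempered[OF rapid_weight])

lemma I_add: "tempered T f \<Longrightarrow> tempered T h \<Longrightarrow> I (\<lambda>t x. f t x + h t x) = I f + I h"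
  unfolding I_def using iint_add[OF rapid_E rapid_E] by (simp add: distrib_left)

lemma I_cmult: "I (\<lambda>t x. a * f t x) = a * I f"
  unfolding I_def using iint_cmult[of T UNIV a "\<lambda>t x. exp (2 * \<theta> t x) * f t x"]
  by (simp add: mult.left_commute)

lemma I_mono:
  assumes "tempered T f" "tempered T h" "\<And>t x. t \<in> {0<..<T} \<Longrightarrow> f t x \<le> h t x"
  shows "I f \<le> I h"
  unfolding I_def by (rule iint_mono_subset) (use assms rapid_E in auto)

lemma I_dx_zero:
  assumes "tempered T X" "tempered T X'" "has_dx T X X'"
  shows "I (\<lambda>t x. X' t x + 2 * \<psi>1 x * \<Lambda> t x * X t x) = 0"
proof -
  have "iint T UNIV (\<lambda>t x. exp (2 * \<theta> t x) * (X' t x + 2 * \<psi>1 x * \<Lambda> t x * X t x)) = 0"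
  proof (rule iint_dx_zero)
    show "rapid T (\<lambda>t x. exp (2 * \<theta> t x) * X t x)" by (rule rapid_E[OF assms(1)])
    show "rapid T (\<lambda>t x. exp (2 * \<theta> t x) * (X' t x + 2 * \<psi>1 x * \<Lambda> t x * X t x))"
      by (intro rapid_E tempered_all assms)
    show "((\<lambda>y. exp (2 * \<theta> t y) * X t y) has_real_derivative
        exp (2 * \<theta> t x) * (X' t x + 2 * \<psi>1 x * \<Lambda> t x * X t x)) (at x)" if "t \<in> {0<..<T}" for t x
      by (auto intro!: derivative_eq_intros has_dxD[OF \<theta>_dx that] has_dxD[OF assms(3) that] simp: algebra_simps)
  qed
  then show ?thesis by (simp add: I_def)
qed

lemma I_dt_zero:
  assumes "tempered T Y" "tempered T Y'" "has_dt T Y Y'"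
  shows "I (\<lambda>t x. Y' t x + 2 * \<theta>t t x * Y t x) = 0"
proof -
  have "iint T UNIV (\<lambda>t x. exp (2 * \<theta> t x) * (Y' t x + 2 * \<theta>t t x * Y t x)) = 0"
  proof (rule iint_dt_zero)
    show "rapid T (\<lambda>t x. exp (2 * \<theta> t x) * Y t x)" by (rule rapid_E[OF assms(1)])
    show "rapid T (\<lambda>t x. exp (2 * \<theta> t x) * (Y' t x + 2 * \<theta>t t x * Y t x))"
      by (intro rapid_E tempered_all assms)
    show "((\<lambda>r. exp (2 * \<theta> r x) * Y r x) has_real_derivative
        exp (2 * \<theta> t x) * (Y' t x + 2 * \<theta>t t x * Y t x)) (at t)" if "t \<in> {0<..<T}" for t x
      by (auto intro!: derivative_eq_intros has_dtD[OF \<theta>_dt that] has_dtD[OF assms(3) that] simp: algebra_simps)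
  qed (rule T)
  then show ?thesis by (simp add: I_def)
qed

text \<open>The device behind all estimates: a pointwise inequality modulo one exact x-derivative
  and one exact t-derivative integrates to an inequality between f and h alone.\<close>

lemma I_le_div:
  assumes "tempered T f" "tempered T h" "tempered T X" "tempered T X'" "has_dx T X X'"
    "tempered T Y" "tempered T Y'" "has_dt T Y Y'"
    and le: "\<And>t x. t \<in> {0<..<T} \<Longrightarrow> f t x \<le> h t x
      + (X' t x + 2 * \<psi>1 x * \<Lambda> t x * X t x) + (Y' t x + 2 * \<theta>t t x * Y t x)"
  shows "I f \<le> I h"
proof -
  have "I f \<le> I (\<lambda>t x. h t x + (X' t x + 2 * \<psi>1 x * \<Lambda> t x * X t x) + (Y' t x + 2 * \<theta>t t x * Y t x))"
    by (rule I_mono) (intro tempered_all assms le | assumption)+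
  also have "\<dots> = I (\<lambda>t x. h t x + (X' t x + 2 * \<psi>1 x * \<Lambda> t x * X t x)) + I (\<lambda>t x. Y' t x + 2 * \<theta>t t x * Y t x)"
    by (rule I_add) (intro tempered_all assms)+
  also have "I (\<lambda>t x. h t x + (X' t x + 2 * \<psi>1 x * \<Lambda> t x * X t x)) = I h + I (\<lambda>t x. X' t x + 2 * \<psi>1 x * \<Lambda> t x * X t x)"
    by (rule I_add) (intro tempered_all assms)+
  finally show ?thesis using I_dx_zero[OF assms(3-5)] I_dt_zero[OF assms(6-8)] by simp
qed

lemma I_le_dx:
  assumes "tempered T f" "tempered T h" "tempered T X" "tempered T X'" "has_dx T X X'"
    and le: "\<And>t x. t \<in> {0<..<T} \<Longrightarrow> f t x \<le> h t x + (X' t x + 2 * \<psi>1 x * \<Lambda> t x * X t x)"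
  shows "I f \<le> I h"
  using I_le_div[OF assms(1-5) tempered_const[of T 0] tempered_const[of T 0]] le
  by (simp add: has_dt_def)

lemma I_le_dt:
  assumes "tempered T f" "tempered T h" "tempered T Y" "tempered T Y'" "has_dt T Y Y'"
    and le: "\<And>t x. t \<in> {0<..<T} \<Longrightarrow> f t x \<le> h t x + (Y' t x + 2 * \<theta>t t x * Y t x)"
  shows "I f \<le> I h"
  using I_le_div[OF assms(1,2) tempered_const[of T 0] tempered_const[of T 0] _ assms(3-5)] le
  by (simp add: has_dx_def)

section \<open>Weighted elliptic estimate and interpolation inequalities\<close>

lemma N_integrand_tempered: "tempered T u \<Longrightarrow> tempered T (\<lambda>t x. g x ^ n * W m t x * (u t x)\<^sup>2)"
  by (intro tempered_all)

lemma N_nonneg: assumes "tempered T u" shows "0 \<le> N m n u"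
proof -
  have "I (\<lambda>t x. 0 * 0) \<le> N m n u" unfolding N_def
  proof (rule I_mono)
    show "0 * 0 \<le> g x ^ n * W m t x * (u t x)\<^sup>2" if "t \<in> {0<..<T}" for t x
      using g(1)[of x] W_bounds(1)[OF that, of m x] by simp
  qed (intro tempered_all assms)+
  then show ?thesis by (simp only: I_cmult)
qed

lemma N_antimono: assumes "tempered T u" "n' \<le> n" shows "N m n u \<le> N m n' u"
  unfolding N_def
  by (rule I_mono) (auto intro!: N_integrand_tempered assms mult_right_mono less_imp_le[OF W_bounds(1)]
    power_decreasing[OF assms(2)] g)

text \<open>A weighted Poincare inequality. When
  \<open>exp (2 * \<theta>) * \<psi>1 * W (m + 1) * u^2\<close> is differentiated, the exponential
  yields 2 (\<psi>')^2 \<Lambda> W (m + 1) u^2. Half of it, together with u'^2, absorbs the cross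
  term u u'; the other half is coercive away from the critical points, and the g^8 term covers the
  rest.\<close>

lemma elliptic_estimate:
  assumes "K * \<epsilon> \<le> c / 2" and u: "tempered T u" "tempered T u'" "has_dx T u u'"
  shows "N (m + 2) 0 u \<le> 2 * K / c * (N m 0 u' + N (m + 2) 8 u)"
proof -
  define X where "X = (\<lambda>t x. \<psi>1 x * W (m + 1) t x * (u t x)\<^sup>2)"
  define X' where "X' = (\<lambda>t x. \<psi>2 x * W (m + 1) t x * (u t x)\<^sup>2
     + real m * \<mu> * (\<psi>1 x)\<^sup>2 * W (m + 1) t x * (u t x)\<^sup>2 + 2 * \<psi>1 x * W (m + 1) t x * u t x * u' t x)"
  have tX: "tempered T X" "tempered T X'" unfolding X_def X'_def by (intro tempered_all u)+
  have dX: "has_dx T X X'"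
    unfolding X_def X'_def
    by (rule has_dxI) (auto intro!: derivative_eq_intros has_dxD[OF W_dx] has_dxD[OF u(3)] \<psi>1_deriv
      simp: algebra_simps power2_eq_square)
  have "I (\<lambda>t x. c / 2 * (g x ^ 0 * W (m + 2) t x * (u t x)\<^sup>2))
      \<le> I (\<lambda>t x. K * (g x ^ 0 * W m t x * (u' t x)\<^sup>2 + g x ^ 8 * W (m + 2) t x * (u t x)\<^sup>2))"
  proof (rule I_le_dx[OF _ _ tX dX])
    fix t x assume t: "t \<in> {0<..<T}"
    define L w a b where "L = \<Lambda> t x" and "w = W m t x" and "a = u t x" and "b = u' t x"
    have L: "L > 0" "1 \<le> \<epsilon> * L" and w: "w > 0"
      using \<Lambda>_bounds[OF t, of x] W_bounds[OF t] by (auto simp: L_def w_def)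
    have W1: "W (m + 1) t x = L * w" and W2: "W (m + 2) t x = L\<^sup>2 * w"
      using W_bounds(2)[OF t] by (auto simp: L_def w_def power2_eq_square)
    have s1: "2 * \<psi>1 x * L * a * b \<ge> - ((\<psi>1 x)\<^sup>2 * L\<^sup>2 * a\<^sup>2 + b\<^sup>2)"
      using zero_le_power2[of "\<psi>1 x * L * a + b"] by (simp add: power2_sum power_mult_distrib algebra_simps)
    \<comment> \<open>A spare power of \<Lambda> is turned into a factor \<epsilon>, which makes the
      term with \<psi>'' harmless.\<close>
    have "K * (L * a\<^sup>2) \<le> c / 2 * (L\<^sup>2 * a\<^sup>2)"
    proof -
      have "K * (L * a\<^sup>2) \<le> K * ((\<epsilon> * L) * L * a\<^sup>2)"
        using L K mult_right_mono[OF L(2), of "L * a\<^sup>2"] by (intro mult_left_mono) auto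
      also have "\<dots> = (K * \<epsilon>) * (L\<^sup>2 * a\<^sup>2)" by (simp add: power2_eq_square)
      also have "\<dots> \<le> c / 2 * (L\<^sup>2 * a\<^sup>2)" using assms(1) by (intro mult_right_mono) auto
      finally show ?thesis .
    qed
    moreover have "\<psi>2 x * (L * a\<^sup>2) \<ge> - K * (L * a\<^sup>2)"
      using bnd(2)[of x] L by (intro mult_right_mono) auto
    ultimately have s2: "\<psi>2 x * L * a\<^sup>2 \<ge> - (c / 2 * (L\<^sup>2 * a\<^sup>2))" by (simp add: mult.assoc)
    \<comment> \<open>The x-derivative of the weight contributes with a good sign, since
      \<open>W (m + 1)\<close> is a nonnegative power of \<Lambda>; so neither m nor \<mu> enters
      the constant.\<close>
    have s3: "real m * \<mu> * (\<psi>1 x)\<^sup>2 * L * a\<^sup>2 \<ge> 0" using \<mu> L by simp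
    have s4: "c * (L\<^sup>2 * a\<^sup>2) \<le> ((\<psi>1 x)\<^sup>2 + K * g x ^ 8) * (L\<^sup>2 * a\<^sup>2)"
      using coercive[of x] by (intro mult_right_mono) auto
    have s5: "b\<^sup>2 \<le> K * b\<^sup>2" using K mult_right_mono[of 1 K "b\<^sup>2"] by simp
    have "c / 2 * (L\<^sup>2 * a\<^sup>2) \<le> K * (b\<^sup>2 + g x ^ 8 * L\<^sup>2 * a\<^sup>2) + (\<psi>2 x * L * a\<^sup>2 + real m * \<mu> * (\<psi>1 x)\<^sup>2 * L * a\<^sup>2
       + 2 * \<psi>1 x * L * a * b + 2 * \<psi>1 x * L * \<psi>1 x * L * a\<^sup>2)"
      using s1 s2 s3 s4 s5 by (simp add: algebra_simps power2_eq_square)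
    then have "w * (c / 2 * (L\<^sup>2 * a\<^sup>2)) \<le> w * (K * (b\<^sup>2 + g x ^ 8 * L\<^sup>2 * a\<^sup>2) + (\<psi>2 x * L * a\<^sup>2 + real m * \<mu> * (\<psi>1 x)\<^sup>2 * L * a\<^sup>2
       + 2 * \<psi>1 x * L * a * b + 2 * \<psi>1 x * L * \<psi>1 x * L * a\<^sup>2))"
      using w by (intro mult_left_mono) auto
    then show "c / 2 * (g x ^ 0 * W (m + 2) t x * (u t x)\<^sup>2)
       \<le> K * (g x ^ 0 * W m t x * (u' t x)\<^sup>2 + g x ^ 8 * W (m + 2) t x * (u t x)\<^sup>2)
         + (X' t x + 2 * \<psi>1 x * \<Lambda> t x * X t x)"
      unfolding X_def X'_def W1 W2 unfolding L_def[symmetric] w_def[symmetric] a_def[symmetric] b_def[symmetric]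
      by (simp add: algebra_simps)
  qed (intro tempered_all u)+
  also have "\<dots> = K * (N m 0 u' + N (m + 2) 8 u)"
    unfolding N_def by (simp only: I_cmult I_add[OF N_integrand_tempered[OF u(2)] N_integrand_tempered[OF u(1)]])
  finally show ?thesis using c unfolding I_cmult by (simp add: N_def field_simps)
qed

text \<open>The derivative of h W (m + 2) u u1 contains h W (m + 2) u1^2; the other terms are split
  by Young. The cutoffs h on u1 and k on u may differ, and the bound of (h')^2 by a multiple of h k
  is exactly what lets the derivative of h be shared between the two.\<close>

lemma interpolation_x_general:
  assumes u: "tempered T u" "tempered T u1" "tempered T u2" "has_dx T u u1" "has_dx T u1 u2"
    and h: "tempered T (\<lambda>t. h)" "tempered T (\<lambda>t. h')" "tempered T (\<lambda>t. k)"
      "\<And>x. (h has_real_derivative h' x) (at x)"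
      "\<And>x. 0 \<le> h x" "\<And>x. h x \<le> k x" "\<And>x. k x \<le> 1" "\<And>x. (h' x)\<^sup>2 \<le> (B * K)\<^sup>2 * (h x * k x)"
    and B: "B \<ge> 0" and d: "d > 0"
  shows "I (\<lambda>t x. h x * W (m + 2) t x * (u1 t x)\<^sup>2) \<le> d * N m 0 u2
    + (1 / d + ((B + real m + 3) * K)\<^sup>2) * I (\<lambda>t x. k x * W (m + 4) t x * (u t x)\<^sup>2)"
proof -
  \<comment> \<open>B K comes from h', (m + 1) K from the x-derivative of \<open>W (m + 2)\<close>,
    and 2 K from the exponential.\<close>
  define M where "M = (B + real m + 3) * K"
  define X where "X = (\<lambda>t x. h x * W (m + 2) t x * u t x * u1 t x)"
  define X' where "X' = (\<lambda>t x. h' x * W (m + 2) t x * u t x * u1 t x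
     + (real m + 1) * \<mu> * \<psi>1 x * h x * W (m + 2) t x * u t x * u1 t x
     + h x * W (m + 2) t x * (u1 t x)\<^sup>2 + h x * W (m + 2) t x * u t x * u2 t x)"
  have tX: "tempered T X" "tempered T X'" unfolding X_def X'_def by (intro tempered_all u h)+
  have dX: "has_dx T X X'"
    unfolding X_def X'_def
    by (rule has_dxI) (auto intro!: derivative_eq_intros has_dxD[OF W_dx] has_dxD[OF u(4)] has_dxD[OF u(5)] h(4)
      simp: algebra_simps power2_eq_square)
  have M: "M \<ge> 0" unfolding M_def using B K by simp
  \<comment> \<open>The exact derivative is taken twice: Young uses up one copy of h W u1^2, and the
    other is the left-hand side.\<close>
  have dX2: "has_dx T (\<lambda>t x. 2 * X t x) (\<lambda>t x. 2 * X' t x)"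
    using dX unfolding has_dx_def by (auto intro!: derivative_eq_intros)
  have "I (\<lambda>t x. h x * W (m + 2) t x * (u1 t x)\<^sup>2)
     \<le> I (\<lambda>t x. d * (g x ^ 0 * W m t x * (u2 t x)\<^sup>2) + (1 / d + M\<^sup>2) * (k x * W (m + 4) t x * (u t x)\<^sup>2))"
  proof (rule I_le_dx[OF _ _ _ _ dX2])
    fix t x assume t: "t \<in> {0<..<T}"
    define L w p q r where "L = \<Lambda> t x" and "w = W m t x" and "p = u t x" and "q = u1 t x" and "r = u2 t x"
    have L: "L > 0" "1 \<le> L" "\<mu> \<le> L" and w: "w > 0"
      using \<Lambda>_bounds[OF t, of x] W_bounds[OF t] by (auto simp: L_def w_def)
    have W2: "W (m + 2) t x = L\<^sup>2 * w" and W4: "W (m + 4) t x = L ^ 4 * w"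
      using W_bounds(2)[OF t] by (auto simp: L_def w_def power2_eq_square eval_nat_numeral)
    define a b where "a = L * q" and "b = L\<^sup>2 * p"
    define e where "e = (h' x + (real m + 1) * \<mu> * \<psi>1 x * h x + 2 * \<psi>1 x * L * h x) / L"
    define s where "s = sqrt (h x * k x)"
    have hk: "0 \<le> h x * k x" using h(5,6) by (meson mult_nonneg_nonneg order_trans)
    have s: "s \<ge> 0" "s\<^sup>2 = h x * k x" using hk by (auto simp: s_def)
    have hs: "h x \<le> s" unfolding s_def
      by (rule real_le_rsqrt) (use h(5,6)[of x] in \<open>auto simp: power2_eq_square intro: mult_left_mono\<close>)
    have h's: "\<bar>h' x\<bar> \<le> B * K * s"
    proof -
      have "(h' x)\<^sup>2 \<le> (B * K * s)\<^sup>2" using h(8)[of x] s by (simp add: power_mult_distrib)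
      then show ?thesis using B K s by (metis abs_le_square_iff abs_of_nonneg mult_nonneg_nonneg order_trans zero_le_one)
    qed
    have e_le: "\<bar>e\<bar> \<le> M * s"
    proof -
      have "\<bar>h' x + (real m + 1) * \<mu> * \<psi>1 x * h x + 2 * \<psi>1 x * L * h x\<bar>
         \<le> \<bar>h' x\<bar> + \<bar>(real m + 1) * \<mu> * \<psi>1 x * h x\<bar> + \<bar>2 * \<psi>1 x * L * h x\<bar>" by linarith
      also have "\<dots> \<le> B * K * s * L + (real m + 1) * L * K * s + 2 * K * L * s"
      proof (intro add_mono)
        have "0 \<le> B * K * s" using B K s by simp
        then show "\<bar>h' x\<bar> \<le> B * K * s * L" using h's L(2) mult_left_mono[OF L(2), of "B * K * s"] by linarith
        show "\<bar>(real m + 1) * \<mu> * \<psi>1 x * h x\<bar> \<le> (real m + 1) * L * K * s"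
          unfolding abs_mult using \<mu> L bnd(1)[of x] hs h(5)[of x] K by (intro mult_mono) auto
        show "\<bar>2 * \<psi>1 x * L * h x\<bar> \<le> 2 * K * L * s"
          unfolding abs_mult using L bnd(1)[of x] hs h(5)[of x] K by (intro mult_mono) auto
      qed
      also have "\<dots> = M * s * L" by (simp add: M_def algebra_simps)
      finally show ?thesis unfolding e_def using L by (simp add: field_simps)
    qed
    have "\<bar>e * (a * b)\<bar> \<le> M * s * \<bar>a * b\<bar>" unfolding abs_mult[of e] by (intro mult_right_mono e_le) simp
    also have "\<dots> = \<bar>(sqrt (h x) * a) * (M * sqrt (k x) * b)\<bar>"
      using M h(5)[of x] h(6)[of x] by (simp add: s_def abs_mult real_sqrt_mult)
    also have "\<dots> \<le> (1 / 2) * (sqrt (h x) * a)\<^sup>2 + (M * sqrt (k x) * b)\<^sup>2 / (4 * (1 / 2))"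
      by (rule young) simp
    also have "\<dots> = h x * a\<^sup>2 / 2 + M\<^sup>2 * k x * b\<^sup>2 / 2"
      using h(5)[of x] h(6)[of x] by (simp add: power_mult_distrib)
    finally have t1: "\<bar>e * (a * b)\<bar> \<le> h x * a\<^sup>2 / 2 + M\<^sup>2 * k x * b\<^sup>2 / 2" .
    have "\<bar>r * (h x * b)\<bar> \<le> (d / 2) * r\<^sup>2 + (h x * b)\<^sup>2 / (4 * (d / 2))" by (rule young) (use d in simp)
    also have "(h x * b)\<^sup>2 \<le> k x * b\<^sup>2"
    proof -
      have "(h x)\<^sup>2 \<le> k x * 1" unfolding power2_eq_square using h(5-7)[of x] by (intro mult_mono) auto
      then show ?thesis by (simp add: power_mult_distrib mult_right_mono)
    qed
    finally have t2: "\<bar>r * (h x * b)\<bar> \<le> (d / 2) * r\<^sup>2 + k x * b\<^sup>2 / (2 * d)" using d by (simp add: divide_right_mono)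
    have "h x * a\<^sup>2 \<le> d * r\<^sup>2 + (1 / d + M\<^sup>2) * k x * b\<^sup>2 + 2 * (e * (a * b) + h x * a\<^sup>2 + h x * (b * r))"
    proof -
      have "(1 / d + M\<^sup>2) * k x * b\<^sup>2 = 2 * (k x * b\<^sup>2 / (2 * d)) + 2 * (M\<^sup>2 * k x * b\<^sup>2 / 2)"
        by (simp add: algebra_simps)
      then show ?thesis using t1 t2 by (simp add: abs_le_iff mult.commute mult.left_commute)
    qed
    then have "w * (h x * a\<^sup>2) \<le> w * (d * r\<^sup>2 + (1 / d + M\<^sup>2) * k x * b\<^sup>2 + 2 * (e * (a * b) + h x * a\<^sup>2 + h x * (b * r)))"
      using w by (intro mult_left_mono) auto
    moreover have "w * (e * (a * b)) = (h' x + (real m + 1) * \<mu> * \<psi>1 x * h x + 2 * \<psi>1 x * L * h x) * (L\<^sup>2 * w * p * q)"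
      unfolding e_def a_def b_def using L by (simp add: power2_eq_square)
    ultimately show "h x * W (m + 2) t x * (u1 t x)\<^sup>2
       \<le> d * (g x ^ 0 * W m t x * (u2 t x)\<^sup>2) + (1 / d + M\<^sup>2) * (k x * W (m + 4) t x * (u t x)\<^sup>2)
         + (2 * X' t x + 2 * \<psi>1 x * \<Lambda> t x * (2 * X t x))"
      unfolding X_def X'_def W2 W4 unfolding L_def[symmetric] w_def[symmetric] p_def[symmetric] q_def[symmetric] r_def[symmetric]
      unfolding a_def b_def by (simp add: algebra_simps power2_eq_square power4_eq_xxxx)
  qed (intro tempered_all u h tX)+
  also have "\<dots> = d * N m 0 u2 + (1 / d + M\<^sup>2) * I (\<lambda>t x. k x * W (m + 4) t x * (u t x)\<^sup>2)"
    unfolding N_def by (subst I_add) ((intro tempered_all u h)+, simp only: I_cmult)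
  finally show ?thesis unfolding M_def .
qed

text \<open>Dominates the square of ((n + 2) + m + 3) K for all m + n \<le> 12, where n + 2 is the
  price of differentiating \<open>g ^ (n + 2)\<close>. One number then serves all interpolations in
  x.\<close>

definition IC :: real where "IC = (17 * K)\<^sup>2"

lemma interpolation_x_0:
  assumes u: "tempered T u" "tempered T u1" "tempered T u2" "has_dx T u u1" "has_dx T u1 u2"
    and d: "d > 0" and m: "m \<le> 6"
  shows "N (m + 2) 0 u1 \<le> d * N m 0 u2 + (1 / d + IC) * N (m + 4) 0 u"
proof -
  have "N (m + 2) 0 u1 \<le> d * N m 0 u2 + (1 / d + ((0 + real m + 3) * K)\<^sup>2) * N (m + 4) 0 u"
    using interpolation_x_general[OF u, where h = "\<lambda>x. 1" and h' = "\<lambda>x. 0" and k = "\<lambda>x. 1" and B = 0 and d = d and m = m] d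
    by (simp add: N_def tempered_const)
  also have "((0 + real m + 3) * K)\<^sup>2 \<le> IC"
    unfolding IC_def using m K by (intro power_mono mult_right_mono) auto
  finally show ?thesis using N_nonneg[OF u(1), of "m + 4" 0] by (simp add: mult_right_mono)
qed

text \<open>With h = g^(n + 2) and k = g^n one has (h')^2 \<le> (n + 2)^2 K^2 h k, so powers of one
  function act as nested cutoffs, at the price of two powers per interpolation.\<close>

lemma interpolation_x:
  assumes u: "tempered T u" "tempered T u1" "tempered T u2" "has_dx T u u1" "has_dx T u1 u2"
    and d: "d > 0" and m: "m + n \<le> 12"
  shows "N (m + 2) (n + 2) u1 \<le> d * N m 0 u2 + (1 / d + IC) * N (m + 4) n u"
proof -
  have "N (m + 2) (n + 2) u1 \<le> d * N m 0 u2 + (1 / d + ((real (n + 2) + real m + 3) * K)\<^sup>2) * N (m + 4) n u"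
    unfolding N_def[of "m + 2"] N_def[of "m + 4"]
  proof (rule interpolation_x_general[OF u])
    show "((\<lambda>x. g x ^ (n + 2)) has_real_derivative real (n + 2) * g x ^ (n + 1) * g1 x) (at x)" for x by (rule g_deriv)
    show "0 \<le> g x ^ (n + 2)" "g x ^ n \<le> 1" "g x ^ (n + 2) \<le> g x ^ n" for x
      using g[of x] power_decreasing[of n "n + 2" "g x"] by (auto intro: power_le_one)
    show "(real (n + 2) * g x ^ (n + 1) * g1 x)\<^sup>2 \<le> (real (n + 2) * K)\<^sup>2 * (g x ^ (n + 2) * g x ^ n)" for x
    proof -
      have "(g1 x)\<^sup>2 \<le> K\<^sup>2" using bnd(4)[of x] K by (simp add: abs_le_square_iff[symmetric])
      then have "(real (n + 2) * g x ^ (n + 1))\<^sup>2 * (g1 x)\<^sup>2 \<le> (real (n + 2) * g x ^ (n + 1))\<^sup>2 * K\<^sup>2"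
        by (intro mult_left_mono) auto
      then show ?thesis by (simp add: power_mult_distrib power_add power2_eq_square mult_ac)
    qed
  qed (use d in \<open>(intro tempered_all | simp)+\<close>)
  also have "((real (n + 2) + real m + 3) * K)\<^sup>2 \<le> IC"
    unfolding IC_def using m K by (intro power_mono mult_right_mono) auto
  finally show ?thesis using N_nonneg[OF u(1), of "m + 4" n] by (simp add: mult_right_mono)
qed

text \<open>A time derivative is worth two powers of \<Lambda>, as much as two x-derivatives, so z
  sits halfway between w with index 0 and u with index 8. Since g does not depend on t, its power n
  is not lowered.\<close>

lemma interpolation_t:
  assumes u: "tempered T u" "tempered T z" "tempered T w" "has_dt T u z" "has_dt T z w" and d: "d > 0"
  shows "N 4 n z \<le> d * N 0 0 w + (1 / d + 25) * N 8 n u"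
proof -
  define X where "X = (\<lambda>t x. g x ^ n * W 4 t x * u t x * z t x)"
  define X' where "X' = (\<lambda>t x. g x ^ n * (3 * \<Lambda>t t x * \<rho> t x) * W 4 t x * u t x * z t x
     + g x ^ n * W 4 t x * (z t x)\<^sup>2 + g x ^ n * W 4 t x * u t x * w t x)"
  have tX: "tempered T X" "tempered T X'" unfolding X_def X'_def by (intro tempered_all u)+
  have dX2: "has_dt T (\<lambda>t x. 2 * X t x) (\<lambda>t x. 2 * X' t x)"
    unfolding X_def X'_def
    by (rule has_dtI) (auto intro!: derivative_eq_intros has_dtD[OF W_dt] has_dtD[OF u(4)] has_dtD[OF u(5)]
      simp: algebra_simps power2_eq_square)
  have "I (\<lambda>t x. g x ^ n * W 4 t x * (z t x)\<^sup>2)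
     \<le> I (\<lambda>t x. d * (g x ^ 0 * W 0 t x * (w t x)\<^sup>2) + (1 / d + 25) * (g x ^ n * W 8 t x * (u t x)\<^sup>2))"
  proof (rule I_le_dt[OF _ _ _ _ dX2])
    fix t x assume t: "t \<in> {0<..<T}"
    define L R p q r where "L = \<Lambda> t x" and "R = \<rho> t x" and "p = u t x" and "q = z t x" and "r = w t x"
    have L: "L > 0" "1 \<le> L" and R: "R > 0" "R \<le> 1"
      using \<Lambda>_bounds[OF t, of x] \<rho>_bounds[OF t, of x] by (auto simp: L_def R_def)
    have W: "W 0 t x = R" "W 4 t x = R * L ^ 4" "W 8 t x = R * L ^ 8"
      by (auto simp: W_eq L_def R_def)
    define h where "h = g x ^ n"
    have h: "0 \<le> h" "h \<le> 1" using g[of x] by (auto simp: h_def power_le_one)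
    define a b where "a = L\<^sup>2 * q" and "b = L ^ 4 * p"
    define e where "e = (3 * \<Lambda>t t x * R + 2 * \<theta>t t x) / L\<^sup>2"
    have \<beta>': "\<bar>y\<bar> \<le> L\<^sup>2" if "\<bar>y\<bar> * \<beta> \<le> \<epsilon> * L\<^sup>2" for y
    proof -
      have "\<bar>y\<bar> \<le> \<bar>y\<bar> * \<beta>" using \<beta> mult_left_mono[OF \<beta>, of "\<bar>y\<bar>"] by simp
      also have "\<dots> \<le> \<epsilon> * L\<^sup>2" by (rule that)
      also have "\<dots> \<le> 1 * L\<^sup>2" using \<epsilon> by (intro mult_right_mono) auto
      finally show ?thesis by simp
    qed
    \<comment> \<open>3 is the exponent of \<Lambda> in \<open>W 4\<close>, and 2 comes from the
      exponential; the square of the sum is the 25 of the statement.\<close>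
    have e_le: "\<bar>e\<bar> \<le> 5"
    proof -
      have "\<bar>\<Lambda>t t x\<bar> * R \<le> L\<^sup>2 * 1" using \<beta>'[of "\<Lambda>t t x"] \<Lambda>t_le[OF t, of x] R by (intro mult_mono) (auto simp: L_def)
      moreover have "\<bar>\<theta>t t x\<bar> \<le> L\<^sup>2" using \<beta>'[of "\<theta>t t x"] \<theta>t_le[OF t, of x] by (auto simp: L_def)
      moreover have "\<bar>3 * \<Lambda>t t x * R + 2 * \<theta>t t x\<bar> \<le> 3 * (\<bar>\<Lambda>t t x\<bar> * R) + 2 * \<bar>\<theta>t t x\<bar>"
        using abs_triangle_ineq[of "3 * \<Lambda>t t x * R" "2 * \<theta>t t x"] R by (simp add: abs_mult)
      ultimately show ?thesis unfolding e_def using L by (simp add: field_simps)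
    qed
    have "\<bar>e * (a * b)\<bar> \<le> 5 * \<bar>a * b\<bar>" unfolding abs_mult[of e] by (intro mult_right_mono e_le) simp
    also have "\<dots> = \<bar>a * (5 * b)\<bar>" by (simp add: abs_mult)
    also have "\<dots> \<le> (1 / 2) * a\<^sup>2 + (5 * b)\<^sup>2 / (4 * (1 / 2))" by (rule young) simp
    finally have t1: "\<bar>e * (a * b)\<bar> \<le> a\<^sup>2 / 2 + 25 * b\<^sup>2 / 2" by (simp add: power_mult_distrib)
    have "\<bar>r * (h * b)\<bar> \<le> (d / 2) * r\<^sup>2 + (h * b)\<^sup>2 / (4 * (d / 2))" by (rule young) (use d in simp)
    also have "(h * b)\<^sup>2 \<le> h * b\<^sup>2"
    proof -
      have "h\<^sup>2 \<le> h * 1" unfolding power2_eq_square using h by (intro mult_left_mono) auto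
      then show ?thesis by (simp add: power_mult_distrib mult_right_mono)
    qed
    finally have t2: "\<bar>r * (h * b)\<bar> \<le> (d / 2) * r\<^sup>2 + h * b\<^sup>2 / (2 * d)" using d by (simp add: divide_right_mono)
    have "h * \<bar>e * (a * b)\<bar> \<le> h * (a\<^sup>2 / 2 + 25 * b\<^sup>2 / 2)" using t1 h by (intro mult_left_mono)
    then have t1': "- (h * (e * (a * b))) \<le> h * a\<^sup>2 / 2 + 25 * (h * b\<^sup>2) / 2"
      using h abs_ge_minus_self[of "h * (e * (a * b))"] by (simp add: abs_mult algebra_simps)
    have "h * a\<^sup>2 \<le> d * r\<^sup>2 + (1 / d + 25) * h * b\<^sup>2 + 2 * (h * (e * (a * b)) + h * a\<^sup>2 + h * (b * r))"
    proof -
      have eq: "(1 / d + 25) * h * b\<^sup>2 = h * b\<^sup>2 / d + 25 * (h * b\<^sup>2)"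
        by (simp add: algebra_simps)
      have t2': "- (h * (b * r)) \<le> d * r\<^sup>2 / 2 + h * b\<^sup>2 / d / 2"
        using t2 abs_ge_minus_self[of "r * (h * b)"] by (simp add: mult_ac)
      have aux: "A \<le> G + (H + 25 * B) + 2 * (E + A + F)"
        if "- F \<le> G / 2 + H / 2" "- E \<le> A / 2 + 25 * B / 2" for A B E F G H :: real
        using that by argo
      show ?thesis unfolding eq by (rule aux[OF t2' t1'])
    qed
    then have "R * (h * a\<^sup>2) \<le> R * (d * r\<^sup>2 + (1 / d + 25) * h * b\<^sup>2 + 2 * (h * (e * (a * b)) + h * a\<^sup>2 + h * (b * r)))"
      using R by (intro mult_left_mono) auto
    moreover have "R * (h * (e * (a * b))) = R * (h * ((3 * \<Lambda>t t x * R + 2 * \<theta>t t x) * (L ^ 4 * p * q)))"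
      unfolding e_def a_def b_def using L by (simp add: power2_eq_square)
    ultimately show "g x ^ n * W 4 t x * (z t x)\<^sup>2
       \<le> d * (g x ^ 0 * W 0 t x * (w t x)\<^sup>2) + (1 / d + 25) * (g x ^ n * W 8 t x * (u t x)\<^sup>2)
         + (2 * X' t x + 2 * \<theta>t t x * (2 * X t x))"
      unfolding X_def X'_def W h_def[symmetric]
      unfolding L_def[symmetric] R_def[symmetric] p_def[symmetric] q_def[symmetric] r_def[symmetric]
      unfolding a_def b_def by (simp add: algebra_simps power2_eq_square power4_eq_xxxx eval_nat_numeral)
  qed (intro tempered_all u tX)+
  also have "\<dots> = d * N 0 0 w + (1 / d + 25) * N 8 n u"
    unfolding N_def by (subst I_add) ((intro tempered_all u)+, simp only: I_cmult)
  finally show ?thesis unfolding N_def[of 4] .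
qed

end

subsection \<open>The damped regime\<close>

context carleman_weight begin

text \<open>
  \<open>Dx_of X D\<close> says that \<open>exp (2 \<theta>) D\<close> is the space derivative of \<open>exp (2 \<theta>) X\<close>, so that \<open>I D = 0\<close>;
  likewise \<open>Dt_of\<close> for time.
\<close>

definition Dx_of :: "(real \<Rightarrow> real \<Rightarrow> real) \<Rightarrow> (real \<Rightarrow> real \<Rightarrow> real) \<Rightarrow> bool" where
  "Dx_of X D \<longleftrightarrow> tempered T X \<and> (\<exists>X'. tempered T X' \<and> has_dx T X X' \<and>
     (\<forall>t\<in>{0<..<T}. \<forall>x. D t x = X' t x + 2 * \<psi>1 x * \<Lambda> t x * X t x))"

definition Dt_of :: "(real \<Rightarrow> real \<Rightarrow> real) \<Rightarrow> (real \<Rightarrow> real \<Rightarrow> real) \<Rightarrow> bool" where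
  "Dt_of X D \<longleftrightarrow> tempered T X \<and> (\<exists>X'. tempered T X' \<and> has_dt T X X' \<and>
     (\<forall>t\<in>{0<..<T}. \<forall>x. D t x = X' t x + 2 * \<theta>t t x * X t x))"

lemma Dx_ofI:
  assumes "tempered T X" "tempered T X'" "has_dx T X X'"
    "\<And>t x. t \<in> {0<..<T} \<Longrightarrow> D t x = X' t x + 2 * \<psi>1 x * \<Lambda> t x * X t x"
  shows "Dx_of X D"
  unfolding Dx_of_def using assms by blast

lemma Dt_ofI:
  assumes "tempered T X" "tempered T X'" "has_dt T X X'"
    "\<And>t x. t \<in> {0<..<T} \<Longrightarrow> D t x = X' t x + 2 * \<theta>t t x * X t x"
  shows "Dt_of X D"
  unfolding Dt_of_def using assms by blast

lemma Dx_of_mult: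
  assumes "Dx_of X D" "tempered T u" "tempered T u'" "has_dx T u u'"
  shows "Dx_of (\<lambda>t x. X t x * u t x) (\<lambda>t x. D t x * u t x + X t x * u' t x)"
proof -
  obtain X' where X': "tempered T X" "tempered T X'" "has_dx T X X'"
    "\<And>t x. t\<in>{0<..<T} \<Longrightarrow> D t x = X' t x + 2 * \<psi>1 x * \<Lambda> t x * X t x"
    using assms(1) unfolding Dx_of_def by blast
  show ?thesis
  proof (rule Dx_ofI)
    show "has_dx T (\<lambda>t x. X t x * u t x) (\<lambda>t x. X' t x * u t x + X t x * u' t x)"
      by (rule has_dxI) (auto intro!: derivative_eq_intros has_dxD[OF X'(3)] has_dxD[OF assms(4)])
  qed (use X'(4) in \<open>(intro tempered_all X' assms | simp add: algebra_simps)+\<close>)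
qed

lemma Dt_of_mult:
  assumes "Dt_of X D" "tempered T u" "tempered T u'" "has_dt T u u'"
  shows "Dt_of (\<lambda>t x. X t x * u t x) (\<lambda>t x. D t x * u t x + X t x * u' t x)"
proof -
  obtain X' where X': "tempered T X" "tempered T X'" "has_dt T X X'"
    "\<And>t x. t\<in>{0<..<T} \<Longrightarrow> D t x = X' t x + 2 * \<theta>t t x * X t x"
    using assms(1) unfolding Dt_of_def by blast
  show ?thesis
  proof (rule Dt_ofI)
    show "has_dt T (\<lambda>t x. X t x * u t x) (\<lambda>t x. X' t x * u t x + X t x * u' t x)"
      by (rule has_dtI) (auto intro!: derivative_eq_intros has_dtD[OF X'(3)] has_dtD[OF assms(4)])
  qed (use X'(4) in \<open>(intro tempered_all X' assms | simp add: algebra_simps)+\<close>)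
qed

lemma Dx_of_add:
  assumes "Dx_of X D" "Dx_of Y D'"
  shows "Dx_of (\<lambda>t x. X t x + Y t x) (\<lambda>t x. D t x + D' t x)"
proof -
  obtain X' where X': "tempered T X" "tempered T X'" "has_dx T X X'"
    "\<And>t x. t\<in>{0<..<T} \<Longrightarrow> D t x = X' t x + 2 * \<psi>1 x * \<Lambda> t x * X t x"
    using assms(1) unfolding Dx_of_def by blast
  obtain Y' where Y': "tempered T Y" "tempered T Y'" "has_dx T Y Y'"
    "\<And>t x. t\<in>{0<..<T} \<Longrightarrow> D' t x = Y' t x + 2 * \<psi>1 x * \<Lambda> t x * Y t x"
    using assms(2) unfolding Dx_of_def by blast
  show ?thesis
  proof (rule Dx_ofI)
    show "has_dx T (\<lambda>t x. X t x + Y t x) (\<lambda>t x. X' t x + Y' t x)"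
      by (rule has_dxI) (auto intro!: derivative_eq_intros has_dxD[OF X'(3)] has_dxD[OF Y'(3)])
  qed (use X'(4) Y'(4) in \<open>(intro tempered_all X' Y' | simp add: algebra_simps)+\<close>)
qed

lemma Dt_of_add:
  assumes "Dt_of X D" "Dt_of Y D'"
  shows "Dt_of (\<lambda>t x. X t x + Y t x) (\<lambda>t x. D t x + D' t x)"
proof -
  obtain X' where X': "tempered T X" "tempered T X'" "has_dt T X X'"
    "\<And>t x. t\<in>{0<..<T} \<Longrightarrow> D t x = X' t x + 2 * \<theta>t t x * X t x"
    using assms(1) unfolding Dt_of_def by blast
  obtain Y' where Y': "tempered T Y" "tempered T Y'" "has_dt T Y Y'"
    "\<And>t x. t\<in>{0<..<T} \<Longrightarrow> D' t x = Y' t x + 2 * \<theta>t t x * Y t x"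
    using assms(2) unfolding Dt_of_def by blast
  show ?thesis
  proof (rule Dt_ofI)
    show "has_dt T (\<lambda>t x. X t x + Y t x) (\<lambda>t x. X' t x + Y' t x)"
      by (rule has_dtI) (auto intro!: derivative_eq_intros has_dtD[OF X'(3)] has_dtD[OF Y'(3)])
  qed (use X'(4) Y'(4) in \<open>(intro tempered_all X' Y' | simp add: algebra_simps)+\<close>)
qed

lemma Dx_of_cmult:
  assumes "Dx_of X D" shows "Dx_of (\<lambda>t x. a * X t x) (\<lambda>t x. a * D t x)"
  using Dx_of_mult[OF assms tempered_const[of T a] tempered_const[of T 0]]
  by (simp add: has_dx_def mult.commute)

lemma Dt_of_cmult:
  assumes "Dt_of X D" shows "Dt_of (\<lambda>t x. a * X t x) (\<lambda>t x. a * D t x)"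
  using Dt_of_mult[OF assms tempered_const[of T a] tempered_const[of T 0]]
  by (simp add: has_dt_def mult.commute)

lemma I_le_Dx_Dt:
  assumes "tempered T f" "tempered T h" "Dx_of X D" "Dt_of Y D'"
    and "\<And>t x. t \<in> {0<..<T} \<Longrightarrow> f t x \<le> h t x + D t x + D' t x"
  shows "I f \<le> I h"
proof -
  obtain X' where X': "tempered T X" "tempered T X'" "has_dx T X X'"
    "\<And>t x. t\<in>{0<..<T} \<Longrightarrow> D t x = X' t x + 2 * \<psi>1 x * \<Lambda> t x * X t x"
    using assms(3) unfolding Dx_of_def by blast
  obtain Y' where Y': "tempered T Y" "tempered T Y'" "has_dt T Y Y'"
    "\<And>t x. t\<in>{0<..<T} \<Longrightarrow> D' t x = Y' t x + 2 * \<theta>t t x * Y t x"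
    using assms(4) unfolding Dt_of_def by blast
  show ?thesis
    by (rule I_le_div[OF assms(1,2) X'(1-3) Y'(1-3)]) (use assms(5) X'(4) Y'(4) in force)
qed

text \<open>\<open>\<rho>x\<close>, \<open>\<rho>xx\<close> and \<open>\<rho>t\<close> are
  derivatives of \<open>exp (2 * \<theta>) * \<rho>\<close> with the exponential divided out,
  simplified by \<rho> \<Lambda> = 1. Their orders are 1, \<Lambda> and \<epsilon> \<Lambda> /
  \<beta>: on the weight 1 / \<Lambda>, an x-derivative costs \<Lambda> and a t-derivative
  \<epsilon> \<Lambda>^2 / \<beta>.\<close>

definition \<rho>x :: "real \<Rightarrow> real \<Rightarrow> real" where
  "\<rho>x t x = \<psi>1 x * (2 - \<mu> * \<rho> t x)"

definition \<rho>xx :: "real \<Rightarrow> real \<Rightarrow> real" where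
  "\<rho>xx t x = \<psi>2 x * (2 - \<mu> * \<rho> t x) + \<mu>\<^sup>2 * (\<psi>1 x)\<^sup>2 * \<rho> t x + 2 * (\<psi>1 x)\<^sup>2 * \<Lambda> t x * (2 - \<mu> * \<rho> t x)"

definition \<rho>t :: "real \<Rightarrow> real \<Rightarrow> real" where
  "\<rho>t t x = \<rho> t x * (2 * \<theta>t t x - \<Lambda>t t x * \<rho> t x)"

lemma Dx_of_\<rho>: "Dx_of \<rho> \<rho>x"
proof (rule Dx_ofI[OF tempered_\<rho> _ \<rho>_dx])
  show "\<rho>x t x = - \<mu> * \<psi>1 x * \<rho> t x + 2 * \<psi>1 x * \<Lambda> t x * \<rho> t x" if "t \<in> {0<..<T}" for t x
    using \<rho>_bounds(3)[OF that, of x] by (simp add: \<rho>x_def algebra_simps)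
qed (intro tempered_all)

lemma Dt_of_\<rho>: "Dt_of \<rho> \<rho>t"
  by (rule Dt_ofI[OF tempered_\<rho> _ \<rho>_dt])
    (intro tempered_all | simp add: \<rho>t_def algebra_simps power2_eq_square)+

lemma Dx_of_\<rho>x: "Dx_of \<rho>x \<rho>xx"
proof (rule Dx_ofI)
  show "has_dx T \<rho>x (\<lambda>t x. \<psi>2 x * (2 - \<mu> * \<rho> t x) + \<mu>\<^sup>2 * (\<psi>1 x)\<^sup>2 * \<rho> t x)"
    unfolding \<rho>x_def
    by (rule has_dxI) (auto intro!: derivative_eq_intros \<psi>1_deriv has_dxD[OF \<rho>_dx] simp: algebra_simps power2_eq_square)
  show "\<rho>xx t x = (\<psi>2 x * (2 - \<mu> * \<rho> t x) + \<mu>\<^sup>2 * (\<psi>1 x)\<^sup>2 * \<rho> t x) + 2 * \<psi>1 x * \<Lambda> t x * \<rho>x t x" for t x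
    by (simp add: \<rho>x_def \<rho>xx_def power2_eq_square)
  show "tempered T \<rho>x" unfolding \<rho>x_def by (intro tempered_all)
qed (intro tempered_all)

lemma \<rho>x_bound:
  assumes t: "t \<in> {0<..<T}" shows "\<bar>\<rho>x t x\<bar> \<le> 3 * K"
proof -
  have "\<bar>2 - \<mu> * \<rho> t x\<bar> \<le> 3" using \<rho>_bounds[OF t, of x] \<mu> by (auto simp: abs_le_iff)
    (smt (verit) mult_nonneg_nonneg)
  then have "\<bar>\<psi>1 x\<bar> * \<bar>2 - \<mu> * \<rho> t x\<bar> \<le> K * 3" using bnd(1)[of x] by (intro mult_mono) auto
  then show ?thesis by (simp add: \<rho>x_def abs_mult)
qed

lemma \<rho>xx_bound:
  assumes t: "t \<in> {0<..<T}" shows "\<bar>\<rho>xx t x\<bar> \<le> 10 * K\<^sup>2 * \<Lambda> t x"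
proof -
  define L where "L = \<Lambda> t x"
  have L: "1 \<le> L" "\<mu> \<le> L" using \<Lambda>_bounds[OF t, of x] by (auto simp: L_def)
  have b: "\<bar>2 - \<mu> * \<rho> t x\<bar> \<le> 3" using \<rho>_bounds[OF t, of x] \<mu> by (auto simp: abs_le_iff)
    (smt (verit) mult_nonneg_nonneg)
  have p2: "(\<psi>1 x)\<^sup>2 \<le> K\<^sup>2" using bnd(1)[of x] K by (simp add: abs_le_square_iff[symmetric])
  have KK: "K \<le> K\<^sup>2" using K by (simp add: power2_eq_square)
  have "\<bar>\<psi>2 x * (2 - \<mu> * \<rho> t x)\<bar> \<le> K\<^sup>2 * (3 * L)"
    unfolding abs_mult using b bnd(2)[of x] KK L by (intro mult_mono) auto
  moreover have "\<bar>\<mu>\<^sup>2 * (\<psi>1 x)\<^sup>2 * \<rho> t x\<bar> \<le> K\<^sup>2 * L"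
  proof -
    have "\<bar>\<mu>\<^sup>2 * (\<psi>1 x)\<^sup>2 * \<rho> t x\<bar> = (\<psi>1 x)\<^sup>2 * (\<mu> * (\<mu> * \<rho> t x))"
      using \<rho>_bounds[OF t, of x] by (simp add: abs_mult power2_eq_square)
    also have "\<dots> \<le> K\<^sup>2 * (L * 1)"
      using \<rho>_bounds[OF t, of x] \<mu> L p2 by (intro mult_mono) auto
    finally show ?thesis by simp
  qed
  moreover have "\<bar>2 * (\<psi>1 x)\<^sup>2 * L * (2 - \<mu> * \<rho> t x)\<bar> \<le> 2 * K\<^sup>2 * L * 3"
    unfolding abs_mult using b p2 L by (intro mult_mono) auto
  ultimately have "\<bar>\<rho>xx t x\<bar> \<le> K\<^sup>2 * (3 * L) + K\<^sup>2 * L + 2 * K\<^sup>2 * L * 3"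
    unfolding \<rho>xx_def L_def by (smt (verit) abs_triangle_ineq)
  then show ?thesis by (simp add: L_def mult_ac)
qed

lemma \<rho>t_bound:
  assumes t: "t \<in> {0<..<T}" shows "\<bar>\<rho>t t x\<bar> * \<beta> \<le> 3 * \<epsilon> * \<Lambda> t x"
proof -
  define L R where "L = \<Lambda> t x" and "R = \<rho> t x"
  have L: "1 \<le> L" and R: "0 < R" "R \<le> 1" "R * L = 1"
    using \<Lambda>_bounds[OF t, of x] \<rho>_bounds[OF t, of x] by (auto simp: L_def R_def)
  have "\<bar>2 * \<theta>t t x - \<Lambda>t t x * R\<bar> \<le> 2 * \<bar>\<theta>t t x\<bar> + \<bar>\<Lambda>t t x\<bar> * R"
    using R abs_triangle_ineq4[of "2 * \<theta>t t x" "\<Lambda>t t x * R"] by (simp add: abs_mult)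
  also have "\<dots> \<le> 2 * \<bar>\<theta>t t x\<bar> + \<bar>\<Lambda>t t x\<bar>" using R mult_left_mono[OF R(2), of "\<bar>\<Lambda>t t x\<bar>"] by simp
  finally have "\<bar>2 * \<theta>t t x - \<Lambda>t t x * R\<bar> * \<beta> \<le> (2 * \<bar>\<theta>t t x\<bar> + \<bar>\<Lambda>t t x\<bar>) * \<beta>"
    using \<beta> by (intro mult_right_mono) auto
  also have "\<dots> \<le> 3 * \<epsilon> * L\<^sup>2" using \<theta>t_le[OF t, of x] \<Lambda>t_le[OF t, of x] by (simp add: L_def algebra_simps)
  finally have "R * (\<bar>2 * \<theta>t t x - \<Lambda>t t x * R\<bar> * \<beta>) \<le> R * (3 * \<epsilon> * L\<^sup>2)"
    using R by (intro mult_left_mono) auto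
  also have "\<dots> = 3 * \<epsilon> * L * (R * L)" by (simp add: power2_eq_square)
  finally show ?thesis using R by (simp add: \<rho>t_def L_def R_def abs_mult mult.assoc)
qed

text \<open>The damped estimate after removal of the exact derivatives and division by \<rho>. Here
  w, e4, z2 stand for z_t, \<eta>_xxxx, z_xx, and Z0, Z1, E3 for \<Lambda>^2 z, \<Lambda> z_x,
  \<Lambda> \<eta>_xxx. The square (w + e4)^2 is split as (w^2 + e4^2) / 3 + 2/3 (w + e4)^2 + 2/3 w
  e4, and only the last product is integrated by parts, into - 2/3 z_xx^2. This is still dominated
  by \<alpha>^2 z_xx^2 at \<alpha> = 1; the - 2 z_xx^2 coming from the full product 2 w e4 would not
  be.\<close>

lemma damped_pointwise:
  fixes \<alpha> \<delta> w e4 z2 Z0 Z1 E3 x1 x2 x4 :: real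
  assumes \<alpha>: "\<alpha> \<ge> 1" and \<delta>: "\<delta> > 0"
    and x: "\<bar>x1\<bar> \<le> 3 * K" "\<bar>x2\<bar> \<le> 10 * K\<^sup>2" "\<bar>x4\<bar> \<le> 3" "\<bar>\<alpha> * x4\<bar> \<le> 3 * \<epsilon>"
  shows "(w\<^sup>2 + e4\<^sup>2 + \<alpha>\<^sup>2 * z2\<^sup>2) / 6
    \<le> (300 + 100 / \<delta>) * K ^ 4 * \<alpha>\<^sup>2 * Z1\<^sup>2 + 300 * K ^ 4 * Z0\<^sup>2 + (3 * \<epsilon> + \<delta>) * E3\<^sup>2
      + ((w\<^sup>2 + e4\<^sup>2) / 3 + 2 / 3 * (w + e4)\<^sup>2 + \<alpha>\<^sup>2 * z2\<^sup>2)
      + 2 * \<alpha> * x1 * w * Z1 - \<alpha> * x4 * Z1\<^sup>2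
      - (2 / 3) * (x4 * Z0 * e4 + x2 * Z0 * z2 + 2 * x1 * Z1 * z2 + z2\<^sup>2)
      - \<alpha> * x4 * E3\<^sup>2 - 2 * \<alpha> * x2 * Z1 * E3 - 2 * \<alpha> * x1 * Z1 * e4"
proof -
  have prod: "\<bar>x * (a * b)\<bar> \<le> d * a\<^sup>2 + M\<^sup>2 * b\<^sup>2 / (4 * d)" if "\<bar>x\<bar> \<le> M" "d > 0" for x M a b d :: real
  proof -
    have "\<bar>x * (a * b)\<bar> \<le> M * \<bar>a * b\<bar>" unfolding abs_mult[of x] using that by (intro mult_right_mono) auto
    also have "\<dots> = \<bar>a * (M * b)\<bar>" using that by (simp add: abs_mult)
    also have "\<dots> \<le> d * a\<^sup>2 + (M * b)\<^sup>2 / (4 * d)" by (rule young[OF that(2)])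
    finally show ?thesis by (simp add: power_mult_distrib)
  qed
  have K2: "K\<^sup>2 \<le> K ^ 4" "1 \<le> K ^ 4" using K by (auto intro: power_increasing)
  have a2: "1 \<le> \<alpha>\<^sup>2" using \<alpha> by simp
  have aZ: "Z1\<^sup>2 \<le> \<alpha>\<^sup>2 * Z1\<^sup>2" "z2\<^sup>2 \<le> \<alpha>\<^sup>2 * z2\<^sup>2"
    using mult_right_mono[OF a2, of "Z1\<^sup>2"] mult_right_mono[OF a2, of "z2\<^sup>2"] by auto
  have KZ: "K\<^sup>2 * y\<^sup>2 \<le> K ^ 4 * y\<^sup>2" "y\<^sup>2 \<le> K ^ 4 * y\<^sup>2" for y :: real
    using mult_right_mono[OF K2(1), of "y\<^sup>2"] mult_right_mono[OF K2(2), of "y\<^sup>2"] by auto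
  \<comment> \<open>The Young parameters 1/12 fit the target 1/6: e4 and z2 are each used twice, and
    1/3 - 2/12 = 1 - 2/3 - 2/12 = 1/6.\<close>
  have t1: "\<bar>(2 * x1) * (w * (\<alpha> * Z1))\<bar> \<le> (1 / 12) * w\<^sup>2 + (6 * K)\<^sup>2 * (\<alpha> * Z1)\<^sup>2 / (4 * (1 / 12))"
    by (rule prod) (use x(1) in auto)
  have t8: "\<bar>(2 * x1) * (e4 * (\<alpha> * Z1))\<bar> \<le> (1 / 12) * e4\<^sup>2 + (6 * K)\<^sup>2 * (\<alpha> * Z1)\<^sup>2 / (4 * (1 / 12))"
    by (rule prod) (use x(1) in auto)
  have t2: "\<bar>\<alpha> * x4 * Z1\<^sup>2\<bar> \<le> 3 * Z1\<^sup>2"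
    using mult_right_mono[of "\<bar>\<alpha> * x4\<bar>" 3 "Z1\<^sup>2"] x(4) \<epsilon> by (simp add: abs_mult)
  have t6: "\<bar>\<alpha> * x4 * E3\<^sup>2\<bar> \<le> 3 * \<epsilon> * E3\<^sup>2"
    using mult_right_mono[OF x(4), of "E3\<^sup>2"] by (simp add: abs_mult)
  have t3: "\<bar>(2 / 3 * x4) * (e4 * Z0)\<bar> \<le> (1 / 12) * e4\<^sup>2 + 2\<^sup>2 * Z0\<^sup>2 / (4 * (1 / 12))"
    by (rule prod) (use x(3) in auto)
  have t4: "\<bar>(2 / 3 * x2) * (z2 * Z0)\<bar> \<le> (1 / 12) * z2\<^sup>2 + (7 * K\<^sup>2)\<^sup>2 * Z0\<^sup>2 / (4 * (1 / 12))"
    by (rule prod) (use x(2) K in \<open>auto simp: abs_mult\<close>)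
  have t5: "\<bar>(4 / 3 * x1) * (z2 * Z1)\<bar> \<le> (1 / 12) * z2\<^sup>2 + (4 * K)\<^sup>2 * Z1\<^sup>2 / (4 * (1 / 12))"
    by (rule prod) (use x(1) in auto)
  have t7: "\<bar>(2 * x2) * (E3 * (\<alpha> * Z1))\<bar> \<le> \<delta> * E3\<^sup>2 + (20 * K\<^sup>2)\<^sup>2 * (\<alpha> * Z1)\<^sup>2 / (4 * \<delta>)"
    by (rule prod) (use x(2) \<delta> in auto)
  have t7': "(20 * K\<^sup>2)\<^sup>2 * (\<alpha> * Z1)\<^sup>2 / (4 * \<delta>) = 100 / \<delta> * K ^ 4 * \<alpha>\<^sup>2 * Z1\<^sup>2"
    by (simp add: power_mult_distrib field_simps flip: power_mult)
  have k4: "(7 * K\<^sup>2)\<^sup>2 = 49 * K ^ 4" by (simp add: power_mult_distrib flip: power_mult)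
  have b1: "(6 * K)\<^sup>2 * (\<alpha> * Z1)\<^sup>2 / (4 * (1 / 12)) \<le> 108 * (K ^ 4 * \<alpha>\<^sup>2 * Z1\<^sup>2)"
    using KZ(1)[of "\<alpha> * Z1"] by (simp add: power_mult_distrib mult.assoc)
  have b2: "3 * Z1\<^sup>2 \<le> 3 * (K ^ 4 * \<alpha>\<^sup>2 * Z1\<^sup>2)"
    using aZ(1) KZ(2)[of "\<alpha> * Z1"] by (simp add: power_mult_distrib mult.assoc)
  have b5: "(4 * K)\<^sup>2 * Z1\<^sup>2 / (4 * (1 / 12)) \<le> 48 * (K ^ 4 * \<alpha>\<^sup>2 * Z1\<^sup>2)"
  proof -
    have "K\<^sup>2 * Z1\<^sup>2 \<le> K ^ 4 * (\<alpha>\<^sup>2 * Z1\<^sup>2)" using aZ(1) K2 by (intro mult_mono) auto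
    then show ?thesis by (simp add: power_mult_distrib mult.assoc)
  qed
  have b3: "2\<^sup>2 * Z0\<^sup>2 / (4 * (1 / 12)) \<le> 12 * (K ^ 4 * Z0\<^sup>2)" using KZ(2)[of Z0] by simp
  have pos: "0 \<le> K ^ 4 * Z0\<^sup>2" "0 \<le> K ^ 4 * \<alpha>\<^sup>2 * Z1\<^sup>2" "0 \<le> (w + e4)\<^sup>2" using K by auto
  note l1 = abs_ge_minus_self[of "(2 * x1) * (w * (\<alpha> * Z1))"] and l2 = abs_ge_self[of "\<alpha> * x4 * Z1\<^sup>2"]
    and l3 = abs_ge_self[of "(2 / 3 * x4) * (e4 * Z0)"] and l4 = abs_ge_self[of "(2 / 3 * x2) * (z2 * Z0)"]
    and l5 = abs_ge_self[of "(4 / 3 * x1) * (z2 * Z1)"] and l6 = abs_ge_self[of "\<alpha> * x4 * E3\<^sup>2"]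
    and l7 = abs_ge_self[of "(2 * x2) * (E3 * (\<alpha> * Z1))"] and l8 = abs_ge_self[of "(2 * x1) * (e4 * (\<alpha> * Z1))"]
  define P1 P2 P3 P4 P5 P6 P7 P8 where "P1 = (2 * x1) * (w * (\<alpha> * Z1))" and "P2 = \<alpha> * x4 * Z1\<^sup>2"
    and "P3 = (2 / 3 * x4) * (e4 * Z0)" and "P4 = (2 / 3 * x2) * (z2 * Z0)"
    and "P5 = (4 / 3 * x1) * (z2 * Z1)" and "P6 = \<alpha> * x4 * E3\<^sup>2"
    and "P7 = (2 * x2) * (E3 * (\<alpha> * Z1))" and "P8 = (2 * x1) * (e4 * (\<alpha> * Z1))"
  define Q0 Q1 where "Q0 = K ^ 4 * Z0\<^sup>2" and "Q1 = K ^ 4 * \<alpha>\<^sup>2 * Z1\<^sup>2"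
  define w2 ee zz az EE D where "w2 = w\<^sup>2" and "ee = e4\<^sup>2" and "zz = z2\<^sup>2" and "az = \<alpha>\<^sup>2 * z2\<^sup>2" and "EE = E3\<^sup>2"
    and "D = 100 / \<delta> * K ^ 4 * \<alpha>\<^sup>2 * Z1\<^sup>2"
  have s1: "- P1 \<le> w2 / 12 + 108 * Q1" using order_trans[OF l1 t1] b1 unfolding P1_def Q1_def w2_def by simp
  have s2: "P2 \<le> 3 * Q1" using order_trans[OF l2 t2] b2 unfolding P2_def Q1_def by simp
  have s3: "P3 \<le> ee / 12 + 12 * Q0" using order_trans[OF l3 t3] b3 unfolding P3_def Q0_def ee_def by simp
  have s4: "P4 \<le> zz / 12 + 147 * Q0" using order_trans[OF l4 t4] unfolding P4_def Q0_def zz_def k4 by simp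
  have s5: "P5 \<le> zz / 12 + 48 * Q1" using order_trans[OF l5 t5] b5 unfolding P5_def Q1_def zz_def by simp
  have s6: "P6 \<le> 3 * \<epsilon> * EE" using order_trans[OF l6 t6] unfolding P6_def EE_def by simp
  have s7: "P7 \<le> \<delta> * EE + D" using order_trans[OF l7 t7] unfolding P7_def EE_def D_def t7' by simp
  have s8: "P8 \<le> ee / 12 + 108 * Q1" using order_trans[OF l8 t8] b1 unfolding P8_def Q1_def ee_def by simp
  have s9: "zz \<le> az" "0 \<le> Q0" "0 \<le> Q1" "0 \<le> (w + e4)\<^sup>2" using aZ pos unfolding zz_def az_def Q0_def Q1_def by auto
  have s10: "0 \<le> w2" "0 \<le> ee" unfolding w2_def ee_def by auto
  have "(w2 + ee + az) / 6 \<le> 300 * Q1 + D + 300 * Q0 + (3 * \<epsilon> * EE + \<delta> * EE)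
      + ((w2 + ee) / 3 + 2 / 3 * (w + e4)\<^sup>2 + az) + P1 - P2 - P3 - P4 - P5 - 2 / 3 * zz - P6 - P7 - P8"
    using s1 s2 s3 s4 s5 s6 s7 s8 s9 s10 by argo
  then show ?thesis
    unfolding P1_def P2_def P3_def P4_def P5_def P6_def P7_def P8_def Q0_def Q1_def w2_def ee_def zz_def az_def EE_def D_def
    by (simp add: algebra_simps)
qed

text \<open>The products - 2 \<alpha> z_t z_xx and - 2 \<alpha> z_xx \<eta>_xxxx of the expanded
  square become, after integration by parts in x, \<alpha> times the t-derivatives of z_x^2 and
  \<eta>_xxx^2, so they leave only commutators with the weight. \<delta> stays free because it
  multiplies the norm of \<eta>_xxx, which has to be absorbed by that of \<eta>_xxxx through the
  elliptic estimates.\<close>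

lemma damped_estimate:
  assumes \<alpha>: "\<alpha> \<ge> 1" "\<alpha> \<le> \<beta>" and \<delta>: "\<delta> > 0"
    and z: "tempered T z" "tempered T z1" "tempered T z2" "tempered T z3" "tempered T z4"
      "has_dx T z z1" "has_dx T z1 z2" "has_dx T z2 z3" "has_dx T z3 z4"
    and w: "tempered T w" "tempered T w1" "has_dx T w w1" "has_dt T z w" "has_dt T z1 w1"
    and e: "tempered T e3" "tempered T e4" "has_dx T e3 e4" "has_dt T e3 z3" "has_dt T e4 z4"
  shows "(N 0 0 w + N 0 0 e4 + \<alpha>\<^sup>2 * N 0 0 z2) / 6
    \<le> N 0 0 (\<lambda>t x. w t x - \<alpha> * z2 t x + e4 t x)
      + (300 + 100 / \<delta>) * K ^ 4 * \<alpha>\<^sup>2 * N 2 0 z1 + 300 * K ^ 4 * N 4 0 z + (3 * \<epsilon> + \<delta>) * N 2 0 e3"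
proof -
  \<comment> \<open>\<open>X1\<close> and \<open>Y1\<close> treat z_t z_xx; \<open>X5\<close>,
    \<open>X6\<close> and \<open>Y3\<close> treat z_xx \<eta>_xxxx; \<open>X2\<close>,
    \<open>X3\<close>, \<open>X4\<close> and \<open>Y2\<close> turn z_t \<eta>_xxxx into -
    z_xx^2.\<close>
  note X1 = Dx_of_mult[OF Dx_of_mult[OF Dx_of_\<rho> w(1,2,3)] z(2,3,7)]
  note X2 = Dx_of_mult[OF Dx_of_mult[OF Dx_of_\<rho> z(1,2,6)] z(4,5,9)]
  note X3 = Dx_of_mult[OF Dx_of_mult[OF Dx_of_\<rho>x z(1,2,6)] z(3,4,8)]
  note X4 = Dx_of_mult[OF Dx_of_mult[OF Dx_of_\<rho> z(2,3,7)] z(3,4,8)]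
  note X5 = Dx_of_mult[OF Dx_of_mult[OF Dx_of_\<rho> z(3,4,8)] e(1,2,3)]
  note X6 = Dx_of_mult[OF Dx_of_mult[OF Dx_of_\<rho>x z(2,3,7)] e(1,2,3)]
  note Y1 = Dt_of_mult[OF Dt_of_mult[OF Dt_of_\<rho> z(2) w(2,5)] z(2) w(2,5)]
  note Y2 = Dt_of_mult[OF Dt_of_mult[OF Dt_of_\<rho> z(1) w(1,4)] e(2) z(5) e(5)]
  note Y3 = Dt_of_mult[OF Dt_of_mult[OF Dt_of_\<rho> e(1) z(4) e(4)] e(1) z(4) e(4)]
  note X = Dx_of_add[OF Dx_of_cmult[OF X1, of "2 * \<alpha>"] Dx_of_add[OF Dx_of_cmult[OF X2, of "2 / 3"]
    Dx_of_add[OF Dx_of_cmult[OF X3, of "- 2 / 3"] Dx_of_add[OF Dx_of_cmult[OF X4, of "- 2 / 3"]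
    Dx_of_add[OF Dx_of_cmult[OF X5, of "2 * \<alpha>"] Dx_of_cmult[OF X6, of "- 2 * \<alpha>"]]]]]]
  note Y = Dt_of_add[OF Dt_of_cmult[OF Y1, of "- \<alpha>"] Dt_of_add[OF Dt_of_cmult[OF Y2, of "- 2 / 3"]
    Dt_of_cmult[OF Y3, of "- \<alpha>"]]]
  define f where "f = (\<lambda>t x. w t x - \<alpha> * z2 t x + e4 t x)"
  have tf: "tempered T f" unfolding f_def by (intro tempered_all z w e)
  have "I (\<lambda>t x. 1 / 6 * (g x ^ 0 * W 0 t x * (w t x)\<^sup>2) + (1 / 6 * (g x ^ 0 * W 0 t x * (e4 t x)\<^sup>2)
        + \<alpha>\<^sup>2 / 6 * (g x ^ 0 * W 0 t x * (z2 t x)\<^sup>2)))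
    \<le> I (\<lambda>t x. g x ^ 0 * W 0 t x * (f t x)\<^sup>2
      + ((300 + 100 / \<delta>) * K ^ 4 * \<alpha>\<^sup>2 * (g x ^ 0 * W 2 t x * (z1 t x)\<^sup>2)
      + (300 * K ^ 4 * (g x ^ 0 * W 4 t x * (z t x)\<^sup>2) + (3 * \<epsilon> + \<delta>) * (g x ^ 0 * W 2 t x * (e3 t x)\<^sup>2))))"
  proof (rule I_le_Dx_Dt[OF _ _ X Y])
    fix t x assume t: "t \<in> {0<..<T}"
    define L R where "L = \<Lambda> t x" and "R = \<rho> t x"
    have L: "0 < L" "1 \<le> L" and R: "0 < R" "R * L = 1"
      using \<Lambda>_bounds[OF t, of x] \<rho>_bounds[OF t, of x] by (auto simp: L_def R_def)
    have W: "W 0 t x = R" "W 2 t x = R * L\<^sup>2" "W 4 t x = R * L ^ 4" by (auto simp: W_eq L_def R_def)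
    define x1 x2 x4 where "x1 = \<rho>x t x" and "x2 = \<rho>xx t x / L" and "x4 = \<rho>t t x / L"
    have RR: "\<rho>x t x = R * L * x1" "\<rho>xx t x = R * L\<^sup>2 * x2" "\<rho>t t x = R * L\<^sup>2 * x4"
      using R L by (auto simp: x1_def x2_def x4_def power2_eq_square field_simps)
    have b: "\<bar>x1\<bar> \<le> 3 * K" "\<bar>x2\<bar> \<le> 10 * K\<^sup>2"
      using \<rho>x_bound[OF t, of x] \<rho>xx_bound[OF t, of x] L by (auto simp: x1_def x2_def L_def field_simps)
    have b4: "\<bar>x4\<bar> * \<beta> \<le> 3 * \<epsilon>" using \<rho>t_bound[OF t, of x] L by (simp add: x4_def L_def field_simps)
    have b4': "\<bar>x4\<bar> \<le> 3" using b4 \<epsilon> mult_left_mono[OF \<beta>, of "\<bar>x4\<bar>"] by simp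
    \<comment> \<open>This is what the factor \<beta> in the hypotheses on the weight is for: the
      time derivative of the weight appears multiplied by \<alpha>, and the product is still of size
      \<epsilon>.\<close>
    have b4'': "\<bar>\<alpha> * x4\<bar> \<le> 3 * \<epsilon>"
      using b4 mult_left_mono[OF \<alpha>(2), of "\<bar>x4\<bar>"] \<alpha>(1) by (simp add: abs_mult mult.commute)
    have "R * ((w t x)\<^sup>2 + (e4 t x)\<^sup>2 + \<alpha>\<^sup>2 * (z2 t x)\<^sup>2) / 6 \<le> R * (
       (300 + 100 / \<delta>) * K ^ 4 * \<alpha>\<^sup>2 * (L * z1 t x)\<^sup>2 + 300 * K ^ 4 * (L\<^sup>2 * z t x)\<^sup>2 + (3 * \<epsilon> + \<delta>) * (L * e3 t x)\<^sup>2
      + (((w t x)\<^sup>2 + (e4 t x)\<^sup>2) / 3 + 2 / 3 * (w t x + e4 t x)\<^sup>2 + \<alpha>\<^sup>2 * (z2 t x)\<^sup>2)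
      + 2 * \<alpha> * x1 * w t x * (L * z1 t x) - \<alpha> * x4 * (L * z1 t x)\<^sup>2
      - (2 / 3) * (x4 * (L\<^sup>2 * z t x) * e4 t x + x2 * (L\<^sup>2 * z t x) * z2 t x + 2 * x1 * (L * z1 t x) * z2 t x + (z2 t x)\<^sup>2)
      - \<alpha> * x4 * (L * e3 t x)\<^sup>2 - 2 * \<alpha> * x2 * (L * z1 t x) * (L * e3 t x) - 2 * \<alpha> * x1 * (L * z1 t x) * e4 t x)"
      unfolding times_divide_eq_right[symmetric]
      using R(1) by (intro mult_left_mono damped_pointwise[OF \<alpha>(1) \<delta> b b4' b4'']) auto
    then show "1 / 6 * (g x ^ 0 * W 0 t x * (w t x)\<^sup>2) + (1 / 6 * (g x ^ 0 * W 0 t x * (e4 t x)\<^sup>2)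
        + \<alpha>\<^sup>2 / 6 * (g x ^ 0 * W 0 t x * (z2 t x)\<^sup>2))
    \<le> g x ^ 0 * W 0 t x * (f t x)\<^sup>2
      + ((300 + 100 / \<delta>) * K ^ 4 * \<alpha>\<^sup>2 * (g x ^ 0 * W 2 t x * (z1 t x)\<^sup>2)
      + (300 * K ^ 4 * (g x ^ 0 * W 4 t x * (z t x)\<^sup>2) + (3 * \<epsilon> + \<delta>) * (g x ^ 0 * W 2 t x * (e3 t x)\<^sup>2)))
      + (2 * \<alpha> * ((\<rho>x t x * w t x + \<rho> t x * w1 t x) * z1 t x + \<rho> t x * w t x * z2 t x)
        + (2 / 3 * ((\<rho>x t x * z t x + \<rho> t x * z1 t x) * z3 t x + \<rho> t x * z t x * z4 t x)
        + (- 2 / 3 * ((\<rho>xx t x * z t x + \<rho>x t x * z1 t x) * z2 t x + \<rho>x t x * z t x * z3 t x)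
        + (- 2 / 3 * ((\<rho>x t x * z1 t x + \<rho> t x * z2 t x) * z2 t x + \<rho> t x * z1 t x * z3 t x)
        + (2 * \<alpha> * ((\<rho>x t x * z2 t x + \<rho> t x * z3 t x) * e3 t x + \<rho> t x * z2 t x * e4 t x)
        + - 2 * \<alpha> * ((\<rho>xx t x * z1 t x + \<rho>x t x * z2 t x) * e3 t x + \<rho>x t x * z1 t x * e4 t x))))))
      + (- \<alpha> * ((\<rho>t t x * z1 t x + \<rho> t x * w1 t x) * z1 t x + \<rho> t x * z1 t x * w1 t x)
        + (- 2 / 3 * ((\<rho>t t x * z t x + \<rho> t x * w t x) * e4 t x + \<rho> t x * z t x * z4 t x)
        + - \<alpha> * ((\<rho>t t x * e3 t x + \<rho> t x * z3 t x) * e3 t x + \<rho> t x * e3 t x * z3 t x)))"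
      unfolding W RR f_def R_def[symmetric]
      by (simp add: algebra_simps add_divide_distrib power2_eq_square power4_eq_xxxx)
  qed (intro tempered_all z w e tf)+
  also have "\<dots> = N 0 0 f + ((300 + 100 / \<delta>) * K ^ 4 * \<alpha>\<^sup>2 * N 2 0 z1 + (300 * K ^ 4 * N 4 0 z + (3 * \<epsilon> + \<delta>) * N 2 0 e3))"
    unfolding N_def by (subst I_add, (intro tempered_all z w e tf)+)+ (simp only: I_cmult)
  also have "I (\<lambda>t x. 1 / 6 * (g x ^ 0 * W 0 t x * (w t x)\<^sup>2) + (1 / 6 * (g x ^ 0 * W 0 t x * (e4 t x)\<^sup>2)
        + \<alpha>\<^sup>2 / 6 * (g x ^ 0 * W 0 t x * (z2 t x)\<^sup>2))) = 1 / 6 * N 0 0 w + (1 / 6 * N 0 0 e4 + \<alpha>\<^sup>2 / 6 * N 0 0 z2)"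
    unfolding N_def by (subst I_add, (intro tempered_all z w e tf)+)+ (simp only: I_cmult)
  finally show ?thesis unfolding f_def by (simp add: add_divide_distrib)
qed

end

subsection \<open>The Schroedinger Carleman estimate\<close>

text \<open>Write the conjugated unknown as p + i q and split the conjugated operator into the
  symmetric part - \<theta>_t - a (D^2 + \<theta>_x^2) + i b (2 \<theta>_x D + \<theta>_xx) and the
  antisymmetric rest. The left side is twice the real part of their product. The commutator of D^2 +
  \<theta>_x^2 with 2 \<theta>_x D + \<theta>_xx occurs once with factor a^2 and once with b^2, so
  a^2 + b^2 = 1 removes r from the leading terms. The two long sums are exact x- and t-derivatives;
  the factors 0 and 1 belong to products with constant coefficient and keep the sums in the form
  delivered by the product rule.\<close>

lemma conjugated_commutator_identity:
  fixes p P1 P2 Pt P1t q Q1 Q2 Qt Q1t th H Hx tt ttt xt a b :: real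
  assumes ab: "a\<^sup>2 + b\<^sup>2 = 1"
  shows "2 * ((- tt * p - a * (P2 + th\<^sup>2 * p) - b * (2 * th * Q1 + H * q)) * (Pt + b * (Q2 + th\<^sup>2 * q) + a * (2 * th * P1 + H * p))
     + (- tt * q - a * (Q2 + th\<^sup>2 * q) + b * (2 * th * P1 + H * p)) * (Qt - b * (P2 + th\<^sup>2 * p) + a * (2 * th * Q1 + H * q)))
   = ttt * (p\<^sup>2 + q\<^sup>2) + 4 * a * th * xt * (p\<^sup>2 + q\<^sup>2) + 4 * b * xt * (p * Q1 - q * P1)
     + 4 * H * (P1\<^sup>2 + Q1\<^sup>2) + 4 * th\<^sup>2 * H * (p\<^sup>2 + q\<^sup>2) + 2 * Hx * (p * P1 + q * Q1)
     + (2 * b * (xt * q * P1 + tt * Q1 * P1 + tt * q * P2)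
        + (- 2 * b * (xt * p * Q1 + tt * P1 * Q1 + tt * p * Q2)
        + (- 2 * a * ((xt * th + tt * H) * p * p + tt * th * P1 * p + tt * th * p * P1)
        + (- 2 * a * ((xt * th + tt * H) * q * q + tt * th * Q1 * q + tt * th * q * Q1)
        + (- 2 * a * (0 * P1 * Pt + 1 * P2 * Pt + 1 * P1 * P1t)
        + (- 2 * a * (0 * Q1 * Qt + 1 * Q2 * Qt + 1 * Q1 * Q1t)
        + (2 * b * (H * p * Qt + th * P1 * Qt + th * p * Q1t)
        + (- 2 * b * (H * q * Pt + th * Q1 * Pt + th * q * P1t)
        + (- 2 * (H * P1 * P1 + th * P2 * P1 + th * P1 * P2)
        + (- 2 * (H * Q1 * Q1 + th * Q2 * Q1 + th * Q1 * Q2)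
        + (- 2 * (Hx * p * P1 + H * P1 * P1 + H * p * P2)
        + (- 2 * (Hx * q * Q1 + H * Q1 * Q1 + H * q * Q2)
        + (- 2 * (3 * (th)\<^sup>2 * H * p * p + th ^ 3 * P1 * p + th ^ 3 * p * P1)
        + - 2 * (3 * (th)\<^sup>2 * H * q * q + th ^ 3 * Q1 * q + th ^ 3 * q * Q1))))))))))))))
     + (- 1 * (ttt * p * p + tt * Pt * p + tt * p * Pt)
        + (- 1 * (ttt * q * q + tt * Qt * q + tt * q * Qt)
        + (a * (0 * P1 * P1 + 1 * P1t * P1 + 1 * P1 * P1t)
        + (a * (0 * Q1 * Q1 + 1 * Q1t * Q1 + 1 * Q1 * Q1t)
        + (- a * (2 * th * xt * p * p + (th)\<^sup>2 * Pt * p + (th)\<^sup>2 * p * Pt)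
        + (- a * (2 * th * xt * q * q + (th)\<^sup>2 * Qt * q + (th)\<^sup>2 * q * Qt)
        + (- 2 * b * (xt * p * Q1 + th * Pt * Q1 + th * p * Q1t)
        + 2 * b * (xt * q * P1 + th * Qt * P1 + th * q * P1t))))))))"
    (is "?l = ?r")
proof -
  have "?l - ?r = 2 * (1 - (a\<^sup>2 + b\<^sup>2)) *
      ((P2 + th\<^sup>2 * p) * (2 * th * P1 + H * p) + (Q2 + th\<^sup>2 * q) * (2 * th * Q1 + H * q))"
    by (simp add: algebra_simps power2_eq_square power3_eq_cube)
  then show ?thesis using ab by simp
qed

context carleman_weight begin

text \<open>
  \<open>conj_dx u v\<close> says that \<open>exp \<theta> v\<close> is the space derivative of \<open>exp \<theta> u\<close>; working with such pairs
  replaces the usual conjugated unknown \<open>exp \<theta> u\<close>.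
\<close>

definition conj_dx :: "(real \<Rightarrow> real \<Rightarrow> real) \<Rightarrow> (real \<Rightarrow> real \<Rightarrow> real) \<Rightarrow> bool" where
  "conj_dx u v \<longleftrightarrow> tempered T u \<and> tempered T v \<and> has_dx T u (\<lambda>t x. v t x - \<psi>1 x * \<Lambda> t x * u t x)"

definition conj_dt :: "(real \<Rightarrow> real \<Rightarrow> real) \<Rightarrow> (real \<Rightarrow> real \<Rightarrow> real) \<Rightarrow> bool" where
  "conj_dt u v \<longleftrightarrow> tempered T u \<and> tempered T v \<and> has_dt T u (\<lambda>t x. v t x - \<theta>t t x * u t x)"

lemma Dx_of_conj:
  assumes k: "tempered T k" "tempered T k'" "has_dx T k k'" and u: "conj_dx u u1" and v: "conj_dx v v1"
  shows "Dx_of (\<lambda>t x. k t x * u t x * v t x) (\<lambda>t x. k' t x * u t x * v t x + k t x * u1 t x * v t x + k t x * u t x * v1 t x)"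
proof -
  have u': "tempered T u" "tempered T u1" "tempered T (\<lambda>t x. u1 t x - \<psi>1 x * \<Lambda> t x * u t x)" "has_dx T u (\<lambda>t x. u1 t x - \<psi>1 x * \<Lambda> t x * u t x)"
    using u unfolding conj_dx_def by (auto intro!: tempered_all)
  have v': "tempered T v" "tempered T v1" "tempered T (\<lambda>t x. v1 t x - \<psi>1 x * \<Lambda> t x * v t x)" "has_dx T v (\<lambda>t x. v1 t x - \<psi>1 x * \<Lambda> t x * v t x)"
    using v unfolding conj_dx_def by (auto intro!: tempered_all)
  show ?thesis
  proof (rule Dx_ofI)
    show "has_dx T (\<lambda>t x. k t x * u t x * v t x) (\<lambda>t x. k' t x * u t x * v t x
        + k t x * (u1 t x - \<psi>1 x * \<Lambda> t x * u t x) * v t x + k t x * u t x * (v1 t x - \<psi>1 x * \<Lambda> t x * v t x))"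
      by (rule has_dxI)
        (auto intro!: derivative_eq_intros has_dxD[OF k(3)] has_dxD[OF u'(4)] has_dxD[OF v'(4)] simp: algebra_simps)
  qed (intro tempered_all k u' v' | simp add: algebra_simps)+
qed

lemma Dt_of_conj:
  assumes k: "tempered T k" "tempered T k'" "has_dt T k k'" and u: "conj_dt u u1" and v: "conj_dt v v1"
  shows "Dt_of (\<lambda>t x. k t x * u t x * v t x) (\<lambda>t x. k' t x * u t x * v t x + k t x * u1 t x * v t x + k t x * u t x * v1 t x)"
proof -
  have u': "tempered T u" "tempered T u1" "tempered T (\<lambda>t x. u1 t x - \<theta>t t x * u t x)" "has_dt T u (\<lambda>t x. u1 t x - \<theta>t t x * u t x)"
    using u unfolding conj_dt_def by (auto intro!: tempered_all)
  have v': "tempered T v" "tempered T v1" "tempered T (\<lambda>t x. v1 t x - \<theta>t t x * v t x)" "has_dt T v (\<lambda>t x. v1 t x - \<theta>t t x * v t x)"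
    using v unfolding conj_dt_def by (auto intro!: tempered_all)
  show ?thesis
  proof (rule Dt_ofI)
    show "has_dt T (\<lambda>t x. k t x * u t x * v t x) (\<lambda>t x. k' t x * u t x * v t x
        + k t x * (u1 t x - \<theta>t t x * u t x) * v t x + k t x * u t x * (v1 t x - \<theta>t t x * v t x))"
      by (rule has_dtI)
        (auto intro!: derivative_eq_intros has_dtD[OF k(3)] has_dtD[OF u'(4)] has_dtD[OF v'(4)] simp: algebra_simps)
  qed (intro tempered_all k u' v' | simp add: algebra_simps)+
qed

definition \<theta>x :: "real \<Rightarrow> real \<Rightarrow> real" where "\<theta>x t x = \<psi>1 x * \<Lambda> t x"
definition \<theta>xt :: "real \<Rightarrow> real \<Rightarrow> real" where "\<theta>xt t x = \<psi>1 x * \<Lambda>t t x"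
definition \<theta>xx :: "real \<Rightarrow> real \<Rightarrow> real" where "\<theta>xx t x = (\<psi>2 x + \<mu> * (\<psi>1 x)\<^sup>2) * \<Lambda> t x"
definition \<theta>xxx :: "real \<Rightarrow> real \<Rightarrow> real" where
  "\<theta>xxx t x = (\<psi>3 x + 3 * \<mu> * \<psi>1 x * \<psi>2 x + \<mu>\<^sup>2 * \<psi>1 x ^ 3) * \<Lambda> t x"

lemma tempered_\<theta>: "tempered T \<theta>x" "tempered T \<theta>xt" "tempered T \<theta>xx" "tempered T \<theta>xxx"
  unfolding \<theta>x_def \<theta>xt_def \<theta>xx_def \<theta>xxx_def by (intro tempered_all)+

lemma \<theta>_derivs:
  "has_dx T \<theta>x \<theta>xx" "has_dx T \<theta>xx \<theta>xxx" "has_dx T \<theta>t \<theta>xt" "has_dt T \<theta>x \<theta>xt"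
proof -
  show "has_dx T \<theta>x \<theta>xx" unfolding \<theta>x_def \<theta>xx_def
    by (rule has_dxI) (auto intro!: derivative_eq_intros \<psi>1_deriv has_dxD[OF \<Lambda>_dx] simp: algebra_simps power2_eq_square)
  show "has_dx T \<theta>xx \<theta>xxx" unfolding \<theta>xx_def \<theta>xxx_def
    by (rule has_dxI) (auto intro!: derivative_eq_intros \<psi>1_deriv \<psi>2_deriv has_dxD[OF \<Lambda>_dx]
      simp: algebra_simps power2_eq_square power3_eq_cube)
  show "has_dx T \<theta>t \<theta>xt" using \<theta>t_dx by (simp add: \<theta>xt_def[abs_def])
  show "has_dt T \<theta>x \<theta>xt" unfolding \<theta>x_def \<theta>xt_def
    by (rule has_dtI) (auto intro!: derivative_eq_intros has_dtD[OF \<Lambda>_dt])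
qed

text \<open>What the commutator leaves once the exact derivatives are removed. The leading terms are
  those with factors 4 \<theta>_xx and 4 \<theta>_x^2 \<theta>_xx; each of the others contains a
  time derivative of the weight or its third x-derivative.\<close>

definition carleman_form :: "real \<Rightarrow> real \<Rightarrow> real \<Rightarrow> real \<Rightarrow> real \<Rightarrow> real \<Rightarrow> real \<Rightarrow> real \<Rightarrow> real" where
  "carleman_form a b t x p P1 q Q1 = \<theta>tt t x * (p\<^sup>2 + q\<^sup>2) + 4 * a * \<theta>x t x * \<theta>xt t x * (p\<^sup>2 + q\<^sup>2)
     + 4 * b * \<theta>xt t x * (p * Q1 - q * P1) + 4 * \<theta>xx t x * (P1\<^sup>2 + Q1\<^sup>2)
     + 4 * (\<theta>x t x)\<^sup>2 * \<theta>xx t x * (p\<^sup>2 + q\<^sup>2) + 2 * \<theta>xxx t x * (p * P1 + q * Q1)"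

text \<open>Since \<theta>_xx = (\<psi>'' + \<mu> (\<psi>')^2) \<Lambda>, a large \<mu> makes the
  leading terms positive wherever \<psi>' is not small; near the critical points the g^8 term
  compensates. The remaining terms are small through \<epsilon>.\<close>

lemma carleman_form_coercive:
  assumes t: "t \<in> {0<..<T}" and a: "0 \<le> a" "a \<le> 1" and b: "\<bar>b\<bar> \<le> 1"
    and \<mu>_large: "16 * K ^ 3 \<le> \<mu> * c\<^sup>2" and \<epsilon>_small: "100 * K ^ 3 * \<epsilon> \<le> c\<^sup>2"
  shows "\<mu> * c\<^sup>2 / 2 * (\<Lambda> t x * (P1\<^sup>2 + Q1\<^sup>2) + \<Lambda> t x ^ 3 * (p\<^sup>2 + q\<^sup>2))
    \<le> carleman_form a b t x p P1 q Q1
      + 4 * \<mu> * K\<^sup>2 * (g x ^ 8 * (\<Lambda> t x * (P1\<^sup>2 + Q1\<^sup>2) + \<Lambda> t x ^ 3 * (p\<^sup>2 + q\<^sup>2)))"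
proof -
  define L where "L = \<Lambda> t x"
  define B where "B = \<Lambda> t x * (P1\<^sup>2 + Q1\<^sup>2)"
  define A where "A = \<Lambda> t x ^ 3 * (p\<^sup>2 + q\<^sup>2)"
  define m where "m = \<mu> * c\<^sup>2"
  define s where "s = \<psi>1 x"
  have L: "0 < L" "1 \<le> L" "\<mu> \<le> \<epsilon> * L" "\<mu> \<le> L" using \<Lambda>_bounds[OF t, of x] by (auto simp: L_def)
  have A: "A = L ^ 3 * (p\<^sup>2 + q\<^sup>2)" "0 \<le> A" and B: "B = L * (P1\<^sup>2 + Q1\<^sup>2)" "0 \<le> B"
    using L by (auto simp: A_def B_def L_def)
  have s: "\<bar>s\<bar> \<le> K" "s\<^sup>2 \<le> K\<^sup>2" using bnd(1)[of x] K by (auto simp: s_def abs_le_square_iff[symmetric])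
  have K': "1 \<le> K\<^sup>2" "K \<le> K ^ 2" "K\<^sup>2 \<le> K ^ 3" "K \<le> K ^ 3" "1 \<le> K ^ 3"
    using K power_increasing[of 1 2 K] power_increasing[of 1 3 K] power_increasing[of 2 3 K] by auto
  have \<beta>1: "\<bar>y\<bar> \<le> e" if "\<bar>y\<bar> * \<beta> \<le> e" for y e
    using that mult_left_mono[OF \<beta>, of "\<bar>y\<bar>"] by simp
  have \<Lambda>t: "\<bar>\<Lambda>t t x\<bar> \<le> \<epsilon> * L\<^sup>2" using \<beta>1 \<Lambda>t_le[OF t, of x] by (simp add: L_def)
  have xt: "\<bar>\<theta>xt t x\<bar> \<le> K * (\<epsilon> * L\<^sup>2)"
    unfolding \<theta>xt_def abs_mult using \<Lambda>t bnd(1)[of x] K by (intro mult_mono) auto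
  have \<epsilon>m: "K ^ 3 * \<epsilon> \<le> m / 100"
  proof -
    have "c\<^sup>2 \<le> m" unfolding m_def using \<mu> mult_right_mono[of 1 \<mu> "c\<^sup>2"] by simp
    then show ?thesis using \<epsilon>_small by simp
  qed
  have Ke: "\<epsilon> \<le> K ^ 3 * \<epsilon>" "K\<^sup>2 * \<epsilon> \<le> K ^ 3 * \<epsilon>" "K * \<epsilon> \<le> K ^ 3 * \<epsilon>"
    using mult_right_mono[OF K'(5), of \<epsilon>] mult_right_mono[OF K'(3), of \<epsilon>] mult_right_mono[OF K'(4), of \<epsilon>] \<epsilon> by auto
  have cross: "L\<^sup>2 * \<bar>y * z\<bar> \<le> (L ^ 3 * y\<^sup>2 + L * z\<^sup>2) / 2" for y z
  proof -
    have "0 \<le> L * (L * \<bar>y\<bar> - \<bar>z\<bar>)\<^sup>2 / 2" using L by simp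
    then show ?thesis by (simp add: power2_eq_square power3_eq_cube abs_mult algebra_simps)
  qed
  have e1: "\<bar>\<theta>tt t x * (p\<^sup>2 + q\<^sup>2)\<bar> \<le> m / 100 * A"
  proof -
    have "\<bar>\<theta>tt t x * (p\<^sup>2 + q\<^sup>2)\<bar> \<le> (\<epsilon> * L ^ 3) * (p\<^sup>2 + q\<^sup>2)"
      using mult_right_mono[OF \<theta>tt_le[OF t, of x], of "p\<^sup>2 + q\<^sup>2"] by (simp add: abs_mult L_def)
    also have "\<dots> = \<epsilon> * A" by (simp add: A)
    also have "\<dots> \<le> m / 100 * A" using Ke(1) \<epsilon>m A(2) by (intro mult_right_mono) auto
    finally show ?thesis .
  qed
  have e2: "\<bar>4 * a * \<theta>x t x * \<theta>xt t x * (p\<^sup>2 + q\<^sup>2)\<bar> \<le> 4 * (m / 100) * A"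
  proof -
    have "\<bar>4 * a * \<theta>x t x * \<theta>xt t x * (p\<^sup>2 + q\<^sup>2)\<bar> \<le> 4 * 1 * (K * L) * (K * (\<epsilon> * L\<^sup>2)) * (p\<^sup>2 + q\<^sup>2)"
      unfolding abs_mult using a xt s L K by (intro mult_mono) (auto simp: \<theta>x_def s_def L_def abs_mult intro: mult_right_mono)
    also have "\<dots> = 4 * (K\<^sup>2 * \<epsilon>) * A" by (simp add: A power2_eq_square power3_eq_cube)
    also have "\<dots> \<le> 4 * (m / 100) * A" using Ke(2) \<epsilon>m A(2) by (intro mult_right_mono mult_left_mono) auto
    finally show ?thesis .
  qed
  have e3: "\<bar>4 * b * \<theta>xt t x * (p * Q1 - q * P1)\<bar> \<le> 2 * (m / 100) * (A + B)"
  proof -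
    have "\<bar>4 * b * \<theta>xt t x * (p * Q1 - q * P1)\<bar> \<le> 4 * 1 * (K * (\<epsilon> * L\<^sup>2)) * (\<bar>p * Q1\<bar> + \<bar>q * P1\<bar>)"
      unfolding abs_mult[of "4 * b * \<theta>xt t x"] abs_mult[of "4 * b"] abs_mult[of 4]
      using b xt K \<epsilon> by (intro mult_mono) auto
    also have "\<dots> = 4 * (K * \<epsilon>) * (L\<^sup>2 * \<bar>p * Q1\<bar> + L\<^sup>2 * \<bar>q * P1\<bar>)" by (simp add: algebra_simps)
    also have "\<dots> \<le> 4 * (K * \<epsilon>) * ((L ^ 3 * p\<^sup>2 + L * Q1\<^sup>2) / 2 + (L ^ 3 * q\<^sup>2 + L * P1\<^sup>2) / 2)"
      using K \<epsilon> by (intro mult_left_mono add_mono cross) auto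
    also have "\<dots> = 2 * (K * \<epsilon>) * (A + B)" by (simp add: A B algebra_simps add_divide_distrib)
    also have "\<dots> \<le> 2 * (m / 100) * (A + B)" using Ke(3) \<epsilon>m A(2) B(2) by (intro mult_right_mono mult_left_mono) auto
    finally show ?thesis .
  qed
  have e4: "\<bar>2 * \<theta>xxx t x * (p * P1 + q * Q1)\<bar> \<le> 5 * (m / 100) * (A + B)"
  proof -
    have "\<bar>\<psi>3 x + 3 * \<mu> * s * \<psi>2 x + \<mu>\<^sup>2 * s ^ 3\<bar> \<le> \<bar>\<psi>3 x\<bar> + \<bar>3 * \<mu> * s * \<psi>2 x\<bar> + \<bar>\<mu>\<^sup>2 * s ^ 3\<bar>" by linarith
    also have "\<dots> \<le> \<mu>\<^sup>2 * K ^ 3 + 3 * \<mu>\<^sup>2 * K ^ 3 + \<mu>\<^sup>2 * K ^ 3"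
    proof (intro add_mono)
      have m2: "1 \<le> \<mu>\<^sup>2" "\<mu> \<le> \<mu>\<^sup>2" using \<mu> one_le_power[of \<mu> 2] power_increasing[of 1 2 \<mu>] by auto
      have "K \<le> \<mu>\<^sup>2 * K ^ 3" using K'(4) mult_right_mono[OF m2(1), of "K ^ 3"] K by linarith
      then show "\<bar>\<psi>3 x\<bar> \<le> \<mu>\<^sup>2 * K ^ 3" using bnd(3)[of x] by linarith
      have "\<bar>3 * \<mu> * s * \<psi>2 x\<bar> \<le> 3 * \<mu> * K * K"
        unfolding abs_mult using s bnd(2)[of x] \<mu> K by (intro mult_mono) auto
      also have "\<dots> = 3 * (\<mu> * K\<^sup>2)" by (simp add: power2_eq_square)
      also have "\<dots> \<le> 3 * (\<mu>\<^sup>2 * K ^ 3)" using m2 K'(3) \<mu> by (intro mult_left_mono mult_mono) auto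
      finally show "\<bar>3 * \<mu> * s * \<psi>2 x\<bar> \<le> 3 * \<mu>\<^sup>2 * K ^ 3" by simp
      show "\<bar>\<mu>\<^sup>2 * s ^ 3\<bar> \<le> \<mu>\<^sup>2 * K ^ 3" using power_mono[OF s(1), of 3]
        by (simp add: abs_mult power_abs mult_left_mono)
    qed
    finally have "\<bar>\<psi>3 x + 3 * \<mu> * s * \<psi>2 x + \<mu>\<^sup>2 * s ^ 3\<bar> * L \<le> (5 * \<mu>\<^sup>2 * K ^ 3) * L"
      using L by (intro mult_right_mono) (simp_all add: mult_ac)
    also have "\<dots> = 5 * K ^ 3 * \<mu> * (\<mu> * L)" by (simp add: power2_eq_square)
    \<comment> \<open>\<theta>_xxx is of order \<mu>^2 \<Lambda>; trading one \<mu> for \<epsilon>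
      \<Lambda> leaves \<epsilon> \<mu> \<Lambda>^2, small against the geometric mean \<mu>
      \<Lambda>^2 of the two leading weights.\<close>
    also have "\<dots> \<le> 5 * K ^ 3 * \<mu> * ((\<epsilon> * L) * L)" using L K \<mu> by (intro mult_left_mono mult_right_mono) auto
    also have "\<dots> = 5 * (\<mu> * (K ^ 3 * \<epsilon>)) * L\<^sup>2" by (simp add: power2_eq_square)
    also have "\<dots> \<le> 5 * (m / 100) * L\<^sup>2"
    proof -
      have "\<mu> * (100 * K ^ 3 * \<epsilon>) \<le> \<mu> * c\<^sup>2" using \<epsilon>_small \<mu> by (intro mult_left_mono) auto
      then have "\<mu> * (K ^ 3 * \<epsilon>) \<le> m / 100" by (simp add: m_def)
      then show ?thesis by (intro mult_right_mono mult_left_mono) auto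
    qed
    finally have xxx: "\<bar>\<theta>xxx t x\<bar> \<le> 5 * (m / 100) * L\<^sup>2" using L by (simp add: \<theta>xxx_def abs_mult s_def L_def)
    have m0: "0 \<le> m" unfolding m_def using \<mu> by simp
    have "\<bar>2 * \<theta>xxx t x * (p * P1 + q * Q1)\<bar> \<le> 2 * (5 * (m / 100) * L\<^sup>2) * (\<bar>p * P1\<bar> + \<bar>q * Q1\<bar>)"
      unfolding abs_mult[of "2 * \<theta>xxx t x"] abs_mult[of 2] using xxx m0 by (intro mult_mono) auto
    also have "\<dots> = 10 * (m / 100) * (L\<^sup>2 * \<bar>p * P1\<bar> + L\<^sup>2 * \<bar>q * Q1\<bar>)" by (simp add: algebra_simps)
    also have "\<dots> \<le> 10 * (m / 100) * ((L ^ 3 * p\<^sup>2 + L * P1\<^sup>2) / 2 + (L ^ 3 * q\<^sup>2 + L * Q1\<^sup>2) / 2)"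
      using m0 by (intro mult_left_mono add_mono cross) auto
    also have "\<dots> = 5 * (m / 100) * (A + B)" by (simp add: A B algebra_simps add_divide_distrib)
    finally show ?thesis .
  qed
  have m4: "K \<le> m / 16" "K ^ 3 \<le> m / 16" using \<mu>_large K'(4) by (auto simp: m_def)
  have g8: "0 \<le> g x ^ 8" "g x ^ 8 \<le> 1" using g[of x] by (auto intro: power_le_one)
  have co: "c \<le> s\<^sup>2 + K * g x ^ 8" using coercive[of x] by (simp add: s_def)
  have co1: "4 * c\<^sup>2 \<le> 4 * s\<^sup>2 + 4 * K\<^sup>2 * g x ^ 8"
  proof -
    have "c\<^sup>2 \<le> c" using c by (simp add: power2_eq_square mult_left_le_one_le)
    moreover have "K * g x ^ 8 \<le> K\<^sup>2 * g x ^ 8" using K'(2) g8 by (intro mult_right_mono) auto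
    ultimately show ?thesis using co by linarith
  qed
  \<comment> \<open>The zero-order term contains (\<psi>')^4, one factor (\<psi>')^2 from
    \<theta>_x^2 and one from \<theta>_xx. Squaring \<open>coercive\<close> explains the c^2 in the
    result.\<close>
  have co2: "2 * c\<^sup>2 \<le> 4 * (s\<^sup>2)\<^sup>2 + 4 * K\<^sup>2 * g x ^ 8"
  proof -
    have "c\<^sup>2 \<le> (s\<^sup>2 + K * g x ^ 8)\<^sup>2" using co c by (intro power_mono) auto
    also have "\<dots> \<le> 2 * (s\<^sup>2)\<^sup>2 + 2 * (K * g x ^ 8)\<^sup>2"
      using zero_le_power2[of "s\<^sup>2 - K * g x ^ 8"] unfolding power2_sum power2_diff by linarith
    also have "(K * g x ^ 8)\<^sup>2 \<le> K\<^sup>2 * (g x ^ 8 * 1)"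
      unfolding power_mult_distrib power2_eq_square[of "g x ^ 8"] using g8 by (intro mult_left_mono) auto
    finally show ?thesis by simp
  qed
  have xx: "\<theta>xx t x = (\<psi>2 x + \<mu> * s\<^sup>2) * L" by (simp add: \<theta>xx_def s_def L_def)
  have e5: "4 * m * B - 4 * \<mu> * K\<^sup>2 * (g x ^ 8 * B) - m / 4 * B \<le> 4 * \<theta>xx t x * (P1\<^sup>2 + Q1\<^sup>2)"
  proof -
    have "4 * \<theta>xx t x * (P1\<^sup>2 + Q1\<^sup>2) = 4 * (\<psi>2 x * B) + \<mu> * (4 * s\<^sup>2 * B)" by (simp add: xx B algebra_simps)
    moreover have "\<mu> * ((4 * c\<^sup>2 - 4 * K\<^sup>2 * g x ^ 8) * B) \<le> \<mu> * (4 * s\<^sup>2 * B)"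
      using co1 \<mu> B(2) by (intro mult_left_mono mult_right_mono) auto
    moreover have "- (m / 16) * B \<le> \<psi>2 x * B" using bnd(2)[of x] m4 B(2) by (intro mult_right_mono) auto
    ultimately show ?thesis by (simp add: m_def algebra_simps)
  qed
  have e6: "2 * m * A - 4 * \<mu> * K\<^sup>2 * (g x ^ 8 * A) - m / 4 * A \<le> 4 * (\<theta>x t x)\<^sup>2 * \<theta>xx t x * (p\<^sup>2 + q\<^sup>2)"
  proof -
    have "4 * (\<theta>x t x)\<^sup>2 * \<theta>xx t x * (p\<^sup>2 + q\<^sup>2) = 4 * (s\<^sup>2 * \<psi>2 x * A) + \<mu> * (4 * (s\<^sup>2)\<^sup>2 * A)"
      by (simp add: xx A \<theta>x_def s_def[symmetric] L_def[symmetric] algebra_simps power2_eq_square power3_eq_cube)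
    moreover have "\<mu> * ((2 * c\<^sup>2 - 4 * K\<^sup>2 * g x ^ 8) * A) \<le> \<mu> * (4 * (s\<^sup>2)\<^sup>2 * A)"
      using co2 \<mu> A(2) by (intro mult_left_mono mult_right_mono) auto
    moreover have "- (m / 16) * A \<le> s\<^sup>2 * \<psi>2 x * A"
    proof -
      have "\<bar>s\<^sup>2 * \<psi>2 x\<bar> \<le> K\<^sup>2 * K" unfolding abs_mult using s bnd(2)[of x] by (intro mult_mono) auto
      also have "\<dots> \<le> m / 16" using m4 by (simp add: power2_eq_square power3_eq_cube)
      finally show ?thesis using A(2) by (intro mult_right_mono) auto
    qed
    ultimately show ?thesis by (simp add: m_def algebra_simps)
  qed
  have mAB: "0 \<le> m * A" "0 \<le> m * B" using A B \<mu> by (auto simp: m_def)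
  have "m / 2 * (B + A) \<le> carleman_form a b t x p P1 q Q1 + (4 * \<mu> * K\<^sup>2 * (g x ^ 8 * B) + 4 * \<mu> * K\<^sup>2 * (g x ^ 8 * A))"
  proof -
    have aux: "(N + M) / 2 \<le> E1 + E2 + E3 + E5 + E6 + E4 + (G1 + G2)"
      if "- E1 \<le> M / 100" "- E2 \<le> 4 * M / 100" "- E3 \<le> 2 * (M + N) / 100" "- E4 \<le> 5 * (M + N) / 100"
        "4 * N - G1 - N / 4 \<le> E5" "2 * M - G2 - M / 4 \<le> E6" "0 \<le> M" "0 \<le> N"
      for M N E1 E2 E3 E4 E5 E6 G1 G2 :: real
      using that by argo
    have "(m * B + m * A) / 2 \<le> carleman_form a b t x p P1 q Q1 + (4 * \<mu> * K\<^sup>2 * (g x ^ 8 * B) + 4 * \<mu> * K\<^sup>2 * (g x ^ 8 * A))"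
      unfolding carleman_form_def
      by (rule aux) (use abs_le_D2[OF e1] abs_le_D2[OF e2] abs_le_D2[OF e3] abs_le_D2[OF e4] e5 e6 mAB in \<open>simp_all add: algebra_simps\<close>)
    then show ?thesis by (simp add: algebra_simps)
  qed
  then show ?thesis unfolding A_def[symmetric] B_def[symmetric] by (simp add: m_def algebra_simps)
qed

lemma W_2_4: "t \<in> {0<..<T} \<Longrightarrow> W 2 t x = \<Lambda> t x" "t \<in> {0<..<T} \<Longrightarrow> W 4 t x = \<Lambda> t x ^ 3"
  using \<Lambda>_bounds(1)[of t x] by (auto simp: W_def power2_eq_square power3_eq_cube power4_eq_xxxx)

text \<open>Of the square of the sum of both parts only the double product is kept, which is
  \<open>carleman_form\<close> up to exact derivatives. The source f is real, so the imaginary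
  component of the equation has right-hand side 0. Coercivity and cutoff term share a factor \<mu>;
  dividing by it leaves the source divided by \<mu>.\<close>

lemma conjugated_carleman:
  assumes ab: "a\<^sup>2 + b\<^sup>2 = 1" "0 \<le> a"
    and \<mu>_large: "16 * K ^ 3 \<le> \<mu> * c\<^sup>2" and \<epsilon>_small: "100 * K ^ 3 * \<epsilon> \<le> c\<^sup>2"
    and p: "conj_dx p P1" "conj_dx P1 P2" "conj_dt p Pt" "conj_dx Pt P1t" "conj_dt P1 P1t"
    and q: "conj_dx q Q1" "conj_dx Q1 Q2" "conj_dt q Qt" "conj_dx Qt Q1t" "conj_dt Q1 Q1t"
    and f: "tempered T f"
    and eq1: "\<And>t x. t \<in> {0<..<T} \<Longrightarrow> f t x =
       (- \<theta>t t x * p t x - a * (P2 t x + (\<theta>x t x)\<^sup>2 * p t x) - b * (2 * \<theta>x t x * Q1 t x + \<theta>xx t x * q t x))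
       + (Pt t x + b * (Q2 t x + (\<theta>x t x)\<^sup>2 * q t x) + a * (2 * \<theta>x t x * P1 t x + \<theta>xx t x * p t x))"
    and eq2: "\<And>t x. t \<in> {0<..<T} \<Longrightarrow> 0 =
       (- \<theta>t t x * q t x - a * (Q2 t x + (\<theta>x t x)\<^sup>2 * q t x) + b * (2 * \<theta>x t x * P1 t x + \<theta>xx t x * p t x))
       + (Qt t x - b * (P2 t x + (\<theta>x t x)\<^sup>2 * p t x) + a * (2 * \<theta>x t x * Q1 t x + \<theta>xx t x * q t x))"
  shows "c\<^sup>2 / 2 * (N 2 0 P1 + N 2 0 Q1 + N 4 0 p + N 4 0 q) \<le>
     I (\<lambda>t x. (f t x)\<^sup>2) / \<mu> + 4 * K\<^sup>2 * (N 2 8 P1 + N 2 8 Q1 + N 4 8 p + N 4 8 q)"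
proof -
  have tp: "tempered T p" "tempered T P1" "tempered T P2" "tempered T Pt" "tempered T P1t"
    "tempered T q" "tempered T Q1" "tempered T Q2" "tempered T Qt" "tempered T Q1t"
    using p q unfolding conj_dx_def conj_dt_def by auto
  have k1: "tempered T \<theta>t" "tempered T \<theta>xt" "has_dx T \<theta>t \<theta>xt" using temp(3) tempered_\<theta> \<theta>_derivs by auto
  have k2: "tempered T (\<lambda>t x. \<theta>t t x * \<theta>x t x)" "tempered T (\<lambda>t x. \<theta>xt t x * \<theta>x t x + \<theta>t t x * \<theta>xx t x)"
    "has_dx T (\<lambda>t x. \<theta>t t x * \<theta>x t x) (\<lambda>t x. \<theta>xt t x * \<theta>x t x + \<theta>t t x * \<theta>xx t x)"
    by (intro tempered_all tempered_\<theta>)+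
      (rule has_dxI, auto intro!: derivative_eq_intros has_dxD[OF k1(3)] has_dxD[OF \<theta>_derivs(1)])
  have k3: "tempered T (\<lambda>t x. 1)" "tempered T (\<lambda>t x. 0)" "has_dx T (\<lambda>t x. 1) (\<lambda>t x. 0)" "has_dt T (\<lambda>t x. 1) (\<lambda>t x. 0)"
    by (auto intro: tempered_const simp: has_dx_def has_dt_def)
  have k4: "tempered T \<theta>x" "tempered T \<theta>xx" "has_dx T \<theta>x \<theta>xx" using tempered_\<theta> \<theta>_derivs by auto
  have k5: "tempered T \<theta>xx" "tempered T \<theta>xxx" "has_dx T \<theta>xx \<theta>xxx" using tempered_\<theta> \<theta>_derivs by auto
  have k6: "tempered T (\<lambda>t x. \<theta>x t x ^ 3)" "tempered T (\<lambda>t x. 3 * (\<theta>x t x)\<^sup>2 * \<theta>xx t x)"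
    "has_dx T (\<lambda>t x. \<theta>x t x ^ 3) (\<lambda>t x. 3 * (\<theta>x t x)\<^sup>2 * \<theta>xx t x)"
    by (intro tempered_all tempered_\<theta>)+ (rule has_dxI, auto intro!: derivative_eq_intros has_dxD[OF \<theta>_derivs(1)])
  have l1: "tempered T \<theta>t" "tempered T \<theta>tt" "has_dt T \<theta>t \<theta>tt" using temp \<theta>t_dt by auto
  have l2: "tempered T \<theta>x" "tempered T \<theta>xt" "has_dt T \<theta>x \<theta>xt" using tempered_\<theta> \<theta>_derivs by auto
  have l3: "tempered T (\<lambda>t x. (\<theta>x t x)\<^sup>2)" "tempered T (\<lambda>t x. 2 * \<theta>x t x * \<theta>xt t x)"
    "has_dt T (\<lambda>t x. (\<theta>x t x)\<^sup>2) (\<lambda>t x. 2 * \<theta>x t x * \<theta>xt t x)"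
    by (intro tempered_all tempered_\<theta>)+ (rule has_dtI, auto intro!: derivative_eq_intros has_dtD[OF \<theta>_derivs(4)])
  note cx = Dx_of_cmult[of _ _ "2 * b"] Dx_of_cmult[of _ _ "- 2 * b"] Dx_of_cmult[of _ _ "- 2 * a"] Dx_of_cmult[of _ _ "- 2"]
  note X = Dx_of_add[OF cx(1)[OF Dx_of_conj[OF k1 q(1) p(2)]] Dx_of_add[OF cx(2)[OF Dx_of_conj[OF k1 p(1) q(2)]]
    Dx_of_add[OF cx(3)[OF Dx_of_conj[OF k2 p(1) p(1)]] Dx_of_add[OF cx(3)[OF Dx_of_conj[OF k2 q(1) q(1)]]
    Dx_of_add[OF cx(3)[OF Dx_of_conj[OF k3(1,2,3) p(2) p(4)]] Dx_of_add[OF cx(3)[OF Dx_of_conj[OF k3(1,2,3) q(2) q(4)]]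
    Dx_of_add[OF cx(1)[OF Dx_of_conj[OF k4 p(1) q(4)]] Dx_of_add[OF cx(2)[OF Dx_of_conj[OF k4 q(1) p(4)]]
    Dx_of_add[OF cx(4)[OF Dx_of_conj[OF k4 p(2) p(2)]] Dx_of_add[OF cx(4)[OF Dx_of_conj[OF k4 q(2) q(2)]]
    Dx_of_add[OF cx(4)[OF Dx_of_conj[OF k5 p(1) p(2)]] Dx_of_add[OF cx(4)[OF Dx_of_conj[OF k5 q(1) q(2)]]
    Dx_of_add[OF cx(4)[OF Dx_of_conj[OF k6 p(1) p(1)]] cx(4)[OF Dx_of_conj[OF k6 q(1) q(1)]]]]]]]]]]]]]]]
  note ct = Dt_of_cmult[of _ _ "- 1"] Dt_of_cmult[of _ _ a] Dt_of_cmult[of _ _ "- a"] Dt_of_cmult[of _ _ "- 2 * b"] Dt_of_cmult[of _ _ "2 * b"]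
  note Y = Dt_of_add[OF ct(1)[OF Dt_of_conj[OF l1 p(3) p(3)]] Dt_of_add[OF ct(1)[OF Dt_of_conj[OF l1 q(3) q(3)]]
    Dt_of_add[OF ct(2)[OF Dt_of_conj[OF k3(1,2,4) p(5) p(5)]] Dt_of_add[OF ct(2)[OF Dt_of_conj[OF k3(1,2,4) q(5) q(5)]]
    Dt_of_add[OF ct(3)[OF Dt_of_conj[OF l3 p(3) p(3)]] Dt_of_add[OF ct(3)[OF Dt_of_conj[OF l3 q(3) q(3)]]
    Dt_of_add[OF ct(4)[OF Dt_of_conj[OF l2 p(3) q(5)]] ct(5)[OF Dt_of_conj[OF l2 q(3) p(5)]]]]]]]]]
  note Xn = Dx_of_cmult[OF X, of "- 1"] and Yn = Dt_of_cmult[OF Y, of "- 1"]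
  have "a\<^sup>2 \<le> 1" "b\<^sup>2 \<le> 1" using ab(1) zero_le_power2[of a] zero_le_power2[of b] by linarith+
  then have a1: "a \<le> 1" and b1: "\<bar>b\<bar> \<le> 1" by (auto simp: abs_square_le_1 dest: abs_le_D1)
  have "I (\<lambda>t x. \<mu> * c\<^sup>2 / 2 * (g x ^ 0 * W 2 t x * (P1 t x)\<^sup>2 + (g x ^ 0 * W 2 t x * (Q1 t x)\<^sup>2
        + (g x ^ 0 * W 4 t x * (p t x)\<^sup>2 + g x ^ 0 * W 4 t x * (q t x)\<^sup>2))))
    \<le> I (\<lambda>t x. (f t x)\<^sup>2 + 4 * \<mu> * K\<^sup>2 * (g x ^ 8 * W 2 t x * (P1 t x)\<^sup>2 + (g x ^ 8 * W 2 t x * (Q1 t x)\<^sup>2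
        + (g x ^ 8 * W 4 t x * (p t x)\<^sup>2 + g x ^ 8 * W 4 t x * (q t x)\<^sup>2))))"
  proof (rule I_le_Dx_Dt[OF _ _ Xn Yn])
    fix t x assume t: "t \<in> {0<..<T}"
    note id = conjugated_commutator_identity[OF ab(1), where tt = "\<theta>t t x" and th = "\<theta>x t x" and H = "\<theta>xx t x"
      and Hx = "\<theta>xxx t x" and ttt = "\<theta>tt t x" and xt = "\<theta>xt t x" and p = "p t x" and ?P1.0 = "P1 t x" and ?P2.0 = "P2 t x"
      and Pt = "Pt t x" and P1t = "P1t t x" and q = "q t x" and ?Q1.0 = "Q1 t x" and ?Q2.0 = "Q2 t x" and Qt = "Qt t x" and Q1t = "Q1t t x"]
    \<comment> \<open>Drops the squares of both parts. m1, m2 are their real and n1, n2 their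
      imaginary components; the latter sum to zero, so n1 n2 \<le> 0.\<close>
    have sq: "2 * (m1 * m2 + n1 * n2) \<le> (m1 + m2)\<^sup>2" if "0 = n1 + n2" for m1 m2 n1 n2 :: real
    proof -
      have "n2 = - n1" using that by simp
      then show ?thesis by (simp add: power2_eq_square algebra_simps)
    qed
    have fin: "m \<le> F + l + - 1 * SX + - 1 * SY" if "m \<le> G + l" "G + SX + SY \<le> F" for m l F G SX SY :: real
      using that by simp
    note le = sq[OF eq2[OF t, of x]]
    note le' = le[where ?m1.0 = "(- \<theta>t t x * p t x - a * (P2 t x + (\<theta>x t x)\<^sup>2 * p t x) - b * (2 * \<theta>x t x * Q1 t x + \<theta>xx t x * q t x))"
      and ?m2.0 = "(Pt t x + b * (Q2 t x + (\<theta>x t x)\<^sup>2 * q t x) + a * (2 * \<theta>x t x * P1 t x + \<theta>xx t x * p t x))",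
      folded eq1[OF t, of x], unfolded id]
    note co = carleman_form_coercive[OF t ab(2) a1 b1 \<mu>_large \<epsilon>_small, of x "P1 t x" "Q1 t x" "p t x" "q t x"]
    show "\<mu> * c\<^sup>2 / 2 * (g x ^ 0 * W 2 t x * (P1 t x)\<^sup>2 + (g x ^ 0 * W 2 t x * (Q1 t x)\<^sup>2
        + (g x ^ 0 * W 4 t x * (p t x)\<^sup>2 + g x ^ 0 * W 4 t x * (q t x)\<^sup>2)))
      \<le> (f t x)\<^sup>2 + 4 * \<mu> * K\<^sup>2 * (g x ^ 8 * W 2 t x * (P1 t x)\<^sup>2 + (g x ^ 8 * W 2 t x * (Q1 t x)\<^sup>2
        + (g x ^ 8 * W 4 t x * (p t x)\<^sup>2 + g x ^ 8 * W 4 t x * (q t x)\<^sup>2)))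
      + - 1 * (2 * b * (\<theta>xt t x * q t x * P1 t x + \<theta>t t x * Q1 t x * P1 t x + \<theta>t t x * q t x * P2 t x)
        + (- 2 * b * (\<theta>xt t x * p t x * Q1 t x + \<theta>t t x * P1 t x * Q1 t x + \<theta>t t x * p t x * Q2 t x)
        + (- 2 * a * ((\<theta>xt t x * \<theta>x t x + \<theta>t t x * \<theta>xx t x) * p t x * p t x + \<theta>t t x * \<theta>x t x * P1 t x * p t x + \<theta>t t x * \<theta>x t x * p t x * P1 t x)
        + (- 2 * a * ((\<theta>xt t x * \<theta>x t x + \<theta>t t x * \<theta>xx t x) * q t x * q t x + \<theta>t t x * \<theta>x t x * Q1 t x * q t x + \<theta>t t x * \<theta>x t x * q t x * Q1 t x)
        + (- 2 * a * (0 * P1 t x * Pt t x + 1 * P2 t x * Pt t x + 1 * P1 t x * P1t t x)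
        + (- 2 * a * (0 * Q1 t x * Qt t x + 1 * Q2 t x * Qt t x + 1 * Q1 t x * Q1t t x)
        + (2 * b * (\<theta>xx t x * p t x * Qt t x + \<theta>x t x * P1 t x * Qt t x + \<theta>x t x * p t x * Q1t t x)
        + (- 2 * b * (\<theta>xx t x * q t x * Pt t x + \<theta>x t x * Q1 t x * Pt t x + \<theta>x t x * q t x * P1t t x)
        + (- 2 * (\<theta>xx t x * P1 t x * P1 t x + \<theta>x t x * P2 t x * P1 t x + \<theta>x t x * P1 t x * P2 t x)
        + (- 2 * (\<theta>xx t x * Q1 t x * Q1 t x + \<theta>x t x * Q2 t x * Q1 t x + \<theta>x t x * Q1 t x * Q2 t x)
        + (- 2 * (\<theta>xxx t x * p t x * P1 t x + \<theta>xx t x * P1 t x * P1 t x + \<theta>xx t x * p t x * P2 t x)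
        + (- 2 * (\<theta>xxx t x * q t x * Q1 t x + \<theta>xx t x * Q1 t x * Q1 t x + \<theta>xx t x * q t x * Q2 t x)
        + (- 2 * (3 * (\<theta>x t x)\<^sup>2 * \<theta>xx t x * p t x * p t x + \<theta>x t x ^ 3 * P1 t x * p t x + \<theta>x t x ^ 3 * p t x * P1 t x)
        + - 2 * (3 * (\<theta>x t x)\<^sup>2 * \<theta>xx t x * q t x * q t x + \<theta>x t x ^ 3 * Q1 t x * q t x + \<theta>x t x ^ 3 * q t x * Q1 t x))))))))))))))
      + - 1 * (- 1 * (\<theta>tt t x * p t x * p t x + \<theta>t t x * Pt t x * p t x + \<theta>t t x * p t x * Pt t x)
        + (- 1 * (\<theta>tt t x * q t x * q t x + \<theta>t t x * Qt t x * q t x + \<theta>t t x * q t x * Qt t x)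
        + (a * (0 * P1 t x * P1 t x + 1 * P1t t x * P1 t x + 1 * P1 t x * P1t t x)
        + (a * (0 * Q1 t x * Q1 t x + 1 * Q1t t x * Q1 t x + 1 * Q1 t x * Q1t t x)
        + (- a * (2 * \<theta>x t x * \<theta>xt t x * p t x * p t x + (\<theta>x t x)\<^sup>2 * Pt t x * p t x + (\<theta>x t x)\<^sup>2 * p t x * Pt t x)
        + (- a * (2 * \<theta>x t x * \<theta>xt t x * q t x * q t x + (\<theta>x t x)\<^sup>2 * Qt t x * q t x + (\<theta>x t x)\<^sup>2 * q t x * Qt t x)
        + (- 2 * b * (\<theta>xt t x * p t x * Q1 t x + \<theta>x t x * Pt t x * Q1 t x + \<theta>x t x * p t x * Q1t t x)
        + 2 * b * (\<theta>xt t x * q t x * P1 t x + \<theta>x t x * Qt t x * P1 t x + \<theta>x t x * q t x * P1t t x))))))))"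
      by (rule fin[OF _ le']) (use co in \<open>simp add: carleman_form_def W_2_4[OF t] algebra_simps\<close>)
  qed (intro tempered_all tp f)+
  also have "\<dots> = I (\<lambda>t x. (f t x)\<^sup>2) + 4 * \<mu> * K\<^sup>2 * (N 2 8 P1 + (N 2 8 Q1 + (N 4 8 p + N 4 8 q)))"
    unfolding N_def by (simp only: I_cmult I_add tempered_intros N_integrand_tempered tp f)
  also have "I (\<lambda>t x. \<mu> * c\<^sup>2 / 2 * (g x ^ 0 * W 2 t x * (P1 t x)\<^sup>2 + (g x ^ 0 * W 2 t x * (Q1 t x)\<^sup>2
        + (g x ^ 0 * W 4 t x * (p t x)\<^sup>2 + g x ^ 0 * W 4 t x * (q t x)\<^sup>2)))) = \<mu> * c\<^sup>2 / 2 * (N 2 0 P1 + (N 2 0 Q1 + (N 4 0 p + N 4 0 q)))"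
    unfolding N_def by (simp only: I_cmult I_add tempered_intros N_integrand_tempered tp f)
  finally have "\<mu> * (c\<^sup>2 / 2 * (N 2 0 P1 + N 2 0 Q1 + N 4 0 p + N 4 0 q)) \<le> I (\<lambda>t x. (f t x)\<^sup>2)
     + \<mu> * (4 * K\<^sup>2 * (N 2 8 P1 + N 2 8 Q1 + N 4 8 p + N 4 8 q))" by (simp add: algebra_simps)
  then show ?thesis using \<mu> by (simp add: field_simps)
qed

end

context carleman_weight begin

section \<open>From the conjugated function back to the unknown\<close>

lemma N_le_2:
  assumes t: "tempered T u" "tempered T v1" "tempered T v2"
    and le: "\<And>t x. t \<in> {0<..<T} \<Longrightarrow> (u t x)\<^sup>2 \<le> a1 * (v1 t x)\<^sup>2 + a2 * (\<Lambda> t x ^ k * (v2 t x)\<^sup>2)"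
  shows "N m n u \<le> a1 * N m n v1 + a2 * N (m + k) n v2"
proof -
  have "N m n u \<le> I (\<lambda>t x. a1 * (g x ^ n * W m t x * (v1 t x)\<^sup>2) + a2 * (g x ^ n * W (m + k) t x * (v2 t x)\<^sup>2))"
    unfolding N_def
  proof (rule I_mono)
    fix t x assume t': "t \<in> {0<..<T}"
    have "(g x ^ n * W m t x) * (u t x)\<^sup>2 \<le> (g x ^ n * W m t x) * (a1 * (v1 t x)\<^sup>2 + a2 * (\<Lambda> t x ^ k * (v2 t x)\<^sup>2))"
      using le[OF t'] g(1)[of x] W_bounds(1)[OF t', of m x] by (intro mult_left_mono) auto
    then show "g x ^ n * W m t x * (u t x)\<^sup>2
      \<le> a1 * (g x ^ n * W m t x * (v1 t x)\<^sup>2) + a2 * (g x ^ n * W (m + k) t x * (v2 t x)\<^sup>2)"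
      by (simp add: W_def power_add algebra_simps)
  qed (intro tempered_all t)+
  also have "\<dots> = a1 * N m n v1 + a2 * N (m + k) n v2"
    unfolding N_def by (simp only: I_cmult I_add tempered_intros N_integrand_tempered t)
  finally show ?thesis .
qed

lemma N_le_3:
  assumes t: "tempered T u" "tempered T v1" "tempered T v2" "tempered T v3"
    and le: "\<And>t x. t \<in> {0<..<T} \<Longrightarrow> (u t x)\<^sup>2 \<le> a1 * (v1 t x)\<^sup>2 + a2 * (v2 t x)\<^sup>2 + a3 * (v3 t x)\<^sup>2"
  shows "N m n u \<le> a1 * N m n v1 + a2 * N m n v2 + a3 * N m n v3"
proof -
  have "N m n u \<le> I (\<lambda>t x. a1 * (g x ^ n * W m t x * (v1 t x)\<^sup>2) + a2 * (g x ^ n * W m t x * (v2 t x)\<^sup>2)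
     + a3 * (g x ^ n * W m t x * (v3 t x)\<^sup>2))"
    unfolding N_def
  proof (rule I_mono)
    fix t x assume t': "t \<in> {0<..<T}"
    have "(g x ^ n * W m t x) * (u t x)\<^sup>2 \<le> (g x ^ n * W m t x) * (a1 * (v1 t x)\<^sup>2 + a2 * (v2 t x)\<^sup>2 + a3 * (v3 t x)\<^sup>2)"
      using le[OF t'] g(1)[of x] W_bounds(1)[OF t', of m x] by (intro mult_left_mono) auto
    then show "g x ^ n * W m t x * (u t x)\<^sup>2 \<le> a1 * (g x ^ n * W m t x * (v1 t x)\<^sup>2)
      + a2 * (g x ^ n * W m t x * (v2 t x)\<^sup>2) + a3 * (g x ^ n * W m t x * (v3 t x)\<^sup>2)"
      by (simp add: algebra_simps)
  qed (intro tempered_all t)+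
  also have "\<dots> = a1 * N m n v1 + a2 * N m n v2 + a3 * N m n v3"
    unfolding N_def by (simp only: I_cmult I_add tempered_intros N_integrand_tempered t)
  finally show ?thesis .
qed

lemma N_0_le: assumes f: "tempered T f" shows "N 0 0 f \<le> I (\<lambda>t x. (f t x)\<^sup>2) / \<mu>"
proof -
  have "N 0 0 f \<le> I (\<lambda>t x. 1 / \<mu> * (f t x)\<^sup>2)"
    unfolding N_def
  proof (rule I_mono)
    fix t x assume t: "t \<in> {0<..<T}"
    have "W 0 t x \<le> 1 / \<mu>" using \<Lambda>_bounds[OF t, of x] \<mu> by (simp add: W_def frac_le)
    then show "g x ^ 0 * W 0 t x * (f t x)\<^sup>2 \<le> 1 / \<mu> * (f t x)\<^sup>2"
      using mult_right_mono[of "W 0 t x" "1 / \<mu>" "(f t x)\<^sup>2"] by simp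
  qed (intro tempered_all f)+
  then show ?thesis by (simp only: I_cmult) simp
qed

text \<open>Derivatives of \<open>exp \<theta> * p\<close> with the exponential divided out. The
  mixed derivative is the same expression whichever variable comes first, as the commutator identity
  requires of its P1t.\<close>

lemma conj_lifts:
  assumes p: "tempered T p" "tempered T px" "tempered T pxx" "tempered T pt" "tempered T pxt"
    "has_dx T p px" "has_dx T px pxx" "has_dx T pt pxt" "has_dt T p pt" "has_dt T px pxt"
  shows "conj_dx p (\<lambda>t x. px t x + \<theta>x t x * p t x)"
    "conj_dx (\<lambda>t x. px t x + \<theta>x t x * p t x) (\<lambda>t x. pxx t x + 2 * \<theta>x t x * px t x + ((\<theta>x t x)\<^sup>2 + \<theta>xx t x) * p t x)"
    "conj_dt p (\<lambda>t x. pt t x + \<theta>t t x * p t x)"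
    "conj_dx (\<lambda>t x. pt t x + \<theta>t t x * p t x)
       (\<lambda>t x. pxt t x + \<theta>x t x * pt t x + \<theta>xt t x * p t x + \<theta>t t x * (px t x + \<theta>x t x * p t x))"
    "conj_dt (\<lambda>t x. px t x + \<theta>x t x * p t x)
       (\<lambda>t x. pxt t x + \<theta>x t x * pt t x + \<theta>xt t x * p t x + \<theta>t t x * (px t x + \<theta>x t x * p t x))"
proof -
  note ti = tempered_all tempered_\<theta> p
  show "conj_dx p (\<lambda>t x. px t x + \<theta>x t x * p t x)"
    unfolding conj_dx_def \<theta>x_def[symmetric] using p(6) by (intro conjI ti) simp
  show "conj_dx (\<lambda>t x. px t x + \<theta>x t x * p t x) (\<lambda>t x. pxx t x + 2 * \<theta>x t x * px t x + ((\<theta>x t x)\<^sup>2 + \<theta>xx t x) * p t x)"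
    unfolding conj_dx_def \<theta>x_def[symmetric]
    by (intro conjI ti has_dxI) (auto intro!: derivative_eq_intros has_dxD[OF p(6)] has_dxD[OF p(7)] has_dxD[OF \<theta>_derivs(1)]
      simp: algebra_simps power2_eq_square)
  show "conj_dt p (\<lambda>t x. pt t x + \<theta>t t x * p t x)"
    unfolding conj_dt_def using p(9) by (intro conjI ti) simp
  show "conj_dx (\<lambda>t x. pt t x + \<theta>t t x * p t x)
       (\<lambda>t x. pxt t x + \<theta>x t x * pt t x + \<theta>xt t x * p t x + \<theta>t t x * (px t x + \<theta>x t x * p t x))"
    unfolding conj_dx_def \<theta>x_def[symmetric]
    by (intro conjI ti has_dxI) (auto intro!: derivative_eq_intros has_dxD[OF p(6)] has_dxD[OF p(8)] has_dxD[OF \<theta>_derivs(3)]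
      simp: algebra_simps power2_eq_square)
  show "conj_dt (\<lambda>t x. px t x + \<theta>x t x * p t x)
       (\<lambda>t x. pxt t x + \<theta>x t x * pt t x + \<theta>xt t x * p t x + \<theta>t t x * (px t x + \<theta>x t x * p t x))"
    unfolding conj_dt_def
    by (intro conjI ti has_dtI) (auto intro!: derivative_eq_intros has_dtD[OF p(9)] has_dtD[OF p(10)] has_dtD[OF \<theta>_derivs(4)]
      simp: algebra_simps power2_eq_square)
qed

text \<open>The conjugated derivative px + \<theta>_x p and px itself differ by at most K \<Lambda>
  |p|, which the zero-order norm controls. The transfer costs a factor 3 K^2 on the left and another
  on the local terms.\<close>

lemma schroedinger_carleman:
  assumes ab: "a\<^sup>2 + b\<^sup>2 = 1" "0 \<le> a"
    and \<mu>_large: "16 * K ^ 3 \<le> \<mu> * c\<^sup>2" and \<epsilon>_small: "100 * K ^ 3 * \<epsilon> \<le> c\<^sup>2"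
    and p: "tempered T p" "tempered T px" "tempered T pxx" "tempered T pt" "tempered T pxt"
      "has_dx T p px" "has_dx T px pxx" "has_dx T pt pxt" "has_dt T p pt" "has_dt T px pxt"
    and q: "tempered T q" "tempered T qx" "tempered T qxx" "tempered T qt" "tempered T qxt"
      "has_dx T q qx" "has_dx T qx qxx" "has_dx T qt qxt" "has_dt T q qt" "has_dt T qx qxt"
    and f: "tempered T f"
    and eq1: "\<And>t x. t \<in> {0<..<T} \<Longrightarrow> f t x = pt t x - a * pxx t x + b * qxx t x"
    and eq2: "\<And>t x. t \<in> {0<..<T} \<Longrightarrow> 0 = qt t x - a * qxx t x - b * pxx t x"
  shows "N 2 0 px + N 2 0 qx + N 4 0 p + N 4 0 q \<le> 6 * K\<^sup>2 / c\<^sup>2 *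
     (I (\<lambda>t x. (f t x)\<^sup>2) / \<mu> + 12 * K ^ 4 * (N 2 8 px + N 2 8 qx + N 4 8 p + N 4 8 q))"
proof -
  define F where "F = I (\<lambda>t x. (f t x)\<^sup>2) / \<mu>"
  define P1 Q1 where "P1 = (\<lambda>t x. px t x + \<theta>x t x * p t x)" and "Q1 = (\<lambda>t x. qx t x + \<theta>x t x * q t x)"
  have tPQ: "tempered T P1" "tempered T Q1" unfolding P1_def Q1_def by (intro tempered_all tempered_\<theta> p q)+
  have main: "c\<^sup>2 / 2 * (N 2 0 P1 + N 2 0 Q1 + N 4 0 p + N 4 0 q) \<le>
     F + 4 * K\<^sup>2 * (N 2 8 P1 + N 2 8 Q1 + N 4 8 p + N 4 8 q)"
    unfolding P1_def Q1_def F_def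
  proof (rule conjugated_carleman[OF ab \<mu>_large \<epsilon>_small conj_lifts[OF p] conj_lifts[OF q] f], goal_cases)
    case (1 t x)
    show ?case unfolding eq1[OF 1] by (simp add: algebra_simps power2_eq_square)
  next
    case (2 t x)
    have "qt t x = a * qxx t x + b * pxx t x" using eq2[OF 2, of x] by simp
    then show ?case by (simp add: algebra_simps power2_eq_square)
  qed
  have K2: "1 \<le> K\<^sup>2" using K by simp
  have th: "(\<theta>x t x * y)\<^sup>2 \<le> K\<^sup>2 * (\<Lambda> t x ^ 2 * y\<^sup>2)" for t x y
  proof -
    have "(\<psi>1 x)\<^sup>2 \<le> K\<^sup>2" using bnd(1)[of x] K by (simp add: abs_le_square_iff[symmetric])
    then have "(\<psi>1 x)\<^sup>2 * (\<Lambda> t x ^ 2 * y\<^sup>2) \<le> K\<^sup>2 * (\<Lambda> t x ^ 2 * y\<^sup>2)" by (intro mult_right_mono) auto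
    then show ?thesis by (simp add: \<theta>x_def power_mult_distrib mult.assoc)
  qed
  have sq: "(u + v)\<^sup>2 \<le> 2 * u\<^sup>2 + 2 * v\<^sup>2" "u\<^sup>2 \<le> 2 * (u + v)\<^sup>2 + 2 * v\<^sup>2" for u v :: real
    using zero_le_power2[of "u - v"] zero_le_power2[of "u + 2 * v"] by (simp_all add: power2_eq_square algebra_simps)
  have c1: "N 2 n P1 \<le> 2 * N 2 n px + (2 * K\<^sup>2) * N (2 + 2) n p" for n
  proof (rule N_le_2[OF tPQ(1) p(2,1)])
    show "(P1 t x)\<^sup>2 \<le> 2 * (px t x)\<^sup>2 + 2 * K\<^sup>2 * (\<Lambda> t x ^ 2 * (p t x)\<^sup>2)" for t x
      using sq(1)[of "px t x" "\<theta>x t x * p t x"] th[of t x "p t x"] unfolding P1_def by linarith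
  qed
  have c2: "N 2 n Q1 \<le> 2 * N 2 n qx + (2 * K\<^sup>2) * N (2 + 2) n q" for n
  proof (rule N_le_2[OF tPQ(2) q(2,1)])
    show "(Q1 t x)\<^sup>2 \<le> 2 * (qx t x)\<^sup>2 + 2 * K\<^sup>2 * (\<Lambda> t x ^ 2 * (q t x)\<^sup>2)" for t x
      using sq(1)[of "qx t x" "\<theta>x t x * q t x"] th[of t x "q t x"] unfolding Q1_def by linarith
  qed
  have c3: "N 2 n px \<le> 2 * N 2 n P1 + (2 * K\<^sup>2) * N (2 + 2) n p" for n
  proof (rule N_le_2[OF p(2) tPQ(1) p(1)])
    show "(px t x)\<^sup>2 \<le> 2 * (P1 t x)\<^sup>2 + 2 * K\<^sup>2 * (\<Lambda> t x ^ 2 * (p t x)\<^sup>2)" for t x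
      using sq(2)[of "px t x" "\<theta>x t x * p t x"] th[of t x "p t x"] unfolding P1_def by linarith
  qed
  have c4: "N 2 n qx \<le> 2 * N 2 n Q1 + (2 * K\<^sup>2) * N (2 + 2) n q" for n
  proof (rule N_le_2[OF q(2) tPQ(2) q(1)])
    show "(qx t x)\<^sup>2 \<le> 2 * (Q1 t x)\<^sup>2 + 2 * K\<^sup>2 * (\<Lambda> t x ^ 2 * (q t x)\<^sup>2)" for t x
      using sq(2)[of "qx t x" "\<theta>x t x * q t x"] th[of t x "q t x"] unfolding Q1_def by linarith
  qed
  define S where "S = N 2 0 P1 + N 2 0 Q1 + N 4 0 p + N 4 0 q"
  define l where "l = N 2 8 px + N 2 8 qx + N 4 8 p + N 4 8 q"
  note nn = N_nonneg[OF p(1)] N_nonneg[OF q(1)] N_nonneg[OF tPQ(1)] N_nonneg[OF tPQ(2)] N_nonneg[OF p(2)] N_nonneg[OF q(2)]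
  have k3: "2 * y \<le> 3 * K\<^sup>2 * y" "y \<le> K\<^sup>2 * y" if "0 \<le> y" for y
    using mult_right_mono[OF K2 that] that by simp_all
  have s1: "N 2 0 px + N 2 0 qx + N 4 0 p + N 4 0 q \<le> 3 * K\<^sup>2 * S"
    using c3[of 0] c4[of 0] k3(1)[OF nn(3), of 2 0] k3(1)[OF nn(4), of 2 0] k3(2)[OF nn(1), of 4 0] k3(2)[OF nn(2), of 4 0]
    unfolding S_def by (simp add: algebra_simps)
  have s2: "N 2 8 P1 + N 2 8 Q1 + N 4 8 p + N 4 8 q \<le> 3 * K\<^sup>2 * l"
    using c1[of 8] c2[of 8] k3(1)[OF nn(5), of 2 8] k3(1)[OF nn(6), of 2 8] k3(2)[OF nn(1), of 4 8] k3(2)[OF nn(2), of 4 8]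
    unfolding l_def by (simp add: algebra_simps)
  have "c\<^sup>2 / 2 * S \<le> F + 4 * K\<^sup>2 * (3 * K\<^sup>2 * l)"
    using order_trans[OF main add_left_mono[OF mult_left_mono[OF s2, of "4 * K\<^sup>2"]]] K unfolding S_def by simp
  then have "S \<le> 2 / c\<^sup>2 * (F + 12 * K ^ 4 * l)"
    using c by (simp add: field_simps power2_eq_square power4_eq_xxxx)
  then have "3 * K\<^sup>2 * S \<le> 3 * K\<^sup>2 * (2 / c\<^sup>2 * (F + 12 * K ^ 4 * l))"
    using K by (intro mult_left_mono) auto
  also have "\<dots> = 6 * K\<^sup>2 / c\<^sup>2 * (F + 12 * K ^ 4 * l)" by simp
  finally show ?thesis using s1 unfolding l_def F_def by linarith
qed

text \<open>The equation is tested with a \<rho> times the second x-derivative. The terms with b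
  cancel between real and imaginary part, so only the parabolic part a survives, while p_t p_xx is,
  up to commutators, minus half the time derivative of (p_x)^2. The factor a in the multiplier makes
  Young's inequality for f p_xx uniform as a tends to 0; hence a^2 on the left.\<close>

lemma energy_estimate:
  assumes ab: "a\<^sup>2 + b\<^sup>2 = 1" "0 \<le> a"
    and p: "tempered T p" "tempered T px" "tempered T pxx" "tempered T pt" "tempered T pxt"
      "has_dx T p px" "has_dx T px pxx" "has_dx T pt pxt" "has_dt T p pt" "has_dt T px pxt"
    and q: "tempered T q" "tempered T qx" "tempered T qxx" "tempered T qt" "tempered T qxt"
      "has_dx T q qx" "has_dx T qx qxx" "has_dx T qt qxt" "has_dt T q qt" "has_dt T qx qxt"
    and f: "tempered T f"
    and eq1: "\<And>t x. t \<in> {0<..<T} \<Longrightarrow> f t x = pt t x - a * pxx t x + b * qxx t x"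
    and eq2: "\<And>t x. t \<in> {0<..<T} \<Longrightarrow> 0 = qt t x - a * qxx t x - b * pxx t x"
  shows "a\<^sup>2 * (N 0 0 pxx + N 0 0 qxx) \<le> 10 * N 0 0 f + 152 * K\<^sup>2 * (N 2 0 px + N 2 0 qx)"
proof -
  note X = Dx_of_add[OF Dx_of_cmult[OF Dx_of_mult[OF Dx_of_mult[OF Dx_of_\<rho> p(4,5,8)] p(2,3,7)], of a]
    Dx_of_cmult[OF Dx_of_mult[OF Dx_of_mult[OF Dx_of_\<rho> q(4,5,8)] q(2,3,7)], of a]]
  note Y = Dt_of_add[OF Dt_of_cmult[OF Dt_of_mult[OF Dt_of_mult[OF Dt_of_\<rho> p(2,5,10)] p(2,5,10)], of "- a / 2"]
    Dt_of_cmult[OF Dt_of_mult[OF Dt_of_mult[OF Dt_of_\<rho> q(2,5,10)] q(2,5,10)], of "- a / 2"]]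
  have "a\<^sup>2 \<le> 1" "b\<^sup>2 \<le> 1" using ab(1) zero_le_power2[of a] zero_le_power2[of b] by linarith+
  then have a1: "a \<le> 1" and b1: "\<bar>b\<bar> \<le> 1" by (auto simp: abs_square_le_1 dest: abs_le_D1)
  have K2: "1 \<le> K\<^sup>2" using K by simp
  have "I (\<lambda>t x. a\<^sup>2 / 2 * (g x ^ 0 * W 0 t x * (pxx t x)\<^sup>2) + a\<^sup>2 / 2 * (g x ^ 0 * W 0 t x * (qxx t x)\<^sup>2))
    \<le> I (\<lambda>t x. 5 * (g x ^ 0 * W 0 t x * (f t x)\<^sup>2) + (76 * K\<^sup>2 * (g x ^ 0 * W 2 t x * (px t x)\<^sup>2)
       + 76 * K\<^sup>2 * (g x ^ 0 * W 2 t x * (qx t x)\<^sup>2)))"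
  proof (rule I_le_Dx_Dt[OF _ _ X Y])
    fix t x assume t: "t \<in> {0<..<T}"
    define L R where "L = \<Lambda> t x" and "R = \<rho> t x"
    have L: "0 < L" "1 \<le> L" and R: "0 < R" "R * L = 1"
      using \<Lambda>_bounds[OF t, of x] \<rho>_bounds[OF t, of x] by (auto simp: L_def R_def)
    have W: "W 0 t x = R" "W 2 t x = R * L\<^sup>2" by (auto simp: W_eq L_def R_def)
    define x1 x4 where "x1 = \<rho>x t x" and "x4 = \<rho>t t x / L"
    have RR: "\<rho>x t x = R * L * x1" "\<rho>t t x = R * L\<^sup>2 * x4"
      using R L by (auto simp: x1_def x4_def power2_eq_square field_simps)
    have b: "\<bar>x1\<bar> \<le> 3 * K" using \<rho>x_bound[OF t, of x] by (simp add: x1_def)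
    have b4: "\<bar>x4\<bar> * \<beta> \<le> 3 * \<epsilon>" using \<rho>t_bound[OF t, of x] L by (simp add: x4_def L_def field_simps)
    have b4': "\<bar>x4\<bar> \<le> 3" using b4 \<epsilon> mult_left_mono[OF \<beta>, of "\<bar>x4\<bar>"] by simp
    define A B F PX QX where "A = pxx t x" and "B = qxx t x" and "F = f t x" and "PX = L * px t x" and "QX = L * qx t x"
    \<comment> \<open>The equations eliminate the time derivatives; b enters them with opposite
      signs.\<close>
    have pt: "pt t x = F + a * A - b * B" and qt: "qt t x = a * B + b * A"
      using eq1[OF t, of x] eq2[OF t, of x] by (auto simp: A_def B_def F_def)
    have prod: "\<bar>y * (u * v)\<bar> \<le> d * u\<^sup>2 + M\<^sup>2 * v\<^sup>2 / (4 * d)" if "\<bar>y\<bar> \<le> M" "d > 0" for y M u v d :: real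
    proof -
      have "\<bar>y * (u * v)\<bar> \<le> M * \<bar>u * v\<bar>" unfolding abs_mult[of y] using that by (intro mult_right_mono) auto
      also have "\<dots> = \<bar>u * (M * v)\<bar>" using that by (simp add: abs_mult)
      also have "\<dots> \<le> d * u\<^sup>2 + (M * v)\<^sup>2 / (4 * d)" by (rule young[OF that(2)])
      finally show ?thesis by (simp add: power_mult_distrib)
    qed
    have bb: "\<bar>x1 * y\<bar> \<le> 3 * K" if "\<bar>y\<bar> \<le> 1" for y
      using mult_mono[OF b that] K by (simp add: abs_mult)
    have t1: "\<bar>(x1 * a) * (F * PX)\<bar> \<le> 1 * F\<^sup>2 + (3 * K)\<^sup>2 * PX\<^sup>2 / (4 * 1)" by (rule prod) (use bb a1 ab in auto)
    have t2: "\<bar>(x1 * a) * ((a * A) * PX)\<bar> \<le> (1/16) * (a * A)\<^sup>2 + (3 * K)\<^sup>2 * PX\<^sup>2 / (4 * (1/16))" by (rule prod) (use bb a1 ab in auto)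
    have t3: "\<bar>(x1 * b) * ((a * B) * PX)\<bar> \<le> (1/16) * (a * B)\<^sup>2 + (3 * K)\<^sup>2 * PX\<^sup>2 / (4 * (1/16))" by (rule prod) (use bb b1 in auto)
    have t4: "\<bar>(x1 * a) * ((a * B) * QX)\<bar> \<le> (1/16) * (a * B)\<^sup>2 + (3 * K)\<^sup>2 * QX\<^sup>2 / (4 * (1/16))" by (rule prod) (use bb a1 ab in auto)
    have t5: "\<bar>(x1 * b) * ((a * A) * QX)\<bar> \<le> (1/16) * (a * A)\<^sup>2 + (3 * K)\<^sup>2 * QX\<^sup>2 / (4 * (1/16))" by (rule prod) (use bb b1 in auto)
    have t6: "\<bar>1 * ((a * A) * F)\<bar> \<le> (1/16) * (a * A)\<^sup>2 + 1\<^sup>2 * F\<^sup>2 / (4 * (1/16))" by (rule prod) auto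
    have ax4: "a * x4 / 2 \<le> 3 / 2"
    proof -
      have "\<bar>a * x4\<bar> \<le> 1 * 3" unfolding abs_mult using a1 ab b4' by (intro mult_mono) auto
      then show ?thesis by linarith
    qed
    have t7: "a * x4 / 2 * (PX\<^sup>2 + QX\<^sup>2) \<le> 3 / 2 * (PX\<^sup>2 + QX\<^sup>2)" using ax4 by (intro mult_right_mono) auto
    have kp: "PX\<^sup>2 \<le> K\<^sup>2 * PX\<^sup>2" "QX\<^sup>2 \<le> K\<^sup>2 * QX\<^sup>2" using mult_right_mono[OF K2, of "PX\<^sup>2"] mult_right_mono[OF K2, of "QX\<^sup>2"] by auto
    have aux: "(aA + aB) / 2 \<le> 5 * F2 + (76 * KP + 76 * KQ) + (aA + aB) + T1 + T2 - T3 + T4 + T5 + T6 - T7"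
      if "- T1 \<le> F2 + 9 * KP / 4" "- T2 \<le> aA / 16 + 36 * KP" "T3 \<le> aB / 16 + 36 * KP" "- T4 \<le> aB / 16 + 36 * KQ"
        "- T5 \<le> aA / 16 + 36 * KQ" "- T6 \<le> aA / 16 + 4 * F2" "T7 \<le> 3 / 2 * (P2 + Q2)" "P2 \<le> KP" "Q2 \<le> KQ"
        "0 \<le> aA" "0 \<le> aB" "0 \<le> KP" "0 \<le> KQ"
      for aA aB F2 KP KQ P2 Q2 T1 T2 T3 T4 T5 T6 T7 :: real
      using that by argo
    have "((a * A)\<^sup>2 + (a * B)\<^sup>2) / 2 \<le> 5 * F\<^sup>2 + (76 * (K\<^sup>2 * PX\<^sup>2) + 76 * (K\<^sup>2 * QX\<^sup>2)) + ((a * A)\<^sup>2 + (a * B)\<^sup>2)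
       + (x1 * a) * (F * PX) + (x1 * a) * ((a * A) * PX) - (x1 * b) * ((a * B) * PX) + (x1 * a) * ((a * B) * QX)
       + (x1 * b) * ((a * A) * QX) + 1 * ((a * A) * F) - a * x4 / 2 * (PX\<^sup>2 + QX\<^sup>2)"
      by (rule aux) (use abs_le_D2[OF t1] abs_le_D2[OF t2] abs_le_D1[OF t3] abs_le_D2[OF t4] abs_le_D2[OF t5] abs_le_D2[OF t6] t7 kp
        in \<open>simp_all add: power_mult_distrib\<close>)
    then have "R * (((a * A)\<^sup>2 + (a * B)\<^sup>2) / 2) \<le> R * (5 * F\<^sup>2 + (76 * (K\<^sup>2 * PX\<^sup>2) + 76 * (K\<^sup>2 * QX\<^sup>2)) + ((a * A)\<^sup>2 + (a * B)\<^sup>2)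
       + (x1 * a) * (F * PX) + (x1 * a) * ((a * A) * PX) - (x1 * b) * ((a * B) * PX) + (x1 * a) * ((a * B) * QX)
       + (x1 * b) * ((a * A) * QX) + 1 * ((a * A) * F) - a * x4 / 2 * (PX\<^sup>2 + QX\<^sup>2))"
      using R by (intro mult_left_mono) auto
    then show "a\<^sup>2 / 2 * (g x ^ 0 * W 0 t x * (pxx t x)\<^sup>2) + a\<^sup>2 / 2 * (g x ^ 0 * W 0 t x * (qxx t x)\<^sup>2)
      \<le> 5 * (g x ^ 0 * W 0 t x * (f t x)\<^sup>2) + (76 * K\<^sup>2 * (g x ^ 0 * W 2 t x * (px t x)\<^sup>2)
       + 76 * K\<^sup>2 * (g x ^ 0 * W 2 t x * (qx t x)\<^sup>2))
       + (a * ((\<rho>x t x * pt t x + \<rho> t x * pxt t x) * px t x + \<rho> t x * pt t x * pxx t x)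
         + a * ((\<rho>x t x * qt t x + \<rho> t x * qxt t x) * qx t x + \<rho> t x * qt t x * qxx t x))
       + (- a / 2 * ((\<rho>t t x * px t x + \<rho> t x * pxt t x) * px t x + \<rho> t x * px t x * pxt t x)
         + - a / 2 * ((\<rho>t t x * qx t x + \<rho> t x * qxt t x) * qx t x + \<rho> t x * qx t x * qxt t x))"
      unfolding W RR pt qt PX_def QX_def R_def[symmetric] A_def[symmetric] B_def[symmetric] F_def[symmetric]
      by (simp add: algebra_simps add_divide_distrib power2_eq_square)
  qed (intro tempered_all p q f)+
  also have "\<dots> = 5 * N 0 0 f + (76 * K\<^sup>2 * N 2 0 px + 76 * K\<^sup>2 * N 2 0 qx)"
    unfolding N_def by (simp only: I_cmult I_add tempered_intros N_integrand_tempered p q f)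
  also have "I (\<lambda>t x. a\<^sup>2 / 2 * (g x ^ 0 * W 0 t x * (pxx t x)\<^sup>2) + a\<^sup>2 / 2 * (g x ^ 0 * W 0 t x * (qxx t x)\<^sup>2))
     = a\<^sup>2 / 2 * N 0 0 pxx + a\<^sup>2 / 2 * N 0 0 qxx"
    unfolding N_def by (simp only: I_cmult I_add tempered_intros N_integrand_tempered p q f)
  finally show ?thesis by (simp add: algebra_simps)
qed

end

subsection \<open>Absorption\<close>

text \<open>A stands for the norm of \<eta>_xxxx, B3 to B0 for the norms of \<eta>_xxx down to
  \<eta>, l3 to l0 for their local versions with g^8, a2 and a1 for the local norms of \<eta>_xx
  with g^6 and \<eta>_x with g^4, and L for that of \<eta> with g^2. The elliptic estimates descend
  from A, and interpolation eliminates the local terms on the way. As a statement about reals it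
  yields a constant depending on E and M alone.\<close>

lemma absorb_elliptic:
  fixes E M :: real
  assumes "E \<ge> 1" "M \<ge> 1"
  obtains C where "C \<ge> 1" "\<And>A B3 B2 B1 B0 l3 l2 l1 l0 a2 a1 L.
    \<lbrakk>0 \<le> A; 0 \<le> B3; 0 \<le> B2; 0 \<le> B1; 0 \<le> B0; 0 \<le> a2; 0 \<le> a1; 0 \<le> L;
     B3 \<le> E * (A + l3); B2 \<le> E * (B3 + l2); B1 \<le> E * (B2 + l1); B0 \<le> E * (B1 + l0);
     \<And>d. d > 0 \<Longrightarrow> l3 \<le> d * A + (1 / d + M) * a2; \<And>d. d > 0 \<Longrightarrow> a2 \<le> d * B3 + (1 / d + M) * a1;
     \<And>d. d > 0 \<Longrightarrow> a1 \<le> d * B2 + (1 / d + M) * L; l2 \<le> a2; l1 \<le> a1; l0 \<le> L\<rbrakk>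
    \<Longrightarrow> B3 + B2 + B1 + B0 \<le> C * (A + L)"
proof -
  define k1 where "k1 = 2 + 146 * E ^ 3 * M\<^sup>2"
  define k2 where "k2 = 1 + 12 * E * M * k1"
  define k3 where "k3 = E * (2 + 2 * M * k2)"
  define k4 where "k4 = E * (k3 + k2)"
  define k5 where "k5 = E * (k4 + k1)"
  define k6 where "k6 = E * (k5 + 1)"
  define C where "C = k3 + k4 + k5 + k6"
  have E0: "0 \<le> E" "0 \<le> M" using assms by auto
  have EM: "1 \<le> E * M" "1 \<le> E ^ 3" "1 \<le> M\<^sup>2" "M \<le> M\<^sup>2" "E ^ 2 \<le> E ^ 3" "E \<le> E ^ 2"
    using assms mult_mono[of 1 E 1 M] power_increasing[of 1 2 M] power_increasing[of 2 3 E] power_increasing[of 1 2 E] by auto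
  have EM3: "M \<le> E ^ 3 * M\<^sup>2" using mult_mono[of 1 "E ^ 3" M "M\<^sup>2"] EM assms by simp
  have k: "0 \<le> k1" "0 \<le> k2" "0 \<le> k3" "0 \<le> k4" "0 \<le> k5" "0 \<le> k6"
    unfolding k1_def k2_def k3_def k4_def k5_def k6_def using E0 by (auto intro!: add_nonneg_nonneg mult_nonneg_nonneg)
  have C1: "C \<ge> 1"
  proof -
    have "1 \<le> E * (k5 + 1)" using mult_mono[of 1 E 1 "k5 + 1"] assms k by simp
    then show ?thesis using k unfolding C_def k6_def by simp
  qed
  show ?thesis
  proof (rule that[OF C1])
    fix A B3 B2 B1 B0 l3 l2 l1 l0 a2 a1 L :: real
    assume nn: "0 \<le> A" "0 \<le> B3" "0 \<le> B2" "0 \<le> B1" "0 \<le> B0" "0 \<le> a2" "0 \<le> a1" "0 \<le> L"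
      and e: "B3 \<le> E * (A + l3)" "B2 \<le> E * (B3 + l2)" "B1 \<le> E * (B2 + l1)" "B0 \<le> E * (B1 + l0)"
      and i3: "\<And>d. d > 0 \<Longrightarrow> l3 \<le> d * A + (1 / d + M) * a2"
      and i2: "\<And>d. d > 0 \<Longrightarrow> a2 \<le> d * B3 + (1 / d + M) * a1"
      and i1: "\<And>d. d > 0 \<Longrightarrow> a1 \<le> d * B2 + (1 / d + M) * L"
      and l: "l2 \<le> a2" "l1 \<le> a1" "l0 \<le> L"
    have l3: "l3 \<le> A + 2 * M * a2"
    proof -
      have "(1 + M) * a2 \<le> (2 * M) * a2" using assms nn by (intro mult_right_mono) auto
      then show ?thesis using i3[of 1] by simp
    qed
    have B3: "B3 \<le> E * (2 * A + 2 * M * a2)"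
      using order_trans[OF e(1) mult_left_mono[of "A + l3" "2 * A + 2 * M * a2" E]] l3 E0 by simp
    have a2: "a2 \<le> A + 12 * E * M * a1"
    proof -
      \<comment> \<open>d = 1 / (8 E M) makes the multiple of a2 that returns through B3 equal to a2
        / 4.\<close>
      have "a2 \<le> 1 / (8 * E * M) * B3 + (8 * E * M + M) * a1" using i2[of "1 / (8 * E * M)"] assms by simp
      moreover have "1 / (8 * E * M) * B3 \<le> 1 / (8 * E * M) * (E * (2 * A + 2 * M * a2))"
        using B3 E0 by (intro mult_left_mono) auto
      moreover have "1 / (8 * E * M) * (E * (2 * A + 2 * M * a2)) \<le> A / 4 + a2 / 4"
      proof -
        have "1 / (8 * E * M) * (E * (2 * A + 2 * M * a2)) = (A / M) / 4 + a2 / 4" using assms by (simp add: field_simps)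
        moreover have "A / M \<le> A" using assms nn mult_left_mono[of 1 M A] by (simp add: field_simps)
        ultimately show ?thesis by simp
      qed
      moreover have "(8 * E * M + M) * a1 \<le> 9 * (E * M * a1)"
      proof -
        have "M * a1 \<le> E * M * a1" using assms nn mult_right_mono[of 1 E "M * a1"] by simp
        then show ?thesis by (simp add: algebra_simps)
      qed
      ultimately have "a2 \<le> A / 4 + a2 / 4 + 9 * (E * M * a1)" by linarith
      then show ?thesis using nn by (simp add: mult.assoc)
    qed
    have a1: "a1 \<le> k1 * (A + L)"
    proof -
      \<comment> \<open>Chosen against the coefficient 36 E^3 M^2 of a1 in the bound for B2, so that
        half of a1 returns.\<close>
      define d where "d = 1 / (72 * E ^ 3 * M\<^sup>2)"
      have d: "d > 0" unfolding d_def using assms by simp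
      have "B2 \<le> E * (B3 + a2)" using order_trans[OF e(2) mult_left_mono[of "B3 + l2" "B3 + a2" E]] l E0 by simp
      also have "\<dots> \<le> E * (E * (2 * A + 2 * M * a2) + E * M * a2)"
      proof -
        have "a2 \<le> E * M * a2" using mult_right_mono[OF EM(1) nn(6)] by simp
        then show ?thesis using B3 E0 by (intro mult_left_mono add_mono) auto
      qed
      also have "\<dots> = E\<^sup>2 * (2 * A + 3 * M * a2)" by (simp add: power2_eq_square algebra_simps)
      also have "\<dots> \<le> E\<^sup>2 * (2 * A + 3 * M * (A + 12 * E * M * a1))"
        using a2 E0 by (intro mult_left_mono add_left_mono) auto
      also have "\<dots> = E\<^sup>2 * (2 + 3 * M) * A + 36 * E ^ 3 * M\<^sup>2 * a1" by (simp add: power2_eq_square power3_eq_cube algebra_simps)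
      also have "E\<^sup>2 * (2 + 3 * M) * A \<le> E ^ 3 * (5 * M\<^sup>2) * A"
        using EM nn assms E0 by (intro mult_right_mono mult_mono) auto
      finally have "d * B2 \<le> d * (E ^ 3 * (5 * M\<^sup>2) * A + 36 * E ^ 3 * M\<^sup>2 * a1)" using d by (intro mult_left_mono) auto
      also have "\<dots> = 5 / 72 * A + a1 / 2" unfolding d_def using assms by (simp add: field_simps)
      finally have "a1 \<le> 5 / 72 * A + a1 / 2 + (1 / d + M) * L" using i1[OF d] by linarith
      moreover have "(1 / d + M) * L \<le> (73 * (E ^ 3 * M\<^sup>2)) * L"
        unfolding d_def using EM3 nn by (intro mult_right_mono) auto
      ultimately have "a1 \<le> A + 146 * E ^ 3 * M\<^sup>2 * L" using nn by (simp add: mult.assoc)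
      also have "\<dots> \<le> k1 * (A + L)"
      proof -
        have "0 \<le> 146 * E ^ 3 * M\<^sup>2 * A" using E0 nn by simp
        then show ?thesis unfolding k1_def using nn by (simp add: algebra_simps)
      qed
      finally show ?thesis .
    qed
    have AL: "A \<le> A + L" "L \<le> A + L" "0 \<le> A + L" using nn by auto
    have a2': "a2 \<le> k2 * (A + L)"
    proof -
      have "12 * E * M * a1 \<le> 12 * E * M * (k1 * (A + L))" using a1 E0 by (intro mult_left_mono) auto
      then show ?thesis using a2 AL unfolding k2_def by (simp add: algebra_simps)
    qed
    have B3': "B3 \<le> k3 * (A + L)"
    proof -
      have "2 * A + 2 * M * a2 \<le> 2 * (A + L) + 2 * M * (k2 * (A + L))"
        using a2' AL E0 by (intro add_mono mult_left_mono) auto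
      then have "E * (2 * A + 2 * M * a2) \<le> E * (2 * (A + L) + 2 * M * (k2 * (A + L)))" using E0 by (intro mult_left_mono)
      then show ?thesis using B3 unfolding k3_def by (simp add: algebra_simps)
    qed
    have step: "X \<le> E * (y + z) * (A + L)" if "X \<le> E * (u + v)" "u \<le> y * (A + L)" "v \<le> z * (A + L)" for X u v y z
    proof -
      have "E * (u + v) \<le> E * (y * (A + L) + z * (A + L))" using that E0 by (intro mult_left_mono add_mono) auto
      then show ?thesis using that(1) by (simp add: algebra_simps)
    qed
    have B2': "B2 \<le> k4 * (A + L)" unfolding k4_def by (rule step[OF e(2) B3' order_trans[OF l(1) a2']])
    have B1': "B1 \<le> k5 * (A + L)" unfolding k5_def by (rule step[OF e(3) B2' order_trans[OF l(2) a1]])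
    have B0': "B0 \<le> k6 * (A + L)" unfolding k6_def by (rule step[OF e(4) B1']) (use l(3) AL in simp)
    show "B3 + B2 + B1 + B0 \<le> C * (A + L)" using B3' B2' B1' B0' unfolding C_def by (simp add: algebra_simps)
  qed
qed

lemma absorb_damped:
  fixes K M C2 :: real
  assumes "K \<ge> 1" "M \<ge> 1" "C2 \<ge> 1"
  obtains C e0 where "C \<ge> 1" "e0 > 0" "\<And>\<epsilon> \<alpha> A W Z2 Z1 Z0 B F L.
    \<lbrakk>0 \<le> A; 0 \<le> W; 0 \<le> Z2; 0 \<le> Z1; 0 \<le> Z0; 0 \<le> F; 0 \<le> L; 0 < \<epsilon>; \<epsilon> \<le> e0; 1 \<le> \<alpha>;
     B \<le> C2 * (A + L);
     \<And>d. d > 0 \<Longrightarrow> (W + A + \<alpha>\<^sup>2 * Z2) / 6 \<le> F + (300 + 100 / d) * K ^ 4 * \<alpha>\<^sup>2 * Z1 + 300 * K ^ 4 * Z0 + (3 * \<epsilon> + d) * B;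
     \<And>d. d > 0 \<Longrightarrow> Z1 \<le> d * Z2 + (1 / d + M) * Z0\<rbrakk>
    \<Longrightarrow> A + W + \<alpha>\<^sup>2 * Z2 + \<alpha>\<^sup>2 * Z1 \<le> C * (F + L + \<alpha>\<^sup>2 * Z0)"
proof -
  \<comment> \<open>The coefficient of \<alpha>^2 Z1 for d = 1 / (24 C2). This d, with \<epsilon>
    \<le> 1 / (72 C2), gives (3 \<epsilon> + d) C2 \<le> 1 / 12.\<close>
  define G where "G = (300 + 2400 * C2) * K ^ 4"
  define H where "H = G * (12 * G + M) + 300 * K ^ 4"
  define C where "C = 12 * H + 13 + M + 12 * H"
  have K4: "1 \<le> K ^ 4" using assms by simp
  have G: "G \<ge> 1" unfolding G_def using K4 assms mult_mono[of 1 "300 + 2400 * C2" 1 "K ^ 4"] by simp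
  have H: "H \<ge> 1"
  proof -
    have "0 \<le> G * (12 * G + M)" using G assms by simp
    then show ?thesis unfolding H_def using K4 by linarith
  qed
  have C: "C \<ge> 1" unfolding C_def using H assms by simp
  have e0: "1 / (72 * C2) > 0" using assms by simp
  show ?thesis
  proof (rule that[OF C e0])
    fix \<epsilon> \<alpha> A W Z2 Z1 Z0 B F L :: real
    assume nn: "0 \<le> A" "0 \<le> W" "0 \<le> Z2" "0 \<le> Z1" "0 \<le> Z0" "0 \<le> F" "0 \<le> L"
      and \<epsilon>: "0 < \<epsilon>" "\<epsilon> \<le> 1 / (72 * C2)" and \<alpha>: "1 \<le> \<alpha>" and B: "B \<le> C2 * (A + L)"
      and d: "\<And>d. d > 0 \<Longrightarrow> (W + A + \<alpha>\<^sup>2 * Z2) / 6 \<le> F + (300 + 100 / d) * K ^ 4 * \<alpha>\<^sup>2 * Z1 + 300 * K ^ 4 * Z0 + (3 * \<epsilon> + d) * B"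
      and z: "\<And>d. d > 0 \<Longrightarrow> Z1 \<le> d * Z2 + (1 / d + M) * Z0"
    have a2: "1 \<le> \<alpha>\<^sup>2" using \<alpha> by simp
    define X Y V where "X = \<alpha>\<^sup>2 * Z2" and "Y = \<alpha>\<^sup>2 * Z1" and "V = \<alpha>\<^sup>2 * Z0"
    have nn': "0 \<le> X" "0 \<le> Y" "0 \<le> V" "Z0 \<le> V"
      unfolding X_def Y_def V_def using nn mult_right_mono[OF a2 nn(5)] by auto
    have B': "(3 * \<epsilon> + 1 / (24 * C2)) * B \<le> (A + L) / 12"
    proof -
      have "(3 * \<epsilon> + 1 / (24 * C2)) * B \<le> (3 * \<epsilon> + 1 / (24 * C2)) * (C2 * (A + L))"
        using B \<epsilon> assms by (intro mult_left_mono) auto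
      also have "\<dots> \<le> (3 * (1 / (72 * C2)) + 1 / (24 * C2)) * (C2 * (A + L))"
        using \<epsilon> nn assms by (intro mult_right_mono) auto
      also have "\<dots> = (A + L) / 12" using assms by (simp add: field_simps)
      finally show ?thesis .
    qed
    have s1: "(W + A + X) / 6 \<le> F + G * Y + 300 * K ^ 4 * Z0 + (A + L) / 12"
      using order_trans[OF d[of "1 / (24 * C2)"] add_left_mono[OF B']] assms unfolding G_def X_def Y_def by (simp add: mult.assoc)
    have zz: "Y \<le> e * X + (1 / e + M) * V" if "e > 0" for e
      using mult_left_mono[OF z[OF that], of "\<alpha>\<^sup>2"] unfolding X_def Y_def V_def by (simp add: algebra_simps)
    have s2: "G * Y \<le> X / 12 + G * (12 * G + M) * V"
    proof -
      have "G * Y \<le> G * (1 / (12 * G) * X + (12 * G + M) * V)" using zz[of "1 / (12 * G)"] G by (intro mult_left_mono) auto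
      also have "\<dots> = X / 12 + G * (12 * G + M) * V" using G by (simp add: field_simps)
      finally show ?thesis .
    qed
    have s3: "300 * K ^ 4 * Z0 \<le> 300 * K ^ 4 * V" using nn' K4 by (intro mult_left_mono) auto
    have "(W + A / 2 + X / 2) / 6 \<le> F + L / 12 + H * V"
    proof -
      have "H * V = G * (12 * G + M) * V + 300 * K ^ 4 * V" unfolding H_def by (simp add: algebra_simps)
      then show ?thesis using s1 s2 s3 by argo
    qed
    then have s4: "W + A + X \<le> 12 * F + L + 12 * (H * V)" using nn by (simp add: field_simps)
    have s5: "Y \<le> X + (1 + M) * V" using zz[of 1] by simp
    have hF: "F \<le> H * F" "L \<le> H * L" using H nn mult_right_mono[of 1 H F] mult_right_mono[of 1 H L] by auto
    have "C * (F + L + V) = 12 * (H * F) + 13 * F + M * F + 12 * (H * F) + (12 * (H * L) + 13 * L + M * L + 12 * (H * L))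
        + (24 * (H * V) + 13 * V + M * V)" unfolding C_def by (simp add: algebra_simps)
    moreover have "0 \<le> M * F" "0 \<le> M * L" "0 \<le> M * V" "0 \<le> H * V" using assms nn nn' H by auto
    moreover have "(1 + M) * V = V + M * V" by (simp add: algebra_simps)
    ultimately show "A + W + \<alpha>\<^sup>2 * Z2 + \<alpha>\<^sup>2 * Z1 \<le> C * (F + L + \<alpha>\<^sup>2 * Z0)"
      unfolding X_def[symmetric] Y_def[symmetric] V_def[symmetric] using s4 s5 hF nn nn' by linarith
  qed
qed

text \<open>The power of \<alpha> arises here, because the damping controls W, Z2 and A only with a
  factor \<alpha>^2. Interpolating l3 against \<alpha>^2 A costs \<alpha>^-2; a2 / \<alpha>^2
  against B3 then leaves a1 / \<alpha>^4, and this against B2 leaves L / \<alpha>^8. In the branch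
  of z, lz1 against \<alpha>^2 Z2 leaves az / \<alpha>^2, and this against \<alpha>^2 W leaves L /
  \<alpha>^6, which is weaker.\<close>

lemma absorb_weakly_damped:
  fixes C3 M E :: real
  assumes "C3 \<ge> 1" "M \<ge> 1" "E \<ge> 1"
  obtains C where "C \<ge> 1" "\<And>\<alpha> A W Z2 Z1 Z0 B3 B2 B1 B0 F L lz l2 lz1 l3 l1 l0 az a2 a1.
    \<lbrakk>0 \<le> A; 0 \<le> W; 0 \<le> Z2; 0 \<le> Z1; 0 \<le> Z0; 0 \<le> B3; 0 \<le> B2; 0 \<le> B1; 0 \<le> B0; 0 \<le> F; 0 \<le> L; 0 \<le> az; 0 \<le> a2; 0 \<le> a1; 0 < \<alpha>; \<alpha> \<le> 1;
     Z0 + B2 + Z1 + B3 + \<alpha>\<^sup>2 * (W + Z2 + A) \<le> C3 * (F + lz + l2 + lz1 + l3);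
     lz \<le> az; l2 \<le> a2; l1 \<le> a1; l0 \<le> L;
     \<And>d. d > 0 \<Longrightarrow> lz1 \<le> d * Z2 + (1 / d + M) * az; \<And>d. d > 0 \<Longrightarrow> l3 \<le> d * A + (1 / d + M) * a2;
     \<And>d. d > 0 \<Longrightarrow> az \<le> d * W + (1 / d + M) * L; \<And>d. d > 0 \<Longrightarrow> a2 \<le> d * B3 + (1 / d + M) * a1;
     \<And>d. d > 0 \<Longrightarrow> a1 \<le> d * B2 + (1 / d + M) * L;
     B1 \<le> E * (B2 + l1); B0 \<le> E * (B1 + l0)\<rbrakk>
    \<Longrightarrow> Z0 + B2 + Z1 + B3 + \<alpha>\<^sup>2 * (W + Z2 + A) + B1 + B0 \<le> C * (F + L / \<alpha> ^ 8)"
proof -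
  \<comment> \<open>The three parameters are tuned so that d1 + 4 D1 d2 + 2 D1 D2 d3 = 1 / (2 C3),
    each summand being 1 / (6 C3); half of the total is then absorbed.\<close>
  define d1 where "d1 = 1 / (6 * C3)"
  define D1 where "D1 = 1 / d1 + M"
  define d2 where "d2 = 1 / (24 * C3 * D1)"
  define D2 where "D2 = 1 / d2 + M"
  define d3 where "d3 = 1 / (12 * C3 * D1 * D2)"
  define D3 where "D3 = 1 / d3 + M"
  define Q where "Q = 2 * D1 * (D2 + D2 * D3)"
  define k where "k = 2 * C3 * (1 + Q)"
  define C where "C = k + E * (2 * k + 1 + M) + E * (E * (2 * k + 1 + M) + 1)"
  have d1: "d1 > 0" and D1: "D1 \<ge> 1" unfolding D1_def d1_def using assms by auto
  have d2: "d2 > 0" unfolding d2_def using assms D1 by simp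
  have D2: "D2 \<ge> 1"
  proof -
    have "0 \<le> 1 / d2" using d2 by simp
    then show ?thesis unfolding D2_def using assms by linarith
  qed
  have d3: "d3 > 0" unfolding d3_def using assms D1 D2 by simp
  have D3: "D3 \<ge> 1"
  proof -
    have "0 \<le> 1 / d3" using d3 by simp
    then show ?thesis unfolding D3_def using assms by linarith
  qed
  have Q: "0 \<le> Q" unfolding Q_def using D1 D2 D3 by simp
  have k1: "1 \<le> k" unfolding k_def using Q assms mult_mono[of 1 "2 * C3" 1 "1 + Q"] by simp
  have C1: "C \<ge> 1"
  proof -
    have "0 \<le> E * (2 * k + 1 + M)" using assms k1 by simp
    then have "0 \<le> E * (E * (2 * k + 1 + M) + 1)" using assms by simp
    then show ?thesis unfolding C_def using k1 \<open>0 \<le> E * (2 * k + 1 + M)\<close> by linarith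
  qed
  show ?thesis
  proof (rule that[OF C1])
    fix \<alpha> A W Z2 Z1 Z0 B3 B2 B1 B0 F L lz l2 lz1 l3 l1 l0 az a2 a1 :: real
    assume nn: "0 \<le> A" "0 \<le> W" "0 \<le> Z2" "0 \<le> Z1" "0 \<le> Z0" "0 \<le> B3" "0 \<le> B2" "0 \<le> B1" "0 \<le> B0" "0 \<le> F" "0 \<le> L"
        "0 \<le> az" "0 \<le> a2" "0 \<le> a1"
      and \<alpha>: "0 < \<alpha>" "\<alpha> \<le> 1"
      and tot: "Z0 + B2 + Z1 + B3 + \<alpha>\<^sup>2 * (W + Z2 + A) \<le> C3 * (F + lz + l2 + lz1 + l3)"
      and l: "lz \<le> az" "l2 \<le> a2" "l1 \<le> a1" "l0 \<le> L"
      and iz1: "\<And>d. d > 0 \<Longrightarrow> lz1 \<le> d * Z2 + (1 / d + M) * az"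
      and i3: "\<And>d. d > 0 \<Longrightarrow> l3 \<le> d * A + (1 / d + M) * a2"
      and iz: "\<And>d. d > 0 \<Longrightarrow> az \<le> d * W + (1 / d + M) * L"
      and i2: "\<And>d. d > 0 \<Longrightarrow> a2 \<le> d * B3 + (1 / d + M) * a1"
      and i1: "\<And>d. d > 0 \<Longrightarrow> a1 \<le> d * B2 + (1 / d + M) * L"
      and e: "B1 \<le> E * (B2 + l1)" "B0 \<le> E * (B1 + l0)"
    define Tot where "Tot = Z0 + B2 + Z1 + B3 + \<alpha>\<^sup>2 * (W + Z2 + A)"
    define N where "N = L / \<alpha> ^ 8"
    have ap: "\<alpha> ^ m > 0" "\<alpha> ^ m \<le> 1" for m using \<alpha> by (auto intro: power_le_one)
    have N: "0 \<le> N" "L / \<alpha> ^ m \<le> N" "L \<le> N" if "m \<le> 8" for m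
    proof -
      show "L / \<alpha> ^ m \<le> N" unfolding N_def using that nn \<alpha> by (intro divide_left_mono power_decreasing) auto
      show "0 \<le> N" unfolding N_def using nn \<alpha> by simp
      show "L \<le> N" unfolding N_def using nn ap(1,2)[of 8] by (simp add: field_simps mult_left_le)
    qed
    \<comment> \<open>Interpolation with parameter d \<alpha>^(m + j), divided by \<alpha>^m. The
      exponent j is the power of \<alpha> available with Y, and Z ends up divided by \<alpha>^(2 m +
      j). As \<alpha> \<le> 1, the constant M is absorbed into the same power.\<close>
    have ipol: "X / \<alpha> ^ m \<le> d * (\<alpha> ^ j * Y) + (1 / d + M) * (Z / \<alpha> ^ (2 * m + j))"
      if "\<And>d. d > 0 \<Longrightarrow> X \<le> d * Y + (1 / d + M) * Z" "d > 0" "0 \<le> Z" for X Y Z d m j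
    proof -
      have "X \<le> (d * \<alpha> ^ (m + j)) * Y + (1 / (d * \<alpha> ^ (m + j)) + M) * Z" using that(1)[of "d * \<alpha> ^ (m + j)"] that(2) ap by simp
      also have "\<dots> \<le> (d * \<alpha> ^ (m + j)) * Y + ((1 / d + M) / \<alpha> ^ (m + j)) * Z"
      proof -
        have "M \<le> M / \<alpha> ^ (m + j)" using ap[of "m + j"] assms by (simp add: field_simps mult_left_le)
        then have "1 / (d * \<alpha> ^ (m + j)) + M \<le> (1 / d + M) / \<alpha> ^ (m + j)" by (simp add: add_divide_distrib)
        then show ?thesis using that(3) by (intro add_left_mono mult_right_mono)
      qed
      finally have "X / \<alpha> ^ m \<le> ((d * \<alpha> ^ (m + j)) * Y + ((1 / d + M) / \<alpha> ^ (m + j)) * Z) / \<alpha> ^ m"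
        using ap by (intro divide_right_mono) (auto simp: less_imp_le)
      also have "\<dots> = d * (\<alpha> ^ j * Y) + (1 / d + M) * (Z / \<alpha> ^ (2 * m + j))"
        using \<alpha>(1) by (simp add: field_simps power_add mult_2_right)
      finally show ?thesis .
    qed
    have j1: "lz1 \<le> d1 * (\<alpha> ^ 2 * Z2) + D1 * (az / \<alpha> ^ 2)"
      using ipol[OF iz1 d1 nn(12), of 0 2] unfolding D1_def by (simp add: power2_eq_square)
    have j2: "l3 \<le> d1 * (\<alpha> ^ 2 * A) + D1 * (a2 / \<alpha> ^ 2)"
      using ipol[OF i3 d1 nn(13), of 0 2] unfolding D1_def by (simp add: power2_eq_square)
    have j3: "az / \<alpha> ^ 2 \<le> d2 * (\<alpha> ^ 2 * W) + D2 * N"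
    proof -
      have "D2 * (L / \<alpha> ^ 6) \<le> D2 * N" using N[of 6] D2 by (intro mult_left_mono) auto
      then show ?thesis using ipol[OF iz d2 nn(11), of 2 2] unfolding D2_def[symmetric] by simp
    qed
    have j4: "a2 / \<alpha> ^ 2 \<le> d2 * B3 + D2 * (a1 / \<alpha> ^ 4)"
      using ipol[OF i2 d2 nn(14), of 2 0] unfolding D2_def by simp
    have j5: "a1 / \<alpha> ^ 4 \<le> d3 * B2 + D3 * N"
      using ipol[OF i1 d3 nn(11), of 4 0] unfolding D3_def N_def by simp
    have small: "az \<le> az / \<alpha> ^ 2" "a2 \<le> a2 / \<alpha> ^ 2"
      using nn ap(1,2)[of 2] by (auto simp: field_simps mult_left_le)
    have T: "0 \<le> \<alpha>\<^sup>2 * W" "0 \<le> \<alpha>\<^sup>2 * Z2" "0 \<le> \<alpha>\<^sup>2 * A" using nn by auto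
    have T': "\<alpha>\<^sup>2 * Z2 + \<alpha>\<^sup>2 * A \<le> Tot" "\<alpha>\<^sup>2 * W \<le> Tot" "B3 \<le> Tot" "B2 \<le> Tot" "0 \<le> Tot"
      unfolding Tot_def distrib_left using nn T by linarith+
    have s1: "az / \<alpha> ^ 2 + a2 / \<alpha> ^ 2 \<le> (2 * d2 + D2 * d3) * Tot + (D2 + D2 * D3) * N"
    proof -
      have "D2 * (a1 / \<alpha> ^ 4) \<le> D2 * (d3 * Tot + D3 * N)"
      proof (rule mult_left_mono)
        show "a1 / \<alpha> ^ 4 \<le> d3 * Tot + D3 * N" using j5 mult_left_mono[OF T'(4), of d3] d3 by linarith
      qed (use D2 in simp)
      moreover have "d2 * (\<alpha> ^ 2 * W) \<le> d2 * Tot" "d2 * B3 \<le> d2 * Tot"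
        using T'(2,3) d2 by (auto intro: mult_left_mono)
      moreover have "(2 * d2 + D2 * d3) * Tot + (D2 + D2 * D3) * N = 2 * (d2 * Tot) + D2 * N + D2 * (d3 * Tot + D3 * N)"
        by (simp add: algebra_simps)
      ultimately show ?thesis using j3 j4 by linarith
    qed
    have s2: "lz + l2 + lz1 + l3 \<le> d1 * Tot + 2 * D1 * (az / \<alpha> ^ 2 + a2 / \<alpha> ^ 2)"
    proof -
      define y where "y = az / \<alpha> ^ 2 + a2 / \<alpha> ^ 2"
      have y: "0 \<le> y" "az + a2 \<le> y" unfolding y_def using nn small by auto
      have "y \<le> D1 * y" using mult_right_mono[OF D1 y(1)] by simp
      moreover have "d1 * (\<alpha> ^ 2 * Z2) + d1 * (\<alpha> ^ 2 * A) \<le> d1 * Tot"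
      proof -
        have "d1 * (\<alpha>\<^sup>2 * Z2 + \<alpha>\<^sup>2 * A) \<le> d1 * Tot" using T'(1) d1 by (intro mult_left_mono) auto
        then show ?thesis by (simp add: distrib_left)
      qed
      moreover have "D1 * (az / \<alpha> ^ 2) + D1 * (a2 / \<alpha> ^ 2) = D1 * y" unfolding y_def by (simp add: algebra_simps)
      ultimately show ?thesis unfolding y_def[symmetric] using l(1,2) j1 j2 y by linarith
    qed
    have s3: "lz + l2 + lz1 + l3 \<le> 1 / (2 * C3) * Tot + Q * N"
    proof -
      have "2 * D1 * (az / \<alpha> ^ 2 + a2 / \<alpha> ^ 2) \<le> 2 * D1 * ((2 * d2 + D2 * d3) * Tot + (D2 + D2 * D3) * N)"
        using s1 D1 by (intro mult_left_mono) auto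
      also have "\<dots> = (4 * D1 * d2 + 2 * D1 * D2 * d3) * Tot + Q * N" unfolding Q_def by (simp add: algebra_simps)
      finally have "lz + l2 + lz1 + l3 \<le> (d1 + 4 * D1 * d2 + 2 * D1 * D2 * d3) * Tot + Q * N"
        using s2 by (simp add: algebra_simps)
      moreover have "d1 + 4 * D1 * d2 + 2 * D1 * D2 * d3 = 1 / (2 * C3)"
        unfolding d1_def d2_def d3_def using D1 D2 assms by (simp add: field_simps)
      ultimately show ?thesis by simp
    qed
    have "Tot \<le> C3 * (F + (lz + l2 + lz1 + l3))" using tot unfolding Tot_def by (simp add: add.assoc)
    also have "\<dots> \<le> C3 * (F + (1 / (2 * C3) * Tot + Q * N))" using s3 assms by (intro mult_left_mono add_left_mono) auto
    also have "\<dots> = C3 * F + Tot / 2 + C3 * Q * N" using assms by (simp add: field_simps)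
    finally have "Tot \<le> 2 * C3 * F + 2 * C3 * Q * N" by (simp add: mult.assoc)
    also have "\<dots> \<le> k * (F + N)"
    proof -
      have "0 \<le> 2 * C3 * Q * F" "0 \<le> 2 * C3 * N" using Q assms nn N(1)[of 0] by auto
      then show ?thesis unfolding k_def by (simp add: algebra_simps)
    qed
    finally have tot': "Tot \<le> k * (F + N)" .
    have FN: "0 \<le> F + N" "N \<le> F + N" using nn N[of 0] by auto
    have a1': "a1 \<le> (k + 1 + M) * (F + N)"
    proof -
      have "a1 \<le> B2 + (1 + M) * L" using i1[of 1] by simp
      also have "\<dots> \<le> k * (F + N) + (1 + M) * (F + N)"
        using T'(4) tot' N[of 0] FN assms by (intro add_mono mult_left_mono) linarith+
      finally show ?thesis by (simp add: algebra_simps)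
    qed
    have B1': "B1 \<le> E * (2 * k + 1 + M) * (F + N)"
    proof -
      have "E * (B2 + l1) \<le> E * (k * (F + N) + (k + 1 + M) * (F + N))"
        using T'(4) tot' a1' l(3) assms by (intro mult_left_mono) linarith+
      then show ?thesis using e(1) by (simp add: algebra_simps)
    qed
    have B0': "B0 \<le> E * (E * (2 * k + 1 + M) + 1) * (F + N)"
    proof -
      have "E * (B1 + l0) \<le> E * (E * (2 * k + 1 + M) * (F + N) + 1 * (F + N))"
      proof (intro mult_left_mono add_mono)
        show "l0 \<le> 1 * (F + N)" using l(4) N(3)[of 0] FN by simp
      qed (use B1' assms in auto)
      then show ?thesis using e(2) by (simp add: algebra_simps)
    qed
    show "Z0 + B2 + Z1 + B3 + \<alpha>\<^sup>2 * (W + Z2 + A) + B1 + B0 \<le> C * (F + L / \<alpha> ^ 8)"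
      using tot' B1' B0' unfolding C_def Tot_def[symmetric] N_def[symmetric] by (simp add: algebra_simps)
  qed
qed

subsection \<open>The estimate for the beam operator\<close>

text \<open>\<open>U i j\<close> is the derivative of order i in t and j in x. Carrying the whole
  family as data makes mixed derivatives independent of the order of differentiation.\<close>

definition beam_regular :: "real \<Rightarrow> (nat \<Rightarrow> nat \<Rightarrow> real \<Rightarrow> real \<Rightarrow> real) \<Rightarrow> bool" where
  "beam_regular T U \<longleftrightarrow> (\<forall>i\<le>2. \<forall>j\<le>4. tempered T (U i j)) \<and>
     (\<forall>i\<le>2. \<forall>j<4. has_dx T (U i j) (U i (Suc j))) \<and> (\<forall>i<2. \<forall>j\<le>4. has_dt T (U i j) (U (Suc i) j))"

text \<open>The target inequality divided by \<mu>, each weighted norm in it being \<mu> times an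
  \<open>N\<close>. \<open>N\<close> and \<open>I\<close> are arguments so that one constant for all
  instances of the locale can be stated outside it.\<close>

definition beam_estimate :: "real \<Rightarrow> real \<Rightarrow> real \<Rightarrow> (nat \<Rightarrow> nat \<Rightarrow> (real \<Rightarrow> real \<Rightarrow> real) \<Rightarrow> real) \<Rightarrow>
    ((real \<Rightarrow> real \<Rightarrow> real) \<Rightarrow> real) \<Rightarrow> (nat \<Rightarrow> nat \<Rightarrow> real \<Rightarrow> real \<Rightarrow> real) \<Rightarrow> bool" where
  "beam_estimate C \<alpha> \<mu> N I U \<longleftrightarrow>
    \<alpha>\<^sup>2 / (1 + \<alpha>\<^sup>2) * (N 0 0 (U 0 4) + N 0 0 (U 2 0)) + \<alpha>\<^sup>2 * N 0 0 (U 1 2)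
      + (N 8 0 (U 0 0) + N 6 0 (U 0 1) + N 4 0 (U 0 2) + (1 + \<alpha>\<^sup>2) * N 4 0 (U 1 0)
        + N 2 0 (U 0 3) + (1 + \<alpha>\<^sup>2) * N 2 0 (U 1 1))
    \<le> C * ((1 / \<alpha> ^ 8 + \<alpha> ^ 4) * N 8 2 (U 0 0)
      + I (\<lambda>t x. (U 2 0 t x - \<alpha> * U 1 2 t x + U 0 4 t x)\<^sup>2) / \<mu> + \<alpha>\<^sup>2 * N 4 0 (U 1 0))"

lemma has_dx_lin:
  assumes "has_dx T u u'" "has_dx T v v'"
  shows "has_dx T (\<lambda>t x. u t x - r * v t x) (\<lambda>t x. u' t x - r * v' t x)"
  using assms unfolding has_dx_def by (auto intro!: derivative_eq_intros)

lemma has_dt_lin: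
  assumes "has_dt T u u'" "has_dt T v v'"
  shows "has_dt T (\<lambda>t x. u t x - r * v t x) (\<lambda>t x. u' t x - r * v' t x)"
  using assms unfolding has_dt_def by (auto intro!: derivative_eq_intros)

lemma has_dx_cmult: "has_dx T v v' \<Longrightarrow> has_dx T (\<lambda>t x. r * v t x) (\<lambda>t x. r * v' t x)"
  unfolding has_dx_def by (auto intro!: derivative_eq_intros)

lemma has_dt_cmult: "has_dt T v v' \<Longrightarrow> has_dt T (\<lambda>t x. r * v t x) (\<lambda>t x. r * v' t x)"
  unfolding has_dt_def by (auto intro!: derivative_eq_intros)

context carleman_weight begin

text \<open>With a = \<alpha> / 2 and b = sqrt (1 - a^2) the roots satisfy r + r' = \<alpha> and r
  r' = 1, which is the factorisation. The Carleman estimate for v yields the norms without \<alpha>;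
  the bound on v_xx, hence on z_xx and \<eta>_xxxx, comes from the energy estimate and carries
  \<alpha>^2. Finally z_t is read off the equation.\<close>

lemma beam_weakly_damped:
  assumes \<alpha>: "0 < \<alpha>" "\<alpha> \<le> 1" and U: "beam_regular T U"
    and \<mu>_large: "16 * K ^ 3 \<le> \<mu> * c\<^sup>2" and \<epsilon>_small: "100 * K ^ 3 * \<epsilon> \<le> c\<^sup>2"
    and f: "f = (\<lambda>t x. U 2 0 t x - \<alpha> * U 1 2 t x + U 0 4 t x)"
  shows "N 4 0 (U 1 0) + N 4 0 (U 0 2) + N 2 0 (U 1 1) + N 2 0 (U 0 3) + \<alpha>\<^sup>2 * (N 0 0 (U 2 0) + N 0 0 (U 1 2) + N 0 0 (U 0 4))
    \<le> (643 + 9732 * K\<^sup>2 * (24 * K ^ 4 * (6 * K\<^sup>2 / c\<^sup>2))) *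
      (I (\<lambda>t x. (f t x)\<^sup>2) / \<mu> + N 4 8 (U 1 0) + N 4 8 (U 0 2) + N 2 8 (U 1 1) + N 2 8 (U 0 3))"
proof -
  define a where "a = \<alpha> / 2"
  define b where "b = sqrt (1 - a\<^sup>2)"
  have a: "0 \<le> a" "a \<le> 1 / 2" "a\<^sup>2 \<le> 1 / 4" using \<alpha> power_mono[of a "1 / 2" 2] by (auto simp: a_def power2_eq_square)
  have b2: "b\<^sup>2 = 1 - a\<^sup>2" unfolding b_def using a by simp
  have ab: "a\<^sup>2 + b\<^sup>2 = 1" using b2 by simp
  \<comment> \<open>Here \<alpha> \<le> 1 enters: b^2 \<ge> 3/4 permits division by b when \<eta>_xx
    is recovered from the imaginary part of v.\<close>
  have b34: "3 / 4 \<le> b\<^sup>2" "b\<^sup>2 \<le> 1" using b2 a by auto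
  have tU: "tempered T (U i j)" if "i \<le> 2" "j \<le> 4" for i j using U that unfolding beam_regular_def by blast
  have dxU: "has_dx T (U i j) (U i (Suc j))" if "i \<le> 2" "j < 4" for i j using U that unfolding beam_regular_def by blast
  have dtU: "has_dt T (U i j) (U (Suc i) j)" if "i < 2" "j \<le> 4" for i j using U that unfolding beam_regular_def by blast
  \<comment> \<open>\<open>P\<close> and \<open>Q\<close> collect the derivatives of the real and
    imaginary parts of v = z - (a - i b) \<eta>_xx.\<close>
  define P where "P = (\<lambda>i j t x. U (Suc i) j t x - a * U i (Suc (Suc j)) t x)"
  define Q where "Q = (\<lambda>i j t x. b * U i (Suc (Suc j)) t x)"
  have tP: "tempered T (P i j)" if "i \<le> 1" "j \<le> 2" for i j unfolding P_def using that by (intro tempered_all tU) auto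
  have tQ: "tempered T (Q i j)" if "i \<le> 1" "j \<le> 2" for i j unfolding Q_def using that by (intro tempered_all tU) auto
  have p: "tempered T (P 0 0)" "tempered T (P 0 1)" "tempered T (P 0 2)" "tempered T (P 1 0)" "tempered T (P 1 1)"
      "has_dx T (P 0 0) (P 0 1)" "has_dx T (P 0 1) (P 0 2)" "has_dx T (P 1 0) (P 1 1)" "has_dt T (P 0 0) (P 1 0)" "has_dt T (P 0 1) (P 1 1)"
    using tP unfolding P_def by (auto simp: numeral_2_eq_2 intro!: has_dx_lin has_dt_lin dxU dtU)
  have q: "tempered T (Q 0 0)" "tempered T (Q 0 1)" "tempered T (Q 0 2)" "tempered T (Q 1 0)" "tempered T (Q 1 1)"
      "has_dx T (Q 0 0) (Q 0 1)" "has_dx T (Q 0 1) (Q 0 2)" "has_dx T (Q 1 0) (Q 1 1)" "has_dt T (Q 0 0) (Q 1 0)" "has_dt T (Q 0 1) (Q 1 1)"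
    using tQ unfolding Q_def by (auto simp: numeral_2_eq_2 intro!: has_dx_cmult has_dt_cmult dxU dtU)
  have tf: "tempered T f" unfolding f by (intro tempered_all tU) auto
  have s4: "Suc (Suc 2) = 4" "Suc (Suc 0) = 2" "Suc (Suc 1) = 3" "Suc 1 = 2" "Suc 0 = 1" by auto
  have eq1: "f t x = P 1 0 t x - a * P 0 2 t x + b * Q 0 2 t x" for t x
  proof -
    have "P 1 0 t x - a * P 0 2 t x + b * Q 0 2 t x = U 2 0 t x - 2 * a * U 1 2 t x + (a\<^sup>2 + b\<^sup>2) * U 0 4 t x"
      unfolding P_def Q_def s4 by (simp add: algebra_simps power2_eq_square)
    then show ?thesis unfolding ab f by (simp add: a_def)
  qed
  have eq2: "0 = Q 1 0 t x - a * Q 0 2 t x - b * P 0 2 t x" for t x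
    unfolding P_def Q_def s4 by (simp add: algebra_simps)
  define F where "F = I (\<lambda>t x. (f t x)\<^sup>2) / \<mu>"
  define V where "V = N 4 0 (P 0 0) + N 4 0 (Q 0 0)"
  define V1 where "V1 = N 2 0 (P 0 1) + N 2 0 (Q 0 1)"
  define V2 where "V2 = N 0 0 (P 0 2) + N 0 0 (Q 0 2)"
  define l where "l = N 4 8 (U 1 0) + N 4 8 (U 0 2) + N 2 8 (U 1 1) + N 2 8 (U 0 3)"
  have F0: "N 0 0 f \<le> F" unfolding F_def by (rule N_0_le[OF tf])
  have sq2: "(u - v)\<^sup>2 \<le> 2 * u\<^sup>2 + 2 * v\<^sup>2" "(u + v)\<^sup>2 \<le> 2 * u\<^sup>2 + 2 * v\<^sup>2" for u v :: real
    using zero_le_power2[of "u + v"] zero_le_power2[of "u - v"] by (simp_all add: power2_eq_square algebra_simps)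
  have av: "(a * v)\<^sup>2 \<le> v\<^sup>2 / 4" for v using mult_right_mono[OF a(3), of "v\<^sup>2"] by (simp add: power_mult_distrib)
  have bv: "(b * v)\<^sup>2 \<le> v\<^sup>2" "v\<^sup>2 \<le> 4 / 3 * (b * v)\<^sup>2" for v
    using mult_right_mono[OF b34(2), of "v\<^sup>2"] mult_right_mono[OF b34(1), of "v\<^sup>2"] by (simp_all add: power_mult_distrib)
  have PQ_le: "N m n (P 0 j) + N m n (Q 0 j) \<le> 2 * (N m n (U 1 j) + N m n (U 0 (j + 2)))" if j: "j \<le> 2" for m n j
  proof -
    have t: "tempered T (U 1 j)" "tempered T (U 0 (j + 2))" using j by (auto intro!: tU)
    have "N m n (P 0 j) \<le> 2 * N m n (U 1 j) + 1 / 2 * N m n (U 0 (j + 2)) + 0 * N m n (U 1 j)"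
    proof (rule N_le_3[OF tP t t(1)])
      show "(P 0 j t x)\<^sup>2 \<le> 2 * (U 1 j t x)\<^sup>2 + 1 / 2 * (U 0 (j + 2) t x)\<^sup>2 + 0 * (U 1 j t x)\<^sup>2" for t x
        using sq2(1)[of "U 1 j t x" "a * U 0 (j + 2) t x"] av[of "U 0 (j + 2) t x"] by (simp add: P_def)
    qed (use j in auto)
    moreover have "N m n (Q 0 j) \<le> 1 * N m n (U 0 (j + 2)) + 0 * N m n (U 1 j) + 0 * N m n (U 1 j)"
    proof (rule N_le_3[OF tQ t(2,1,1)])
      show "(Q 0 j t x)\<^sup>2 \<le> 1 * (U 0 (j + 2) t x)\<^sup>2 + 0 * (U 1 j t x)\<^sup>2 + 0 * (U 1 j t x)\<^sup>2" for t x
        using bv(1)[of "U 0 (j + 2) t x"] by (simp add: Q_def)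
    qed (use j in auto)
    ultimately show ?thesis using N_nonneg[OF t(2), of m n] by simp
  qed
  have U_le: "N m n (U 1 j) + N m n (U 0 (j + 2)) \<le> 4 * (N m n (P 0 j) + N m n (Q 0 j))" if j: "j \<le> 2" for m n j
  proof -
    have t: "tempered T (P 0 j)" "tempered T (Q 0 j)" using j by (auto intro!: tP tQ)
    have "N m n (U 1 j) \<le> 2 * N m n (P 0 j) + 1 * N m n (Q 0 j) + 0 * N m n (P 0 j)"
    proof (rule N_le_3[OF tU t t(1)])
      show "(U 1 j t x)\<^sup>2 \<le> 2 * (P 0 j t x)\<^sup>2 + 1 * (Q 0 j t x)\<^sup>2 + 0 * (P 0 j t x)\<^sup>2" for t x
      proof -
        have u: "U 1 j t x = P 0 j t x + a * U 0 (j + 2) t x" by (simp add: P_def)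
        have q: "Q 0 j t x = b * U 0 (j + 2) t x" by (simp add: Q_def)
        show ?thesis unfolding u q
          using sq2(2)[of "P 0 j t x" "a * U 0 (j + 2) t x"] av[of "U 0 (j + 2) t x"] bv(2)[of "U 0 (j + 2) t x"]
            zero_le_power2[of "b * U 0 (j + 2) t x"] by linarith
      qed
    qed (use j in auto)
    moreover have "N m n (U 0 (j + 2)) \<le> 4 / 3 * N m n (Q 0 j) + 0 * N m n (P 0 j) + 0 * N m n (P 0 j)"
    proof (rule N_le_3[OF tU t(2,1,1)])
      show "(U 0 (j + 2) t x)\<^sup>2 \<le> 4 / 3 * (Q 0 j t x)\<^sup>2 + 0 * (P 0 j t x)\<^sup>2 + 0 * (P 0 j t x)\<^sup>2" for t x
        using bv(2)[of "U 0 (j + 2) t x"] by (simp add: Q_def)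
    qed (use j in auto)
    ultimately show ?thesis using N_nonneg[OF t(1), of m n] N_nonneg[OF t(2), of m n] by simp
  qed
  have K1: "1 \<le> K\<^sup>2" "1 \<le> K ^ 4" using K by auto
  define C1 where "C1 = 6 * K\<^sup>2 / c\<^sup>2"
  have C1: "0 \<le> C1" unfolding C1_def by simp
  have nnU: "0 \<le> N m n (U i j)" if "i \<le> 2" "j \<le> 4" for m n i j using tU[OF that] by (rule N_nonneg)
  have nn: "0 \<le> l" "0 \<le> V" "0 \<le> V1" "0 \<le> V2" "0 \<le> N 0 0 f"
    unfolding l_def V_def V1_def V2_def using p q tf N_nonneg nnU by (auto intro!: add_nonneg_nonneg)
  have main: "V1 + V \<le> 24 * K ^ 4 * C1 * (F + l)"
  proof -
    have "N 2 0 (P 0 1) + N 2 0 (Q 0 1) + N 4 0 (P 0 0) + N 4 0 (Q 0 0)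
      \<le> C1 * (F + 12 * K ^ 4 * (N 2 8 (P 0 1) + N 2 8 (Q 0 1) + N 4 8 (P 0 0) + N 4 8 (Q 0 0)))"
      unfolding C1_def F_def by (rule schroedinger_carleman[OF ab a(1) \<mu>_large \<epsilon>_small p q tf eq1 eq2])
    also have "\<dots> \<le> C1 * (24 * K ^ 4 * F + 12 * K ^ 4 * (2 * l))"
    proof (intro mult_left_mono add_mono)
      show "N 2 8 (P 0 1) + N 2 8 (Q 0 1) + N 4 8 (P 0 0) + N 4 8 (Q 0 0) \<le> 2 * l"
        using PQ_le[of 1 2 8] PQ_le[of 0 4 8] unfolding l_def by (simp add: numeral_2_eq_2 numeral_3_eq_3)
      show "F \<le> 24 * K ^ 4 * F" using mult_right_mono[of 1 "24 * K ^ 4" F] K1 F0 nn(5) by simp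
    qed (use C1 K1 in auto)
    also have "\<dots> = 24 * K ^ 4 * C1 * (F + l)" by (simp add: algebra_simps)
    finally show ?thesis unfolding V_def V1_def by simp
  qed
  have energy: "a\<^sup>2 * V2 \<le> 10 * N 0 0 f + 152 * K\<^sup>2 * V1"
    unfolding V2_def V1_def by (rule energy_estimate[OF ab a(1) p q tf eq1 eq2])
  have W: "N 0 0 (U 2 0) \<le> 3 * N 0 0 f + 3 * N 0 0 (U 1 2) + 3 * N 0 0 (U 0 4)"
  proof (rule N_le_3)
    fix t x
    have w: "U 2 0 t x = f t x + \<alpha> * U 1 2 t x + - U 0 4 t x" unfolding f by simp
    have "(u + v + y)\<^sup>2 \<le> 3 * u\<^sup>2 + 3 * v\<^sup>2 + 3 * y\<^sup>2" for u v y :: real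
      using zero_le_power2[of "u - v"] zero_le_power2[of "u - y"] zero_le_power2[of "v - y"]
      by (simp add: power2_eq_square algebra_simps)
    from this[of "f t x" "\<alpha> * U 1 2 t x" "- U 0 4 t x"]
    have "(U 2 0 t x)\<^sup>2 \<le> 3 * (f t x)\<^sup>2 + 3 * (\<alpha> * U 1 2 t x)\<^sup>2 + 3 * (U 0 4 t x)\<^sup>2" unfolding w by simp
    moreover have "(\<alpha> * U 1 2 t x)\<^sup>2 \<le> (U 1 2 t x)\<^sup>2"
      using mult_right_mono[of "\<alpha>\<^sup>2" 1 "(U 1 2 t x)\<^sup>2"] \<alpha> by (simp add: power_mult_distrib power_le_one)
    ultimately show "(U 2 0 t x)\<^sup>2 \<le> 3 * (f t x)\<^sup>2 + 3 * (U 1 2 t x)\<^sup>2 + 3 * (U 0 4 t x)\<^sup>2" by linarith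
  qed (auto intro: tU tf)
  define Y where "Y = N 0 0 (U 1 2) + N 0 0 (U 0 4)"
  have Y: "\<alpha>\<^sup>2 * Y \<le> 160 * N 0 0 f + 2432 * (K\<^sup>2 * V1)"
  proof -
    have "Y \<le> 4 * V2" using U_le[of 2 0 0] unfolding Y_def V2_def by simp
    then have "\<alpha>\<^sup>2 * Y \<le> \<alpha>\<^sup>2 * (4 * V2)" by (intro mult_left_mono) auto
    \<comment> \<open>\<alpha> = 2 a, and passing from v_xx to z_xx and \<eta>_xxxx has cost a
      factor 4.\<close>
    also have "\<dots> = 16 * (a\<^sup>2 * V2)" unfolding a_def by (simp add: power2_eq_square)
    finally show ?thesis using energy by simp
  qed
  have \<alpha>2: "\<alpha>\<^sup>2 \<le> 1" using \<alpha> by (simp add: power_le_one)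
  have W': "\<alpha>\<^sup>2 * N 0 0 (U 2 0) \<le> 3 * N 0 0 f + 3 * (\<alpha>\<^sup>2 * Y)"
  proof -
    have "\<alpha>\<^sup>2 * N 0 0 (U 2 0) \<le> \<alpha>\<^sup>2 * (3 * N 0 0 f + 3 * Y)" using W unfolding Y_def by (intro mult_left_mono) auto
    moreover have "\<alpha>\<^sup>2 * N 0 0 f \<le> N 0 0 f" using mult_right_mono[OF \<alpha>2 nn(5)] by simp
    ultimately show ?thesis by (simp add: algebra_simps)
  qed
  have low: "N 4 0 (U 1 0) + N 4 0 (U 0 2) + N 2 0 (U 1 1) + N 2 0 (U 0 3) \<le> 4 * (V1 + V)"
    using U_le[of 1 2 0] U_le[of 0 4 0] unfolding V_def V1_def by (simp add: numeral_2_eq_2 numeral_3_eq_3)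
  have KV: "V \<le> K\<^sup>2 * V" "V1 \<le> K\<^sup>2 * V1" using mult_right_mono[OF K1(1) nn(2)] mult_right_mono[OF K1(1) nn(3)] by auto
  have "\<alpha>\<^sup>2 * (N 0 0 (U 2 0) + N 0 0 (U 1 2) + N 0 0 (U 0 4)) = \<alpha>\<^sup>2 * N 0 0 (U 2 0) + \<alpha>\<^sup>2 * Y" unfolding Y_def by (simp add: algebra_simps)
  \<comment> \<open>The term z_t contributes 3 F + 3 \<alpha>^2 Y, so 643 = 3 + 4 * 160 and 9728 = 4
    * 2432; the lower-order norms add another 4 to the latter.\<close>
  also have "\<dots> \<le> 643 * F + 9728 * (K\<^sup>2 * V1)" using W' Y F0 by linarith
  finally have "N 4 0 (U 1 0) + N 4 0 (U 0 2) + N 2 0 (U 1 1) + N 2 0 (U 0 3)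
      + \<alpha>\<^sup>2 * (N 0 0 (U 2 0) + N 0 0 (U 1 2) + N 0 0 (U 0 4)) \<le> 643 * F + 9732 * (K\<^sup>2 * (V1 + V))"
    using low KV nn by (simp add: algebra_simps)
  also have "\<dots> \<le> 643 * (F + l) + 9732 * (K\<^sup>2 * (24 * K ^ 4 * C1 * (F + l)))"
    using main nn by (intro add_mono mult_left_mono) auto
  also have "\<dots> = (643 + 9732 * K\<^sup>2 * (24 * K ^ 4 * C1)) * (F + l)" by (simp add: algebra_simps)
  finally show ?thesis unfolding F_def l_def C1_def by (simp add: add.assoc)
qed

end

lemma weakly_damped_combination:
  fixes Q S b0 b1 b2 b3 z0 z0' z1 z1' R A W :: real
  assumes "Q \<le> A + W" "z0' \<le> 2 * z0" "z1' \<le> 2 * z1" "z0 + b2 + z1 + b3 + (W + S + A) + b1 + b0 \<le> R"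
    "0 \<le> z0" "0 \<le> b2" "0 \<le> z1" "0 \<le> b3" "0 \<le> W" "0 \<le> S" "0 \<le> A" "0 \<le> b1" "0 \<le> b0"
  shows "Q + S + (b0 + b1 + b2 + z0' + b3 + z1') \<le> 2 * R"
  using assms by linarith

text \<open>C, e0 and m0 depend on K and c alone: they are drawn from the absorption lemmas before
  \<alpha>, T and the weight are introduced. Both regimes are joined here, with \<beta> = 1 +
  \<alpha>.\<close>

lemma beam_carleman:
  fixes K c :: real
  assumes K: "K \<ge> 1" and c: "0 < c" "c \<le> 1"
  obtains C e0 m0 where "C \<ge> 1" "0 < e0" "e0 \<le> 1" "m0 \<ge> 1"
    "\<And>T \<mu> \<epsilon> \<alpha> \<theta> \<theta>t \<theta>tt \<Lambda> \<Lambda>t \<psi>1 \<psi>2 \<psi>3 g g1 U.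
      \<lbrakk>carleman_weight T \<mu> (1 + \<alpha>) \<epsilon> K c \<theta> \<theta>t \<theta>tt \<Lambda> \<Lambda>t \<psi>1 \<psi>2 \<psi>3 g g1;
       \<epsilon> \<le> e0; m0 \<le> \<mu>; 0 < \<alpha>; beam_regular T U\<rbrakk>
      \<Longrightarrow> beam_estimate C \<alpha> \<mu> (carleman_weight.N T \<theta> \<Lambda> g) (carleman_weight.I T \<theta>) U"
proof -
  define E where "E = 2 * K / c"
  define M where "M = (17 * K)\<^sup>2"
  have E: "E \<ge> 1" unfolding E_def using K c by (simp add: field_simps)
  have M: "M \<ge> 1" "M \<ge> 25" using one_le_power[OF K, of 2] unfolding M_def power_mult_distrib by simp_all
  obtain C2 where C2: "C2 \<ge> 1" and elliptic: "\<And>A B3 B2 B1 B0 l3 l2 l1 l0 a2 a1 L.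
    \<lbrakk>0 \<le> A; 0 \<le> B3; 0 \<le> B2; 0 \<le> B1; 0 \<le> B0; 0 \<le> a2; 0 \<le> a1; 0 \<le> L;
     B3 \<le> E * (A + l3); B2 \<le> E * (B3 + l2); B1 \<le> E * (B2 + l1); B0 \<le> E * (B1 + l0);
     \<And>d. d > 0 \<Longrightarrow> l3 \<le> d * A + (1 / d + M) * a2; \<And>d. d > 0 \<Longrightarrow> a2 \<le> d * B3 + (1 / d + M) * a1;
     \<And>d. d > 0 \<Longrightarrow> a1 \<le> d * B2 + (1 / d + M) * L; l2 \<le> a2; l1 \<le> a1; l0 \<le> L\<rbrakk>
    \<Longrightarrow> B3 + B2 + B1 + B0 \<le> C2 * (A + L)"
    by (rule absorb_elliptic[OF E M(1)]) blast
  obtain Cd e1 where Cd: "Cd \<ge> 1" "e1 > 0" and damped: "\<And>\<epsilon> \<alpha> A W Z2 Z1 Z0 B F L.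
    \<lbrakk>0 \<le> A; 0 \<le> W; 0 \<le> Z2; 0 \<le> Z1; 0 \<le> Z0; 0 \<le> F; 0 \<le> L; 0 < \<epsilon>; \<epsilon> \<le> e1; 1 \<le> \<alpha>;
     B \<le> C2 * (A + L);
     \<And>d. d > 0 \<Longrightarrow> (W + A + \<alpha>\<^sup>2 * Z2) / 6 \<le> F + (300 + 100 / d) * K ^ 4 * \<alpha>\<^sup>2 * Z1 + 300 * K ^ 4 * Z0 + (3 * \<epsilon> + d) * B;
     \<And>d. d > 0 \<Longrightarrow> Z1 \<le> d * Z2 + (1 / d + M) * Z0\<rbrakk>
    \<Longrightarrow> A + W + \<alpha>\<^sup>2 * Z2 + \<alpha>\<^sup>2 * Z1 \<le> Cd * (F + L + \<alpha>\<^sup>2 * Z0)"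
    by (rule absorb_damped[OF K M(1) C2]) blast
  define C3 where "C3 = 643 + 9732 * K\<^sup>2 * (24 * K ^ 4 * (6 * K\<^sup>2 / c\<^sup>2))"
  have C3: "C3 \<ge> 1"
  proof -
    have "0 \<le> 9732 * K\<^sup>2 * (24 * K ^ 4 * (6 * K\<^sup>2 / c\<^sup>2))" by simp
    then show ?thesis unfolding C3_def by linarith
  qed
  obtain Cw where Cw: "Cw \<ge> 1" and weakly: "\<And>\<alpha> A W Z2 Z1 Z0 B3 B2 B1 B0 F L lz l2 lz1 l3 l1 l0 az a2 a1.
    \<lbrakk>0 \<le> A; 0 \<le> W; 0 \<le> Z2; 0 \<le> Z1; 0 \<le> Z0; 0 \<le> B3; 0 \<le> B2; 0 \<le> B1; 0 \<le> B0; 0 \<le> F; 0 \<le> L; 0 \<le> az; 0 \<le> a2; 0 \<le> a1; 0 < \<alpha>; \<alpha> \<le> 1;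
     Z0 + B2 + Z1 + B3 + \<alpha>\<^sup>2 * (W + Z2 + A) \<le> C3 * (F + lz + l2 + lz1 + l3);
     lz \<le> az; l2 \<le> a2; l1 \<le> a1; l0 \<le> L;
     \<And>d. d > 0 \<Longrightarrow> lz1 \<le> d * Z2 + (1 / d + M) * az; \<And>d. d > 0 \<Longrightarrow> l3 \<le> d * A + (1 / d + M) * a2;
     \<And>d. d > 0 \<Longrightarrow> az \<le> d * W + (1 / d + M) * L; \<And>d. d > 0 \<Longrightarrow> a2 \<le> d * B3 + (1 / d + M) * a1;
     \<And>d. d > 0 \<Longrightarrow> a1 \<le> d * B2 + (1 / d + M) * L;
     B1 \<le> E * (B2 + l1); B0 \<le> E * (B1 + l0)\<rbrakk>
    \<Longrightarrow> Z0 + B2 + Z1 + B3 + \<alpha>\<^sup>2 * (W + Z2 + A) + B1 + B0 \<le> Cw * (F + L / \<alpha> ^ 8)"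
    by (rule absorb_weakly_damped[OF C3 M(1) E]) blast
  \<comment> \<open>One demand per estimate: c / (2 K) for the elliptic one, c^2 / (100 K^3) for
    coercivity of the commutator, e1 for the damped regime. The choice of m0 lets \<mu> (\<psi>')^2
    dominate \<psi>'' where the cutoff does not help.\<close>
  define e0 where "e0 = min 1 (min (c / (2 * K)) (min (c\<^sup>2 / (100 * K ^ 3)) e1))"
  define m0 where "m0 = max 1 (16 * K ^ 3 / c\<^sup>2)"
  define C where "C = 2 * Cd + 2 + C2 * (Cd + 1) + 2 * Cw"
  have "0 \<le> C2 * (Cd + 1)" using C2 Cd by simp
  then have C: "C \<ge> 1" "C \<ge> 2 * Cd + 2 + C2 * (Cd + 1)" "C \<ge> 2 * Cw" unfolding C_def using Cd Cw by auto
  have e0: "0 < e0" "e0 \<le> 1" unfolding e0_def using K c Cd by auto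
  show ?thesis
  proof (rule that[OF C(1) e0])
    show "m0 \<ge> 1" unfolding m0_def by simp
    fix T \<mu> \<epsilon> \<alpha> \<theta> \<theta>t \<theta>tt \<Lambda> \<Lambda>t \<psi>1 \<psi>2 \<psi>3 g g1 U
    assume cw: "carleman_weight T \<mu> (1 + \<alpha>) \<epsilon> K c \<theta> \<theta>t \<theta>tt \<Lambda> \<Lambda>t \<psi>1 \<psi>2 \<psi>3 g g1"
      and \<epsilon>: "\<epsilon> \<le> e0" and \<mu>: "m0 \<le> \<mu>" and \<alpha>: "0 < \<alpha>" and U: "beam_regular T U"
    define N where "N = carleman_weight.N T \<theta> \<Lambda> g"
    define f where "f = (\<lambda>t x. U 2 0 t x - \<alpha> * U 1 2 t x + U 0 4 t x)"
    note N = N_def and f = f_def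
    interpret w: carleman_weight T \<mu> "1 + \<alpha>" \<epsilon> K c \<theta> \<theta>t \<theta>tt \<Lambda> \<Lambda>t \<psi>1 \<psi>2 \<psi>3 g g1 by (rule cw)
    have M_IC: "w.IC = M" unfolding M_def w.IC_def ..
    have \<epsilon>1: "K * \<epsilon> \<le> c / 2" and \<epsilon>2: "100 * K ^ 3 * \<epsilon> \<le> c\<^sup>2" and \<epsilon>3: "\<epsilon> \<le> e1"
      using \<epsilon> K unfolding e0_def by (auto simp: field_simps)
    have \<mu>1: "16 * K ^ 3 \<le> \<mu> * c\<^sup>2" using \<mu> c unfolding m0_def by (auto simp: field_simps)
    have tU: "tempered T (U i j)" if "i \<le> 2" "j \<le> 4" for i j using U that unfolding beam_regular_def by blast
    have dxU: "has_dx T (U i j) (U i j')" if "i \<le> 2" "j < 4" "j' = Suc j" for i j j' using U that unfolding beam_regular_def by blast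
    have dtU: "has_dt T (U i j) (U i' j)" if "i < 2" "j \<le> 4" "i' = Suc i" for i i' j using U that unfolding beam_regular_def by blast
    have nn: "0 \<le> N m n (U i j)" if "i \<le> 2" "j \<le> 4" for m n i j unfolding N using tU[OF that] by (rule w.N_nonneg)
    have mono: "N m n (U i j) \<le> N m n' (U i j)" if "i \<le> 2" "j \<le> 4" "n' \<le> n" for m n n' i j
      unfolding N by (rule w.N_antimono[OF tU[OF that(1,2)] that(3)])
    have ell: "N (m + 2) 0 (U 0 j) \<le> E * (N m 0 (U 0 (Suc j)) + N (m + 2) 8 (U 0 j))" if "j < 4" for m j
      unfolding N E_def using that by (intro w.elliptic_estimate \<epsilon>1 tU dxU) auto
    have ip: "N (m + 2) (n + 2) (U i (Suc j)) \<le> d * N m 0 (U i (Suc (Suc j))) + (1 / d + M) * N (m + 4) n (U i j)"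
      if "i \<le> 2" "j \<le> 2" "d > 0" "m + n \<le> 12" for m n i j d
      unfolding N M_IC[symmetric] using that by (intro w.interpolation_x tU dxU) auto
    have ip0: "N (m + 2) 0 (U i (Suc j)) \<le> d * N m 0 (U i (Suc (Suc j))) + (1 / d + M) * N (m + 4) 0 (U i j)"
      if "i \<le> 2" "j \<le> 2" "d > 0" "m \<le> 6" for m i j d
      unfolding N M_IC[symmetric] using that by (intro w.interpolation_x_0 tU dxU) auto
    have it: "N 4 n (U 1 0) \<le> d * N 0 0 (U 2 0) + (1 / d + M) * N 8 n (U 0 0)" if "d > 0" for n d
    proof -
      have "N 4 n (U 1 0) \<le> d * N 0 0 (U 2 0) + (1 / d + 25) * N 8 n (U 0 0)"
        unfolding N using that by (intro w.interpolation_t tU dtU) auto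
      also have "(1 / d + 25) * N 8 n (U 0 0) \<le> (1 / d + M) * N 8 n (U 0 0)"
        using M nn by (intro mult_right_mono) auto
      finally show ?thesis by simp
    qed
    have tf: "tempered T f" unfolding f by (intro tempered_intros tU) auto
    define F where "F = w.I (\<lambda>t x. (f t x)\<^sup>2) / \<mu>"
    have F0: "N 0 0 f \<le> F" "0 \<le> N 0 0 f" unfolding F_def N by (rule w.N_0_le[OF tf] w.N_nonneg[OF tf])+
    \<comment> \<open>The cutoff exponents run 8, 6, 4, 2 from \<eta>_xxx down to \<eta>, two being
      consumed per interpolation. A local norm with g^8 of lower order is bounded by the one with
      smaller exponent, because 0 \<le> g \<le> 1.\<close>
    have B: "N 2 0 (U 0 3) + N 4 0 (U 0 2) + N 6 0 (U 0 1) + N 8 0 (U 0 0) \<le> C2 * (N 0 0 (U 0 4) + N 8 2 (U 0 0))"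
    proof (rule elliptic[of _ _ _ _ _ "N 4 6 (U 0 2)" "N 6 4 (U 0 1)" _ "N 2 8 (U 0 3)" "N 4 8 (U 0 2)" "N 6 8 (U 0 1)" "N 8 8 (U 0 0)"])
      show "N 2 0 (U 0 3) \<le> E * (N 0 0 (U 0 4) + N 2 8 (U 0 3))" using ell[of 3 0] by (simp add: eval_nat_numeral)
      show "N 4 0 (U 0 2) \<le> E * (N 2 0 (U 0 3) + N 4 8 (U 0 2))" using ell[of 2 2] by (simp add: eval_nat_numeral)
      show "N 6 0 (U 0 1) \<le> E * (N 4 0 (U 0 2) + N 6 8 (U 0 1))" using ell[of 1 4] by (simp add: eval_nat_numeral)
      show "N 8 0 (U 0 0) \<le> E * (N 6 0 (U 0 1) + N 8 8 (U 0 0))" using ell[of 0 6] by (simp add: eval_nat_numeral)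
      show "N 2 8 (U 0 3) \<le> d * N 0 0 (U 0 4) + (1 / d + M) * N 4 6 (U 0 2)" if "d > 0" for d
        using ip[of 0 2 d 0 6] that by (simp add: eval_nat_numeral)
      show "N 4 6 (U 0 2) \<le> d * N 2 0 (U 0 3) + (1 / d + M) * N 6 4 (U 0 1)" if "d > 0" for d
        using ip[of 0 1 d 2 4] that by (simp add: eval_nat_numeral)
      show "N 6 4 (U 0 1) \<le> d * N 4 0 (U 0 2) + (1 / d + M) * N 8 2 (U 0 0)" if "d > 0" for d
        using ip[of 0 0 d 4 2] that by (simp add: eval_nat_numeral)
    qed (auto intro!: nn mono)
    define L where "L = N 8 2 (U 0 0)"
    have L: "0 \<le> L" unfolding L_def by (auto intro: nn)
    define X where "X = (1 / \<alpha> ^ 8 + \<alpha> ^ 4) * L + F + \<alpha>\<^sup>2 * N 4 0 (U 1 0)"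
    have Xnn: "0 \<le> F" "0 \<le> \<alpha>\<^sup>2 * N 4 0 (U 1 0)" "0 \<le> (1 / \<alpha> ^ 8 + \<alpha> ^ 4) * L" using F0 nn L \<alpha> by auto
    \<comment> \<open>For \<alpha> \<ge> 1 the coefficients \<alpha>^2 / (1 + \<alpha>^2) and 1 +
      \<alpha>^2 are replaced by 1 and 2 \<alpha>^2, for \<alpha> < 1 by \<alpha>^2 and 2; this
      matches what the two regimes control.\<close>
    have goal: "\<alpha>\<^sup>2 / (1 + \<alpha>\<^sup>2) * (N 0 0 (U 0 4) + N 0 0 (U 2 0)) + \<alpha>\<^sup>2 * N 0 0 (U 1 2)
        + (N 8 0 (U 0 0) + N 6 0 (U 0 1) + N 4 0 (U 0 2) + (1 + \<alpha>\<^sup>2) * N 4 0 (U 1 0)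
          + N 2 0 (U 0 3) + (1 + \<alpha>\<^sup>2) * N 2 0 (U 1 1)) \<le> C * X"
    proof (cases "1 \<le> \<alpha>")
      case True
      have a2: "1 \<le> \<alpha>\<^sup>2" "1 \<le> \<alpha> ^ 4" using True by auto
      have d: "N 0 0 (U 0 4) + N 0 0 (U 2 0) + \<alpha>\<^sup>2 * N 0 0 (U 1 2) + \<alpha>\<^sup>2 * N 2 0 (U 1 1)
          \<le> Cd * (F + L + \<alpha>\<^sup>2 * N 4 0 (U 1 0))"
      proof (rule damped[where B = "N 2 0 (U 0 3)"])
        show "N 2 0 (U 0 3) \<le> C2 * (N 0 0 (U 0 4) + L)"
          using B nn[of 0 2 4 0] nn[of 0 1 6 0] nn[of 0 0 8 0] unfolding L_def by simp
        show "(N 0 0 (U 2 0) + N 0 0 (U 0 4) + \<alpha>\<^sup>2 * N 0 0 (U 1 2)) / 6 \<le> F + (300 + 100 / d) * K ^ 4 * \<alpha>\<^sup>2 * N 2 0 (U 1 1)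
            + 300 * K ^ 4 * N 4 0 (U 1 0) + (3 * \<epsilon> + d) * N 2 0 (U 0 3)" if "d > 0" for d
        proof -
          have "(N 0 0 (U 2 0) + N 0 0 (U 0 4) + \<alpha>\<^sup>2 * N 0 0 (U 1 2)) / 6 \<le> N 0 0 f + (300 + 100 / d) * K ^ 4 * \<alpha>\<^sup>2 * N 2 0 (U 1 1)
            + 300 * K ^ 4 * N 4 0 (U 1 0) + (3 * \<epsilon> + d) * N 2 0 (U 0 3)"
            unfolding N f using True that
            by (intro w.damped_estimate[of _ _ _ _ _ "U 1 3" "U 1 4" _ "U 2 1"] tU dxU dtU) auto
          then show ?thesis using F0 by linarith
        qed
        show "N 2 0 (U 1 1) \<le> d * N 0 0 (U 1 2) + (1 / d + M) * N 4 0 (U 1 0)" if "d > 0" for d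
          using ip0[of 1 0 d 0] that by (simp add: eval_nat_numeral)
      qed (use True \<epsilon>3 w.\<epsilon> Xnn L in \<open>auto intro!: nn\<close>)
      define Y where "Y = F + L + \<alpha>\<^sup>2 * N 4 0 (U 1 0)"
      have Y: "0 \<le> Y" "L \<le> Y" "\<alpha>\<^sup>2 * N 4 0 (U 1 0) \<le> Y" unfolding Y_def using Xnn L by auto
      have YX: "Y \<le> X"
      proof -
        have "0 \<le> 1 / \<alpha> ^ 8" using \<alpha> by simp
        then have "1 * L \<le> (1 / \<alpha> ^ 8 + \<alpha> ^ 4) * L" using a2 L by (intro mult_right_mono) linarith+
        then show ?thesis unfolding X_def Y_def by simp
      qed
      have A: "N 0 0 (U 0 4) \<le> Cd * Y"
        using d nn[of 2 0 0 0] mult_nonneg_nonneg[OF zero_le_power2[of \<alpha>] nn[of 1 2 0 0]]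
          mult_nonneg_nonneg[OF zero_le_power2[of \<alpha>] nn[of 1 1 2 0]] unfolding Y_def by simp
      have B': "N 2 0 (U 0 3) + N 4 0 (U 0 2) + N 6 0 (U 0 1) + N 8 0 (U 0 0) \<le> C2 * (Cd + 1) * Y"
      proof -
        have "C2 * (N 0 0 (U 0 4) + N 8 2 (U 0 0)) \<le> C2 * (Cd * Y + Y)"
          using A Y C2 unfolding L_def by (intro mult_left_mono add_mono) auto
        then show ?thesis using B by (simp add: algebra_simps)
      qed
      have q: "\<alpha>\<^sup>2 / (1 + \<alpha>\<^sup>2) * y \<le> y" "(1 + \<alpha>\<^sup>2) * y \<le> 2 * (\<alpha>\<^sup>2 * y)" if "0 \<le> y" for y
      proof -
        have "\<alpha>\<^sup>2 / (1 + \<alpha>\<^sup>2) \<le> 1" using a2 by (simp add: field_simps)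
            then show "\<alpha>\<^sup>2 / (1 + \<alpha>\<^sup>2) * y \<le> y" using mult_right_mono[of _ 1 y] that by fastforce
        show "(1 + \<alpha>\<^sup>2) * y \<le> 2 * (\<alpha>\<^sup>2 * y)" using mult_right_mono[OF a2(1) that] by (simp add: algebra_simps)
      qed
      have d': "N 0 0 (U 0 4) + N 0 0 (U 2 0) + \<alpha>\<^sup>2 * N 0 0 (U 1 2) + \<alpha>\<^sup>2 * N 2 0 (U 1 1) \<le> Cd * Y" using d unfolding Y_def .
      have "\<alpha>\<^sup>2 / (1 + \<alpha>\<^sup>2) * (N 0 0 (U 0 4) + N 0 0 (U 2 0)) + \<alpha>\<^sup>2 * N 0 0 (U 1 2)
        + (N 8 0 (U 0 0) + N 6 0 (U 0 1) + N 4 0 (U 0 2) + (1 + \<alpha>\<^sup>2) * N 4 0 (U 1 0)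
          + N 2 0 (U 0 3) + (1 + \<alpha>\<^sup>2) * N 2 0 (U 1 1)) \<le> 2 * (Cd * Y) + 2 * Y + C2 * (Cd + 1) * Y"
        using q(1)[of "N 0 0 (U 0 4) + N 0 0 (U 2 0)"] q(2)[of "N 4 0 (U 1 0)"] q(2)[of "N 2 0 (U 1 1)"]
          nn[of 0 4 0 0] nn[of 2 0 0 0] B' d' Y(3) mult_nonneg_nonneg[OF zero_le_power2[of \<alpha>] nn[of 1 2 0 0]]
          nn[of 1 0 4 0] nn[of 1 1 2 0] by linarith
      also have "\<dots> = (2 * Cd + 2 + C2 * (Cd + 1)) * Y" by (simp add: algebra_simps)
      also have "\<dots> \<le> C * X" using C(1,2) Y(1) YX by (intro mult_mono) auto
      finally show ?thesis .
    next
      case False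
      then have a1: "\<alpha> \<le> 1" by simp
      have tot: "N 4 0 (U 1 0) + N 4 0 (U 0 2) + N 2 0 (U 1 1) + N 2 0 (U 0 3) + \<alpha>\<^sup>2 * (N 0 0 (U 2 0) + N 0 0 (U 1 2) + N 0 0 (U 0 4))
        + N 6 0 (U 0 1) + N 8 0 (U 0 0) \<le> Cw * (F + L / \<alpha> ^ 8)"
      proof (rule weakly[where az = "N 4 6 (U 1 0)" and ?a2.0 = "N 4 6 (U 0 2)" and ?a1.0 = "N 6 4 (U 0 1)"
            and lz = "N 4 8 (U 1 0)" and ?lz1.0 = "N 2 8 (U 1 1)" and ?l3.0 = "N 2 8 (U 0 3)" and ?l2.0 = "N 4 8 (U 0 2)"
            and ?l1.0 = "N 6 8 (U 0 1)" and ?l0.0 = "N 8 8 (U 0 0)"])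
        show "N 4 0 (U 1 0) + N 4 0 (U 0 2) + N 2 0 (U 1 1) + N 2 0 (U 0 3) + \<alpha>\<^sup>2 * (N 0 0 (U 2 0) + N 0 0 (U 1 2) + N 0 0 (U 0 4))
          \<le> C3 * (F + N 4 8 (U 1 0) + N 4 8 (U 0 2) + N 2 8 (U 1 1) + N 2 8 (U 0 3))"
          unfolding N F_def C3_def by (rule w.beam_weakly_damped[OF \<alpha> a1 U \<mu>1 \<epsilon>2 f])
        show "N 6 0 (U 0 1) \<le> E * (N 4 0 (U 0 2) + N 6 8 (U 0 1))" using ell[of 1 4] by (simp add: eval_nat_numeral)
        show "N 8 0 (U 0 0) \<le> E * (N 6 0 (U 0 1) + N 8 8 (U 0 0))" using ell[of 0 6] by (simp add: eval_nat_numeral)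
        show "N 2 8 (U 0 3) \<le> d * N 0 0 (U 0 4) + (1 / d + M) * N 4 6 (U 0 2)" if "d > 0" for d
          using ip[of 0 2 d 0 6] that by (simp add: eval_nat_numeral)
        show "N 4 6 (U 0 2) \<le> d * N 2 0 (U 0 3) + (1 / d + M) * N 6 4 (U 0 1)" if "d > 0" for d
          using ip[of 0 1 d 2 4] that by (simp add: eval_nat_numeral)
        show "N 6 4 (U 0 1) \<le> d * N 4 0 (U 0 2) + (1 / d + M) * L" if "d > 0" for d
          using ip[of 0 0 d 4 2] that unfolding L_def by (simp add: eval_nat_numeral)
        show "N 2 8 (U 1 1) \<le> d * N 0 0 (U 1 2) + (1 / d + M) * N 4 6 (U 1 0)" if "d > 0" for d
          using ip[of 1 0 d 0 6] that by (simp add: eval_nat_numeral)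
        show "N 4 6 (U 1 0) \<le> d * N 0 0 (U 2 0) + (1 / d + M) * L" if d: "d > 0" for d
        proof -
          \<comment> \<open>Interpolation in time keeps the exponent 6; it is relaxed to 2 so that
            this branch ends in the same local term as the other one.\<close>
          have "(1 / d + M) * N 8 6 (U 0 0) \<le> (1 / d + M) * L"
            unfolding L_def using d M by (intro mult_left_mono mono) auto
          then show ?thesis using it[OF d, of 6] by linarith
        qed
        show "N 8 8 (U 0 0) \<le> L" unfolding L_def by (rule mono) auto
      qed (use \<alpha> a1 Xnn L in \<open>auto intro!: nn mono\<close>)
      have a2: "\<alpha>\<^sup>2 \<le> 1" using \<alpha> a1 by (simp add: power_le_one)
      have q: "\<alpha>\<^sup>2 / (1 + \<alpha>\<^sup>2) * y \<le> \<alpha>\<^sup>2 * y" "(1 + \<alpha>\<^sup>2) * y \<le> 2 * y" if "0 \<le> y" for y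
      proof -
        have "\<alpha>\<^sup>2 / (1 + \<alpha>\<^sup>2) \<le> \<alpha>\<^sup>2" using \<alpha> by (simp add: divide_le_eq mult_le_cancel_left1 add_pos_nonneg)
        then show "\<alpha>\<^sup>2 / (1 + \<alpha>\<^sup>2) * y \<le> \<alpha>\<^sup>2 * y" using that by (rule mult_right_mono)
        show "(1 + \<alpha>\<^sup>2) * y \<le> 2 * y" using mult_right_mono[OF a2 that] by (simp add: algebra_simps)
      qed
      have Y: "F + L / \<alpha> ^ 8 \<le> X" "0 \<le> F + L / \<alpha> ^ 8"
        unfolding X_def using Xnn L \<alpha> by (auto simp: distrib_right)
      have "\<alpha>\<^sup>2 / (1 + \<alpha>\<^sup>2) * (N 0 0 (U 0 4) + N 0 0 (U 2 0)) + \<alpha>\<^sup>2 * N 0 0 (U 1 2)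
        + (N 8 0 (U 0 0) + N 6 0 (U 0 1) + N 4 0 (U 0 2) + (1 + \<alpha>\<^sup>2) * N 4 0 (U 1 0)
          + N 2 0 (U 0 3) + (1 + \<alpha>\<^sup>2) * N 2 0 (U 1 1)) \<le> 2 * (Cw * (F + L / \<alpha> ^ 8))"
      proof -
        have "0 \<le> N 0 0 (U 0 4) + N 0 0 (U 2 0)" using nn[of 0 4 0 0] nn[of 2 0 0 0] by simp
        then have q1: "\<alpha>\<^sup>2 / (1 + \<alpha>\<^sup>2) * (N 0 0 (U 0 4) + N 0 0 (U 2 0)) \<le> \<alpha>\<^sup>2 * N 0 0 (U 0 4) + \<alpha>\<^sup>2 * N 0 0 (U 2 0)"
          using q(1)[of "N 0 0 (U 0 4) + N 0 0 (U 2 0)"] by (simp only: distrib_left)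
        have q2: "(1 + \<alpha>\<^sup>2) * N 4 0 (U 1 0) \<le> 2 * N 4 0 (U 1 0)" "(1 + \<alpha>\<^sup>2) * N 2 0 (U 1 1) \<le> 2 * N 2 0 (U 1 1)"
          by (intro q(2) nn; simp)+
        note t = tot[unfolded distrib_left[of "\<alpha>\<^sup>2"]]
        have p: "0 \<le> N 4 0 (U 1 0)" "0 \<le> N 4 0 (U 0 2)" "0 \<le> N 2 0 (U 1 1)" "0 \<le> N 2 0 (U 0 3)"
          "0 \<le> \<alpha>\<^sup>2 * N 0 0 (U 2 0)" "0 \<le> \<alpha>\<^sup>2 * N 0 0 (U 1 2)" "0 \<le> \<alpha>\<^sup>2 * N 0 0 (U 0 4)"
          "0 \<le> N 6 0 (U 0 1)" "0 \<le> N 8 0 (U 0 0)"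
          by (simp_all add: nn)
        show ?thesis by (rule weakly_damped_combination[OF q1 q2 t p])
      qed
      also have "\<dots> = (2 * Cw) * (F + L / \<alpha> ^ 8)" by simp
      also have "\<dots> \<le> C * X" using C(1,3) Y by (intro mult_mono) auto
      finally show ?thesis .
    qed
    then show "beam_estimate C \<alpha> \<mu> (carleman_weight.N T \<theta> \<Lambda> g) (carleman_weight.I T \<theta>) U"
      unfolding beam_estimate_def X_def F_def L_def N_def[symmetric] f_def[symmetric] by (simp add: f_def)
  qed
qed

subsection \<open>Regularity of the unknown\<close>

lemma deriv_iterate_periodic:
  fixes f :: "real \<Rightarrow> real"
  assumes "\<And>x. f (x + p) = f x"
  shows "(deriv ^^ j) f (x + p) = (deriv ^^ j) f x"
proof (induction j arbitrary: x)
  case (Suc j)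
  have "(\<lambda>y. (deriv ^^ j) f (y + p)) = (deriv ^^ j) f" using Suc by auto
  moreover have "deriv F (x + p) = deriv (\<lambda>y. F (y + p)) x" for F :: "real \<Rightarrow> real"
    by (simp add: deriv_def DERIV_shift)
  ultimately show ?case by simp
qed (use assms in simp)

lemma torus_funD: "torus_fun f \<Longrightarrow> f (x + 2 * pi) = f x"
  unfolding torus_fun_def by (rule periodic_fun_simple.plus_period)

lemma torus_fun_representative:
  fixes f :: "real \<Rightarrow> 'b"
  assumes "\<And>x. f (x + 2 * pi) = f x"
  obtains y where "y \<in> {0..<2 * pi}" "f y = f x"
proof -
  interpret periodic_fun_simple f "2 * pi" by standard (rule assms)
  define n where "n = \<lfloor>x / (2 * pi)\<rfloor>"
  have "of_int n \<le> x / (2 * pi)" "x / (2 * pi) < of_int n + 1" unfolding n_def by linarith+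
  then have "x + of_int (- n) * (2 * pi) \<in> {0..<2 * pi}" by (auto simp: field_simps)
  moreover have "f (x + of_int (- n) * (2 * pi)) = f x" by (rule plus_of_int)
  ultimately show ?thesis by (rule that)
qed

lemma torus_Cn_DERIV:
  assumes "torus_Cn n f" "j < n"
  shows "((deriv ^^ j) f has_real_derivative (deriv ^^ Suc j) f x) (at x)"
  using assms DERIV_deriv_iff_real_differentiable by (auto simp: torus_Cn_def)

lemma torus_Cn_continuous:
  assumes "torus_Cn n f" "j \<le> n"
  shows "continuous_on UNIV ((deriv ^^ j) f)"
proof (cases "j = n")
  case False
  then show ?thesis using torus_Cn_DERIV[OF assms(1), of j] assms(2)
    by (intro continuous_at_imp_continuous_on) (auto intro: DERIV_isCont)
qed (use assms in \<open>simp add: torus_Cn_def\<close>)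

lemma torus_Cn_periodic:
  assumes "torus_Cn n f" shows "(deriv ^^ j) f (x + 2 * pi) = (deriv ^^ j) f x"
  using assms by (intro deriv_iterate_periodic torus_funD) (simp add: torus_Cn_def)

lemma torus_continuous_bounded:
  fixes f :: "real \<Rightarrow> real"
  assumes "continuous_on UNIV f" "\<And>x. f (x + 2 * pi) = f x"
  shows "\<exists>B. \<forall>x. \<bar>f x\<bar> \<le> B"
proof -
  have "compact (f ` {0..2 * pi})"
    by (intro compact_continuous_image continuous_on_subset[OF assms(1)]) auto
  then obtain B where B: "\<forall>y\<in>{0..2 * pi}. \<bar>f y\<bar> \<le> B"
    using compact_imp_bounded[of "f ` {0..2 * pi}"] by (auto simp: bounded_iff)
  have "\<bar>f x\<bar> \<le> B" for x
  proof -
    obtain y where "y \<in> {0..<2 * pi}" "f y = f x"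
      by (rule torus_fun_representative[of f x]) (use assms(2) in auto)
    then show ?thesis using B by (metis atLeastAtMost_iff atLeastLessThan_iff less_imp_le)
  qed
  then show ?thesis by blast
qed

text \<open>A supremum of reals is an upper bound only for a set that is bounded above; continuity
  and periodicity of each derivative supply this.\<close>

lemma Cn_norm_bound:
  assumes "torus_Cn n f" "j \<le> n"
  shows "\<bar>(deriv ^^ j) f x\<bar> \<le> Cn_norm n f"
proof -
  have bdd: "bdd_above (range (\<lambda>x. \<bar>(deriv ^^ i) f x\<bar>))" if i: "i \<le> n" for i
  proof -
    obtain B where "\<forall>x. \<bar>(deriv ^^ i) f x\<bar> \<le> B"
      using torus_continuous_bounded[OF torus_Cn_continuous[OF assms(1) i] torus_Cn_periodic[OF assms(1)]] by blast
    then show ?thesis by (auto intro!: bdd_aboveI[of _ B])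
  qed
  have up: "\<bar>(deriv ^^ i) f y\<bar> \<le> (SUP x. \<bar>(deriv ^^ i) f x\<bar>)" if "i \<le> n" for i y
    by (rule cSUP_upper[OF _ bdd[OF that]]) simp
  have "\<bar>(deriv ^^ j) f x\<bar> \<le> (SUP x. \<bar>(deriv ^^ j) f x\<bar>)" by (rule up[OF assms(2)])
  also have "\<dots> \<le> Cn_norm n f"
    unfolding Cn_norm_def
    by (rule member_le_sum) (use assms(2) up in \<open>auto intro: order_trans[OF abs_ge_zero]\<close>)
  finally show ?thesis .
qed

lemma torus_Cn_lincomb:
  assumes f: "torus_Cn n f" and g: "torus_Cn n g"
  shows "j \<le> n \<Longrightarrow> (deriv ^^ j) (\<lambda>x. a * f x + b * g x) = (\<lambda>x. a * (deriv ^^ j) f x + b * (deriv ^^ j) g x)"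
    and "torus_Cn n (\<lambda>x. a * f x + b * g x)"
proof -
  show D: "(deriv ^^ j) (\<lambda>x. a * f x + b * g x) = (\<lambda>x. a * (deriv ^^ j) f x + b * (deriv ^^ j) g x)" if "j \<le> n" for j
    using that
  proof (induction j)
    case (Suc j)
    then have "(deriv ^^ Suc j) (\<lambda>x. a * f x + b * g x) = deriv (\<lambda>x. a * (deriv ^^ j) f x + b * (deriv ^^ j) g x)" by simp
    also have "\<dots> = (\<lambda>x. a * (deriv ^^ Suc j) f x + b * (deriv ^^ Suc j) g x)"
    proof
      fix x
      show "deriv (\<lambda>x. a * (deriv ^^ j) f x + b * (deriv ^^ j) g x) x = a * (deriv ^^ Suc j) f x + b * (deriv ^^ Suc j) g x"
        by (rule DERIV_imp_deriv)
          (use Suc.prems torus_Cn_DERIV[OF f, of j x] torus_Cn_DERIV[OF g, of j x] in \<open>auto intro!: derivative_eq_intros\<close>)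
    qed
    finally show ?case .
  qed simp
  have "torus_fun (\<lambda>x. a * f x + b * g x)"
    unfolding torus_fun_def
    by unfold_locales (use f g in \<open>simp add: torus_Cn_def torus_funD\<close>)
  moreover have "(deriv ^^ i) (\<lambda>x. a * f x + b * g x) differentiable (at x)" if "i < n" for i x
  proof -
    have "(deriv ^^ i) (\<lambda>x. a * f x + b * g x) = (\<lambda>x. a * (deriv ^^ i) f x + b * (deriv ^^ i) g x)" using that by (intro D) simp
    then show ?thesis using f g that
      by (auto simp: torus_Cn_def intro!: differentiable_add differentiable_mult)
  qed
  moreover have "continuous_on UNIV ((deriv ^^ n) (\<lambda>x. a * f x + b * g x))"
    unfolding D[OF order_refl] using f g by (auto simp: torus_Cn_def intro!: continuous_intros)
  ultimately show "torus_Cn n (\<lambda>x. a * f x + b * g x)" unfolding torus_Cn_def by blast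
qed

lemma torus_Cn_diff:
  assumes "torus_Cn n f" "torus_Cn n g"
  shows "j \<le> n \<Longrightarrow> (deriv ^^ j) (\<lambda>x. f x - g x) = (\<lambda>x. (deriv ^^ j) f x - (deriv ^^ j) g x)"
    and "torus_Cn n (\<lambda>x. f x - g x)"
  using torus_Cn_lincomb[OF assms, where a = 1 and b = "- 1"] by auto

lemma torus_Cn_quotient:
  assumes "torus_Cn n f" "torus_Cn n g" "torus_Cn n h"
  shows "j \<le> n \<Longrightarrow> (deriv ^^ j) (\<lambda>x. (f x - g x) / r - h x)
      = (\<lambda>x. ((deriv ^^ j) f x - (deriv ^^ j) g x) / r - (deriv ^^ j) h x)"
    and "torus_Cn n (\<lambda>x. (f x - g x) / r - h x)"
  using torus_Cn_lincomb[OF torus_Cn_diff(2)[OF assms(1,2)] assms(3), where a = "1 / r" and b = "- 1"]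
    torus_Cn_diff(1)[OF assms(1,2)] by auto

section \<open>Functions of class C^j in time with values in C^n\<close>

lemma C_time_torus_Cn: "C_time j n T u \<Longrightarrow> t \<in> {0..T} \<Longrightarrow> torus_Cn n (u t)"
  by (cases j) auto

text \<open>For j > 0 continuity in the norm is not part of \<open>C_time\<close> but follows from
  the difference quotient: the increment is |r - t| times something bounded near t. The time r = t
  is left out, as the quotient degenerates there.\<close>

lemma C_time_modulus:
  assumes u: "C_time j n T u" and t: "t \<in> {0..T}"
  obtains b where "\<And>r i x. r \<in> {0..T} \<Longrightarrow> r \<noteq> t \<Longrightarrow> i \<le> n \<Longrightarrow> \<bar>(deriv ^^ i) (u r) x - (deriv ^^ i) (u t) x\<bar> \<le> b r"
    "(b \<longlongrightarrow> 0) (at t within {0..T})"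
proof (cases j)
  case 0
  show ?thesis
  proof (rule that)
    show "((\<lambda>r. Cn_norm n (\<lambda>x. u r x - u t x)) \<longlongrightarrow> 0) (at t within {0..T})" using u t 0 by simp
    fix r i x assume r: "r \<in> {0..T}" and i: "i \<le> n"
    show "\<bar>(deriv ^^ i) (u r) x - (deriv ^^ i) (u t) x\<bar> \<le> Cn_norm n (\<lambda>x. u r x - u t x)"
      using Cn_norm_bound[OF torus_Cn_diff(2)[OF C_time_torus_Cn[OF u r] C_time_torus_Cn[OF u t]] i, of x]
        torus_Cn_diff(1)[OF C_time_torus_Cn[OF u r] C_time_torus_Cn[OF u t] i] by simp
  qed
next
  case (Suc k)
  then obtain v where v: "C_time k n T v"
    "((\<lambda>r. Cn_norm n (\<lambda>x. (u r x - u t x) / (r - t) - v t x)) \<longlongrightarrow> 0) (at t within {0..T})"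
    using u t by auto
  define b where "b = (\<lambda>r. \<bar>r - t\<bar> * (Cn_norm n (\<lambda>x. (u r x - u t x) / (r - t) - v t x) + Cn_norm n (v t)))"
  show ?thesis
  proof (rule that[of b])
    have "(b \<longlongrightarrow> \<bar>t - t\<bar> * (0 + Cn_norm n (v t))) (at t within {0..T})"
      unfolding b_def by (intro tendsto_intros v(2))
    then show "(b \<longlongrightarrow> 0) (at t within {0..T})" by simp
    fix r i x assume r: "r \<in> {0..T}" "r \<noteq> t" and i: "i \<le> n"
    note cn = C_time_torus_Cn[OF u r(1)] C_time_torus_Cn[OF u t] C_time_torus_Cn[OF v(1) t]
    define q where "q = ((deriv ^^ i) (u r) x - (deriv ^^ i) (u t) x) / (r - t)"
    have "\<bar>q - (deriv ^^ i) (v t) x\<bar> \<le> Cn_norm n (\<lambda>x. (u r x - u t x) / (r - t) - v t x)"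
      using Cn_norm_bound[OF torus_Cn_quotient(2)[OF cn] i, of "r - t" x] torus_Cn_quotient(1)[OF cn i]
      by (simp add: q_def)
    moreover have "\<bar>(deriv ^^ i) (v t) x\<bar> \<le> Cn_norm n (v t)" by (rule Cn_norm_bound[OF cn(3) i])
    ultimately have "\<bar>q\<bar> \<le> Cn_norm n (\<lambda>x. (u r x - u t x) / (r - t) - v t x) + Cn_norm n (v t)" by linarith
    then have "\<bar>r - t\<bar> * \<bar>q\<bar> \<le> b r" unfolding b_def by (intro mult_left_mono) auto
    moreover have "(r - t) * q = (deriv ^^ i) (u r) x - (deriv ^^ i) (u t) x" using r by (simp add: q_def)
    ultimately show "\<bar>(deriv ^^ i) (u r) x - (deriv ^^ i) (u t) x\<bar> \<le> b r" by (metis abs_mult)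
  qed
qed

text \<open>Continuity in t, uniform in x, together with continuity in x at the fixed time
  t.\<close>

lemma C_time_continuous:
  assumes u: "C_time j n T u" and i: "i \<le> n"
  shows "continuous_on ({0..T} \<times> UNIV) (\<lambda>p. (deriv ^^ i) (u (fst p)) (snd p))"
  unfolding continuous_on_iff
proof (intro ballI allI impI)
  fix p :: "real \<times> real" and e :: real assume p: "p \<in> {0..T} \<times> UNIV" and e: "0 < e"
  obtain t x where tx: "p = (t, x)" by (cases p)
  have t': "t \<in> {0..T}" using p tx by simp
  obtain b where b: "\<And>r x. r \<in> {0..T} \<Longrightarrow> r \<noteq> t \<Longrightarrow> \<bar>(deriv ^^ i) (u r) x - (deriv ^^ i) (u t) x\<bar> \<le> b r"
    and lim: "(b \<longlongrightarrow> 0) (at t within {0..T})"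
    using C_time_modulus[OF u t'] i by metis
  have "\<forall>\<^sub>F r in at t within {0..T}. dist (b r) 0 < e / 2" using lim e tendstoD[of b 0 _ "e / 2"] by simp
  then obtain d where d: "d > 0" "\<And>r. r \<in> {0..T} \<Longrightarrow> r \<noteq> t \<Longrightarrow> dist r t < d \<Longrightarrow> \<bar>b r\<bar> < e / 2"
    unfolding eventually_at by auto
  have "isCont ((deriv ^^ i) (u t)) x"
    using torus_Cn_continuous[OF C_time_torus_Cn[OF u t'] i] by (simp add: continuous_on_eq_continuous_at)
  then obtain d' where d': "d' > 0" "\<And>y. dist y x < d' \<Longrightarrow> dist ((deriv ^^ i) (u t) y) ((deriv ^^ i) (u t) x) < e / 2"
    unfolding continuous_at_eps_delta using e by (metis half_gt_zero)
  show "\<exists>d>0. \<forall>q\<in>{0..T} \<times> UNIV. dist q p < d \<longrightarrow>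
      dist ((deriv ^^ i) (u (fst q)) (snd q)) ((deriv ^^ i) (u (fst p)) (snd p)) < e"
  proof (intro exI[of _ "min d d'"] conjI ballI impI)
    fix q :: "real \<times> real" assume q: "q \<in> {0..T} \<times> UNIV" and ds: "dist q p < min d d'"
    obtain r y where ry: "q = (r, y)" by (cases q)
    have r: "0 \<le> r" "r \<le> T" using q ry by auto
    have "dist r t < d" "dist y x < d'"
      using ds dist_fst_le[of q p] dist_snd_le[of q p] by (auto simp: tx ry)
    moreover have "\<bar>(deriv ^^ i) (u r) y - (deriv ^^ i) (u t) y\<bar> < e / 2"
    proof (cases "r = t")
      case False
      then show ?thesis using b[of r y] d(2)[of r] r \<open>dist r t < d\<close> by force
    qed (use e in simp)
    moreover have "\<bar>(deriv ^^ i) (u t) y - (deriv ^^ i) (u t) x\<bar> < e / 2"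
      using d'(2)[OF \<open>dist y x < d'\<close>] by (simp add: dist_real_def)
    ultimately show "dist ((deriv ^^ i) (u (fst q)) (snd q)) ((deriv ^^ i) (u (fst p)) (snd p)) < e"
      unfolding dist_real_def tx ry fst_conv snd_conv by linarith
  qed (use d d' in auto)
qed

lemma C_time_tempered:
  assumes u: "C_time j n T u" and i: "i \<le> n"
  shows "tempered T (\<lambda>t. (deriv ^^ i) (u t))"
proof -
  have c: "continuous_on ({0..T} \<times> UNIV) (\<lambda>p. (deriv ^^ i) (u (fst p)) (snd p))" by (rule C_time_continuous[OF u i])
  have "compact ((\<lambda>p. (deriv ^^ i) (u (fst p)) (snd p)) ` ({0..T} \<times> {0..2 * pi}))"
    by (intro compact_continuous_image continuous_on_subset[OF c] compact_Times compact_Icc) auto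
  from compact_imp_bounded[OF this] obtain B
    where B: "\<forall>t\<in>{0..T}. \<forall>x\<in>{0..2 * pi}. \<bar>(deriv ^^ i) (u t) x\<bar> \<le> B"
    by (auto simp: bounded_iff)
  have per: "(deriv ^^ i) (u t) (x + 2 * pi) = (deriv ^^ i) (u t) x" if "t \<in> {0..T}" for t x
    by (rule torus_Cn_periodic[OF C_time_torus_Cn[OF u that]])
  show ?thesis
  proof (rule tempered_bounded[of _ _ B])
    show "continuous_on ({0<..<T} \<times> UNIV) (\<lambda>p. (deriv ^^ i) (u (fst p)) (snd p))"
      by (rule continuous_on_subset[OF c]) auto
    fix t x assume t: "t \<in> {0<..<T}"
    show "(deriv ^^ i) (u t) (x + 2 * pi) = (deriv ^^ i) (u t) x" using per t by simp
    obtain y where "y \<in> {0..<2 * pi}" "(deriv ^^ i) (u t) y = (deriv ^^ i) (u t) x"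
      by (rule torus_fun_representative[of "(deriv ^^ i) (u t)" x]) (use per t in auto)
    then show "\<bar>(deriv ^^ i) (u t) x\<bar> \<le> B" using B[rule_format, of t y] t by simp
  qed
qed

lemma C_time_DERIV_x:
  assumes "C_time j n T u" "t \<in> {0<..<T}" "i < n"
  shows "((deriv ^^ i) (u t) has_real_derivative (deriv ^^ Suc i) (u t) x) (at x)"
  using assms by (intro torus_Cn_DERIV[OF C_time_torus_Cn]) auto

text \<open>Convergence of difference quotients in the C^n norm differentiates all x-derivatives at
  once, so one function v serves every order i and the time derivative commutes with those in
  x.\<close>

lemma C_time_Suc_DERIV_t:
  assumes u: "C_time (Suc j) n T u"
  obtains v where "C_time j n T v"
    "\<And>t x i. t \<in> {0<..<T} \<Longrightarrow> i \<le> n \<Longrightarrow> ((\<lambda>r. (deriv ^^ i) (u r) x) has_real_derivative (deriv ^^ i) (v t) x) (at t)"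
proof -
  obtain v where v: "C_time j n T v"
    and lim: "\<And>t. t \<in> {0..T} \<Longrightarrow> ((\<lambda>r. Cn_norm n (\<lambda>x. (u r x - u t x) / (r - t) - v t x)) \<longlongrightarrow> 0) (at t within {0..T})"
    using u by auto
  show ?thesis
  proof (rule that[OF v])
    fix t x i assume t: "t \<in> {0<..<T}" and i: "i \<le> n"
    then have t': "t \<in> {0..T}" by simp
    have "((\<lambda>r. ((deriv ^^ i) (u r) x - (deriv ^^ i) (u t) x) / (r - t) - (deriv ^^ i) (v t) x) \<longlongrightarrow> 0) (at t within {0..T})"
    proof (rule Lim_null_comparison[OF _ lim[OF t']])
      show "\<forall>\<^sub>F r in at t within {0..T}. norm (((deriv ^^ i) (u r) x - (deriv ^^ i) (u t) x) / (r - t) - (deriv ^^ i) (v t) x)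
          \<le> Cn_norm n (\<lambda>x. (u r x - u t x) / (r - t) - v t x)"
        unfolding eventually_at_filter
      proof (intro always_eventually allI impI)
        fix r assume r: "r \<in> {0..T}"
        note cn = C_time_torus_Cn[OF u r] C_time_torus_Cn[OF u t'] C_time_torus_Cn[OF v(1) t']
        show "norm (((deriv ^^ i) (u r) x - (deriv ^^ i) (u t) x) / (r - t) - (deriv ^^ i) (v t) x)
          \<le> Cn_norm n (\<lambda>x. (u r x - u t x) / (r - t) - v t x)"
          using Cn_norm_bound[OF torus_Cn_quotient(2)[OF cn] i, of "r - t" x] torus_Cn_quotient(1)[OF cn i] by simp
      qed
    qed
    then have "((\<lambda>r. (deriv ^^ i) (u r) x) has_real_derivative (deriv ^^ i) (v t) x) (at t within {0..T})"
      unfolding has_field_derivative_iff by (simp add: LIM_zero_iff)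
    moreover have "at t within {0..T} = at t" using t by (intro at_within_interior) auto
    ultimately show "((\<lambda>r. (deriv ^^ i) (u r) x) has_real_derivative (deriv ^^ i) (v t) x) (at t)" by simp
  qed
qed

lemma deriv_cong_interval:
  fixes f g :: "real \<Rightarrow> real"
  assumes "\<And>r. r \<in> {0<..<T} \<Longrightarrow> f r = g r" "t \<in> {0<..<T}"
  shows "deriv f t = deriv g t"
proof (rule deriv_cong_ev)
  show "\<forall>\<^sub>F r in nhds t. f r = g r"
    using eventually_nhds_in_open[of "{0<..<T}" t] assms by (auto elim: eventually_mono)
qed simp

text \<open>Links the iterated \<open>deriv\<close> of the final statement with a family
  \<open>U\<close>. The identities are for 0 < t < T only: values of \<eta> outside [0,T] are
  arbitrary, and a two-sided \<open>deriv\<close> at an end point would see them.\<close>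

lemma C_time_beam_regular:
  assumes "C_time 2 4 T \<eta>"
  obtains U where "beam_regular T U"
    "\<And>j t x. t \<in> {0<..<T} \<Longrightarrow> j \<le> 4 \<Longrightarrow> Dx j \<eta> t x = U 0 j t x"
    "\<And>t x. t \<in> {0<..<T} \<Longrightarrow> Dt 1 \<eta> t x = U 1 0 t x"
    "\<And>t x. t \<in> {0<..<T} \<Longrightarrow> Dt 2 \<eta> t x = U 2 0 t x"
    "\<And>j t x. t \<in> {0<..<T} \<Longrightarrow> j \<le> 4 \<Longrightarrow> Dt 1 (Dx j \<eta>) t x = U 1 j t x"
    "\<And>j t x. t \<in> {0<..<T} \<Longrightarrow> j \<le> 4 \<Longrightarrow> Dx j (Dt 1 \<eta>) t x = U 1 j t x"
proof -
  have c0: "C_time (Suc (Suc 0)) 4 T \<eta>" using assms by (simp only: numeral_2_eq_2)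
  obtain v where v: "C_time (Suc 0) 4 T v"
    and dv: "\<And>t x i. t \<in> {0<..<T} \<Longrightarrow> i \<le> 4 \<Longrightarrow> ((\<lambda>r. (deriv ^^ i) (\<eta> r) x) has_real_derivative (deriv ^^ i) (v t) x) (at t)"
    by (rule C_time_Suc_DERIV_t[OF c0]) blast
  obtain w where w: "C_time 0 4 T w"
    and dw: "\<And>t x i. t \<in> {0<..<T} \<Longrightarrow> i \<le> 4 \<Longrightarrow> ((\<lambda>r. (deriv ^^ i) (v r) x) has_real_derivative (deriv ^^ i) (w t) x) (at t)"
    by (rule C_time_Suc_DERIV_t[OF v]) blast
  define u where "u = (\<lambda>i::nat. if i = 0 then \<eta> else if i = 1 then v else w)"
  define U where "U = (\<lambda>i j t. (deriv ^^ j) (u i t))"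
  have cu: "C_time (2 - i) 4 T (u i)" if "i \<le> 2" for i :: nat
  proof -
    have "i = 0 \<or> i = 1 \<or> i = 2" using that by auto
    then show ?thesis using c0 v w by (auto simp: u_def numeral_2_eq_2)
  qed
  have dxv: "deriv (\<lambda>r. \<eta> r x) t = v t x" if "t \<in> {0<..<T}" for t x
    using DERIV_imp_deriv[OF dv[OF that, of 0 x]] by simp
  have r1: "beam_regular T U"
    unfolding beam_regular_def
  proof (intro conjI allI impI)
    show "tempered T (U i j)" if "i \<le> 2" "j \<le> 4" for i j
      unfolding U_def by (rule C_time_tempered[OF cu[OF that(1)] that(2)])
    show "has_dx T (U i j) (U i (Suc j))" if "i \<le> 2" "j < 4" for i j
      unfolding U_def by (intro has_dxI C_time_DERIV_x[OF cu] that)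
    show "has_dt T (U i j) (U (Suc i) j)" if "i < 2" "j \<le> 4" for i j
    proof (rule has_dtI)
      fix t x assume t: "t \<in> {0<..<T}"
      have "i = 0 \<or> i = 1" using that by auto
      then show "((\<lambda>r. U i j r x) has_real_derivative U (Suc i) j t x) (at t)"
        unfolding U_def u_def using dv[OF t that(2), of x] dw[OF t that(2), of x] by auto
    qed
  qed
  have r2: "Dx j \<eta> t x = U 0 j t x" for j t x unfolding Dx_def U_def u_def by simp
  have r3: "Dt 1 \<eta> t x = U 1 0 t x" if "t \<in> {0<..<T}" for t x
    unfolding Dt_def U_def u_def using dxv[OF that] by simp
  have r4: "Dt 2 \<eta> t x = U 2 0 t x" if t: "t \<in> {0<..<T}" for t x
  proof -
    \<comment> \<open>The first time derivative is identified only on (0,T), but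
      \<open>deriv\<close> depends only on a neighbourhood of t.\<close>
    have "deriv (deriv (\<lambda>r. \<eta> r x)) t = deriv (\<lambda>r. v r x) t"
      by (rule deriv_cong_interval[OF dxv t])
    also have "\<dots> = w t x" using DERIV_imp_deriv[OF dw[OF t, of 0 x]] by simp
    finally show ?thesis unfolding Dt_def U_def u_def by (simp add: numeral_2_eq_2)
  qed
  have r5: "Dt 1 (Dx j \<eta>) t x = U 1 j t x" if "t \<in> {0<..<T}" "j \<le> 4" for j t x
    unfolding Dt_def Dx_def U_def u_def using DERIV_imp_deriv[OF dv[OF that]] by simp
  have r6: "Dx j (Dt 1 \<eta>) t x = U 1 j t x" if "t \<in> {0<..<T}" for j t x
  proof -
    have "(\<lambda>y. Dt 1 \<eta> t y) = v t" using dxv[OF that] by (auto simp: Dt_def)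
    then show ?thesis unfolding Dx_def U_def u_def by simp
  qed
  show ?thesis by (rule that[of U]) (rule r1 r2 r3 r4 r5 r6; assumption)+
qed

subsection \<open>The concrete weight\<close>

text \<open>Valid for arbitrary f and A: where the essential supremum is infinite of either sign,
  for instance over a null set or for non-measurable f, \<open>real_of_ereal\<close> returns
  0.\<close>

lemma Linfty_norm_nonneg: "0 \<le> Linfty_norm A f"
proof -
  define M where "M = restrict_space lborel A"
  define h where "h = (\<lambda>x. ereal \<bar>f x\<bar>)"
  have "0 \<le> real_of_ereal (esssup M h)"
  proof (cases "h \<in> borel_measurable M \<and> emeasure M (space M) \<noteq> 0")
    case True
    have "esssup M (\<lambda>x. 0) \<le> esssup M h" by (rule esssup_mono) (auto simp: h_def)
    then show ?thesis using True by (simp add: esssup_const real_of_ereal_pos)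
  next
    case False
    then show ?thesis
      by (cases "h \<in> borel_measurable M") (auto simp: esssup_zero_space esssup_non_measurable top_ereal_def)
  qed
  then show ?thesis unfolding Linfty_norm_def M_def h_def .
qed

text \<open>By continuity, a value above the norm would persist on an interval of positive length
  inside {p..<q}, contradicting the almost-everywhere bound.\<close>

lemma continuous_le_Linfty_norm:
  fixes f :: "real \<Rightarrow> real"
  assumes f: "continuous_on UNIV f" and b: "\<And>x. \<bar>f x\<bar> \<le> B" and x: "x \<in> {p..<q}"
  shows "f x \<le> Linfty_norm {p..<q} f"
proof (rule ccontr)
  assume less: "\<not> f x \<le> Linfty_norm {p..<q} f"
  define M where "M = restrict_space lborel {p..<q}"
  define h where "h = (\<lambda>x. ereal \<bar>f x\<bar>)"
  define s where "s = Linfty_norm {p..<q} f"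
  have fm: "f \<in> borel_measurable borel" using f by (rule borel_measurable_continuous_onI)
  have hm: "h \<in> borel_measurable M"
    unfolding h_def M_def by (rule measurable_restrict_space1) (use fm in measurable)
  have up: "esssup M h \<le> ereal B" by (rule esssup_I[OF hm]) (use b in \<open>auto simp: h_def\<close>)
  have ae: "AE y in M. h y \<le> esssup M h" by (rule esssup_AE)
  have "esssup M h \<le> ereal s"
  proof (cases "esssup M h")
    case (real r)
    then show ?thesis unfolding s_def Linfty_norm_def M_def h_def by simp
  qed (use up in auto)
  then have "\<bar>f y\<bar> \<le> s" if "h y \<le> esssup M h" for y
    using that unfolding h_def by (metis ereal_less_eq(3) order_trans)
  then have "AE y in M. \<bar>f y\<bar> \<le> s" using ae by (auto elim: eventually_mono)
  then have ae2: "AE y in lborel. y \<in> {p..<q} \<longrightarrow> \<bar>f y\<bar> \<le> s"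
    unfolding M_def by (subst (asm) AE_restrict_space_iff) auto
  obtain d where d: "d > 0" "\<And>y. \<bar>y - x\<bar> < d \<Longrightarrow> s < f y"
  proof -
    have "isCont f x" using f by (simp add: continuous_on_eq_continuous_at)
    then have "((\<lambda>y. f y) \<longlongrightarrow> f x) (nhds x)" by (simp add: isCont_def tendsto_at_iff_tendsto_nhds)
    moreover have "s < f x" using less by (simp add: s_def)
    ultimately have "\<forall>\<^sub>F y in nhds x. s < f y" by (rule order_tendstoD(1))
    then show ?thesis using that unfolding eventually_nhds_metric dist_real_def by blast
  qed
  \<comment> \<open>The interval is taken to the right of x, since x may equal p but never
    q.\<close>
  define e where "e = min (x + d) q"
  have e: "x < e" "e \<le> q" "e \<le> x + d" using d x by (auto simp: e_def)
  have "y \<notin> {x<..<e}" if "y \<in> {p..<q} \<longrightarrow> \<bar>f y\<bar> \<le> s" for y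
  proof
    assume y: "y \<in> {x<..<e}"
    then have "s < f y" using d(2)[of y] e by auto
    then show False using that y e x by auto
  qed
  then have "AE y in lborel. y \<notin> {x<..<e}" using ae2 by (auto elim: eventually_mono)
  then have "emeasure lborel {x<..<e} = 0"
    by (subst (asm) AE_iff_measurable[of "{x<..<e}"]) auto
  then show False using e by simp
qed

text \<open>The \<Omega> part of \<open>Psi\<close> only adds a nonnegative amount. This pointwise
  bound is what makes \<open>phi0\<close> negative.\<close>

lemma Psi_upper_bound:
  assumes "torus_Cn 0 f" shows "f x \<le> Psi h f"
proof -
  have c: "continuous_on UNIV f" using torus_Cn_continuous[OF assms, of 0] by simp
  have p: "f (x + 2 * pi) = f x" for x using torus_Cn_periodic[OF assms, of 0] by simp
  obtain B where B: "\<And>x. \<bar>f x\<bar> \<le> B" using torus_continuous_bounded[OF c p] by blast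
  obtain y where y: "y \<in> {0..<2 * pi}" "f y = f x" by (rule torus_fun_representative[of f x]) (use p in auto)
  show ?thesis
    using continuous_le_Linfty_norm[OF c B y(1)] Linfty_norm_nonneg[of "{0..<2*pi} \<times> {0<..<1}" h] y(2)
    unfolding Psi_def by simp
qed

text \<open>From exponent 2 on, the corner of the positive part at 0 disappears: the difference
  quotient there is at most |v|^(n + 1).\<close>

lemma positive_part_power_DERIV:
  "((\<lambda>u::real. max 0 u ^ (n + 2)) has_real_derivative real (n + 2) * max 0 u ^ (n + 1)) (at u)"
proof -
  consider "u > 0" | "u < 0" | "u = 0" by linarith
  then show ?thesis
  proof cases
    case 1
    have "((\<lambda>u::real. u ^ (n + 2)) has_real_derivative real (n + 2) * max 0 u ^ (n + 1)) (at u)"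
      using DERIV_pow[of "n + 2" u] 1 by (simp add: max_def)
    moreover have "\<forall>\<^sub>F v in nhds u. v ^ (n + 2) = max 0 v ^ (n + 2)"
      using eventually_nhds_in_open[of "{0<..}" u] 1 by (auto elim: eventually_mono)
    ultimately show ?thesis by (subst (asm) DERIV_cong_ev[OF refl _ refl]) auto
  next
    case 2
    have "((\<lambda>u::real. 0) has_real_derivative real (n + 2) * max 0 u ^ (n + 1)) (at u)"
      using 2 by simp
    moreover have "\<forall>\<^sub>F v in nhds u. 0 = max 0 v ^ (n + 2)"
      using eventually_nhds_in_open[of "{..<0}" u] 2 by (auto elim: eventually_mono)
    ultimately show ?thesis by (subst (asm) DERIV_cong_ev[OF refl _ refl]) auto
  next
    case 3
    have "((\<lambda>v. max 0 v ^ (n + 2) / v) \<longlongrightarrow> 0) (at (0::real))"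
    proof (rule Lim_null_comparison)
      have "norm (max 0 v ^ (n + 2) / v) \<le> \<bar>v\<bar> ^ (n + 1)" for v :: real
      proof (cases "v > 0")
        case False
        then have "norm (max 0 v ^ (n + 2) / v) = 0" by simp
        then show ?thesis using zero_le_power[of "\<bar>v\<bar>" "n + 1"] by linarith
      qed simp
      then show "\<forall>\<^sub>F v in at (0::real). norm (max 0 v ^ (n + 2) / v) \<le> \<bar>v\<bar> ^ (n + 1)" by simp
      have "((\<lambda>v::real. \<bar>v\<bar> ^ (n + 1)) \<longlongrightarrow> \<bar>0\<bar> ^ (n + 1)) (at 0)" by (intro tendsto_intros)
      then show "((\<lambda>v::real. \<bar>v\<bar> ^ (n + 1)) \<longlongrightarrow> 0) (at 0)" by simp
    qed
    then show ?thesis unfolding 3 has_field_derivative_iff by simp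
  qed
qed

text \<open>
  The cutoff is \<open>g = max 0 (1 - (\<psi>' / \<delta>)\<^sup>2)\<close>. Differentiating a power of \<open>g\<close> costs one factor \<open>g\<close>, so its
  powers replace a nested family of cutoffs.
\<close>

lemma exists_gradient_cutoff:
  fixes \<psi> :: "real \<Rightarrow> real"
  assumes \<psi>: "torus_smooth \<psi>" and J0: "torus_set J0" "open J0" and zero: "\<forall>x. deriv \<psi> x = 0 \<longrightarrow> x \<in> J0"
  shows "\<exists>K c g g1. K \<ge> 1 \<and> 0 < c \<and> c \<le> 1 \<and> continuous_on UNIV g \<and> continuous_on UNIV g1 \<and>
    (\<forall>x. g (x + 2 * pi) = g x) \<and> (\<forall>x. g1 (x + 2 * pi) = g1 x) \<and>
    (\<forall>x. 0 \<le> g x) \<and> (\<forall>x. g x \<le> 1) \<and> (\<forall>x. x \<notin> J0 \<longrightarrow> g x = 0) \<and>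
    (\<forall>x. \<forall>j\<in>{1, 2, 3}. \<bar>(deriv ^^ j) \<psi> x\<bar> \<le> K) \<and> (\<forall>x. \<bar>g1 x\<bar> \<le> K) \<and>
    (\<forall>x. c \<le> (deriv \<psi> x)\<^sup>2 + K * g x ^ 8) \<and>
    (\<forall>x n. ((\<lambda>y. g y ^ (n + 2)) has_real_derivative real (n + 2) * g x ^ (n + 1) * g1 x) (at x))"
proof -
  have cn: "torus_Cn n \<psi>" for n using \<psi> by (simp add: torus_smooth_def)
  have cont: "continuous_on UNIV ((deriv ^^ j) \<psi>)" for j by (rule torus_Cn_continuous[OF cn order_refl])
  have per: "(deriv ^^ j) \<psi> (x + 2 * pi) = (deriv ^^ j) \<psi> x" for j x by (rule torus_Cn_periodic[OF cn[of 0]])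
  have DER: "((deriv ^^ j) \<psi> has_real_derivative (deriv ^^ Suc j) \<psi> x) (at x)" for j x
    by (rule torus_Cn_DERIV[OF cn[of "Suc j"]]) simp
  define p where "p = deriv \<psi>"
  define p2 where "p2 = (deriv ^^ 2) \<psi>"
  have pc: "continuous_on UNIV p" "continuous_on UNIV p2" using cont[of 1] cont[of 2] by (auto simp: p_def p2_def)
  have pp: "p (x + 2 * pi) = p x" "p2 (x + 2 * pi) = p2 x" for x using per[of 1 x] per[of 2 x] by (auto simp: p_def p2_def)
  have dp: "(p has_real_derivative p2 x) (at x)" for x using DER[of 1 x] by (simp add: p_def p2_def numeral_2_eq_2)
  have J0p: "x + 2 * pi \<in> J0 \<longleftrightarrow> x \<in> J0" for x
    using torus_funD[of "\<lambda>x. x \<in> J0" x] J0(1) by (simp add: torus_set_def)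
  \<comment> \<open>On the compact part of a period outside J0, where \<psi>' has no zero, |\<psi>'|
    attains a positive minimum; periodicity extends the bound to the line.\<close>
  obtain \<delta> where \<delta>: "0 < \<delta>" "\<delta> \<le> 1" "\<And>x. x \<notin> J0 \<Longrightarrow> \<delta> \<le> \<bar>p x\<bar>"
  proof -
    define S where "S = {0..2 * pi} - J0"
    have S: "compact S" unfolding S_def using J0(2) by (rule compact_diff[OF compact_Icc])
    have "\<exists>\<delta>. 0 < \<delta> \<and> (\<forall>x\<in>S. \<delta> \<le> \<bar>p x\<bar>)"
    proof (cases "S = {}")
      case False
      have "continuous_on S (\<lambda>x. \<bar>p x\<bar>)" by (intro continuous_on_rabs continuous_on_subset[OF pc(1)]) simp
      then obtain y where y: "y \<in> S" "\<And>x. x \<in> S \<Longrightarrow> \<bar>p y\<bar> \<le> \<bar>p x\<bar>"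
        using continuous_attains_inf[OF S False] by blast
      have "p y \<noteq> 0" using zero y(1) by (auto simp: p_def S_def)
      then show ?thesis using y by (intro exI[of _ "\<bar>p y\<bar>"]) auto
    qed (auto intro: exI[of _ 1])
    then obtain \<delta> where \<delta>: "0 < \<delta>" "\<And>x. x \<in> S \<Longrightarrow> \<delta> \<le> \<bar>p x\<bar>" by blast
    have "min \<delta> 1 \<le> \<bar>p x\<bar>" if "x \<notin> J0" for x
    proof -
      obtain y where "y \<in> {0..<2 * pi}" "(p y, y \<in> J0) = (p x, x \<in> J0)"
        by (rule torus_fun_representative[of "\<lambda>x. (p x, x \<in> J0)" x]) (use pp J0p in auto)
      then show ?thesis using \<delta>(2)[of y] that by (auto simp: S_def)
    qed
    then show ?thesis using \<delta>(1) by (intro that[of "min \<delta> 1"]) auto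
  qed
  define g where "g = (\<lambda>x. max 0 (1 - (p x)\<^sup>2 / \<delta>\<^sup>2))"
  \<comment> \<open>The derivative of the expression inside the positive part. Where g = 0 it need
    not be the derivative of g, but in \<open>g_deriv\<close> it is always multiplied by a positive
    power of g.\<close>
  define g1 where "g1 = (\<lambda>x. - 2 * p x * p2 x / \<delta>\<^sup>2)"
  have gc: "continuous_on UNIV g" "continuous_on UNIV g1"
    unfolding g_def g1_def using \<delta> by (auto intro!: continuous_intros pc)
  have gp: "g (x + 2 * pi) = g x" "g1 (x + 2 * pi) = g1 x" for x unfolding g_def g1_def pp by auto
  have g01: "0 \<le> g x" "g x \<le> 1" for x unfolding g_def by auto
  have gJ: "g x = 0" if "x \<notin> J0" for x
  proof -
    have "\<delta>\<^sup>2 \<le> (p x)\<^sup>2" using \<delta>(3)[OF that] \<delta>(1) by (simp add: abs_le_square_iff[symmetric])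
    then show ?thesis unfolding g_def using \<delta>(1) by (simp add: field_simps)
  qed
  have "\<exists>B. \<forall>x. \<bar>(deriv ^^ j) \<psi> x\<bar> \<le> B" for j by (rule torus_continuous_bounded[OF cont per])
  then obtain B where B: "\<And>j x. \<bar>(deriv ^^ j) \<psi> x\<bar> \<le> B j" by metis
  obtain B' where B': "\<And>x. \<bar>g1 x\<bar> \<le> B'" using torus_continuous_bounded[OF gc(2) gp(2)] by blast
  \<comment> \<open>Where (\<psi>')^2 < \<delta>^2 / 4 one has g \<ge> 3/4, and (3/4)^8 is just
    above 1/10; the 10 in K therefore gives K g^8 \<ge> 1.\<close>
  define K where "K = max 10 (max (max (B 1) (B 2)) (max (B 3) B'))"
  define c where "c = \<delta>\<^sup>2 / 4"
  have c: "0 < c" "c \<le> 1" unfolding c_def using \<delta> power_le_one[of \<delta> 2] by auto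
  show ?thesis
  proof (rule exI[of _ K], rule exI[of _ c], rule exI[of _ g], rule exI[of _ g1], intro conjI allI ballI impI)
    show "K \<ge> 1" unfolding K_def by simp
    show "\<bar>(deriv ^^ j) \<psi> x\<bar> \<le> K" if "j \<in> {1, 2, 3}" for x j using that B[of j x] unfolding K_def by auto
    show "\<bar>g1 x\<bar> \<le> K" for x using B'[of x] unfolding K_def by simp
    show "c \<le> (deriv \<psi> x)\<^sup>2 + K * g x ^ 8" for x
    proof (cases "c \<le> (p x)\<^sup>2")
      case True
      have "0 \<le> K * g x ^ 8" using g01[of x] unfolding K_def by simp
      then show ?thesis using True by (simp add: p_def)
    next
      case False
      then have "(p x)\<^sup>2 / \<delta>\<^sup>2 \<le> 1 / 4" unfolding c_def using \<delta>(1) by (simp add: field_simps)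
      then have "3 / 4 \<le> 1 - (p x)\<^sup>2 / \<delta>\<^sup>2" by simp
      then have "3 / 4 \<le> g x" unfolding g_def by (rule max.coboundedI2)
      then have "(3 / 4) ^ 8 \<le> g x ^ 8" by (intro power_mono) auto
      then have "10 * (1 / 10) \<le> K * g x ^ 8" unfolding K_def by (intro mult_mono) (auto simp: power_divide)
      then show ?thesis using c(2) zero_le_power2[of "deriv \<psi> x"] by linarith
    qed
    show "((\<lambda>y. g y ^ (n + 2)) has_real_derivative real (n + 2) * g x ^ (n + 1) * g1 x) (at x)" for x n
    proof -
      have "((\<lambda>y. 1 - (p y)\<^sup>2 / \<delta>\<^sup>2) has_real_derivative g1 x) (at x)"
      proof -
        have "((\<lambda>y. 1 - (p y)\<^sup>2 * (1 / \<delta>\<^sup>2)) has_real_derivative - 2 * p x * p2 x * (1 / \<delta>\<^sup>2)) (at x)"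
          by (rule derivative_eq_intros dp refl)+ simp
        then show ?thesis by (simp add: g1_def)
      qed
      from DERIV_chain2[OF positive_part_power_DERIV this] show ?thesis unfolding g_def .
    qed
  qed (use c gc gp g01 gJ in auto)
qed

text \<open>The inequality (1 + y / N)^N \<le> exp y, inverted. Taken at a multiple of a negative
  power of l(t), it makes the Carleman weight rapid.\<close>

lemma exp_minus_le_power:
  fixes y :: real assumes "y > 0" shows "exp (- y) \<le> (real N / y) ^ N"
proof (cases "N = 0")
  case False
  have "(y / real N) ^ N \<le> (1 + y / real N) ^ N" using assms by (intro power_mono) auto
  also have "\<dots> \<le> exp y" using False assms by (intro exp_ge_one_plus_x_over_n_power_n) auto
  finally have "inverse (exp y) \<le> inverse ((y / real N) ^ N)" using assms False by (intro le_imp_inverse_le) auto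
  then show ?thesis by (simp add: exp_minus power_divide)
qed (use assms in simp)

section \<open>The singular time factor and its derivatives\<close>

definition ell_pow :: "real \<Rightarrow> real \<Rightarrow> real \<Rightarrow> real" where
  "ell_pow T m t = ell T t powr (- m)"

definition ell_pow_t :: "real \<Rightarrow> real \<Rightarrow> real \<Rightarrow> real" where
  "ell_pow_t T m t = - m * (T - 2 * t) * (1 / ell T t) * ell_pow T m t"

definition ell_pow_tt :: "real \<Rightarrow> real \<Rightarrow> real \<Rightarrow> real" where
  "ell_pow_tt T m t = m * (m + 1) * (T - 2 * t)\<^sup>2 * (1 / ell T t)\<^sup>2 * ell_pow T m t
     + 2 * m * (1 / ell T t) * ell_pow T m t"

context
  fixes T m :: real
  assumes T: "T > 0" and m: "m \<ge> 1"
begin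

lemma ell_pow_DERIV:
  assumes "t \<in> {0<..<T}"
  shows "(ell_pow T m has_real_derivative ell_pow_t T m t) (at t)" "(ell_pow_t T m has_real_derivative ell_pow_tt T m t) (at t)"
proof -
  have l: "ell T t > 0" by (rule ell_pos[OF assms])
  have dl: "(ell T has_real_derivative (T - 2 * t)) (at t)"
    unfolding ell_def by (auto intro!: derivative_eq_intros simp: algebra_simps)
  show dq: "(ell_pow T m has_real_derivative ell_pow_t T m t) (at t)"
    unfolding  ell_pow_def ell_pow_t_def using l
    by (auto intro!: derivative_eq_intros dl simp: powr_diff)
  show "(ell_pow_t T m has_real_derivative ell_pow_tt T m t) (at t)"
    unfolding ell_pow_t_def using l
    by (auto intro!: derivative_eq_intros dl dq simp: ell_pow_tt_def ell_pow_t_def field_simps power2_eq_square)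
qed

text \<open>The origin of T^k + T^(k - 1) in the threshold for s. Let q = l^(-m) with m = k / 2.
  From l \<le> T^2 one gets 1 \<le> q T^(2 m), which will make \<Lambda> large. As |l'| \<le> T and
  T / l \<le> q T^(2 m - 1), each time derivative costs a factor q T^(2 m - 1). The last bound turns
  growth of q into decay of the weight; all bounds of 1 / l by q rest on m \<ge> 1.\<close>

lemma ell_pow_bounds:
  assumes t: "t \<in> {0<..<T}"
  shows "0 < ell_pow T m t" "T / ell T t \<le> ell_pow T m t * T powr (2 * m - 1)" "1 \<le> ell_pow T m t * T powr (2 * m)"
    "\<bar>ell_pow_t T m t\<bar> \<le> m * (ell_pow T m t)\<^sup>2 * T powr (2 * m - 1)"
    "\<bar>ell_pow_tt T m t\<bar> \<le> m * (m + 3) * ell_pow T m t ^ 3 * (T powr (2 * m - 1))\<^sup>2"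
    "1 / (ell T t * T powr (2 * m - 2)) \<le> ell_pow T m t"
proof -
  define l where "l = ell T t"
  have l: "0 < l" "l \<le> T\<^sup>2" using ell_pos[OF t] ell_le[OF t] by (auto simp: l_def)
  have TT: "T\<^sup>2 = T powr 2" using T by (simp add: powr_numeral)
  show q0: "0 < ell_pow T m t" unfolding  ell_pow_def using l by (simp add: l_def)
  have "l powr (m - 1) \<le> (T\<^sup>2) powr (m - 1)" using l m by (intro powr_mono2) auto
  also have "\<dots> = T powr (2 * m - 2)" unfolding TT powr_powr by (simp add: algebra_simps)
  finally have e1: "l powr (m - 1) \<le> T powr (2 * m - 2)" .
  have ql: "ell_pow T m t * l powr (m - 1) = 1 / l"
    unfolding  ell_pow_def l_def[symmetric] using l by (simp add: powr_minus powr_diff field_simps)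
  have il: "1 / l \<le> ell_pow T m t * T powr (2 * m - 2)"
    unfolding ql[symmetric] using e1 q0 by (intro mult_left_mono) auto
  show "1 / (ell T t * T powr (2 * m - 2)) \<le> ell_pow T m t"
    using il l T by (simp add: l_def field_simps)
  have T1: "T * T powr (2 * m - 2) = T powr (2 * m - 1)"
    using T powr_add[of T 1 "2 * m - 2"] by simp
  show Tl: "T / ell T t \<le> ell_pow T m t * T powr (2 * m - 1)"
    using mult_left_mono[OF il, of T] T unfolding T1[symmetric] by (simp add: l_def mult_ac)
  have "l powr m \<le> (T\<^sup>2) powr m" using l m by (intro powr_mono2) auto
  also have "\<dots> = T powr (2 * m)" unfolding TT powr_powr by simp
  finally have "ell_pow T m t * l powr m \<le> ell_pow T m t * T powr (2 * m)" using q0 by (intro mult_left_mono) auto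
  moreover have "ell_pow T m t * l powr m = 1" unfolding  ell_pow_def l_def[symmetric] using l by (simp flip: powr_add)
  ultimately show "1 \<le> ell_pow T m t * T powr (2 * m)" by simp
  define a where "a = T / l"
  define b where "b = ell_pow T m t * T powr (2 * m - 1)"
  have ab: "0 \<le> a" "a \<le> b" using Tl l T by (auto simp: a_def b_def l_def)
  have Tt: "\<bar>T - 2 * t\<bar> \<le> T" using t by auto
  have i1: "\<bar>T - 2 * t\<bar> * (1 / l) \<le> a" using mult_right_mono[OF Tt, of "1 / l"] l by (simp add: a_def)
  have "\<bar>ell_pow_t T m t\<bar> = m * (\<bar>T - 2 * t\<bar> * (1 / l)) * ell_pow T m t"
    unfolding ell_pow_t_def l_def[symmetric] using m q0 l by (simp add: abs_mult)
  also have "\<dots> \<le> m * b * ell_pow T m t" using i1 ab m q0 by (intro mult_right_mono mult_left_mono) auto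
  finally show "\<bar>ell_pow_t T m t\<bar> \<le> m * (ell_pow T m t)\<^sup>2 * T powr (2 * m - 1)" by (simp add: b_def power2_eq_square mult_ac)
  have i2: "(T - 2 * t)\<^sup>2 * (1 / l)\<^sup>2 \<le> a\<^sup>2"
    using power_mono[OF i1, of 2, unfolded power_mult_distrib power2_abs] l by simp
  have i3: "1 / l \<le> a\<^sup>2"
  proof -
    have "1 / l = l / l\<^sup>2" using l by (simp add: power2_eq_square)
    also have "\<dots> \<le> T\<^sup>2 / l\<^sup>2" using l by (intro divide_right_mono) auto
    finally show ?thesis by (simp add: a_def power_divide)
  qed
  have a2: "a\<^sup>2 \<le> b\<^sup>2" using ab by (intro power_mono) auto
  \<comment> \<open>The coefficients add up to m (m + 1) + 2 m = m (m + 3), with 1 / l \<le> (T /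
    l)^2 used for the second term.\<close>
  have "\<bar>ell_pow_tt T m t\<bar> = (m * (m + 1) * ((T - 2 * t)\<^sup>2 * (1 / l)\<^sup>2) + 2 * m * (1 / l)) * ell_pow T m t"
    unfolding ell_pow_tt_def l_def[symmetric] using m q0 l by (simp add: algebra_simps abs_of_nonneg)
  also have "\<dots> \<le> (m * (m + 1) * b\<^sup>2 + 2 * m * b\<^sup>2) * ell_pow T m t"
    using i2 i3 a2 m q0 by (intro mult_right_mono add_mono mult_left_mono) auto
  also have "\<dots> = m * (m + 3) * ell_pow T m t ^ 3 * (T powr (2 * m - 1))\<^sup>2"
    by (simp add: b_def power2_eq_square power3_eq_cube algebra_simps)
  finally show "\<bar>ell_pow_tt T m t\<bar> \<le> m * (m + 3) * ell_pow T m t ^ 3 * (T powr (2 * m - 1))\<^sup>2" .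
qed

lemma tempered_ell_pow: "tempered T (\<lambda>t x. ell_pow T m t)" "tempered T (\<lambda>t x. ell_pow_t T m t)" "tempered T (\<lambda>t x. ell_pow_tt T m t)"
proof -
  have cq: "continuous_on {0<..<T} (ell_pow T m)" by (rule DERIV_continuous_on[OF has_field_derivative_at_within[OF ell_pow_DERIV(1)]])
  have cl: "continuous_on {0<..<T} (ell T)" unfolding ell_def by (intro continuous_intros)
  have cont_fst: "continuous_on ({0<..<T} \<times> (UNIV :: real set)) (\<lambda>p. h (fst p))" if "continuous_on {0<..<T} h" for h :: "real \<Rightarrow> real"
    using that by (rule continuous_on_compose2) (auto intro!: continuous_intros)
  show tq: "tempered T (\<lambda>t x. ell_pow T m t)"
  proof (rule temperedI)
    define n where "n = nat \<lceil>m\<rceil>"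
    have n: "m \<le> real n" using m unfolding n_def by linarith
    show "\<bar>ell_pow T m t\<bar> \<le> (T\<^sup>2) powr (real n - m) / ell T t ^ n" if t: "t \<in> {0<..<T}" for t
    proof -
      have l: "0 < ell T t" "ell T t \<le> T\<^sup>2" using ell_pos[OF t] ell_le[OF t] by auto
      have "ell_pow T m t * ell T t ^ n = ell T t powr (real n - m)"
        unfolding  ell_pow_def using l by (simp add: powr_realpow[symmetric] flip: powr_add)
      also have "\<dots> \<le> (T\<^sup>2) powr (real n - m)" using l n by (intro powr_mono2) auto
      finally show ?thesis using ell_pow_bounds(1)[OF t] l by (simp add: field_simps)
    qed
  qed (auto intro: cont_fst cq)
  have ti: "tempered T (\<lambda>t x. 1 / ell T t)"
  proof (rule temperedI)
    show "\<bar>1 / ell T t\<bar> \<le> 1 / ell T t ^ 1" if "t \<in> {0<..<T}" for t using ell_pos[OF that] by simp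
    have "continuous_on {0<..<T} (\<lambda>t. 1 / ell T t)"
      using ell_pos by (intro continuous_on_divide continuous_on_const cl) (auto simp: less_le)
    then show "continuous_on ({0<..<T} \<times> (UNIV :: real set)) (\<lambda>p. 1 / ell T (fst p))" by (rule cont_fst[of "\<lambda>t. 1 / ell T t"])
  qed auto
  have tt: "tempered T (\<lambda>t x. T - 2 * t)"
    by (rule tempered_bounded[of _ _ T]) (auto intro!: continuous_intros)
  show "tempered T (\<lambda>t x. ell_pow_t T m t)" "tempered T (\<lambda>t x. ell_pow_tt T m t)"
    unfolding ell_pow_t_def ell_pow_tt_def by (intro tempered_intros tq ti tt)+
qed

end

text \<open>Let G = exp (\<mu> \<psi> + 8 \<lambda> P) and H = exp (10 \<lambda> P). The numbers 8
  and 10 do two things: \<mu> \<psi> \<le> \<lambda> P gives G \<le> exp (9 \<lambda> P) < H, so the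
  phase is negative; and 10 \<le> 16 gives H \<le> G^2, hence |G - H| \<le> G^2. Time derivatives of
  the phase retain the factor G - H, so they are controlled by powers of \<Lambda>.\<close>

lemma carleman_weight_instance:
  fixes T \<mu> lam \<alpha> \<epsilon> K c P k s s0 :: real and \<psi> g g1 :: "real \<Rightarrow> real"
  assumes T: "T > 0" and \<mu>: "\<mu> \<ge> 1" "\<mu> \<le> lam" and \<alpha>: "\<alpha> > 0" and \<epsilon>: "0 < \<epsilon>" "\<epsilon> \<le> 1" and k: "k \<ge> 2"
    and P: "P > 0" "\<And>x. 0 < \<psi> x" "\<And>x. \<psi> x \<le> P"
    and \<psi>: "torus_smooth \<psi>"
    and K: "K \<ge> 1" and c: "0 < c" "c \<le> 1"
    and g: "continuous_on UNIV g" "continuous_on UNIV g1" "\<And>x. g (x + 2 * pi) = g x" "\<And>x. g1 (x + 2 * pi) = g1 x"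
      "\<And>x. 0 \<le> g x" "\<And>x. g x \<le> 1"
    and bnd: "\<And>x j. j \<in> {1, 2, 3} \<Longrightarrow> \<bar>(deriv ^^ j) \<psi> x\<bar> \<le> K" "\<And>x. \<bar>g1 x\<bar> \<le> K"
    and coercive: "\<And>x. c \<le> (deriv \<psi> x)\<^sup>2 + K * g x ^ 8"
    and g_deriv: "\<And>x n. ((\<lambda>y. g y ^ (n + 2)) has_real_derivative real (n + 2) * g x ^ (n + 1) * g1 x) (at x)"
    and s0: "(k / 2 + 3)\<^sup>2 / \<epsilon> \<le> s0" and s: "s0 * (1 + \<alpha>) * (T powr k + T powr (k - 1)) \<le> s"
  shows "carleman_weight T \<mu> (1 + \<alpha>) \<epsilon> K c
    (\<lambda>t x. s * ((exp (\<mu> * \<psi> x + 8 * lam * P) - exp (10 * lam * P)) * ell_pow T (k / 2) t))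
    (\<lambda>t x. s * ((exp (\<mu> * \<psi> x + 8 * lam * P) - exp (10 * lam * P)) * ell_pow_t T (k / 2) t))
    (\<lambda>t x. s * ((exp (\<mu> * \<psi> x + 8 * lam * P) - exp (10 * lam * P)) * ell_pow_tt T (k / 2) t))
    (\<lambda>t x. s * \<mu> * (exp (\<mu> * \<psi> x + 8 * lam * P) * ell_pow T (k / 2) t))
    (\<lambda>t x. s * \<mu> * (exp (\<mu> * \<psi> x + 8 * lam * P) * ell_pow_t T (k / 2) t))
    (deriv \<psi>) ((deriv ^^ 2) \<psi>) ((deriv ^^ 3) \<psi>) g g1"
proof -
  define m where "m = k / 2"
  have m: "m \<ge> 1" using k by (simp add: m_def)
  define G where "G = (\<lambda>x. exp (\<mu> * \<psi> x + 8 * lam * P))"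
  define H where "H = exp (10 * lam * P)"
  define \<tau> where "\<tau> = T powr (k - 1)"
  have lam: "lam \<ge> 1" "0 < lam * P" using \<mu> P by auto
  have cn: "torus_Cn n \<psi>" for n using \<psi> by (simp add: torus_smooth_def)
  have cont: "continuous_on UNIV ((deriv ^^ j) \<psi>)" for j by (rule torus_Cn_continuous[OF cn order_refl])
  have per: "(deriv ^^ j) \<psi> (x + 2 * pi) = (deriv ^^ j) \<psi> x" for j x by (rule torus_Cn_periodic[OF cn[of 0]])
  have DER: "((deriv ^^ j) \<psi> has_real_derivative (deriv ^^ Suc j) \<psi> x) (at x)" for j x
    by (rule torus_Cn_DERIV[OF cn[of "Suc j"]]) simp
  have d1: "(\<psi> has_real_derivative deriv \<psi> x) (at x)" for x using DER[of 0 x] by simp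
  have G1: "1 \<le> G x" for x
  proof -
    have "0 \<le> \<mu> * \<psi> x" "0 \<le> 8 * (lam * P)" using P(2)[of x] \<mu> lam by auto
    then show ?thesis unfolding G_def by (simp add: mult.assoc)
  qed
  have GH: "G x \<le> exp (9 * lam * P)" for x
  proof -
    have "\<mu> * \<psi> x \<le> lam * P" using P(2,3)[of x] \<mu> by (intro mult_mono) auto
    then show ?thesis unfolding G_def by (simp add: algebra_simps)
  qed
  have HG: "H \<le> (G x)\<^sup>2" for x
  proof -
    have "0 \<le> \<mu> * \<psi> x" using P(2)[of x] \<mu> by simp
    then have "10 * lam * P \<le> 2 * (\<mu> * \<psi> x + 8 * lam * P)" using lam(2) by (simp add: algebra_simps)
    then show ?thesis unfolding H_def G_def exp_double[symmetric] by simp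
  qed
  have H0: "0 < H" "exp (9 * lam * P) < H" unfolding H_def using lam P(1) by auto
  have GmH: "\<bar>G x - H\<bar> \<le> (G x)\<^sup>2" for x
    using GH[of x] H0 HG[of x] G1[of x] by linarith
  have tx: "tempered T (\<lambda>t. h)" if h: "continuous_on UNIV h" "\<And>x. h (x + 2 * pi) = h x" for h :: "real \<Rightarrow> real"
  proof -
    obtain B where "\<And>x. \<bar>h x\<bar> \<le> B" using torus_continuous_bounded[OF h] by blast
    moreover have "continuous_on ({0<..<T} \<times> UNIV) (\<lambda>p. h (snd p))"
      by (rule continuous_on_compose2[OF h(1)]) (auto intro!: continuous_intros)
    ultimately show ?thesis using h(2) by (intro tempered_bounded[of _ _ B]) auto
  qed
  have tG: "tempered T (\<lambda>t. G)"
    using cont[of 0] per[of 0] unfolding G_def by (intro tx continuous_intros) auto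
  note tq = tempered_ell_pow[OF T m]
  note ti = tempered_intros tG tq
  have \<tau>: "\<tau> = T powr (2 * m - 1)" "T powr k = T powr (2 * m)" "0 < \<tau>" using T by (auto simp: \<tau>_def m_def)
  \<comment> \<open>(m + 3)^2 dominates the three constants to be absorbed: 1 for the lower bound on
    \<Lambda>, m for the first and m (m + 3) for the second time derivatives.\<close>
  have m3: "1 \<le> (m + 3)\<^sup>2" "m \<le> (m + 3)\<^sup>2" "m * (m + 3) \<le> (m + 3)\<^sup>2"
    using m by (auto simp: power2_eq_square algebra_simps)
  have s0': "1 \<le> s0" "(m + 3)\<^sup>2 \<le> \<epsilon> * s0" "0 < s0"
  proof -
    show 2: "(m + 3)\<^sup>2 \<le> \<epsilon> * s0" using s0 \<epsilon> by (simp add: m_def field_simps)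
    have "1 \<le> \<epsilon> * s0" using 2 m3(1) by linarith
    then show "0 < s0" using \<epsilon> by (metis less_le_trans zero_less_mult_pos zero_less_one)
    then show "1 \<le> s0" using \<open>1 \<le> \<epsilon> * s0\<close> \<epsilon> mult_right_mono[of \<epsilon> 1 s0] by linarith
  qed
  \<comment> \<open>The two halves of the threshold serve separately: T^(k - 1), with the factor 1 +
    \<alpha>, for the time derivatives, and T^k for the size of \<Lambda>.\<close>
  have s1: "s0 * (1 + \<alpha>) * \<tau> \<le> s" and s2: "s0 * T powr k \<le> s"
  proof -
    have p: "0 \<le> s0 * (1 + \<alpha>) * \<tau>" "0 \<le> s0 * (1 + \<alpha>) * T powr k" using s0' \<alpha> \<tau> by auto
    have e: "s0 * (1 + \<alpha>) * (T powr k + T powr (k - 1)) = s0 * (1 + \<alpha>) * T powr k + s0 * (1 + \<alpha>) * \<tau>"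
      by (simp add: \<tau>_def algebra_simps)
    show "s0 * (1 + \<alpha>) * \<tau> \<le> s" using s p unfolding e by linarith
    have "s0 * T powr k \<le> s0 * (1 + \<alpha>) * T powr k" using s0' \<alpha> by (intro mult_right_mono) auto
    then show "s0 * T powr k \<le> s" using s p unfolding e by linarith
  qed
  have s: "0 < s"
  proof -
    have "0 < s0 * T powr k" using s0' T by simp
    then show ?thesis using s2 by linarith
  qed
  have key1: "m * \<tau> * (1 + \<alpha>) \<le> \<epsilon> * s"
  proof -
    have "m * (\<tau> * (1 + \<alpha>)) \<le> (\<epsilon> * s0) * (\<tau> * (1 + \<alpha>))"
      using m3(2) s0'(2) \<tau> \<alpha> by (intro mult_right_mono) auto
    also have "\<dots> = \<epsilon> * (s0 * (1 + \<alpha>) * \<tau>)" by simp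
    also have "\<dots> \<le> \<epsilon> * s" using s1 \<epsilon> by (intro mult_left_mono) auto
    finally show ?thesis by (simp add: mult_ac)
  qed
  have key2: "m * (m + 3) * \<tau>\<^sup>2 \<le> \<epsilon> * s\<^sup>2"
  proof -
    have "s0 * \<tau> \<le> s0 * (1 + \<alpha>) * \<tau>" using s0' \<alpha> \<tau> by (intro mult_right_mono) auto
    from order_trans[OF this s1] have "(s0 * \<tau>)\<^sup>2 \<le> s\<^sup>2" using s0' \<tau>(3) by (intro power_mono) auto
    have "m * (m + 3) * \<tau>\<^sup>2 \<le> (\<epsilon> * s0) * \<tau>\<^sup>2" using m3(3) s0'(2) by (intro mult_right_mono) auto
    also have "\<dots> \<le> (\<epsilon> * (s0 * s0)) * \<tau>\<^sup>2"
      using s0' \<epsilon> mult_left_mono[of 1 s0 "\<epsilon> * s0"] by (intro mult_right_mono) auto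
    also have "\<dots> = \<epsilon> * (s0 * \<tau>)\<^sup>2" by (simp add: power2_eq_square)
    also have "\<dots> \<le> \<epsilon> * s\<^sup>2" using \<open>(s0 * \<tau>)\<^sup>2 \<le> s\<^sup>2\<close> \<epsilon> by (intro mult_left_mono) auto
    finally show ?thesis .
  qed
  note qb = ell_pow_bounds[OF T m, folded \<tau>(1)]
  have dG: "(G has_real_derivative \<mu> * deriv \<psi> x * G x) (at x)" for x
    unfolding G_def by (auto intro!: derivative_eq_intros d1)
  have dqt: "(ell_pow T m has_real_derivative ell_pow_t T m t) (at t)" "(ell_pow_t T m has_real_derivative ell_pow_tt T m t) (at t)"
    if "t \<in> {0<..<T}" for t by (rule ell_pow_DERIV[OF T m that])+
  have "carleman_weight T \<mu> (1 + \<alpha>) \<epsilon> K c (\<lambda>t x. s * ((G x - H) * ell_pow T m t)) (\<lambda>t x. s * ((G x - H) * ell_pow_t T m t))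
     (\<lambda>t x. s * ((G x - H) * ell_pow_tt T m t)) (\<lambda>t x. s * \<mu> * (G x * ell_pow T m t)) (\<lambda>t x. s * \<mu> * (G x * ell_pow_t T m t))
     (deriv \<psi>) ((deriv ^^ 2) \<psi>) ((deriv ^^ 3) \<psi>) g g1"
  proof
    show "tempered T (\<lambda>t x. s * \<mu> * (G x * ell_pow T m t))" "tempered T (\<lambda>t x. s * \<mu> * (G x * ell_pow_t T m t))"
      "tempered T (\<lambda>t x. s * ((G x - H) * ell_pow_t T m t))" "tempered T (\<lambda>t x. s * ((G x - H) * ell_pow_tt T m t))"
      by (intro ti)+
    show "tempered T (\<lambda>t. deriv \<psi>)" using cont[of 1] per[of 1] by (intro tx) auto
    show "tempered T (\<lambda>t. (deriv ^^ 2) \<psi>)" "tempered T (\<lambda>t. (deriv ^^ 3) \<psi>)" by (intro tx cont per)+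
    show "tempered T (\<lambda>t. g)" "tempered T (\<lambda>t. g1)" by (intro tx g)+
    show "\<bar>deriv \<psi> x\<bar> \<le> K" "\<bar>(deriv ^^ 2) \<psi> x\<bar> \<le> K" "\<bar>(deriv ^^ 3) \<psi> x\<bar> \<le> K" for x
      using bnd(1)[of 1 x] bnd(1)[of 2 x] bnd(1)[of 3 x] by auto
    show "(deriv \<psi> has_real_derivative (deriv ^^ 2) \<psi> x) (at x)" for x using DER[of 1 x] by (simp add: numeral_2_eq_2)
    show "((deriv ^^ 2) \<psi> has_real_derivative (deriv ^^ 3) \<psi> x) (at x)" for x
      using DER[of 2 x] by (simp add: numeral_2_eq_2 numeral_3_eq_3)
    show "rapid T (\<lambda>t x. exp (2 * (s * ((G x - H) * ell_pow T m t))))"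
      unfolding rapid_def
    proof (intro conjI ballI allI)
      have tth: "tempered T (\<lambda>t x. 2 * (s * ((G x - H) * ell_pow T m t)))" by (intro ti)
      show "continuous_on ({0<..<T} \<times> UNIV) (\<lambda>p. exp (2 * (s * ((G (snd p) - H) * ell_pow T m (fst p)))))"
        by (intro continuous_on_exp temperedD(1)[OF tth])
      show "exp (2 * (s * ((G (x + 2 * pi) - H) * ell_pow T m t))) = exp (2 * (s * ((G x - H) * ell_pow T m t)))"
        if "t \<in> {0<..<T}" for t x using temperedD(2)[OF tth that] by simp
      fix N
      \<comment> \<open>The gap between H and the upper bound of G is positive and independent of x,
        so twice the phase is at most - d l^(-m), uniformly in x.\<close>
      define d where "d = 2 * s * (H - exp (9 * lam * P))"
      have d: "d > 0" unfolding d_def using H0 s by simp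
      define C where "C = (real N * T powr (2 * m - 2) / d) ^ N"
      have "\<bar>exp (2 * (s * ((G x - H) * ell_pow T m t)))\<bar> \<le> C * ell T t ^ N" if t: "t \<in> {0<..<T}" for t x
      proof -
        have l: "0 < ell T t" by (rule ell_pos[OF t])
        have q0: "0 < ell_pow T m t" by (rule qb(1)[OF t])
        have "d * ell_pow T m t \<le> 2 * s * (H - G x) * ell_pow T m t"
          unfolding d_def using GH[of x] s q0 by (intro mult_right_mono mult_left_mono) auto
        then have "exp (2 * (s * ((G x - H) * ell_pow T m t))) \<le> exp (- (d * ell_pow T m t))" by (simp add: algebra_simps)
        also have "\<dots> \<le> (real N / (d * ell_pow T m t)) ^ N" using d q0 by (intro exp_minus_le_power) simp
        also have "\<dots> \<le> (real N * T powr (2 * m - 2) / d * ell T t) ^ N"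
        proof (rule power_mono)
          have "1 / ell_pow T m t \<le> ell T t * T powr (2 * m - 2)"
            using qb(6)[OF t] q0 l T by (simp add: field_simps)
          then have "real N / d * (1 / ell_pow T m t) \<le> real N / d * (ell T t * T powr (2 * m - 2))"
            using d by (intro mult_left_mono) auto
          then show "real N / (d * ell_pow T m t) \<le> real N * T powr (2 * m - 2) / d * ell T t" by (simp add: mult_ac)
        qed (use d q0 in auto)
        finally show ?thesis unfolding C_def abs_exp_cancel power_mult_distrib .
      qed
      then show "\<exists>C. \<forall>t\<in>{0<..<T}. \<forall>x. \<bar>exp (2 * (s * ((G x - H) * ell_pow T m t)))\<bar> \<le> C * ell T t ^ N" by blast
    qed
    fix t x assume t: "t \<in> {0<..<T}"
    define y where "y = ell_pow T m t"
    define L where "L = s * \<mu> * (G x * y)"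
    have y: "0 < y" unfolding y_def by (rule qb(1)[OF t])
    have Gy: "0 \<le> G x" "1 \<le> \<mu> * G x" using G1[of x] \<mu> mult_mono[of 1 \<mu> 1 "G x"] by auto
    show "\<mu> / \<epsilon> \<le> s * \<mu> * (G x * ell_pow T m t)"
    proof -
      have "1 \<le> \<epsilon> * s0" using s0'(2) m3(1) by linarith
      then have "1 / \<epsilon> \<le> s0 * 1" using \<epsilon> by (simp add: field_simps)
      also have "\<dots> \<le> s0 * (y * T powr k)" using qb(3)[OF t] s0' unfolding \<tau>(2) y_def by (intro mult_left_mono) auto
      also have "\<dots> = (s0 * T powr k) * (1 * y)" by simp
      also have "\<dots> \<le> s * (G x * y)" using s2 s G1[of x] y s0' by (intro mult_mono) auto
      finally have "\<mu> * (1 / \<epsilon>) \<le> \<mu> * (s * (G x * y))" using \<mu> by (intro mult_left_mono) auto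
      then show ?thesis by (simp add: y_def mult_ac)
    qed
    have sy: "m * y\<^sup>2 * \<tau> * (1 + \<alpha>) \<le> \<epsilon> * s * y\<^sup>2"
      using mult_right_mono[OF key1, of "y\<^sup>2"] by (simp add: mult_ac)
    have L2: "s * (G x)\<^sup>2 * (\<epsilon> * s * y\<^sup>2) \<le> \<epsilon> * L\<^sup>2"
    proof -
      have "1 \<le> \<mu>\<^sup>2" using \<mu> by simp
      then have "(\<epsilon> * (s * (G x * y))\<^sup>2) * 1 \<le> (\<epsilon> * (s * (G x * y))\<^sup>2) * \<mu>\<^sup>2" using \<epsilon> by (intro mult_left_mono) auto
      then show ?thesis by (simp add: L_def power_mult_distrib power2_eq_square mult_ac)
    qed
    have qty: "\<bar>ell_pow_t T m t\<bar> * (1 + \<alpha>) \<le> \<epsilon> * s * y\<^sup>2"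
    proof -
      have "\<bar>ell_pow_t T m t\<bar> * (1 + \<alpha>) \<le> m * y\<^sup>2 * \<tau> * (1 + \<alpha>)"
        unfolding y_def by (rule mult_right_mono[OF qb(4)[OF t]]) (use \<alpha> in simp)
      then show ?thesis using sy by linarith
    qed
    show "\<bar>s * ((G x - H) * ell_pow_t T m t)\<bar> * (1 + \<alpha>) \<le> \<epsilon> * (s * \<mu> * (G x * ell_pow T m t))\<^sup>2"
    proof -
      have "\<bar>s * ((G x - H) * ell_pow_t T m t)\<bar> * (1 + \<alpha>) = (s * \<bar>G x - H\<bar>) * (\<bar>ell_pow_t T m t\<bar> * (1 + \<alpha>))"
        using s by (simp add: abs_mult)
      also have "\<dots> \<le> (s * (G x)\<^sup>2) * (\<epsilon> * s * y\<^sup>2)"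
        by (rule mult_mono[OF mult_left_mono[OF GmH] qty]) (use s \<alpha> in auto)
      also have "\<dots> \<le> \<epsilon> * L\<^sup>2" by (rule L2)
      finally show ?thesis by (simp add: L_def y_def)
    qed
    show "\<bar>s * \<mu> * (G x * ell_pow_t T m t)\<bar> * (1 + \<alpha>) \<le> \<epsilon> * (s * \<mu> * (G x * ell_pow T m t))\<^sup>2"
    proof -
      have "\<bar>s * \<mu> * (G x * ell_pow_t T m t)\<bar> * (1 + \<alpha>) = (s * (\<mu> * G x)) * (\<bar>ell_pow_t T m t\<bar> * (1 + \<alpha>))"
        using s \<mu> Gy by (simp add: abs_mult)
      also have "\<dots> \<le> (s * (\<mu> * G x)) * (\<epsilon> * s * y\<^sup>2)"
        using qty s Gy by (intro mult_left_mono) auto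
      also have "\<dots> \<le> (s * (\<mu> * G x)\<^sup>2) * (\<epsilon> * s * y\<^sup>2)"
        using Gy s \<epsilon> mult_left_mono[OF Gy(2), of "\<mu> * G x"] by (intro mult_right_mono mult_left_mono) (auto simp: power2_eq_square)
      also have "\<dots> = \<epsilon> * L\<^sup>2" by (simp add: L_def power_mult_distrib power2_eq_square)
      finally show ?thesis by (simp add: L_def y_def)
    qed
    show "\<bar>s * ((G x - H) * ell_pow_tt T m t)\<bar> \<le> \<epsilon> * (s * \<mu> * (G x * ell_pow T m t)) ^ 3"
    proof -
      have "\<bar>s * ((G x - H) * ell_pow_tt T m t)\<bar> = s * \<bar>G x - H\<bar> * \<bar>ell_pow_tt T m t\<bar>" using s by (simp add: abs_mult)
      also have "\<dots> \<le> s * (G x)\<^sup>2 * (m * (m + 3) * y ^ 3 * \<tau>\<^sup>2)"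
        using GmH[of x] qb(5)[OF t] s by (intro mult_mono) (auto simp: y_def)
      also have "\<dots> = s * (G x)\<^sup>2 * y ^ 3 * (m * (m + 3) * \<tau>\<^sup>2)" by simp
      also have "\<dots> \<le> s * (G x)\<^sup>2 * y ^ 3 * (\<epsilon> * s\<^sup>2)" using key2 s y by (intro mult_left_mono) auto
      also have "\<dots> = (\<epsilon> * (s * y) ^ 3) * (G x)\<^sup>2" by (simp add: power_mult_distrib power2_eq_square power3_eq_cube)
      also have "\<dots> \<le> (\<epsilon> * (s * y) ^ 3) * (\<mu> * G x) ^ 3"
      proof (rule mult_left_mono)
        have "(G x)\<^sup>2 \<le> (\<mu> * G x)\<^sup>2" using \<mu> Gy(1) mult_right_mono[OF \<mu>(1) Gy(1)] by (intro power_mono) auto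
        also have "\<dots> \<le> (\<mu> * G x) ^ 3" using Gy(2) by (intro power_increasing) auto
        finally show "(G x)\<^sup>2 \<le> (\<mu> * G x) ^ 3" .
      qed (use \<epsilon> s y in auto)
      also have "\<dots> = \<epsilon> * L ^ 3" by (simp add: L_def power_mult_distrib)
      finally show ?thesis by (simp add: L_def y_def)
    qed
  next
    show "has_dx T (\<lambda>t x. s * ((G x - H) * ell_pow T m t)) (\<lambda>t x. deriv \<psi> x * (s * \<mu> * (G x * ell_pow T m t)))"
      by (rule has_dxI) (auto intro!: derivative_eq_intros dG)
    show "has_dx T (\<lambda>t x. s * \<mu> * (G x * ell_pow T m t)) (\<lambda>t x. \<mu> * deriv \<psi> x * (s * \<mu> * (G x * ell_pow T m t)))"
      by (rule has_dxI) (auto intro!: derivative_eq_intros dG)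
    show "has_dx T (\<lambda>t x. s * ((G x - H) * ell_pow_t T m t)) (\<lambda>t x. deriv \<psi> x * (s * \<mu> * (G x * ell_pow_t T m t)))"
      by (rule has_dxI) (auto intro!: derivative_eq_intros dG)
    show "has_dt T (\<lambda>t x. s * ((G x - H) * ell_pow T m t)) (\<lambda>t x. s * ((G x - H) * ell_pow_t T m t))"
      by (rule has_dtI) (auto intro!: derivative_eq_intros dqt)
    show "has_dt T (\<lambda>t x. s * ((G x - H) * ell_pow_t T m t)) (\<lambda>t x. s * ((G x - H) * ell_pow_tt T m t))"
      by (rule has_dtI) (auto intro!: derivative_eq_intros dqt)
    show "has_dt T (\<lambda>t x. s * \<mu> * (G x * ell_pow T m t)) (\<lambda>t x. s * \<mu> * (G x * ell_pow_t T m t))"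
      by (rule has_dtI) (auto intro!: derivative_eq_intros dqt)
  qed (use T \<mu> \<alpha> \<epsilon> K c g bnd coercive g_deriv in auto)
  then show ?thesis unfolding G_def H_def m_def .
qed

section \<open>The Carleman inequality for the explicit weight\<close>

theorem theorem1p10:
  fixes J J0 :: "real set" and \<omega> \<omega>0 :: "(real \<times> real) set"
    and \<psi>\<Omega> :: "real \<times> real \<Rightarrow> real" and \<psi>I :: "real \<Rightarrow> real" and k :: real
  assumes \<omega>: "strip_set \<omega>" "open \<omega>" "\<omega> \<noteq> {}" "\<omega> \<subseteq> Omega"
    and J: "torus_set J" "open J" "J \<noteq> {}"
    and k: "k \<ge> 2"
    and \<omega>0: "strip_set \<omega>0" "open \<omega>0" "\<omega>0 \<noteq> {}" "\<omega>0 \<Subset> \<omega>"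
    and J0: "torus_set J0" "open J0" "J0 \<noteq> {}" "J0 \<Subset> J"
    and \<psi>\<Omega>: "strip_smooth \<psi>\<Omega>"
      "\<forall>p\<in>Omega. \<psi>\<Omega> p > 0"
      "\<forall>p\<in>Omega_boundary. \<psi>\<Omega> p = 0"
      "\<forall>p\<in>Omega_boundary. has_normal_derivative \<psi>\<Omega> (- 1) p"
      "\<forall>p\<in>Omega_closed. has_gradient \<psi>\<Omega> 0 p \<longrightarrow> p \<in> \<omega>0"
    and \<psi>I: "torus_smooth \<psi>I"
      "\<forall>x. \<psi>I x > 0"
      "\<forall>x. deriv \<psi>I x = 0 \<longrightarrow> x \<in> J0"
  shows "\<exists>c0 > 0. \<exists>\<mu>0 \<ge> 1. \<exists>s0 \<ge> 1.
    \<forall>\<mu> \<ge> \<mu>0. \<forall>lam \<ge> \<mu>. \<forall>\<alpha> > 0. \<forall>T > 0. \<forall>s \<ge> s0 * (1 + \<alpha>) * (T powr k + T powr (k - 1)).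
    \<forall>\<eta> :: real \<Rightarrow> real \<Rightarrow> real. C_time 2 4 T \<eta> \<longrightarrow>
    (let \<xi> = xi0 k \<psi>\<Omega> \<psi>I lam \<mu> T; \<phi> = phi0 k \<psi>\<Omega> \<psi>I lam \<mu> T in
      \<alpha>^2 / (1 + \<alpha>^2) * (1 / s) *
        iint T UNIV (\<lambda>t x. 1 / \<xi> t x * exp (2 * s * \<phi> t x) *
          (\<bar>Dx 4 \<eta> t x\<bar>^2 + \<bar>Dt 2 \<eta> t x\<bar>^2))
      + \<alpha>^2 / s *
        iint T UNIV (\<lambda>t x. 1 / \<xi> t x * exp (2 * s * \<phi> t x) * \<bar>Dt 1 (Dx 2 \<eta>) t x\<bar>^2)
      + iint T UNIV (\<lambda>t x. exp (2 * s * \<phi> t x) *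
          ( s^7 * \<mu>^8 * \<xi> t x ^ 7 * \<bar>\<eta> t x\<bar>^2
          + s^5 * \<mu>^6 * \<xi> t x ^ 5 * \<bar>Dx 1 \<eta> t x\<bar>^2
          + s^3 * \<mu>^4 * \<xi> t x ^ 3 * \<bar>Dx 2 \<eta> t x\<bar>^2
          + (1 + \<alpha>^2) * s^3 * \<mu>^4 * \<xi> t x ^ 3 * \<bar>Dt 1 \<eta> t x\<bar>^2
          + s * \<mu>^2 * \<xi> t x * \<bar>Dx 3 \<eta> t x\<bar>^2
          + (1 + \<alpha>^2) * s * \<mu>^2 * \<xi> t x * \<bar>Dt 1 (Dx 1 \<eta>) t x\<bar>^2))
      \<le> c0 *
        ( (\<alpha> powi (- 8) + \<alpha>^4) *
            iint T J (\<lambda>t x. s^7 * \<mu>^8 * \<xi> t x ^ 7 * exp (2 * s * \<phi> t x) * \<bar>\<eta> t x\<bar>^2)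
        + iint T UNIV (\<lambda>t x. exp (2 * s * \<phi> t x) *
            \<bar>Dt 2 \<eta> t x - \<alpha> * Dx 2 (Dt 1 \<eta>) t x + Dx 4 \<eta> t x\<bar>^2)
        + \<alpha>^2 * s^3 * \<mu>^4 *
            iint T UNIV (\<lambda>t x. \<xi> t x ^ 3 * exp (2 * s * \<phi> t x) * \<bar>Dt 1 \<eta> t x\<bar>^2)))"
proof -
  have \<psi>0: "torus_Cn 0 \<psi>I" using \<psi>I(1) by (simp add: torus_smooth_def)
  define P where "P = Psi \<psi>\<Omega> \<psi>I"
  have \<psi>P: "\<psi>I x \<le> P" for x unfolding P_def by (rule Psi_upper_bound[OF \<psi>0])
  have P: "P > 0" using \<psi>P[of 0] \<psi>I(2) by (meson less_le_trans)
  obtain K c g g1 where K: "K \<ge> 1" and c: "0 < c" "c \<le> 1"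
    and gs: "continuous_on UNIV g" "continuous_on UNIV g1" "\<forall>x. g (x + 2 * pi) = g x" "\<forall>x. g1 (x + 2 * pi) = g1 x"
      "\<forall>x. 0 \<le> g x" "\<forall>x. g x \<le> 1" "\<forall>x. x \<notin> J0 \<longrightarrow> g x = 0"
      "\<forall>x. \<forall>j\<in>{1, 2, 3}. \<bar>(deriv ^^ j) \<psi>I x\<bar> \<le> K" "\<forall>x. \<bar>g1 x\<bar> \<le> K"
      "\<forall>x. c \<le> (deriv \<psi>I x)\<^sup>2 + K * g x ^ 8"
      "\<forall>x n. ((\<lambda>y. g y ^ (n + 2)) has_real_derivative real (n + 2) * g x ^ (n + 1) * g1 x) (at x)"
    using exists_gradient_cutoff[OF \<psi>I(1) J0(1,2) \<psi>I(3)] by blast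
  note g = gs(1-6)[rule_format] and gJ0 = gs(7)[rule_format] and bnd = gs(8,9)[rule_format]
    and coercive = gs(10)[rule_format] and g_deriv = gs(11)[rule_format]
  \<comment> \<open>The cutoff vanishes off J0, hence off J; this is how the observation region
    enters.\<close>
  have gJ: "g x = 0" if "x \<notin> J" for x
    using gJ0[of x] that J0(4) closure_subset[of J0] by (auto simp: compactly_inside_def)
  obtain C e0 m0 where C: "C \<ge> 1" "0 < e0" "e0 \<le> 1" "m0 \<ge> 1"
    and beam: "\<And>T \<mu> \<epsilon> \<alpha> \<theta> \<theta>t \<theta>tt \<Lambda> \<Lambda>t \<psi>1 \<psi>2 \<psi>3 g g1 U.
      \<lbrakk>carleman_weight T \<mu> (1 + \<alpha>) \<epsilon> K c \<theta> \<theta>t \<theta>tt \<Lambda> \<Lambda>t \<psi>1 \<psi>2 \<psi>3 g g1;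
       \<epsilon> \<le> e0; m0 \<le> \<mu>; 0 < \<alpha>; beam_regular T U\<rbrakk>
      \<Longrightarrow> beam_estimate C \<alpha> \<mu> (carleman_weight.N T \<theta> \<Lambda> g) (carleman_weight.I T \<theta>) U"
    by (rule beam_carleman[OF K c]) blast
  \<comment> \<open>The smallness e0 demanded by the beam estimate dictates the threshold; (k / 2 +
    3)^2 bounds the constants produced by differentiating the time factor twice.\<close>
  define s0 where "s0 = (k / 2 + 3)\<^sup>2 / e0"
  have s0: "s0 \<ge> 1"
  proof -
    have "1 \<le> (k / 2 + 3)\<^sup>2" using k by (intro one_le_power) simp
    then show ?thesis unfolding s0_def using C by (simp add: field_simps)
  qed
  show ?thesis
  proof (rule exI[of _ C], rule conjI, goal_cases)
    case 2
    show ?case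
    proof (rule exI[of _ m0], rule conjI[OF C(4)], rule exI[of _ s0], rule conjI[OF s0], intro allI impI)
    fix \<mu> lam \<alpha> T s :: real and \<eta> :: "real \<Rightarrow> real \<Rightarrow> real"
    assume \<mu>: "m0 \<le> \<mu>" "\<mu> \<le> lam" and \<alpha>: "0 < \<alpha>" and T: "0 < T"
      and s: "s0 * (1 + \<alpha>) * (T powr k + T powr (k - 1)) \<le> s" and \<eta>: "C_time 2 4 T \<eta>"
    define \<xi> \<phi> where "\<xi> = xi0 k \<psi>\<Omega> \<psi>I lam \<mu> T" and "\<phi> = phi0 k \<psi>\<Omega> \<psi>I lam \<mu> T"
    define \<theta> \<Lambda> where "\<theta> = (\<lambda>t x. s * \<phi> t x)" and "\<Lambda> = (\<lambda>t x. s * \<mu> * \<xi> t x)"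
    have \<mu>1: "1 \<le> \<mu>" using \<mu> C by simp
    have s_pos: "0 < s"
    proof -
      have "0 < s0 * (1 + \<alpha>) * (T powr k + T powr (k - 1))" using s0 \<alpha> T by (intro mult_pos_pos add_pos_pos) auto
      then show ?thesis using s by linarith
    qed
    have \<theta>_eq: "\<theta> = (\<lambda>t x. s * ((exp (\<mu> * \<psi>I x + 8 * lam * P) - exp (10 * lam * P)) * ell_pow T (k / 2) t))"
      unfolding \<theta>_def \<phi>_def phi0_def P_def ell_pow_def powr_minus_divide by simp
    have \<Lambda>_eq: "\<Lambda> = (\<lambda>t x. s * \<mu> * (exp (\<mu> * \<psi>I x + 8 * lam * P) * ell_pow T (k / 2) t))"
      unfolding \<Lambda>_def \<xi>_def xi0_def P_def ell_pow_def powr_minus_divide by simp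
    note cw = carleman_weight_instance[OF T \<mu>1 \<mu>(2) \<alpha> C(2,3) k P \<psi>I(2)[rule_format] \<psi>P \<psi>I(1) K c g bnd coercive g_deriv
        order_refl s[unfolded s0_def], folded \<theta>_eq \<Lambda>_eq]
    interpret w: carleman_weight T \<mu> "1 + \<alpha>" e0 K c \<theta>
      "\<lambda>t x. s * ((exp (\<mu> * \<psi>I x + 8 * lam * P) - exp (10 * lam * P)) * ell_pow_t T (k / 2) t)"
      "\<lambda>t x. s * ((exp (\<mu> * \<psi>I x + 8 * lam * P) - exp (10 * lam * P)) * ell_pow_tt T (k / 2) t)"
      \<Lambda> "\<lambda>t x. s * \<mu> * (exp (\<mu> * \<psi>I x + 8 * lam * P) * ell_pow_t T (k / 2) t)"
      "deriv \<psi>I" "(deriv ^^ 2) \<psi>I" "(deriv ^^ 3) \<psi>I" g g1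
      by (rule cw)
    obtain U where U: "beam_regular T U"
      and D0: "\<And>j t x. t \<in> {0<..<T} \<Longrightarrow> j \<le> 4 \<Longrightarrow> Dx j \<eta> t x = U 0 j t x"
      and Dt1: "\<And>t x. t \<in> {0<..<T} \<Longrightarrow> Dt 1 \<eta> t x = U 1 0 t x"
      and Dt2: "\<And>t x. t \<in> {0<..<T} \<Longrightarrow> Dt 2 \<eta> t x = U 2 0 t x"
      and D1: "\<And>j t x. t \<in> {0<..<T} \<Longrightarrow> j \<le> 4 \<Longrightarrow> Dt 1 (Dx j \<eta>) t x = U 1 j t x"
      and D1': "\<And>j t x. t \<in> {0<..<T} \<Longrightarrow> j \<le> 4 \<Longrightarrow> Dx j (Dt 1 \<eta>) t x = U 1 j t x"
      by (rule C_time_beam_regular[OF \<eta>]) blast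
    have est: "beam_estimate C \<alpha> \<mu> w.N w.I U"
      by (rule beam[OF cw order_refl \<mu>(1) \<alpha> U])
    have tU: "tempered T (U i j)" if "i \<le> 2" "j \<le> 4" for i j using U that unfolding beam_regular_def by blast
    have tU': "tempered T (U 0 0)" "tempered T (U 0 1)" "tempered T (U 0 2)" "tempered T (U 0 3)" "tempered T (U 0 4)"
      "tempered T (U 1 0)" "tempered T (U 1 1)" "tempered T (U 1 2)" "tempered T (U 2 0)"
      by (rule tU; simp)+
    have \<Lambda>0: "0 < \<Lambda> t x" if "t \<in> {0<..<T}" for t x by (rule w.\<Lambda>_bounds(1)[OF that])
    have \<xi>0: "0 < \<xi> t x" if "t \<in> {0<..<T}" for t x
      using zero_less_mult_pos[of "s * \<mu>" "\<xi> t x"] \<Lambda>0[OF that, of x] s_pos \<mu>1 by (simp add: \<Lambda>_def)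
    have E: "exp (2 * s * \<phi> t x) = exp (2 * \<theta> t x)" for t x by (simp add: \<theta>_def mult.assoc)
    have \<eta>0: "\<eta> t x = U 0 0 t x" if "t \<in> {0<..<T}" for t x using D0[OF that, of 0 x] by (simp add: Dx_def)
    have W: "\<Lambda> t x ^ Suc n / \<Lambda> t x = (s * \<mu> * \<xi> t x) ^ n" if "t \<in> {0<..<T}" for t x n
    proof -
      have "s * \<mu> * \<xi> t x \<noteq> 0" using \<Lambda>0[OF that, of x] unfolding \<Lambda>_def by (rule less_imp_neq[symmetric])
      then show ?thesis unfolding \<Lambda>_def power_Suc by (rule nonzero_mult_div_cancel_left)
    qed
    have W_num: "w.W 8 t x = (s * \<mu> * \<xi> t x) ^ 7" "w.W 6 t x = (s * \<mu> * \<xi> t x) ^ 5" "w.W 4 t x = (s * \<mu> * \<xi> t x) ^ 3"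
      "w.W 2 t x = s * \<mu> * \<xi> t x" "w.W 0 t x = 1 / (s * \<mu> * \<xi> t x)" if "t \<in> {0<..<T}" for t x
      unfolding w.W_def using W[OF that, where n = 7 and x = x] W[OF that, where n = 5 and x = x]
        W[OF that, where n = 3 and x = x] W[OF that, where n = 1 and x = x]
      by (simp_all only: numeral_eq_Suc pred_numeral_simps power_one_right One_nat_def BitM.simps power_0) (simp_all add: \<Lambda>_def)
    note tN = w.N_integrand_tempered
    \<comment> \<open>1 / \<xi> = s \<mu> / \<Lambda>, so the prefactor 1 / s of the statement will
      leave exactly the common factor \<mu>.\<close>
    have l1: "iint T UNIV (\<lambda>t x. 1 / \<xi> t x * exp (2 * s * \<phi> t x) * (\<bar>Dx 4 \<eta> t x\<bar>\<^sup>2 + \<bar>Dt 2 \<eta> t x\<bar>\<^sup>2))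
        = s * \<mu> * (w.N 0 0 (U 0 4) + w.N 0 0 (U 2 0))"
    proof -
      have "iint T UNIV (\<lambda>t x. 1 / \<xi> t x * exp (2 * s * \<phi> t x) * (\<bar>Dx 4 \<eta> t x\<bar>\<^sup>2 + \<bar>Dt 2 \<eta> t x\<bar>\<^sup>2))
          = w.I (\<lambda>t x. s * \<mu> * (g x ^ 0 * w.W 0 t x * (U 0 4 t x)\<^sup>2 + g x ^ 0 * w.W 0 t x * (U 2 0 t x)\<^sup>2))"
        unfolding w.I_def
      proof (rule iint_cong)
        fix t x assume t: "t \<in> {0<..<T}"
        show "1 / \<xi> t x * exp (2 * s * \<phi> t x) * (\<bar>Dx 4 \<eta> t x\<bar>\<^sup>2 + \<bar>Dt 2 \<eta> t x\<bar>\<^sup>2)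
          = exp (2 * \<theta> t x) * (s * \<mu> * (g x ^ 0 * w.W 0 t x * (U 0 4 t x)\<^sup>2 + g x ^ 0 * w.W 0 t x * (U 2 0 t x)\<^sup>2))"
          unfolding E D0[OF t order_refl] Dt2[OF t] W_num[OF t] using \<xi>0[OF t, of x] s_pos \<mu>1 by (simp add: field_simps)
      qed simp
      also have "\<dots> = s * \<mu> * (w.N 0 0 (U 0 4) + w.N 0 0 (U 2 0))"
        unfolding w.N_def by (simp only: w.I_cmult w.I_add tempered_intros tN tU')
      finally show ?thesis .
    qed
    have l2: "iint T UNIV (\<lambda>t x. 1 / \<xi> t x * exp (2 * s * \<phi> t x) * \<bar>Dt 1 (Dx 2 \<eta>) t x\<bar>\<^sup>2) = s * \<mu> * w.N 0 0 (U 1 2)"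
    proof -
      have "iint T UNIV (\<lambda>t x. 1 / \<xi> t x * exp (2 * s * \<phi> t x) * \<bar>Dt 1 (Dx 2 \<eta>) t x\<bar>\<^sup>2)
          = w.I (\<lambda>t x. s * \<mu> * (g x ^ 0 * w.W 0 t x * (U 1 2 t x)\<^sup>2))"
        unfolding w.I_def
      proof (rule iint_cong)
        fix t x assume t: "t \<in> {0<..<T}"
        have D: "Dt 1 (Dx 2 \<eta>) t x = U 1 2 t x" by (rule D1[OF t]) simp
        show "1 / \<xi> t x * exp (2 * s * \<phi> t x) * \<bar>Dt 1 (Dx 2 \<eta>) t x\<bar>\<^sup>2
          = exp (2 * \<theta> t x) * (s * \<mu> * (g x ^ 0 * w.W 0 t x * (U 1 2 t x)\<^sup>2))"
          unfolding E D W_num[OF t] using \<xi>0[OF t, of x] s_pos \<mu>1 by (simp add: field_simps)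
      qed simp
      then show ?thesis unfolding w.N_def w.I_cmult .
    qed
    have l3: "iint T UNIV (\<lambda>t x. exp (2 * s * \<phi> t x) *
          ( s^7 * \<mu>^8 * \<xi> t x ^ 7 * \<bar>\<eta> t x\<bar>^2
          + s^5 * \<mu>^6 * \<xi> t x ^ 5 * \<bar>Dx 1 \<eta> t x\<bar>^2
          + s^3 * \<mu>^4 * \<xi> t x ^ 3 * \<bar>Dx 2 \<eta> t x\<bar>^2
          + (1 + \<alpha>^2) * s^3 * \<mu>^4 * \<xi> t x ^ 3 * \<bar>Dt 1 \<eta> t x\<bar>^2
          + s * \<mu>^2 * \<xi> t x * \<bar>Dx 3 \<eta> t x\<bar>^2
          + (1 + \<alpha>^2) * s * \<mu>^2 * \<xi> t x * \<bar>Dt 1 (Dx 1 \<eta>) t x\<bar>^2))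
       = \<mu> * (w.N 8 0 (U 0 0) + w.N 6 0 (U 0 1) + w.N 4 0 (U 0 2) + (1 + \<alpha>\<^sup>2) * w.N 4 0 (U 1 0)
          + w.N 2 0 (U 0 3) + (1 + \<alpha>\<^sup>2) * w.N 2 0 (U 1 1))" (is "iint T UNIV ?h = _")
    proof -
      have "iint T UNIV ?h = w.I (\<lambda>t x. \<mu> * (g x ^ 0 * w.W 8 t x * (U 0 0 t x)\<^sup>2 + g x ^ 0 * w.W 6 t x * (U 0 1 t x)\<^sup>2
          + g x ^ 0 * w.W 4 t x * (U 0 2 t x)\<^sup>2 + (1 + \<alpha>\<^sup>2) * (g x ^ 0 * w.W 4 t x * (U 1 0 t x)\<^sup>2)
          + g x ^ 0 * w.W 2 t x * (U 0 3 t x)\<^sup>2 + (1 + \<alpha>\<^sup>2) * (g x ^ 0 * w.W 2 t x * (U 1 1 t x)\<^sup>2)))"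
        unfolding w.I_def
      proof (rule iint_cong)
        fix t x assume t: "t \<in> {0<..<T}"
        have D: "Dx 1 \<eta> t x = U 0 1 t x" "Dx 2 \<eta> t x = U 0 2 t x" "Dx 3 \<eta> t x = U 0 3 t x" "Dt 1 (Dx 1 \<eta>) t x = U 1 1 t x"
          by (rule D0[OF t] D1[OF t]; simp)+
        show "?h t x = exp (2 * \<theta> t x) * (\<mu> * (g x ^ 0 * w.W 8 t x * (U 0 0 t x)\<^sup>2 + g x ^ 0 * w.W 6 t x * (U 0 1 t x)\<^sup>2
          + g x ^ 0 * w.W 4 t x * (U 0 2 t x)\<^sup>2 + (1 + \<alpha>\<^sup>2) * (g x ^ 0 * w.W 4 t x * (U 1 0 t x)\<^sup>2)
          + g x ^ 0 * w.W 2 t x * (U 0 3 t x)\<^sup>2 + (1 + \<alpha>\<^sup>2) * (g x ^ 0 * w.W 2 t x * (U 1 1 t x)\<^sup>2)))"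
          unfolding E D \<eta>0[OF t] Dt1[OF t] W_num[OF t]
          by (rule arg_cong[where f = "\<lambda>y. exp (2 * \<theta> t x) * y"]) (simp add: power_mult_distrib algebra_simps eval_nat_numeral)
      qed simp
      also have "\<dots> = \<mu> * (w.N 8 0 (U 0 0) + w.N 6 0 (U 0 1) + w.N 4 0 (U 0 2) + (1 + \<alpha>\<^sup>2) * w.N 4 0 (U 1 0)
          + w.N 2 0 (U 0 3) + (1 + \<alpha>\<^sup>2) * w.N 2 0 (U 1 1))"
        unfolding w.N_def by (simp only: w.I_cmult w.I_add tempered_intros tN tU')
      finally show ?thesis .
    qed
    \<comment> \<open>The only inequality in the translation, all other terms being equal: g^2 \<le>
      1 on J and g = 0 elsewhere.\<close>
    have r1: "\<mu> * w.N 8 2 (U 0 0) \<le> iint T J (\<lambda>t x. s^7 * \<mu>^8 * \<xi> t x ^ 7 * exp (2 * s * \<phi> t x) * \<bar>\<eta> t x\<bar>^2)"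
    proof -
      have "\<mu> * w.N 8 2 (U 0 0) = iint T UNIV (\<lambda>t x. \<mu> * (exp (2 * \<theta> t x) * (g x ^ 2 * w.W 8 t x * (U 0 0 t x)\<^sup>2)))"
        unfolding w.N_def w.I_def iint_cmult ..
      also have "\<dots> \<le> iint T J (\<lambda>t x. \<mu> * (exp (2 * \<theta> t x) * (w.W 8 t x * (U 0 0 t x)\<^sup>2)))"
      proof (rule iint_mono_subset)
        have "rapid T (\<lambda>t x. exp (2 * \<theta> t x) * (\<mu> * (g x ^ 2 * w.W 8 t x * (U 0 0 t x)\<^sup>2)))"
          by (intro w.rapid_E tempered_intros w.tempered_W w.temp tU')
        then show "rapid T (\<lambda>t x. \<mu> * (exp (2 * \<theta> t x) * (g x ^ 2 * w.W 8 t x * (U 0 0 t x)\<^sup>2)))"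
          by (simp add: mult_ac)
        have "rapid T (\<lambda>t x. exp (2 * \<theta> t x) * (\<mu> * (w.W 8 t x * (U 0 0 t x)\<^sup>2)))"
          by (intro w.rapid_E tempered_intros w.tempered_W w.temp tU')
        then show "rapid T (\<lambda>t x. \<mu> * (exp (2 * \<theta> t x) * (w.W 8 t x * (U 0 0 t x)\<^sup>2)))"
          by (simp add: mult_ac)
        show "J \<in> sets borel" using J(2) by simp
        fix t x assume t: "t \<in> {0<..<T}"
        have "g x ^ 2 * (w.W 8 t x * (U 0 0 t x)\<^sup>2) \<le> 1 * (w.W 8 t x * (U 0 0 t x)\<^sup>2)"
          using g(5,6)[of x] w.W_bounds(1)[OF t, of 8 x] by (intro mult_right_mono) (auto simp: power_le_one)
        then show "\<mu> * (exp (2 * \<theta> t x) * (g x ^ 2 * w.W 8 t x * (U 0 0 t x)\<^sup>2)) \<le> \<mu> * (exp (2 * \<theta> t x) * (w.W 8 t x * (U 0 0 t x)\<^sup>2))"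
          using \<mu>1 by (intro mult_left_mono) (auto simp: mult.assoc)
        show "\<mu> * (exp (2 * \<theta> t x) * (g x ^ 2 * w.W 8 t x * (U 0 0 t x)\<^sup>2)) \<le> 0" if "x \<notin> J" using gJ[OF that] by simp
      qed
      also have "\<dots> = iint T J (\<lambda>t x. s^7 * \<mu>^8 * \<xi> t x ^ 7 * exp (2 * s * \<phi> t x) * \<bar>\<eta> t x\<bar>^2)"
      proof (rule iint_cong)
        fix t x assume t: "t \<in> {0<..<T}"
        show "\<mu> * (exp (2 * \<theta> t x) * (w.W 8 t x * (U 0 0 t x)\<^sup>2)) = s^7 * \<mu>^8 * \<xi> t x ^ 7 * exp (2 * s * \<phi> t x) * \<bar>\<eta> t x\<bar>^2"
          unfolding E \<eta>0[OF t] W_num[OF t] by (simp add: power_mult_distrib eval_nat_numeral)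
      qed (use J(2) in simp)
      finally show ?thesis .
    qed
    have r2: "iint T UNIV (\<lambda>t x. exp (2 * s * \<phi> t x) * \<bar>Dt 2 \<eta> t x - \<alpha> * Dx 2 (Dt 1 \<eta>) t x + Dx 4 \<eta> t x\<bar>^2)
        = w.I (\<lambda>t x. (U 2 0 t x - \<alpha> * U 1 2 t x + U 0 4 t x)\<^sup>2)"
      unfolding w.I_def
    proof (rule iint_cong)
      fix t x assume t: "t \<in> {0<..<T}"
      have D: "Dx 2 (Dt 1 \<eta>) t x = U 1 2 t x" by (rule D1'[OF t]) simp
      show "exp (2 * s * \<phi> t x) * \<bar>Dt 2 \<eta> t x - \<alpha> * Dx 2 (Dt 1 \<eta>) t x + Dx 4 \<eta> t x\<bar>^2
        = exp (2 * \<theta> t x) * (U 2 0 t x - \<alpha> * U 1 2 t x + U 0 4 t x)\<^sup>2"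
        unfolding E D D0[OF t order_refl] Dt2[OF t] by simp
    qed simp
    have r3: "s^3 * \<mu>^4 * iint T UNIV (\<lambda>t x. \<xi> t x ^ 3 * exp (2 * s * \<phi> t x) * \<bar>Dt 1 \<eta> t x\<bar>^2) = \<mu> * w.N 4 0 (U 1 0)"
    proof -
      have "s^3 * \<mu>^4 * iint T UNIV (\<lambda>t x. \<xi> t x ^ 3 * exp (2 * s * \<phi> t x) * \<bar>Dt 1 \<eta> t x\<bar>^2)
        = iint T UNIV (\<lambda>t x. \<mu> * (exp (2 * \<theta> t x) * (g x ^ 0 * w.W 4 t x * (U 1 0 t x)\<^sup>2)))"
        unfolding iint_cmult[symmetric]
      proof (rule iint_cong)
        fix t x assume t: "t \<in> {0<..<T}"
        show "s^3 * \<mu>^4 * (\<xi> t x ^ 3 * exp (2 * s * \<phi> t x) * \<bar>Dt 1 \<eta> t x\<bar>^2)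
          = \<mu> * (exp (2 * \<theta> t x) * (g x ^ 0 * w.W 4 t x * (U 1 0 t x)\<^sup>2))"
          unfolding E Dt1[OF t] W_num[OF t] by (simp add: power_mult_distrib eval_nat_numeral)
      qed simp
      then show ?thesis unfolding w.N_def w.I_def iint_cmult .
    qed
    define A B Z2 X L F Z0 where "A = w.N 0 0 (U 0 4)" and "B = w.N 0 0 (U 2 0)" and "Z2 = w.N 0 0 (U 1 2)"
      and "X = w.N 8 0 (U 0 0) + w.N 6 0 (U 0 1) + w.N 4 0 (U 0 2) + (1 + \<alpha>\<^sup>2) * w.N 4 0 (U 1 0)
          + w.N 2 0 (U 0 3) + (1 + \<alpha>\<^sup>2) * w.N 2 0 (U 1 1)"
      and "L = w.N 8 2 (U 0 0)" and "F = w.I (\<lambda>t x. (U 2 0 t x - \<alpha> * U 1 2 t x + U 0 4 t x)\<^sup>2)" and "Z0 = w.N 4 0 (U 1 0)"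
    define LJ where "LJ = iint T J (\<lambda>t x. s^7 * \<mu>^8 * \<xi> t x ^ 7 * exp (2 * s * \<phi> t x) * \<bar>\<eta> t x\<bar>^2)"
    have "\<alpha>\<^sup>2 / (1 + \<alpha>\<^sup>2) * (A + B) + \<alpha>\<^sup>2 * Z2 + X \<le> C * ((1 / \<alpha> ^ 8 + \<alpha> ^ 4) * L + F / \<mu> + \<alpha>\<^sup>2 * Z0)"
      using est unfolding beam_estimate_def A_def B_def Z2_def X_def L_def F_def Z0_def .
    then have "\<mu> * (\<alpha>\<^sup>2 / (1 + \<alpha>\<^sup>2) * (A + B) + \<alpha>\<^sup>2 * Z2 + X) \<le> \<mu> * (C * ((1 / \<alpha> ^ 8 + \<alpha> ^ 4) * L + F / \<mu> + \<alpha>\<^sup>2 * Z0))"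
      using \<mu>1 by (intro mult_left_mono) auto
    also have "\<dots> = C * ((1 / \<alpha> ^ 8 + \<alpha> ^ 4) * (\<mu> * L) + F + \<alpha>\<^sup>2 * (\<mu> * Z0))" using \<mu>1 by (simp add: algebra_simps)
    also have "\<dots> \<le> C * ((1 / \<alpha> ^ 8 + \<alpha> ^ 4) * LJ + F + \<alpha>\<^sup>2 * (\<mu> * Z0))"
      using r1 C \<alpha> \<mu>1 unfolding L_def LJ_def by (intro mult_left_mono add_mono) auto
    finally have fin: "\<mu> * (\<alpha>\<^sup>2 / (1 + \<alpha>\<^sup>2) * (A + B) + \<alpha>\<^sup>2 * Z2 + X) \<le> C * ((1 / \<alpha> ^ 8 + \<alpha> ^ 4) * LJ + F + \<alpha>\<^sup>2 * (\<mu> * Z0))" .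
    have powi: "\<alpha> powi (- 8) = 1 / \<alpha> ^ 8" by (simp add: power_int_def field_simps)
    have lhs: "\<alpha>\<^sup>2 / (1 + \<alpha>\<^sup>2) * (1 / s) * (s * \<mu> * (A + B)) + \<alpha>\<^sup>2 / s * (s * \<mu> * Z2) + \<mu> * X
        = \<mu> * (\<alpha>\<^sup>2 / (1 + \<alpha>\<^sup>2) * (A + B) + \<alpha>\<^sup>2 * Z2 + X)"
    proof -
      have "x * (1 / s) * (s * \<mu> * y) = \<mu> * (x * y)" "x / s * (s * \<mu> * y) = \<mu> * (x * y)" for x y
        using s_pos by simp_all
      then show ?thesis by (simp only: distrib_left)
    qed
    have r3': "\<alpha>\<^sup>2 * s^3 * \<mu>^4 * iint T UNIV (\<lambda>t x. \<xi> t x ^ 3 * exp (2 * s * \<phi> t x) * \<bar>Dt 1 \<eta> t x\<bar>^2) = \<alpha>\<^sup>2 * (\<mu> * Z0)"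
      using r3 unfolding Z0_def by (simp add: mult.assoc)
    show "let \<xi> = xi0 k \<psi>\<Omega> \<psi>I lam \<mu> T; \<phi> = phi0 k \<psi>\<Omega> \<psi>I lam \<mu> T in
      \<alpha>^2 / (1 + \<alpha>^2) * (1 / s) *
        iint T UNIV (\<lambda>t x. 1 / \<xi> t x * exp (2 * s * \<phi> t x) *
          (\<bar>Dx 4 \<eta> t x\<bar>^2 + \<bar>Dt 2 \<eta> t x\<bar>^2))
      + \<alpha>^2 / s *
        iint T UNIV (\<lambda>t x. 1 / \<xi> t x * exp (2 * s * \<phi> t x) * \<bar>Dt 1 (Dx 2 \<eta>) t x\<bar>^2)
      + iint T UNIV (\<lambda>t x. exp (2 * s * \<phi> t x) *
          ( s^7 * \<mu>^8 * \<xi> t x ^ 7 * \<bar>\<eta> t x\<bar>^2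
          + s^5 * \<mu>^6 * \<xi> t x ^ 5 * \<bar>Dx 1 \<eta> t x\<bar>^2
          + s^3 * \<mu>^4 * \<xi> t x ^ 3 * \<bar>Dx 2 \<eta> t x\<bar>^2
          + (1 + \<alpha>^2) * s^3 * \<mu>^4 * \<xi> t x ^ 3 * \<bar>Dt 1 \<eta> t x\<bar>^2
          + s * \<mu>^2 * \<xi> t x * \<bar>Dx 3 \<eta> t x\<bar>^2
          + (1 + \<alpha>^2) * s * \<mu>^2 * \<xi> t x * \<bar>Dt 1 (Dx 1 \<eta>) t x\<bar>^2))
      \<le> C *
        ( (\<alpha> powi (- 8) + \<alpha>^4) *
            iint T J (\<lambda>t x. s^7 * \<mu>^8 * \<xi> t x ^ 7 * exp (2 * s * \<phi> t x) * \<bar>\<eta> t x\<bar>^2)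
        + iint T UNIV (\<lambda>t x. exp (2 * s * \<phi> t x) *
            \<bar>Dt 2 \<eta> t x - \<alpha> * Dx 2 (Dt 1 \<eta>) t x + Dx 4 \<eta> t x\<bar>^2)
        + \<alpha>^2 * s^3 * \<mu>^4 *
            iint T UNIV (\<lambda>t x. \<xi> t x ^ 3 * exp (2 * s * \<phi> t x) * \<bar>Dt 1 \<eta> t x\<bar>^2))"
      unfolding Let_def \<xi>_def[symmetric] \<phi>_def[symmetric] l1 l2 l3 r2 r3' powi
      using fin unfolding lhs[symmetric] LJ_def[symmetric] unfolding A_def B_def Z2_def X_def F_def .
    qed
  qed (use C in simp)
qed

end
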